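(* Fix $T>0$ and let $D=(D_t)_{t\in[0,T]}$ be the Dirichlet process over $[0,T]$, i.e. $D_t=\gamma_t/\gamma_T$ where $(\gamma_t)_{t\ge0}$ is a gamma process. Let $k:[0,T]\times[0,1]\to\mathbb R_+$ be a measurable function such that, for some finite constants $\kappa\ge1$ and $\alpha\in\,]0,1[$, $$|k(s,x)-k(s,y)|\le\kappa|x-y|^\alpha,\qquad 0<\kappa^{-1}\le k(s,x)\le\kappa<\infty,\qquad\forall\,x,y\in[0,1],\ s\in[0,T],$$ and set $K(s,x)=\int_0^xk(s,y)\,dy$ for $x\in[0,1]$, $s\in[0,T]$. With $\Delta D_s=D_s-D_{s-}$, define $$D^K_t:=\frac{\sum_{s\le t}K(s,\Delta D_s)}{\sum_{s\le T}K(s,\Delta D_s)},\qquad t\in[0,T].$$ Then the laws of $(D^K_t,\,t\in[0,T])$ and $(D_t,\,t\in[0,T])$ are equivalent.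
   Context: $\mathbb R_+=[0,\infty)$. The gamma process $(\gamma_t)_{t\ge0}$ is the subordinator (non-decreasing càdlàg Lévy process, $\gamma_0=0$) with $\mathbb P(\gamma_t\in dx)=1_{[0,\infty)}(x)\frac{1}{\Gamma(t)}x^{t-1}e^{-x}\,dx$ for $t>0$. Sums over $s\le t$ effectively run over the countable set of jump times in $[0,t]$. Laws are probability measures on the space of càdlàg functions on $[0,T]$ endowed with the Skorohod topology; two laws are equivalent if they are mutually absolutely continuous. *)

theory Defs
  imports "HOL-Probability.Probability"
begin

section \<open>Cadlag functions and the Skorohod space\<close>

definition cadlag_on :: "real set \<Rightarrow> (real \<Rightarrow> real) \<Rightarrow> bool" where
  "cadlag_on I f \<longleftrightarrow>
    (\<forall>t\<in>I. (f \<longlongrightarrow> f t) (at t within (I \<inter> {t<..})) \<and>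
           (\<exists>l. (f \<longlongrightarrow> l) (at t within (I \<inter> {..<t}))))"

text \<open>The points of the Skorohod space are functions on \<open>[0,T]\<close>, represented as functions
  on the whole line that are \<open>undefined\<close> outside \<open>[0,T]\<close>.\<close>

definition skorohod_space :: "real \<Rightarrow> (real \<Rightarrow> real) set" where
  "skorohod_space T = {f \<in> extensional {0..T}. cadlag_on {0..T} f}"

definition time_changes :: "real \<Rightarrow> (real \<Rightarrow> real) set" where
  "time_changes T =
    {\<theta>. continuous_on {0..T} \<theta> \<and> strict_mono_on {0..T} \<theta> \<and> \<theta> ` {0..T} = {0..T}}"

definition skorohod_bounds :: "real \<Rightarrow> (real \<Rightarrow> real) \<Rightarrow> (real \<Rightarrow> real) \<Rightarrow> real set" where
  "skorohod_bounds T f g =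
    {\<epsilon>. 0 < \<epsilon> \<and> (\<exists>\<theta>\<in>time_changes T. \<forall>t\<in>{0..T}. \<bar>\<theta> t - t\<bar> \<le> \<epsilon> \<and> \<bar>f t - g (\<theta> t)\<bar> \<le> \<epsilon>)}"

text \<open>Skorohod's \<open>J1\<close> metric, in the form given by Billingsley. The value outside the Skorohod
  space is irrelevant; it is \<open>0\<close> because \<open>Metric_space\<close> asks for nonnegativity everywhere.\<close>

definition skorohod_dist :: "real \<Rightarrow> (real \<Rightarrow> real) \<Rightarrow> (real \<Rightarrow> real) \<Rightarrow> real" where
  "skorohod_dist T f g =
    (if f \<in> skorohod_space T \<and> g \<in> skorohod_space T then Inf (skorohod_bounds T f g) else 0)"

definition skorohod_topology :: "real \<Rightarrow> (real \<Rightarrow> real) topology" where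
  "skorohod_topology T = Metric_space.mtopology (skorohod_space T) (skorohod_dist T)"

definition skorohod_borel :: "real \<Rightarrow> (real \<Rightarrow> real) measure" where
  "skorohod_borel T = sigma (skorohod_space T) {U. openin (skorohod_topology T) U}"

lemma id_time_change: "(\<lambda>t. t) \<in> time_changes T"
  by (auto simp: time_changes_def strict_mono_on_def)

lemma time_changes_comp:
  assumes "l \<in> time_changes T" "m \<in> time_changes T"
  shows "(\<lambda>t. m (l t)) \<in> time_changes T"
proof -
  have l: "continuous_on {0..T} l" "strict_mono_on {0..T} l" "l ` {0..T} = {0..T}"
    and m: "continuous_on {0..T} m" "strict_mono_on {0..T} m" "m ` {0..T} = {0..T}"
    using assms by (auto simp: time_changes_def)
  have "continuous_on {0..T} (\<lambda>t. m (l t))"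
    using continuous_on_compose2[OF m(1) l(1)] l(3) by simp
  moreover have "strict_mono_on {0..T} (\<lambda>t. m (l t))"
    using l(2,3) m(2) unfolding strict_mono_on_def by (metis imageI)
  moreover have "(\<lambda>t. m (l t)) ` {0..T} = {0..T}"
    using l(3) m(3) by (metis image_image)
  ultimately show ?thesis by (simp add: time_changes_def)
qed

lemma time_changes_inverse:
  assumes "l \<in> time_changes T"
  obtains m where "m \<in> time_changes T"
    "\<And>t. t \<in> {0..T} \<Longrightarrow> m (l t) = t" "\<And>t. t \<in> {0..T} \<Longrightarrow> l (m t) = t"
proof -
  have l: "continuous_on {0..T} l" "strict_mono_on {0..T} l" "l ` {0..T} = {0..T}"
    using assms by (auto simp: time_changes_def)
  have inj: "inj_on l {0..T}" using l(2) by (rule strict_mono_on_imp_inj_on)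
  let ?m = "inv_into {0..T} l"
  have ml: "?m (l t) = t" if "t \<in> {0..T}" for t
    using inj that by (rule inv_into_f_f)
  have lm: "l (?m t) = t" if "t \<in> {0..T}" for t
    using that l(3) f_inv_into_f[of t l "{0..T}"] by simp
  have mi: "?m ` {0..T} = {0..T}"
    using inj l(3) by (metis inv_into_image_cancel subset_refl)
  have "continuous_on {0..T} ?m"
    using continuous_on_inv[OF l(1) compact_Icc] ml l(3) by simp
  moreover have "strict_mono_on {0..T} ?m"
  proof (rule strict_mono_onI)
    fix r s assume rs: "r \<in> {0..T}" "s \<in> {0..T}" "r < s"
    have m: "?m r \<in> {0..T}" "?m s \<in> {0..T}" using mi rs by auto
    show "?m r < ?m s"
    proof (rule ccontr)
      assume "\<not> ?m r < ?m s"
      then have "l (?m s) \<le> l (?m r)"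
        using l(2) m unfolding strict_mono_on_def by (metis less_eq_real_def not_less)
      then show False using lm rs by simp
    qed
  qed
  ultimately have "?m \<in> time_changes T" using mi by (simp add: time_changes_def)
  then show thesis using that ml lm by blast
qed

lemma time_change_end:
  assumes "l \<in> time_changes T" "0 \<le> T"
  shows "l T = T"
proof -
  have l: "strict_mono_on {0..T} l" "l ` {0..T} = {0..T}"
    using assms by (auto simp: time_changes_def)
  obtain s where s: "s \<in> {0..T}" "l s = T" using l(2) assms(2) by (metis atLeastAtMost_iff imageE order_refl)
  have "l T \<in> {0..T}" using l(2) assms(2) by auto
  then have "\<not> s < T" using strict_mono_onD[OF l(1) s(1), of T] s(2) assms(2) by auto
  then show ?thesis using s by simp
qed

lemma skorohod_bounds_commute: "skorohod_bounds T f g = skorohod_bounds T g f"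
proof -
  have "skorohod_bounds T f g \<subseteq> skorohod_bounds T g f" for f g
  proof
    fix e assume "e \<in> skorohod_bounds T f g"
    then obtain l where e: "0 < e" "l \<in> time_changes T"
      "\<And>t. t \<in> {0..T} \<Longrightarrow> \<bar>l t - t\<bar> \<le> e \<and> \<bar>f t - g (l t)\<bar> \<le> e"
      by (auto simp: skorohod_bounds_def)
    obtain m where m: "m \<in> time_changes T" "\<And>t. t \<in> {0..T} \<Longrightarrow> l (m t) = t"
      using time_changes_inverse[OF e(2)] by metis
    have "\<bar>m t - t\<bar> \<le> e \<and> \<bar>g t - f (m t)\<bar> \<le> e" if "t \<in> {0..T}" for t
    proof -
      have "m t \<in> {0..T}" using m(1) that by (auto simp: time_changes_def)
      from e(3)[OF this] m(2)[OF that] show ?thesis by (simp add: abs_minus_commute)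
    qed
    then show "e \<in> skorohod_bounds T g f"
      using e(1) m(1) unfolding skorohod_bounds_def by (auto intro!: bexI[of _ m])
  qed
  then show ?thesis by blast
qed

lemma cadlag_bounded:
  assumes "cadlag_on {0..T} f"
  obtains B where "\<And>t. t \<in> {0..T} \<Longrightarrow> \<bar>f t\<bar> \<le> B"
proof -
  have loc: "\<exists>U B. open U \<and> t \<in> U \<and> (\<forall>s\<in>U \<inter> {0..T}. \<bar>f s\<bar> \<le> B)" if t: "t \<in> {0..T}" for t
  proof -
    obtain l where r: "(f \<longlongrightarrow> f t) (at t within ({0..T} \<inter> {t<..}))"
      and l: "(f \<longlongrightarrow> l) (at t within ({0..T} \<inter> {..<t}))"
      using assms t unfolding cadlag_on_def by blast
    obtain d where d: "d > 0"
      "\<And>s. s \<in> {0..T} \<inter> {t<..} \<Longrightarrow> dist s t < d \<Longrightarrow> dist (f s) (f t) < 1"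
      using tendstoD[OF r zero_less_one] unfolding eventually_at by auto
    obtain e where e: "e > 0"
      "\<And>s. s \<in> {0..T} \<inter> {..<t} \<Longrightarrow> dist s t < e \<Longrightarrow> dist (f s) l < 1"
      using tendstoD[OF l zero_less_one] unfolding eventually_at by auto
    have "\<bar>f s\<bar> \<le> \<bar>f t\<bar> + \<bar>l\<bar> + 1" if "s \<in> ball t (min d e) \<inter> {0..T}" for s
      using d(2)[of s] e(2)[of s] that
      by (cases s t rule: linorder_cases) (auto simp: dist_real_def abs_minus_commute)
    then show ?thesis
      by (intro exI[of _ "ball t (min d e)"] exI[of _ "\<bar>f t\<bar> + \<bar>l\<bar> + 1"]) (use d e in auto)
  qed
  then obtain U B where UB: "\<And>t. t \<in> {0..T} \<Longrightarrow>
      open (U t) \<and> t \<in> U t \<and> (\<forall>s\<in>U t \<inter> {0..T}. \<bar>f s\<bar> \<le> B t)"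
    by metis
  obtain C where C: "C \<subseteq> {0..T}" "finite C" "{0..T} \<subseteq> (\<Union>c\<in>C. U c)"
    by (rule compactE_image[of "{0..T}" "{0..T}" U]) (use UB in auto)
  have "\<bar>f t\<bar> \<le> (\<Sum>c\<in>C. \<bar>B c\<bar>)" if t: "t \<in> {0..T}" for t
  proof -
    obtain c where c: "c \<in> C" "t \<in> U c" using C t by blast
    have "\<bar>f t\<bar> \<le> B c" using UB[of c] c t C(1) by blast
    also have "\<dots> \<le> \<bar>B c\<bar>" by simp
    also have "\<dots> \<le> (\<Sum>c\<in>C. \<bar>B c\<bar>)"
      by (rule member_le_sum) (use c C in auto)
    finally show ?thesis .
  qed
  then show thesis by (rule that)
qed

lemma skorohod_bounds_nonempty:
  assumes "f \<in> skorohod_space T" "g \<in> skorohod_space T"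
  shows "skorohod_bounds T f g \<noteq> {}"
proof -
  have fg: "cadlag_on {0..T} f" "cadlag_on {0..T} g"
    using assms by (auto simp: skorohod_space_def)
  obtain A where A: "\<And>t. t \<in> {0..T} \<Longrightarrow> \<bar>f t\<bar> \<le> A" using cadlag_bounded[OF fg(1)] by blast
  obtain B where B: "\<And>t. t \<in> {0..T} \<Longrightarrow> \<bar>g t\<bar> \<le> B" using cadlag_bounded[OF fg(2)] by blast
  have "\<bar>t - t\<bar> \<le> \<bar>A\<bar> + \<bar>B\<bar> + 1 \<and> \<bar>f t - g t\<bar> \<le> \<bar>A\<bar> + \<bar>B\<bar> + 1" if "t \<in> {0..T}" for t
    using A[OF that] B[OF that] by linarith
  then have "\<bar>A\<bar> + \<bar>B\<bar> + 1 \<in> skorohod_bounds T f g"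
    unfolding skorohod_bounds_def using id_time_change[of T] by fastforce
  then show ?thesis by blast
qed

lemma skorohod_bounds_bdd_below: "bdd_below (skorohod_bounds T f g)"
  by (rule bdd_belowI[of _ 0]) (auto simp: skorohod_bounds_def)

lemma skorohod_bounds_triangle:
  assumes "a \<in> skorohod_bounds T f g" "b \<in> skorohod_bounds T g h"
  shows "a + b \<in> skorohod_bounds T f h"
proof -
  obtain l where l: "0 < a" "l \<in> time_changes T"
    "\<And>t. t \<in> {0..T} \<Longrightarrow> \<bar>l t - t\<bar> \<le> a \<and> \<bar>f t - g (l t)\<bar> \<le> a"
    using assms(1) by (auto simp: skorohod_bounds_def)
  obtain m where m: "0 < b" "m \<in> time_changes T"
    "\<And>t. t \<in> {0..T} \<Longrightarrow> \<bar>m t - t\<bar> \<le> b \<and> \<bar>g t - h (m t)\<bar> \<le> b"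
    using assms(2) by (auto simp: skorohod_bounds_def)
  have "\<bar>m (l t) - t\<bar> \<le> a + b \<and> \<bar>f t - h (m (l t))\<bar> \<le> a + b" if t: "t \<in> {0..T}" for t
  proof -
    have "l t \<in> {0..T}" using l(2) t by (auto simp: time_changes_def)
    from m(3)[OF this] l(3)[OF t] show ?thesis by linarith
  qed
  then show ?thesis
    using l(1) m(1) time_changes_comp[OF l(2) m(2)] unfolding skorohod_bounds_def
    by (auto intro!: bexI[of _ "\<lambda>t. m (l t)"])
qed

lemma skorohod_separated:
  assumes f: "f \<in> skorohod_space T" and g: "g \<in> skorohod_space T"
    and 0: "Inf (skorohod_bounds T f g) = 0"
  shows "f = g"
proof -
  have small: "\<exists>l\<in>time_changes T. \<forall>t\<in>{0..T}. \<bar>l t - t\<bar> \<le> e \<and> \<bar>f t - g (l t)\<bar> \<le> e"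
    if e: "e > 0" for e
  proof -
    obtain a where a: "a \<in> skorohod_bounds T f g" "a < e"
      using cInf_lessD[OF skorohod_bounds_nonempty[OF f g]] 0 e by metis
    then obtain l where "l \<in> time_changes T"
      "\<And>t. t \<in> {0..T} \<Longrightarrow> \<bar>l t - t\<bar> \<le> a \<and> \<bar>f t - g (l t)\<bar> \<le> a"
      by (auto simp: skorohod_bounds_def)
    then show ?thesis using a(2) by (intro bexI[of _ l]) force+
  qed
  have "f t = g t" if t: "t \<in> {0..T}" for t
  proof -
    have le: "\<bar>f t - g t\<bar> \<le> 3 * e" if e: "e > 0" for e
    proof (cases "t = T")
      case True
      then show ?thesis using small[OF e] time_change_end[of _ T] t e by fastforce
    next
      case False
      have r: "(f \<longlongrightarrow> f t) (at t within ({0..T} \<inter> {t<..}))"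
        "(g \<longlongrightarrow> g t) (at t within ({0..T} \<inter> {t<..}))"
        using f g t by (auto simp: skorohod_space_def cadlag_on_def)
      obtain d where d: "d > 0"
        "\<And>s. s \<in> {0..T} \<Longrightarrow> t < s \<Longrightarrow> s < t + d \<Longrightarrow> \<bar>f s - f t\<bar> < e"
        using tendstoD[OF r(1) e] unfolding eventually_at by (force simp: dist_real_def)
      obtain c where c: "c > 0"
        "\<And>s. s \<in> {0..T} \<Longrightarrow> t < s \<Longrightarrow> s < t + c \<Longrightarrow> \<bar>g s - g t\<bar> < e"
        using tendstoD[OF r(2) e] unfolding eventually_at by (force simp: dist_real_def)
      define b where "b = min (T - t) (min c d)"
      have b: "b > 0" "b \<le> T - t" "b \<le> c" "b \<le> d"
        using False t c(1) d(1) by (auto simp: b_def)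
      obtain l where l: "l \<in> time_changes T"
        "\<And>t. t \<in> {0..T} \<Longrightarrow> \<bar>l t - t\<bar> \<le> min e (b / 4) \<and> \<bar>f t - g (l t)\<bar> \<le> min e (b / 4)"
        using small[of "min e (b / 4)"] e b(1) by auto
      define s where "s = t + b / 2"
      have s: "s \<in> {0..T}" "t < s" "s < t + d" using t b by (auto simp: s_def)
      have ls: "\<bar>l s - s\<bar> \<le> b / 4" "\<bar>f s - g (l s)\<bar> \<le> e" using l(2)[OF s(1)] by auto
      have "l s \<in> {0..T}" using l(1) s(1) by (auto simp: time_changes_def)
      moreover have "t < l s" "l s < t + c" using ls(1) b unfolding s_def by linarith+
      ultimately have "\<bar>g (l s) - g t\<bar> < e" by (rule c(2))
      moreover have "\<bar>f s - f t\<bar> < e" using s by (rule d(2))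
      ultimately show ?thesis using ls(2) by linarith
    qed
    show ?thesis
    proof (rule ccontr)
      assume "f t \<noteq> g t"
      then show False using le[of "\<bar>f t - g t\<bar> / 4"] by simp
    qed
  qed
  moreover have "f \<in> extensional {0..T}" "g \<in> extensional {0..T}"
    using f g by (auto simp: skorohod_space_def)
  ultimately show ?thesis by (intro extensionalityI) auto
qed

text \<open>This makes \<open>skorohod_topology\<close> a genuine metric topology rather than an unspecified one.\<close>

lemma Metric_space_skorohod: "Metric_space (skorohod_space T) (skorohod_dist T)"
proof
  fix f g
  show "0 \<le> skorohod_dist T f g"
    using skorohod_bounds_nonempty[of f T g]
    by (auto simp: skorohod_dist_def skorohod_bounds_def intro!: cInf_greatest)
  show "skorohod_dist T f g = skorohod_dist T g f"
    by (simp add: skorohod_dist_def skorohod_bounds_commute[of T f g] conj_commute)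
next
  fix f g assume fg: "f \<in> skorohod_space T" "g \<in> skorohod_space T"
  show "skorohod_dist T f g = 0 \<longleftrightarrow> f = g"
  proof
    assume "skorohod_dist T f g = 0"
    then show "f = g" using skorohod_separated fg by (simp add: skorohod_dist_def)
  next
    assume [simp]: "f = g"
    have "skorohod_bounds T f f = {0<..}"
      using id_time_change[of T] by (force simp: skorohod_bounds_def)
    then show "skorohod_dist T f g = 0" using fg by (simp add: skorohod_dist_def)
  qed
next
  fix f g h
  assume fgh: "f \<in> skorohod_space T" "g \<in> skorohod_space T" "h \<in> skorohod_space T"
  have "Inf (skorohod_bounds T f h) - a \<le> Inf (skorohod_bounds T g h)"
    if a: "a \<in> skorohod_bounds T f g" for a
  proof (rule cInf_greatest[OF skorohod_bounds_nonempty[OF fgh(2,3)]])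
    fix b assume "b \<in> skorohod_bounds T g h"
    then have "Inf (skorohod_bounds T f h) \<le> a + b"
      using cInf_lower[OF skorohod_bounds_triangle[OF a] skorohod_bounds_bdd_below] by blast
    then show "Inf (skorohod_bounds T f h) - a \<le> b" by simp
  qed
  then have "Inf (skorohod_bounds T f h) - Inf (skorohod_bounds T g h)
      \<le> Inf (skorohod_bounds T f g)"
    by (intro cInf_greatest[OF skorohod_bounds_nonempty[OF fgh(1,2)]])
      (simp add: algebra_simps)
  then show "skorohod_dist T f h \<le> skorohod_dist T f g + skorohod_dist T g h"
    using fgh by (simp add: skorohod_dist_def)
qed


section \<open>The gamma process\<close>

text \<open>Processes are indexed by \<open>real\<close>; only the times \<open>t \<ge> 0\<close> are meaningful.\<close>

locale levy_process = prob_space M for M :: "'a measure" +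
  fixes X :: "real \<Rightarrow> 'a \<Rightarrow> real"
  assumes random_variable_X: "0 \<le> t \<Longrightarrow> random_variable borel (X t)"
    and X_0: "\<omega> \<in> space M \<Longrightarrow> X 0 \<omega> = 0"
    and cadlag_X: "\<omega> \<in> space M \<Longrightarrow> cadlag_on {0..} (\<lambda>t. X t \<omega>)"
    and independent_increments:
      "\<And>(t :: nat \<Rightarrow> real) n. 0 \<le> t 0 \<Longrightarrow> mono_on {..n} t \<Longrightarrow>
        indep_vars (\<lambda>_. borel) (\<lambda>i \<omega>. X (t (Suc i)) \<omega> - X (t i) \<omega>) {..<n}"
    and stationary_increments:
      "0 \<le> s \<Longrightarrow> 0 \<le> h \<Longrightarrow>
        distr M borel (\<lambda>\<omega>. X (s + h) \<omega> - X s \<omega>) = distr M borel (X h)"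

locale subordinator = levy_process +
  assumes mono_X: "\<omega> \<in> space M \<Longrightarrow> mono_on {0..} (\<lambda>t. X t \<omega>)"

locale gamma_process = subordinator M \<gamma> for M :: "'a measure" and \<gamma> :: "real \<Rightarrow> 'a \<Rightarrow> real" +
  assumes gamma_distributed:
    "0 < t \<Longrightarrow> distributed M lborel (\<gamma> t)
      (\<lambda>x. ennreal (indicator {0..} x * (1 / Gamma t) * x powr (t - 1) * exp (- x)))"


section \<open>The Dirichlet process and its transformation\<close>

text \<open>On the null events \<open>\<gamma> T = 0\<close> and "no jump in \<open>[0,T]\<close>" the quotients below are \<open>0 / 0 = 0\<close>,
  so that all sample paths are cadlag.\<close>

definition dirichlet_process :: "(real \<Rightarrow> 'a \<Rightarrow> real) \<Rightarrow> real \<Rightarrow> real \<Rightarrow> 'a \<Rightarrow> real" where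
  "dirichlet_process \<gamma> T t \<omega> = \<gamma> t \<omega> / \<gamma> T \<omega>"

text \<open>There is no jump at time \<open>0\<close>, i.e. the left limit at \<open>0\<close> is by convention the value at \<open>0\<close>.\<close>

definition jump :: "(real \<Rightarrow> real) \<Rightarrow> real \<Rightarrow> real" where
  "jump f s = (if s = 0 then 0 else f s - Lim (at_left s) f)"

definition primitive :: "(real \<Rightarrow> real \<Rightarrow> real) \<Rightarrow> real \<Rightarrow> real \<Rightarrow> real" where
  "primitive k s x = (LINT y:{0..x}|lborel. k s y)"

definition jump_transform ::
  "(real \<Rightarrow> real \<Rightarrow> real) \<Rightarrow> real \<Rightarrow> (real \<Rightarrow> 'a \<Rightarrow> real) \<Rightarrow> real \<Rightarrow> 'a \<Rightarrow> real" where
  "jump_transform K T D t \<omega> =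
    (\<Sum>\<^sub>\<infinity>s\<in>{0..t}. K s (jump (\<lambda>u. D u \<omega>) s)) / (\<Sum>\<^sub>\<infinity>s\<in>{0..T}. K s (jump (\<lambda>u. D u \<omega>) s))"

definition sample_path :: "real \<Rightarrow> (real \<Rightarrow> 'a \<Rightarrow> real) \<Rightarrow> 'a \<Rightarrow> (real \<Rightarrow> real)" where
  "sample_path T X \<omega> = restrict (\<lambda>t. X t \<omega>) {0..T}"

text \<open>\<open>distr\<close> is a push-forward only for a measurable map, so this is a law only if
  \<open>sample_path T X\<close> is a random element of the Skorohod space.\<close>

definition skorohod_law :: "'a measure \<Rightarrow> real \<Rightarrow> (real \<Rightarrow> 'a \<Rightarrow> real) \<Rightarrow> (real \<Rightarrow> real) measure" where
  "skorohod_law M T X = distr M (skorohod_borel T) (sample_path T X)"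

definition equivalent_measures :: "'b measure \<Rightarrow> 'b measure \<Rightarrow> bool" where
  "equivalent_measures P Q \<longleftrightarrow>
    sets P = sets Q \<and> absolutely_continuous P Q \<and> absolutely_continuous Q P"

end

theory Submission
  imports Defs
begin

text \<open>
The increments of \<open>\<gamma>\<close> over dyadic cells are independent gamma variables. For a vector \<open>x\<close> of such
variables, the coordinatewise transformation \<open>x\<^sub>i \<mapsto> K\<^sub>i x\<^sub>i\<close> has an explicit density, and Hoelder
continuity of \<open>k\<close> bounds it above and below by \<open>C exp (\<plusminus> c \<Sum> x\<^sub>i\<^sup>\<alpha>)\<close> with constants that do not
depend on the number of cells. Since the total mass of \<open>x\<close> is independent of its normalisation, the
same bounds pass to the normalised transformation of Dirichlet vectors, by conditioning on the total
mass lying in a small window. The sums \<open>\<Sum> x\<^sub>i\<^sup>\<alpha>\<close> increase under refinement and have bounded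
expectation. Hence they are almost surely bounded, so that the paths are pure jump, and on the events
where they stay below \<open>R\<close> the two discretised laws are comparable up to a factor depending on \<open>R\<close>
only. Refining the cells gives the same comparison for the laws of the processes.
\<close>

section \<open>Approximation of cadlag paths in the Skorohod space\<close>

text \<open>The kernels are not homogeneous, so the total mass cannot simply be divided out:
  \<open>K s\<close> acts on the jumps of a path of total mass 1, a null event for the gamma vector,
  whereas the change of variables is available for the unnormalised vector only. The window gives
  the comparison for \<open>normalise (KK (scale u (normalise x)))\<close> with some u between 1 and
  1 + \<epsilon>, found by averaging and depending on the grid and on the test function. This is
  harmless because u tends to 1 along the grids. The limit is taken for integrals of continuous
  functions of the values at dyadic times; inner regularity turns the resulting inequalities into
  statements about null sets, so equivalence comes out but no explicit density. \<open>k\<close> is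
  merely measurable in time, so its values at grid points say nothing about its values at the jump
  times. Each cell therefore carries the average of \<open>k\<close> over it. The error is
  controlled in mean: \<open>jump_measure\<close>, averaged over the sample space and projected to
  time, is the uniform law, so an error small in L1 in time is small at the jumps of
  \<open>D\<close>, weighted by their sizes.\<close>

lemma cadlag_oscillation:
  assumes "cadlag_on {0..T} f" "0 < e"
  obtains P where "finite P" "P \<subseteq> {0..T}"
    "\<And>s t. 0 \<le> s \<Longrightarrow> s \<le> t \<Longrightarrow> t \<le> T \<Longrightarrow> P \<inter> {s<..t} = {} \<Longrightarrow> \<bar>f s - f t\<bar> < e"
proof -
  \<comment> \<open>Two points on the same side of \<open>c\<close> are compared through the
    one-sided limit at \<open>c\<close>; the point \<open>c\<close> itself counts as right, by right
    continuity.\<close>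
  have loc: "\<exists>d>0. \<forall>s t. s \<in> {0..T} \<longrightarrow> t \<in> {0..T} \<longrightarrow> s \<in> {c - d<..<c + d} \<longrightarrow> t \<in> {c - d<..<c + d} \<longrightarrow>
      (s < c \<longleftrightarrow> t < c) \<longrightarrow> \<bar>f s - f t\<bar> < e" if c: "c \<in> {0..T}" for c
  proof -
    obtain l where r: "(f \<longlongrightarrow> f c) (at c within ({0..T} \<inter> {c<..}))"
      and l: "(f \<longlongrightarrow> l) (at c within ({0..T} \<inter> {..<c}))"
      using assms c unfolding cadlag_on_def by blast
    have e2: "e / 2 > 0" using assms by simp
    obtain d where d: "d > 0"
      "\<And>s. s \<in> {0..T} \<Longrightarrow> c < s \<Longrightarrow> s < c + d \<Longrightarrow> \<bar>f s - f c\<bar> < e / 2"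
      using tendstoD[OF r e2] unfolding eventually_at by (force simp: dist_real_def)
    obtain d' where d': "d' > 0"
      "\<And>s. s \<in> {0..T} \<Longrightarrow> s < c \<Longrightarrow> c - d' < s \<Longrightarrow> \<bar>f s - l\<bar> < e / 2"
      using tendstoD[OF l e2] unfolding eventually_at by (force simp: dist_real_def)
    show ?thesis
    proof (intro exI[of _ "min d d'"] conjI allI impI)
      show "0 < min d d'" using d d' by simp
      fix s t assume st: "s \<in> {0..T}" "t \<in> {0..T}" "s \<in> {c - min d d'<..<c + min d d'}"
        "t \<in> {c - min d d'<..<c + min d d'}" "(s < c) = (t < c)"
      show "\<bar>f s - f t\<bar> < e"
      proof (cases "s < c")
        case True
        then have tc: "t < c" using st(5) by simp
        have md: "min d d' \<le> d'" by simp
        have sd: "c - d' < s" using st(3) md unfolding greaterThanLessThan_iff by linarith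
        have td: "c - d' < t" using st(4) md unfolding greaterThanLessThan_iff by linarith
        show ?thesis using d'(2)[OF st(1) True sd] d'(2)[OF st(2) tc td] by linarith
      next
        case False
        have md: "min d d' \<le> d" by simp
        have "\<bar>f x - f c\<bar> < e / 2" if "x \<in> {0..T}" "c \<le> x" "x < c + min d d'" for x
          using d(2)[of x] that md e2 by (cases "x = c") auto
        then have "\<bar>f s - f c\<bar> < e / 2" "\<bar>f t - f c\<bar> < e / 2" using st False by simp_all
        then show ?thesis by linarith
      qed
    qed
  qed
  then obtain d where d: "\<And>c. c \<in> {0..T} \<Longrightarrow> d c > 0"
    "\<And>c s t. c \<in> {0..T} \<Longrightarrow> s \<in> {0..T} \<Longrightarrow> t \<in> {0..T} \<Longrightarrow> s \<in> {c - d c<..<c + d c} \<Longrightarrow>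
      t \<in> {c - d c<..<c + d c} \<Longrightarrow> (s < c \<longleftrightarrow> t < c) \<Longrightarrow> \<bar>f s - f t\<bar> < e"
    by metis
  have cover: "{0..T} \<subseteq> (\<Union>c\<in>{0..T}. {c - d c<..<c + d c})"
    using d(1) by (intro subsetI UN_I) auto
  obtain C where C: "C \<subseteq> {0..T}" "finite C" "{0..T} \<subseteq> (\<Union>c\<in>C. {c - d c<..<c + d c})"
    by (rule compactE_image[OF compact_Icc _ cover]) (use that in auto)
  \<comment> \<open>A centre in \<open>P\<close> separates the two sides of its neighbourhood, and a
    right end \<open>c + d c\<close> in \<open>P\<close> shows when \<open>t\<close> has left the
    neighbourhood that contains \<open>s\<close>.\<close>
  show thesis
  proof (rule that[of "(C \<union> (\<lambda>c. c + d c) ` C) \<inter> {0..T}"])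
    fix s t assume st: "0 \<le> s" "s \<le> t" "t \<le> T" "(C \<union> (\<lambda>c. c + d c) ` C) \<inter> {0..T} \<inter> {s<..t} = {}"
    obtain c where c: "c \<in> C" "s \<in> {c - d c<..<c + d c}" 
    proof -
      have "s \<in> {0..T}" using st by simp
      then show thesis using C(3) that by blast
    qed
    have P: "\<And>x. x \<in> C \<union> (\<lambda>c. c + d c) ` C \<Longrightarrow> s < x \<Longrightarrow> x \<le> t \<Longrightarrow> False"
    proof -
      fix x assume x: "x \<in> C \<union> (\<lambda>c. c + d c) ` C" "s < x" "x \<le> t"
      then have "x \<in> {0..T}" "x \<in> {s<..t}" using st by simp_all
      with x(1) st(4) show False by blast
    qed
    have "t < c + d c"
    proof (rule ccontr)
      assume "\<not> t < c + d c"
      then show False using P[of "c + d c"] c by simp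
    qed
    moreover have "s < c \<longleftrightarrow> t < c"
    proof
      show "s < c" if "t < c" using that st(2) by simp
      show "t < c" if "s < c" using P[of c] c(1) that by (simp add: not_le[symmetric]) blast
    qed
    ultimately show "\<bar>f s - f t\<bar> < e" using c st C(1) by (intro d(2)[of c]) auto
  qed (use C in auto)
qed

lemma cadlag_on_subset:
  assumes f: "cadlag_on S f" and sub: "R \<subseteq> S"
  shows "cadlag_on R f"
  unfolding cadlag_on_def
proof (intro ballI conjI)
  fix t assume "t \<in> R"
  then have "t \<in> S" using sub by blast
  then obtain l where r: "(f \<longlongrightarrow> f t) (at t within S \<inter> {t<..})" and l: "(f \<longlongrightarrow> l) (at t within S \<inter> {..<t})"
    using f unfolding cadlag_on_def by blast
  show "(f \<longlongrightarrow> f t) (at t within R \<inter> {t<..})" by (rule tendsto_within_subset[OF r]) (use sub in auto)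
  have "(f \<longlongrightarrow> l) (at t within R \<inter> {..<t})" by (rule tendsto_within_subset[OF l]) (use sub in auto)
  then show "\<exists>l. (f \<longlongrightarrow> l) (at t within R \<inter> {..<t})" by blast
qed

text \<open>The index reaches \<open>n\<close> at time T only, so n + 1 values determine the path
  and the value at T is kept exactly. This is forced, since every time change fixes T.\<close>

definition step_path :: "real \<Rightarrow> nat \<Rightarrow> (nat \<Rightarrow> real) \<Rightarrow> real \<Rightarrow> real" where
  "step_path T n v = restrict (\<lambda>t. v (nat \<lfloor>real n * t / T\<rfloor>)) {0..T}"

lemma step_path_in_skorohod_space:
  assumes "0 < T" "0 < n"
  shows "step_path T n v \<in> skorohod_space T"
proof -
  define r where "r = real n / T"
  have r: "r > 0" using assms by (simp add: r_def)
  have eq: "step_path T n v t = v (nat \<lfloor>r * t\<rfloor>)" if "t \<in> {0..T}" for t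
    using that by (simp add: step_path_def r_def)
  have "cadlag_on {0..T} (step_path T n v)"
    unfolding cadlag_on_def
  proof (intro ballI conjI)
    fix t assume t: "t \<in> {0..T}"
    show "(step_path T n v \<longlongrightarrow> step_path T n v t) (at t within {0..T} \<inter> {t<..})"
    proof (rule tendsto_eventually, unfold eventually_at, intro exI conjI ballI impI)
      show "(of_int \<lfloor>r * t\<rfloor> + 1 - r * t) / r > 0" using r by simp
      fix s assume s: "s \<in> {0..T} \<inter> {t<..}" "s \<noteq> t \<and> dist s t < (of_int \<lfloor>r * t\<rfloor> + 1 - r * t) / r"
      then have "s - t < (of_int \<lfloor>r * t\<rfloor> + 1 - r * t) / r" by (simp add: dist_real_def)
      then have "r * s < of_int \<lfloor>r * t\<rfloor> + 1" using r by (simp add: field_simps)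
      moreover have "r * t \<le> r * s" using s r by simp
      ultimately have "\<lfloor>r * s\<rfloor> = \<lfloor>r * t\<rfloor>" by (simp add: floor_eq_iff) linarith
      then show "step_path T n v s = step_path T n v t" using eq s t by simp
    qed
    show "\<exists>l. (step_path T n v \<longlongrightarrow> l) (at t within {0..T} \<inter> {..<t})"
    proof (intro exI tendsto_eventually, unfold eventually_at, intro exI conjI ballI impI)
      \<comment> \<open>The ceiling minus one is the index of the cell that reaches \<open>t\<close>
        from the left, also when \<open>t\<close> is itself a grid point.\<close>
      show "(r * t - (of_int \<lceil>r * t\<rceil> - 1)) / r > 0" by (intro divide_pos_pos r) linarith
      fix s assume s: "s \<in> {0..T} \<inter> {..<t}" "s \<noteq> t \<and> dist s t < (r * t - (of_int \<lceil>r * t\<rceil> - 1)) / r"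
      then have "t - s < (r * t - (of_int \<lceil>r * t\<rceil> - 1)) / r" by (simp add: dist_real_def)
      then have "r * s > of_int \<lceil>r * t\<rceil> - 1" using r by (simp add: field_simps)
      moreover have "r * s < r * t" using s r by simp
      ultimately have "\<lfloor>r * s\<rfloor> = \<lceil>r * t\<rceil> - 1" by (simp add: floor_eq_iff) linarith
      then show "step_path T n v s = v (nat (\<lceil>r * t\<rceil> - 1))" using eq s by simp
    qed
  qed
  then show ?thesis by (simp add: skorohod_space_def step_path_def)
qed

lemma finite_separated:
  fixes P :: "real set"
  assumes "finite P"
  obtains \<eta> where "0 < \<eta>" "\<And>p q. p \<in> P \<Longrightarrow> q \<in> P \<Longrightarrow> p \<noteq> q \<Longrightarrow> \<eta> \<le> \<bar>p - q\<bar>"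
proof -
  \<comment> \<open>The element 1 keeps the set nonempty when \<open>P\<close> has at most one
    point.\<close>
  define E where "E = insert 1 ((\<lambda>(p,q). \<bar>p - q\<bar>) ` {(p,q) \<in> P \<times> P. p \<noteq> q})"
  have fin: "finite E"
    unfolding E_def using assms by (intro finite.insertI finite_imageI finite_subset[OF _ finite_cartesian_product[of P P]]) auto
  have "0 < Min E" using fin by (subst Min_gr_iff) (auto simp: E_def)
  moreover have "Min E \<le> \<bar>p - q\<bar>" if "p \<in> P" "q \<in> P" "p \<noteq> q" for p q
    using fin that by (intro Min_le) (force simp: E_def)+
  ultimately show thesis using that by blast
qed

text \<open>The time change moves each point \<open>p\<close> of a partition with small oscillations up to the next
  grid point. It differs from the identity by a sum of hat functions with disjoint supports whose
  heights are at most the mesh, so it is increasing as soon as the mesh is small.\<close>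

lemma step_path_approx:
  assumes T: "0 < T" and f: "cadlag_on {0..T} f" and e: "0 < e"
  shows "\<exists>N. \<forall>n\<ge>N. 0 < n \<and> e \<in> skorohod_bounds T f (step_path T n (\<lambda>i. f (T * real i / real n)))"
proof -
  obtain P0 where P0: "finite P0" "P0 \<subseteq> {0..T}"
    "\<And>s t. 0 \<le> s \<Longrightarrow> s \<le> t \<Longrightarrow> t \<le> T \<Longrightarrow> P0 \<inter> {s<..t} = {} \<Longrightarrow> \<bar>f s - f t\<bar> < e"
    using cadlag_oscillation[OF f e] by metis
  define P where "P = P0 \<union> {0, T}"
  have P: "finite P" "P \<subseteq> {0..T}" "0 \<in> P" "T \<in> P" using P0 T by (auto simp: P_def)
  have osc: "\<bar>f s - f t\<bar> < e" if "0 \<le> s" "s \<le> t" "t \<le> T" "P \<inter> {s<..t} = {}" for s t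
    using P0(3)[of s t] that by (auto simp: P_def)
  obtain \<eta> where \<eta>: "0 < \<eta>" "\<And>p q. p \<in> P \<Longrightarrow> q \<in> P \<Longrightarrow> p \<noteq> q \<Longrightarrow> \<eta> \<le> \<bar>p - q\<bar>"
    using finite_separated[OF P(1)] by blast
  define c where "c = real (card P)"
  have c: "c > 0" using P by (auto simp: c_def card_gt_0_iff)
  \<comment> \<open>Makes \<open>card P\<close> times the mesh smaller than both \<eta> and e. The
    bound by \<eta> makes the Lipschitz constant of the perturbation less than 1, the bound by e
    keeps the time change within e of the identity.\<close>
  define N where "N = nat \<lceil>T * c / min \<eta> e\<rceil> + 1"
  show ?thesis
  proof (intro exI[of _ N] allI impI conjI)
    fix n assume n: "N \<le> n"
    then show n0: "0 < n" by (simp add: N_def)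
    have "T * c / min \<eta> e < real N" unfolding N_def by (simp; linarith)
    then have "T * c / min \<eta> e < real n" using n by linarith
    then have small: "T * c < min \<eta> e * real n" using \<eta>(1) e by (simp add: divide_less_eq mult.commute)
    define \<delta> where "\<delta> = T / real n"
    have \<delta>: "\<delta> > 0" using T n0 by (simp add: \<delta>_def)
    have "c * \<delta> < min \<eta> e" 
    proof -
      have "c * \<delta> = T * c / real n" by (simp add: \<delta>_def)
      also have "\<dots> < min \<eta> e" using small n0 by (subst pos_divide_less_eq) simp_all
      finally show ?thesis .
    qed
    then have cd: "c * \<delta> < \<eta>" "c * \<delta> < e" by auto
    define u where "u p = \<delta> * of_int \<lceil>p / \<delta>\<rceil>" for p
    have u: "p \<le> u p" "u p - p \<le> \<delta>" for p
    proof -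
      have "p / \<delta> \<le> of_int \<lceil>p / \<delta>\<rceil>" "of_int \<lceil>p / \<delta>\<rceil> \<le> p / \<delta> + 1" by linarith+
      then have "p \<le> of_int \<lceil>p / \<delta>\<rceil> * \<delta>" "of_int \<lceil>p / \<delta>\<rceil> * \<delta> \<le> p + \<delta>"
        using \<delta> mult_right_mono[of "of_int \<lceil>p / \<delta>\<rceil>" "p / \<delta> + 1" \<delta>]
          mult_right_mono[of "p / \<delta>" "of_int \<lceil>p / \<delta>\<rceil>" \<delta>]
        by (simp_all add: distrib_right)
      then show "p \<le> u p" "u p - p \<le> \<delta>" by (simp_all add: u_def mult.commute)
    qed
    have u0: "u 0 = 0" by (simp add: u_def)
    have uT: "u T = T" using n0 T by (simp add: u_def \<delta>_def)
    define h where "h p t = max 0 (1 - \<bar>t - p\<bar> / \<eta>)" for p t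
    have h01: "0 \<le> h p t" "h p t \<le> 1" for p t using \<eta>(1) by (auto simp: h_def)
    have hlip: "\<bar>h p t - h p s\<bar> \<le> \<bar>t - s\<bar> / \<eta>" for p s t
    proof -
      have "\<bar>h p t - h p s\<bar> \<le> \<bar>\<bar>t - p\<bar> / \<eta> - \<bar>s - p\<bar> / \<eta>\<bar>" unfolding h_def by linarith
      also have "\<dots> = \<bar>\<bar>t - p\<bar> - \<bar>s - p\<bar>\<bar> / \<eta>" using \<eta>(1) by (simp add: diff_divide_distrib[symmetric])
      also have "\<dots> \<le> \<bar>t - s\<bar> / \<eta>" using \<eta>(1) by (intro divide_right_mono) auto
      finally show ?thesis .
    qed
    have hpq: "h p q = (if p = q then 1 else 0)" if "p \<in> P" "q \<in> P" for p q
    proof (cases "p = q")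
      case False
      then have "1 \<le> \<bar>q - p\<bar> / \<eta>" using \<eta> that by simp
      then show ?thesis using False by (simp add: h_def)
    qed (simp add: h_def)
    define \<phi> where "\<phi> t = (\<Sum>p\<in>P. (u p - p) * h p t)" for t
    define \<theta> where "\<theta> t = t + \<phi> t" for t
    have \<theta>P: "\<theta> q = u q" if "q \<in> P" for q
    proof -
      have "\<phi> q = (\<Sum>p\<in>P. if p = q then u q - q else 0)"
        unfolding \<phi>_def using that by (intro sum.cong) (auto simp: hpq)
      then show ?thesis using that P(1) by (simp add: \<theta>_def)
    qed
    have \<phi>lip: "\<bar>\<phi> t - \<phi> s\<bar> \<le> c * \<delta> / \<eta> * \<bar>t - s\<bar>" for s t
    proof -
      have "\<bar>\<phi> t - \<phi> s\<bar> = \<bar>\<Sum>p\<in>P. (u p - p) * (h p t - h p s)\<bar>"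
        by (simp add: \<phi>_def sum_subtractf[symmetric] right_diff_distrib)
      also have "\<dots> \<le> (\<Sum>p\<in>P. \<bar>(u p - p) * (h p t - h p s)\<bar>)" by (rule sum_abs)
      also have "\<dots> \<le> (\<Sum>p\<in>P. \<delta> * (\<bar>t - s\<bar> / \<eta>))"
        unfolding abs_mult by (intro sum_mono mult_mono hlip) (use u \<delta> in auto)
      finally show ?thesis by (simp add: c_def)
    qed
    have cdn: "c * \<delta> / \<eta> < 1" using cd \<eta> by simp
    have smono: "\<theta> s < \<theta> t" if "s < t" for s t
    proof -
      have "\<bar>\<phi> t - \<phi> s\<bar> < \<bar>t - s\<bar>"
        using \<phi>lip[of t s] mult_strict_right_mono[OF cdn, of "\<bar>t - s\<bar>"] that by simp
      then show ?thesis using that unfolding \<theta>_def by linarith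
    qed
    have mono: "\<theta> s \<le> \<theta> t" if "s \<le> t" for s t using smono[of s t] that by (cases "s = t") auto
    have cont: "continuous_on {0..T} \<theta>"
      unfolding \<theta>_def \<phi>_def h_def using \<eta>(1) by (intro continuous_intros) auto
    have \<theta>0: "\<theta> 0 = 0" and \<theta>T: "\<theta> T = T" using \<theta>P P u0 uT by auto
    have "\<theta> ` {0..T} = {0..T}"
    proof
      show "\<theta> ` {0..T} \<subseteq> {0..T}" using mono[of 0] mono[of _ T] \<theta>0 \<theta>T by force
      show "{0..T} \<subseteq> \<theta> ` {0..T}"
      proof
        fix y assume y: "y \<in> {0..T}"
        then obtain x where "0 \<le> x" "x \<le> T" "\<theta> x = y"
          using IVT'[of \<theta> 0 y T] cont \<theta>0 \<theta>T T by auto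
        then show "y \<in> \<theta> ` {0..T}" by auto
      qed
    qed
    then have tc: "\<theta> \<in> time_changes T"
      unfolding time_changes_def using cont smono by (auto simp: strict_mono_on_def)
    show "e \<in> skorohod_bounds T f (step_path T n (\<lambda>i. f (T * real i / real n)))"
      unfolding skorohod_bounds_def
    proof (intro CollectI conjI bexI[OF _ tc] ballI e)
      fix t assume t: "t \<in> {0..T}"
      have "\<bar>\<phi> t\<bar> \<le> (\<Sum>p\<in>P. \<bar>(u p - p) * h p t\<bar>)" unfolding \<phi>_def by (rule sum_abs)
      also have "\<dots> \<le> (\<Sum>p\<in>P. \<delta> * 1)"
        unfolding abs_mult using u h01 \<delta> by (intro sum_mono mult_mono) auto
      finally show "\<bar>\<theta> t - t\<bar> \<le> e" using cd by (simp add: \<theta>_def c_def)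
      \<comment> \<open>\<open>g\<close> is the grid point whose value of \<open>f\<close> the step
        path takes at time \<theta> t. Since \<theta> p = u p is the first grid point from
        \<open>p\<close> on, p \<le> t holds exactly if p \<le> g, so no point of \<open>P\<close>
        separates \<open>t\<close> from \<open>g\<close>.\<close>
      define j where "j = \<lfloor>\<theta> t / \<delta>\<rfloor>"
      define g where "g = \<delta> * of_int j"
      have \<theta>t: "\<theta> t \<in> {0..T}" using tc t by (auto simp: time_changes_def)
      have j0: "0 \<le> j" using \<theta>t \<delta> by (simp add: j_def)
      have g\<theta>: "g \<le> \<theta> t"
        using \<delta> mult_left_mono[OF of_int_floor_le[of "\<theta> t / \<delta>"], of \<delta>] by (simp add: g_def j_def)
      have gr: "0 \<le> g" "g \<le> T" 
        using j0 \<delta> g\<theta> \<theta>t by (simp add: g_def del: zero_le_mult_iff, simp)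
      have gge: "u p \<le> g" if "u p \<le> \<theta> t" for p
      proof -
        have "of_int \<lceil>p / \<delta>\<rceil> \<le> \<theta> t / \<delta>" using that \<delta> by (simp add: u_def field_simps)
        then have "\<lceil>p / \<delta>\<rceil> \<le> j" by (simp add: j_def le_floor_iff)
        then show ?thesis using \<delta> by (simp add: u_def g_def)
      qed
      have ule: "u p \<le> g" if "p \<le> g" for p
      proof -
        have "p / \<delta> \<le> of_int j" using that \<delta> by (simp add: g_def field_simps)
        then have "\<lceil>p / \<delta>\<rceil> \<le> j" by (simp add: ceiling_le_iff)
        then show ?thesis using \<delta> by (simp add: u_def g_def)
      qed
      have "step_path T n (\<lambda>i. f (T * real i / real n)) (\<theta> t) = f g"
      proof -
        have "real n * \<theta> t / T = \<theta> t / \<delta>" using n0 T by (simp add: \<delta>_def)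
        then show ?thesis using \<theta>t j0 by (simp add: step_path_def g_def \<delta>_def j_def mult.commute)
      qed
      moreover have "\<bar>f t - f g\<bar> < e"
      proof (cases "t \<le> g")
        case True
        have "P \<inter> {t<..g} = {}"
        proof (rule ccontr)
          assume "P \<inter> {t<..g} \<noteq> {}"
          then obtain p where p: "p \<in> P" "t < p" "p \<le> g" by auto
          have "\<theta> t < u p" using smono[OF p(2)] \<theta>P[OF p(1)] by simp
          then show False using ule[OF p(3)] g\<theta> by linarith
        qed
        then show ?thesis using osc[of t g] True t gr by auto
      next
        case False
        have "P \<inter> {g<..t} = {}"
        proof (rule ccontr)
          assume "P \<inter> {g<..t} \<noteq> {}"
          then obtain p where p: "p \<in> P" "g < p" "p \<le> t" by auto
          have "u p \<le> g" using mono[OF p(3)] \<theta>P[OF p(1)] gge by simp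
          then show False using u(1)[of p] p(2) by linarith
        qed
        then show ?thesis using osc[of g t] False t gr by (auto simp: abs_minus_commute)
      qed
      ultimately show "\<bar>f t - step_path T n (\<lambda>i. f (T * real i / real n)) (\<theta> t)\<bar> \<le> e" by simp
    qed
  qed
qed

section \<open>Borel sets of the Skorohod space and values at dyadic times\<close>

lemma skorohod_dist_le:
  assumes "f \<in> skorohod_space T" "g \<in> skorohod_space T" "e \<in> skorohod_bounds T f g"
  shows "skorohod_dist T f g \<le> e"
  using assms cInf_lower[OF _ skorohod_bounds_bdd_below] by (simp add: skorohod_dist_def)

text \<open>A step path depends on n + 1 coordinates only. Moving each of them by at most r / 2
  moves the path by at most r / 2, already with the identity as time change, so balls pull back to
  open sets of the product topology.\<close>

lemma open_step_path_vimage: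
  assumes T: "0 < T" "0 < n" and U: "openin (skorohod_topology T) U"
  shows "open {v. step_path T n v \<in> U}"
proof -
  interpret Metric_space "skorohod_space T" "skorohod_dist T" by (rule Metric_space_skorohod)
  have "\<exists>W. open W \<and> v \<in> W \<and> W \<subseteq> {v. step_path T n v \<in> U}" if v: "step_path T n v \<in> U" for v
  proof -
    obtain r where r: "r > 0" "mball (step_path T n v) r \<subseteq> U"
      using U v unfolding skorohod_topology_def openin_mtopology by blast
    define W where "W = (\<Inter>i\<in>{..n}. (\<lambda>w. w i) -` ball (v i) (r / 2))"
    have "open W" unfolding W_def
      by (intro open_INT ballI open_vimage open_ball continuous_on_product_coordinates finite_atMost)
    moreover have "v \<in> W" using r by (simp add: W_def)
    moreover have "step_path T n w \<in> U" if w: "w \<in> W" for w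
    proof -
      have "\<bar>step_path T n v t - step_path T n w t\<bar> \<le> r / 2" if t: "t \<in> {0..T}" for t
      proof -
        have "real n * t / T \<le> real n" using t T by (simp add: divide_le_eq)
        then have "\<lfloor>real n * t / T\<rfloor> \<le> int n" by linarith
        then have "nat \<lfloor>real n * t / T\<rfloor> \<in> {..n}" by simp
        then have "w (nat \<lfloor>real n * t / T\<rfloor>) \<in> ball (v (nat \<lfloor>real n * t / T\<rfloor>)) (r / 2)"
          using w by (simp only: W_def INT_iff vimage_eq)
        then show ?thesis using t by (simp add: step_path_def dist_real_def)
      qed
      then have "r / 2 \<in> skorohod_bounds T (step_path T n v) (step_path T n w)"
        unfolding skorohod_bounds_def using r(1)
        by (intro CollectI conjI bexI[OF _ id_time_change] ballI) auto
      then have "skorohod_dist T (step_path T n v) (step_path T n w) \<le> r / 2"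
        using T by (intro skorohod_dist_le step_path_in_skorohod_space)
      then show ?thesis using r T step_path_in_skorohod_space by (force simp: in_mball)
    qed
    ultimately show ?thesis by blast
  qed
  then show ?thesis by (subst open_subopen) simp
qed

text \<open>Membership of \<open>f\<close> in an open set can be read off the approximations
  \<open>A m f\<close>, which depend on finitely many values of \<open>f\<close>: for some k, all
  late \<open>A m f\<close> stay farther than 1 / (k + 1) from the complement. This writes the event
  as a countable combination of events about finitely many coordinates.\<close>

lemma measurable_skorohod_borel:
  assumes T: "0 < T"
    and X: "\<And>\<omega>. \<omega> \<in> space M \<Longrightarrow> X \<omega> \<in> skorohod_space T"
    and meas: "\<And>m i. i \<le> 2 ^ m \<Longrightarrow> (\<lambda>\<omega>. X \<omega> (T * real i / 2 ^ m)) \<in> borel_measurable M"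
  shows "X \<in> measurable M (skorohod_borel T)"
proof -
  interpret Metric_space "skorohod_space T" "skorohod_dist T" by (rule Metric_space_skorohod)
  define A where "A m f = step_path T (2 ^ m) (\<lambda>i. f (T * real i / 2 ^ m))" for m f
  have A_in: "A m f \<in> skorohod_space T" for m f
    unfolding A_def using T by (intro step_path_in_skorohod_space) auto
  have A_conv: "\<exists>N. \<forall>m\<ge>N. skorohod_dist T f (A m f) \<le> e" if f: "f \<in> skorohod_space T" and e: "0 < e" for f e
  proof -
    obtain N where N: "\<And>n. n \<ge> N \<Longrightarrow> e \<in> skorohod_bounds T f (step_path T n (\<lambda>i. f (T * real i / real n)))"
      using step_path_approx[OF T _ e, of f] f by (auto simp: skorohod_space_def)
    have "skorohod_dist T f (A m f) \<le> e" if "m \<ge> N" for m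
    proof -
      have "N \<le> 2 ^ m" using that less_exp[of m] by linarith
      from N[OF this] show ?thesis using f A_in by (intro skorohod_dist_le) (auto simp: A_def)
    qed
    then show ?thesis by blast
  qed
  have A_meas: "{\<omega> \<in> space M. A m (X \<omega>) \<in> W} \<in> sets M" if W: "openin (skorohod_topology T) W" for m W
  proof -
    \<comment> \<open>Capping the index keeps all coordinates at times in [0, T], where
      measurability is known; the step path reads no index beyond 2 ^ m.\<close>
    define Y where "Y \<omega> = (\<lambda>i. X \<omega> (T * real (min i (2 ^ m)) / 2 ^ m))" for \<omega>
    have Y: "Y \<in> measurable M borel"
      unfolding Y_def by (rule measurable_coordinatewise_then_product) (rule meas, simp)
    have "A m (X \<omega>) = step_path T (2 ^ m) (Y \<omega>)" for \<omega>
    proof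
      fix t
      show "A m (X \<omega>) t = step_path T (2 ^ m) (Y \<omega>) t"
      proof (cases "t \<in> {0..T}")
        case True
        have "real (2 ^ m) * t / T \<le> real (2 ^ m)" using True T by (simp add: divide_le_eq)
        then have "\<lfloor>real (2 ^ m) * t / T\<rfloor> \<le> int (2 ^ m)" by linarith
        then have "nat \<lfloor>real (2 ^ m) * t / T\<rfloor> \<le> 2 ^ m" by linarith
        then show ?thesis by (simp add: A_def Y_def step_path_def min_def)
      next
        case False
        then show ?thesis unfolding A_def step_path_def restrict_def by (simp only: if_False)
      qed
    qed
    then have "{\<omega> \<in> space M. A m (X \<omega>) \<in> W} = Y -` {v. step_path T (2 ^ m) v \<in> W} \<inter> space M"
      by auto
    also have "\<dots> \<in> sets M"
      using T W by (intro measurable_sets[OF Y] borel_open open_step_path_vimage) auto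
    finally show ?thesis .
  qed
  show ?thesis unfolding skorohod_borel_def
  proof (rule measurable_measure_of)
    show "{U. openin (skorohod_topology T) U} \<subseteq> Pow (skorohod_space T)"
      using openin_subset by (force simp: skorohod_topology_def)
    show "X \<in> space M \<rightarrow> skorohod_space T" using X by auto
    fix U assume "U \<in> {U. openin (skorohod_topology T) U}"
    then have U: "openin (skorohod_topology T) U" by simp
    define C where "C = skorohod_space T - U"
    define q where "q k = 1 / real (Suc k)" for k
    have q: "q k > 0" for k by (simp add: q_def)
    \<comment> \<open>A uniform lower bound r in place of an infimum of distances, so that the case
      of an empty complement needs no separate treatment.\<close>
    define W where "W k = {f \<in> skorohod_space T. \<exists>r>q k. \<forall>g\<in>C. r \<le> skorohod_dist T f g}" for k
    have W_open: "openin (skorohod_topology T) (W k)" for k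
      unfolding skorohod_topology_def openin_mtopology
    proof (intro conjI allI impI)
      show "W k \<subseteq> skorohod_space T" by (auto simp: W_def)
      fix f assume "f \<in> W k"
      then obtain r where f: "f \<in> skorohod_space T" and r: "r > q k"
        "\<And>g. g \<in> C \<Longrightarrow> r \<le> skorohod_dist T f g" by (auto simp: W_def)
      have "h \<in> W k" if h: "h \<in> mball f ((r - q k) / 2)" for h
      proof -
        have h': "h \<in> skorohod_space T" "skorohod_dist T f h < (r - q k) / 2" using h by auto
        have "(r + q k) / 2 \<le> skorohod_dist T h g" if g: "g \<in> C" for g
        proof -
          have "g \<in> skorohod_space T" using g by (simp add: C_def)
          then have tr: "skorohod_dist T f g \<le> skorohod_dist T f h + skorohod_dist T h g"
            by (rule triangle[OF f h'(1)])
          have "2 * skorohod_dist T f h < r - q k" using h'(2) by simp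
          moreover have "2 * r \<le> 2 * skorohod_dist T f h + 2 * skorohod_dist T h g"
            using tr r(2)[OF g] by linarith
          ultimately have "r + q k \<le> 2 * skorohod_dist T h g" by argo
          then show ?thesis by simp
        qed
        moreover have "q k < (r + q k) / 2" using r(1) by (simp add: field_simps)
        ultimately show ?thesis unfolding W_def using h'(1) by blast
      qed
      then show "\<exists>r>0. mball f r \<subseteq> W k"
        using r(1) by (intro exI[of _ "(r - q k) / 2"]) auto
    qed
    have U_iff: "f \<in> U \<longleftrightarrow> (\<exists>k N. \<forall>m\<ge>N. A m f \<in> W k)" if f: "f \<in> skorohod_space T" for f
    proof
      assume "f \<in> U"
      then obtain r where r: "r > 0" "mball f r \<subseteq> U"
        using U unfolding skorohod_topology_def openin_mtopology by blast
      have far: "r \<le> skorohod_dist T f g" if "g \<in> C" for g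
        using that r(2) f by (force simp: C_def)
      obtain k where k: "q k < r / 2" using r(1) nat_approx_posE[of "r / 2"] unfolding q_def by auto
      obtain N where N: "\<And>m. m \<ge> N \<Longrightarrow> skorohod_dist T f (A m f) \<le> r / 2" using A_conv[OF f, of "r / 2"] r(1) by auto
      have "A m f \<in> W k" if "m \<ge> N" for m
      proof -
        have "r / 2 \<le> skorohod_dist T (A m f) g" if g: "g \<in> C" for g
          using triangle[OF f A_in[of m f], of g] far[OF g] N[OF \<open>m \<ge> N\<close>] g by (auto simp: C_def)
        then show ?thesis unfolding W_def using k A_in by blast
      qed
      then show "\<exists>k N. \<forall>m\<ge>N. A m f \<in> W k" by blast
    next
      assume "\<exists>k N. \<forall>m\<ge>N. A m f \<in> W k"
      then obtain k N where kN: "\<And>m. m \<ge> N \<Longrightarrow> A m f \<in> W k" by blast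
      show "f \<in> U"
      proof (rule ccontr)
        assume "f \<notin> U"
        then have fC: "f \<in> C" using f by (simp add: C_def)
        obtain N' where N': "\<And>m. m \<ge> N' \<Longrightarrow> skorohod_dist T f (A m f) \<le> q k"
          using A_conv[OF f, of "q k"] q by auto
        have "q k < skorohod_dist T (A (max N N') f) f"
          using kN[of "max N N'"] fC by (force simp: W_def)
        then show False using N'[of "max N N'"] commute by (metis max.cobounded2 not_le)
      qed
    qed
    have "X -` U \<inter> space M = {\<omega> \<in> space M. \<exists>k N. \<forall>m\<in>{N..}. A m (X \<omega>) \<in> W k}"
      using U_iff X by (simp add: set_eq_iff atLeast_def Ball_def) blast
    also have "\<dots> \<in> sets M" using A_meas[OF W_open] by measurable
    finally show "X -` U \<inter> space M \<in> sets M" .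
  qed
qed

text \<open>One index enumerates the dyadic times of all levels, so that the values of a path there
  form a point of the Polish space of real sequences. The cap makes every index denote a time in
  [0, T].\<close>

definition dyadic_time :: "real \<Rightarrow> nat \<Rightarrow> real" where
  "dyadic_time T j = (case prod_decode j of (m, i) \<Rightarrow> T * real (min i (2 ^ m)) / 2 ^ m)"

lemma dyadic_time_eq: "dyadic_time T (prod_encode (m, i)) = T * real (min i (2 ^ m)) / 2 ^ m"
  by (simp add: dyadic_time_def)

lemma dyadic_time_in: "0 \<le> T \<Longrightarrow> dyadic_time T j \<in> {0..T}"
  by (auto simp: dyadic_time_def divide_le_eq mult_left_mono split: prod.split)

text \<open>The identity is measurable from the sigma-algebra generated by the dyadic evaluations to
  the Borel sets, by \<open>measurable_skorohod_borel\<close>. Comparing laws on the Skorohod space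
  thus reduces to comparing laws of sequences.\<close>

lemma skorohod_borel_cylinder:
  assumes T: "0 < T" and B: "B \<in> sets (skorohod_borel T)"
  obtains A where "A \<in> sets borel"
    "\<And>f. f \<in> skorohod_space T \<Longrightarrow> f \<in> B \<longleftrightarrow> (\<lambda>j. f (dyadic_time T j)) \<in> A"
proof -
  let ?E = "\<lambda>f j. f (dyadic_time T j)"
  let ?V = "vimage_algebra (skorohod_space T) ?E borel"
  have vt: "?E \<in> skorohod_space T \<rightarrow> space borel" by simp
  then have E: "?E \<in> measurable ?V borel"
    by (rule measurable_vimage_algebra1)
  have "(\<lambda>f. f) \<in> measurable ?V (skorohod_borel T)"
  proof (rule measurable_skorohod_borel[OF T])
    fix m i assume "i \<le> (2::nat) ^ m"
    then have eq: "T * real i / 2 ^ m = dyadic_time T (prod_encode (m, i))"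
      by (simp add: dyadic_time_eq)
    show "(\<lambda>f. f (T * real i / 2 ^ m)) \<in> borel_measurable ?V"
      unfolding eq by (rule measurable_product_then_coordinatewise[OF E])
  qed simp
  from measurable_sets[OF this B] have "B \<inter> skorohod_space T \<in> sets ?V" by simp
  then obtain A where A: "A \<in> sets borel" "B \<inter> skorohod_space T = ?E -` A \<inter> skorohod_space T"
    unfolding sets_vimage_algebra2[OF vt] mem_Collect_eq by metis
  have "f \<in> B \<longleftrightarrow> (\<lambda>j. f (dyadic_time T j)) \<in> A" if "f \<in> skorohod_space T" for f
    using A(2) that by blast
  with A(1) show thesis by (rule that)
qed

section \<open>Change of variables for the gamma distribution\<close>

definition gamma_density :: "real \<Rightarrow> real \<Rightarrow> real" where
  "gamma_density a x = indicator {0..} x * (1 / Gamma a) * x powr (a - 1) * exp (- x)"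

definition gamma_measure :: "real \<Rightarrow> real measure" where
  "gamma_measure a = density lborel (\<lambda>x. ennreal (gamma_density a x))"

lemma gamma_density_measurable [measurable]: "gamma_density a \<in> borel_measurable borel"
  unfolding gamma_density_def by measurable

text \<open>At 0 this rests on the convention \<open>0 powr _ = 0\<close>, which also covers the
  exponents a - 1 < 0.\<close>

lemma gamma_density_nonpos: "x \<le> 0 \<Longrightarrow> gamma_density a x = 0"
  by (cases "x = 0") (auto simp: gamma_density_def)

lemma gamma_density_pos: "0 < x \<Longrightarrow> gamma_density a x = x powr (a - 1) * exp (- x) / Gamma a"
  by (simp add: gamma_density_def)

lemma gamma_density_nonneg: "0 < a \<Longrightarrow> 0 \<le> gamma_density a x"
  by (cases "0 < x") (auto simp: gamma_density_pos gamma_density_nonpos Gamma_real_nonneg)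

lemma sets_gamma_measure [measurable_cong, simp]: "sets (gamma_measure a) = sets borel"
  and space_gamma_measure [simp]: "space (gamma_measure a) = UNIV"
  by (simp_all add: gamma_measure_def)

lemma nn_integral_gamma_measure:
  assumes "f \<in> borel_measurable borel"
  shows "(\<integral>\<^sup>+x. f x \<partial>gamma_measure a) = (\<integral>\<^sup>+x. ennreal (gamma_density a x) * f x \<partial>lborel)"
  unfolding gamma_measure_def using assms by (subst nn_integral_density) auto

lemma nn_integral_gamma_density:
  assumes "0 < a"
  shows "(\<integral>\<^sup>+x. ennreal (gamma_density a x) \<partial>lborel) = 1"
proof -
  have eq: "gamma_density a = (\<lambda>x. if x \<in> {0..} then x powr (a - 1) / exp x * (1 / Gamma a) else 0)"
    by (auto simp: gamma_density_def exp_minus divide_inverse)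
  have "((\<lambda>x. x powr (a - 1) / exp x * (1 / Gamma a)) has_integral Gamma a * (1 / Gamma a)) {0..}"
    by (intro has_integral_mult_left Gamma_integral_real assms)
  moreover have "Gamma a \<noteq> 0" using Gamma_real_pos[OF assms] by simp
  ultimately have "(gamma_density a has_integral 1) UNIV"
    unfolding eq has_integral_restrict_UNIV by simp
  then show ?thesis
    using nn_integral_has_integral_lborel[of "gamma_density a" 1] gamma_density_nonneg[OF assms] by simp
qed

lemma prob_space_gamma_measure: "0 < a \<Longrightarrow> prob_space (gamma_measure a)"
  by (intro prob_spaceI) (simp add: gamma_measure_def emeasure_density nn_integral_gamma_density)

lemma AE_gamma_measure_pos: "AE x in gamma_measure a. 0 < x"
  unfolding gamma_measure_def
  by (subst AE_density) (auto intro!: AE_I2 simp: gamma_density_nonpos not_less[symmetric] intro: ccontr)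

text \<open>The factor \<open>x powr p\<close> turns the density of parameter \<open>a\<close> into
  a multiple of the density of parameter a + p.\<close>

lemma gamma_moment:
  assumes "0 < a" "0 < p"
  shows "(\<integral>\<^sup>+x. ennreal (x powr p) \<partial>gamma_measure a) = ennreal (Gamma (a + p) / Gamma a)"
proof -
  have "(\<integral>\<^sup>+x. ennreal (x powr p) \<partial>gamma_measure a)
      = (\<integral>\<^sup>+x. ennreal (gamma_density a x) * ennreal (x powr p) \<partial>lborel)"
    by (rule nn_integral_gamma_measure) simp
  also have "\<dots> = (\<integral>\<^sup>+x. ennreal (Gamma (a + p) / Gamma a) * ennreal (gamma_density (a + p) x) \<partial>lborel)"
  proof (rule nn_integral_cong)
    fix x :: real
    have e: "x powr (a + p - 1) = x powr p * x powr (a - 1)"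
      using powr_add[of x p "a - 1"] by (simp add: algebra_simps)
    have "Gamma (a + p) > 0" using assms by (intro Gamma_real_pos) simp
    then have "gamma_density a x * x powr p = Gamma (a + p) / Gamma a * gamma_density (a + p) x"
      by (cases "0 < x") (simp_all add: gamma_density_pos gamma_density_nonpos not_less e)
    then show "ennreal (gamma_density a x) * ennreal (x powr p)
        = ennreal (Gamma (a + p) / Gamma a) * ennreal (gamma_density (a + p) x)"
      using assms by (simp add: ennreal_mult'[symmetric] ennreal_mult''[symmetric] gamma_density_nonneg)
  qed
  also have "\<dots> = ennreal (Gamma (a + p) / Gamma a)"
    using assms by (simp add: nn_integral_cmult nn_integral_gamma_density)
  finally show ?thesis .
qed

text \<open>By substitution, the density is the quotient of
  \<open>gamma_density a (L y) / k (L y)\<close> by \<open>gamma_density a y\<close>. It is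
  regrouped so that the delicate factor \<open>y / (L y * k (L y))\<close> stands alone; over many
  cells the other two will multiply to quantities bounded in terms of the total parameter and the
  total mass.\<close>

lemma distr_gamma_measure_increasing:
  fixes K k L :: "real \<Rightarrow> real"
  assumes a: "0 < a"
    and der: "\<And>x. (K has_real_derivative k x) (at x)" and k: "continuous_on UNIV k" "\<And>x. 0 < k x"
    and K0: "K 0 = 0" and LK: "\<And>x. L (K x) = x" and KL: "\<And>y. K (L y) = y"
  shows "distr (gamma_measure a) borel K = density (gamma_measure a)
    (\<lambda>y. ennreal ((L y / y) powr a * (y / (L y * k (L y))) * exp (y - L y)))"
proof -
  define \<phi> where "\<phi> y = (L y / y) powr a * (y / (L y * k (L y))) * exp (y - L y)" for y
  have K_less: "K x < K y" if "x < y" for x y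
    using DERIV_pos_imp_increasing[OF that, of K] der k(2) by blast
  have K_mono: "K x \<le> K y \<longleftrightarrow> x \<le> y" for x y
    using K_less[of x y] K_less[of y x] by (cases x y rule: linorder_cases) auto
  have K_meas [measurable]: "K \<in> borel_measurable borel"
    using der by (intro borel_measurable_continuous_onI DERIV_continuous_on[of UNIV K k]) auto
  have "mono L" using K_mono KL by (intro monoI) metis
  then have L_meas [measurable]: "L \<in> borel_measurable borel" by (rule borel_measurable_mono)
  have k_meas [measurable]: "k \<in> borel_measurable borel"
    using k(1) by (rule borel_measurable_continuous_onI)
  have \<phi>_meas [measurable]: "\<phi> \<in> borel_measurable borel" unfolding \<phi>_def by measurable
  have L0: "L 0 = 0" using LK[of 0] K0 by simp
  have Kpos: "0 < K x" if "0 < x" for x using K_less[OF that] K0 by simp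
  have \<phi>_nonneg: "0 \<le> \<phi> y" if "0 < y" for y
  proof -
    have "0 < L y" using that K_mono[of "L y" 0] KL[of y] K0 by (simp add: not_le[symmetric])
    then show ?thesis using that k(2)[of "L y"] by (simp add: \<phi>_def)
  qed
  have key: "\<phi> (K x) * gamma_density a (K x) * k x = gamma_density a x" if "0 \<le> x" for x
  proof (cases "x = 0")
    case False
    then have x: "0 < x" using that by simp
    have "k x \<noteq> 0" using k(2)[of x] by simp
    then have "\<phi> (K x) * gamma_density a (K x) * k x
        = (x / K x) powr a * (K x / x) * K x powr (a - 1) * (exp (K x - x) * exp (- K x)) / Gamma a"
      using x Kpos[OF x] by (simp add: \<phi>_def gamma_density_pos LK mult_ac)
    also have "\<dots> = x powr (a - 1) * exp (- x) / Gamma a"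
      using x Kpos[OF x] by (simp add: powr_divide powr_diff exp_add[symmetric])
    finally show ?thesis using x by (simp add: gamma_density_pos)
  qed (simp add: K0 gamma_density_nonpos)
  have "distr (gamma_measure a) borel K = density (gamma_measure a) (\<lambda>y. ennreal (\<phi> y))"
  proof (rule measure_eqI)
    fix A assume "A \<in> sets (distr (gamma_measure a) borel K)"
    then have A [measurable]: "A \<in> sets borel" by simp
    \<comment> \<open>The substitution rule concerns compact intervals, so the half line is
      exhausted by [0, n] on one side and by [0, K n] on the other.\<close>
    have sub: "(\<integral>\<^sup>+y. ennreal (indicator A y * \<phi> y * gamma_density a y * indicator {0..K (real n)} y) \<partial>lborel)
        = (\<integral>\<^sup>+x. ennreal (gamma_density a x * indicator A (K x) * indicator {0..real n} x) \<partial>lborel)" for n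
    proof -
      have "(\<integral>\<^sup>+y. ennreal (indicator A y * \<phi> y * gamma_density a y * indicator {K 0..K (real n)} y) \<partial>lborel)
        = (\<integral>\<^sup>+x. ennreal (indicator A (K x) * \<phi> (K x) * gamma_density a (K x) * k x * indicator {0..real n} x) \<partial>lborel)"
        by (intro nn_integral_substitution)
          (auto simp: set_borel_measurable_def der less_imp_le[OF k(2)] intro: continuous_on_subset[OF k(1)])
      also have "\<dots> = (\<integral>\<^sup>+x. ennreal (gamma_density a x * indicator A (K x) * indicator {0..real n} x) \<partial>lborel)"
        by (intro nn_integral_cong arg_cong[where f = ennreal]) (auto simp: indicator_def key[symmetric] mult_ac)
      finally show ?thesis by (simp add: K0)
    qed
    have sup: "(\<Squnion>n. ennreal (c * indicator {0..b n} x)) = (if 0 \<le> x then ennreal c else 0)"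
      if "incseq b" and ub: "\<And>y. \<exists>n. y \<le> b n" for c x and b :: "nat \<Rightarrow> real"
    proof (cases "0 \<le> x")
      case True
      obtain n where n: "x \<le> b n" using ub by blast
      show ?thesis
      proof (rule antisym)
        show "(\<Squnion>n. ennreal (c * indicator {0..b n} x)) \<le> (if 0 \<le> x then ennreal c else 0)"
          using True by (intro SUP_least) (simp add: indicator_def)
        show "(if 0 \<le> x then ennreal c else 0) \<le> (\<Squnion>n. ennreal (c * indicator {0..b n} x))"
          using True n by (intro SUP_upper2[of n]) auto
      qed
    qed simp
    have mono_ind: "incseq (\<lambda>n x. ennreal (c x * indicator {0..b n} x))" if "incseq b" for c and b :: "nat \<Rightarrow> real"
      using that by (intro incseq_SucI le_funI) (auto simp: indicator_def incseq_Suc_iff intro: order_trans)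
    have bK: "incseq (\<lambda>n. K (real n))" "\<And>y. \<exists>n. y \<le> K (real n)"
    proof -
      show "incseq (\<lambda>n. K (real n))" by (intro incseq_SucI) (simp add: K_mono)
      show "\<exists>n. y \<le> K (real n)" for y using real_arch_simple[of "L y"] K_mono KL by metis
    qed
    have bn: "incseq real" "\<And>y. \<exists>n. y \<le> real n" by (auto simp: incseq_def real_arch_simple)
    have "emeasure (distr (gamma_measure a) borel K) A
        = (\<integral>\<^sup>+x. indicator A (K x) \<partial>gamma_measure a)"
      by (subst nn_integral_distr[symmetric, of K _ borel "indicator A"]) auto
    also have "\<dots> = (\<integral>\<^sup>+x. ennreal (gamma_density a x) * indicator A (K x) \<partial>lborel)"
      by (rule nn_integral_gamma_measure) simp
    also have "\<dots> = (\<integral>\<^sup>+x. (\<Squnion>n. ennreal (gamma_density a x * indicator A (K x) * indicator {0..real n} x)) \<partial>lborel)"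
      unfolding sup[OF bn] by (intro nn_integral_cong) (auto simp: indicator_def gamma_density_nonpos)
    also have "\<dots> = (\<Squnion>n. \<integral>\<^sup>+x. ennreal (gamma_density a x * indicator A (K x) * indicator {0..real n} x) \<partial>lborel)"
      by (intro nn_integral_monotone_convergence_SUP mono_ind bn) measurable
    also have "\<dots> = (\<Squnion>n. \<integral>\<^sup>+y. ennreal (indicator A y * \<phi> y * gamma_density a y * indicator {0..K (real n)} y) \<partial>lborel)"
      by (simp add: sub)
    also have "\<dots> = (\<integral>\<^sup>+y. (\<Squnion>n. ennreal (indicator A y * \<phi> y * gamma_density a y * indicator {0..K (real n)} y)) \<partial>lborel)"
      by (intro nn_integral_monotone_convergence_SUP[symmetric] mono_ind bK) measurable
    also have "\<dots> = (\<integral>\<^sup>+y. ennreal (gamma_density a y) * (ennreal (\<phi> y) * indicator A y) \<partial>lborel)"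
      unfolding sup[OF bK]
    proof (intro nn_integral_cong)
      fix y :: real
      show "(if 0 \<le> y then ennreal (indicator A y * \<phi> y * gamma_density a y) else 0)
          = ennreal (gamma_density a y) * (ennreal (\<phi> y) * indicator A y)"
        using \<phi>_nonneg[of y] gamma_density_nonneg[OF a, of y] gamma_density_nonpos[of y a]
        by (cases "0 < y") (auto simp: indicator_def ennreal_mult'' mult_ac)
    qed
    also have "\<dots> = (\<integral>\<^sup>+y. ennreal (\<phi> y) * indicator A y \<partial>gamma_measure a)"
      by (rule nn_integral_gamma_measure[symmetric]) measurable
    also have "\<dots> = emeasure (density (gamma_measure a) (\<lambda>y. ennreal (\<phi> y))) A"
      by (subst emeasure_density) auto
    finally show "emeasure (distr (gamma_measure a) borel K) A
        = emeasure (density (gamma_measure a) (\<lambda>y. ennreal (\<phi> y))) A" .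
  qed simp
  then show ?thesis by (simp add: \<phi>_def)
qed

lemma distr_gamma_measure_scale:
  assumes "0 < a" "0 < r"
  shows "distr (gamma_measure a) borel (\<lambda>x. r * x)
    = density (gamma_measure a) (\<lambda>y. ennreal (r powr (- a) * exp ((1 - 1 / r) * y)))"
proof -
  have "distr (gamma_measure a) borel (\<lambda>x. r * x) = density (gamma_measure a)
    (\<lambda>y. ennreal ((y / r / y) powr a * (y / (y / r * r)) * exp (y - y / r)))"
    using assms by (intro distr_gamma_measure_increasing) (auto intro!: derivative_eq_intros)
  also have "\<dots> = density (gamma_measure a) (\<lambda>y. ennreal (r powr (- a) * exp ((1 - 1 / r) * y)))"
  proof (rule density_cong)
    show "AE y in gamma_measure a. ennreal ((y / r / y) powr a * (y / (y / r * r)) * exp (y - y / r))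
        = ennreal (r powr (- a) * exp ((1 - 1 / r) * y))"
      using AE_gamma_measure_pos
    proof eventually_elim
      case (elim y)
      have "(y / r / y) powr a = r powr (- a)" using elim assms by (simp add: powr_divide powr_minus_divide)
      moreover have "y - y / r = (1 - 1 / r) * y" by (simp add: left_diff_distrib)
      ultimately show ?case using elim assms by simp
    qed
  qed measurable
  finally show ?thesis .
qed

text \<open>The role of a mark \<open>k\<close> of the theorem at a fixed time, extended to the line.\<close>

locale hoelder_kernel =
  fixes k K :: "real \<Rightarrow> real" and \<kappa> \<alpha> :: real
  assumes \<kappa>: "1 \<le> \<kappa>" and \<alpha>: "0 < \<alpha>" "\<alpha> < 1"
    and hoelder: "\<bar>k x - k y\<bar> \<le> \<kappa> * \<bar>x - y\<bar> powr \<alpha>"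
    and lower: "1 / \<kappa> \<le> k x" and upper: "k x \<le> \<kappa>"
    and deriv: "(K has_real_derivative k x) (at x)" and K_0: "K 0 = 0"
begin

lemma k_pos: "0 < k x"
proof -
  have "0 < 1 / \<kappa>" using \<kappa> by simp
  then show ?thesis using lower[of x] by linarith
qed

lemma continuous_k: "continuous_on UNIV k"
proof -
  have "isCont k x" for x
  proof -
    have "((\<lambda>y. \<bar>y - x\<bar>) \<longlongrightarrow> \<bar>x - x\<bar>) (at x)" by (intro tendsto_intros)
    then have "((\<lambda>y. \<bar>y - x\<bar> powr \<alpha>) \<longlongrightarrow> 0 powr \<alpha>) (at x)"
      using \<alpha>(1) by (intro tendsto_powr2 tendsto_const) (simp_all add: always_eventually)
    then have "((\<lambda>y. \<kappa> * \<bar>y - x\<bar> powr \<alpha>) \<longlongrightarrow> 0) (at x)"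
      by (simp add: tendsto_mult_right_zero)
    then have "((\<lambda>y. k y - k x) \<longlongrightarrow> 0) (at x)"
      by (rule Lim_null_comparison[rotated]) (simp add: hoelder)
    then show ?thesis unfolding isCont_def by (simp add: LIM_zero_iff)
  qed
  then show ?thesis by (simp add: continuous_on_eq_continuous_at)
qed

lemma mvt:
  assumes "x < y"
  obtains z where "x < z" "z < y" "K y - K x = (y - x) * k z"
  using MVT2[OF assms, of K k] deriv by blast

lemma increment: 
  assumes "x \<le> y"
  shows "(y - x) / \<kappa> \<le> K y - K x" "K y - K x \<le> \<kappa> * (y - x)"
proof -
  have "(y - x) / \<kappa> \<le> K y - K x \<and> K y - K x \<le> \<kappa> * (y - x)"
  proof (cases "x = y")
    case False
    then obtain z where z: "K y - K x = (y - x) * k z" using assms mvt[of x y] by auto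
    show ?thesis
      using mult_left_mono[OF lower[of z], of "y - x"] mult_left_mono[OF upper[of z], of "y - x"] assms
      by (simp add: z mult_ac)
  qed simp
  then show "(y - x) / \<kappa> \<le> K y - K x" "K y - K x \<le> \<kappa> * (y - x)" by auto
qed

lemma lipschitz: "\<bar>K x - K y\<bar> \<le> \<kappa> * \<bar>x - y\<bar>"
proof -
  have "\<bar>K y - K x\<bar> \<le> \<kappa> * \<bar>y - x\<bar>" if "x \<le> y" for x y
    using increment[OF that] that \<kappa> by (smt (verit) divide_nonneg_nonneg)
  from this[of x y] this[of y x] show ?thesis by (cases "x \<le> y") (auto simp: abs_minus_commute)
qed

lemma nonneg_bounds: "0 \<le> x \<Longrightarrow> x / \<kappa> \<le> K x" "0 \<le> x \<Longrightarrow> K x \<le> \<kappa> * x"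
  using increment[of 0 x] K_0 by auto

lemma K_nonneg: "0 \<le> x \<Longrightarrow> 0 \<le> K x"
  using nonneg_bounds(1)[of x] \<kappa> by (smt (verit) divide_nonneg_nonneg)

lemma K_less: "x < y \<Longrightarrow> K x < K y"
  using increment(1)[of x y] \<kappa> by (smt (verit) divide_pos_pos)

lemma continuous_K: "continuous_on UNIV K"
  using deriv by (intro DERIV_continuous_on[of UNIV K k]) auto

lemma surj_K: "\<exists>x. K x = y"
proof -
  define c where "c = \<kappa> * \<bar>y\<bar>"
  have c: "0 \<le> c" using \<kappa> by (simp add: c_def)
  have "\<bar>y\<bar> \<le> K c" "K (- c) \<le> - \<bar>y\<bar>"
    using increment(1)[of 0 c] increment(1)[of "- c" 0] \<kappa> c K_0 by (simp_all add: c_def)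
  then obtain x where "K x = y"
    using IVT'[of K "- c" y c] c continuous_on_subset[OF continuous_K] by force
  then show ?thesis by blast
qed

text \<open>A total inverse, because the slope of \<open>K\<close> is at least 1 / \<kappa> on the
  whole line and not only on [0, 1].\<close>

definition L :: "real \<Rightarrow> real" where "L y = (THE x. K x = y)"

lemma LK: "L (K x) = x"
proof -
  have "z = x" if "K z = K x" for z
    using K_less[of z x] K_less[of x z] that by (cases z x rule: linorder_cases) auto
  then show ?thesis unfolding L_def by (intro the_equality) auto
qed

lemma KL: "K (L y) = y"
  using surj_K[of y] LK by metis

lemma L_0: "L 0 = 0" using LK[of 0] K_0 by simp

lemma L_increment:
  assumes "x \<le> y"
  shows "(y - x) / \<kappa> \<le> L y - L x" "L y - L x \<le> \<kappa> * (y - x)"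
proof -
  have le: "L x \<le> L y" using assms K_less[of "L y" "L x"] KL by (metis not_le)
  show "(y - x) / \<kappa> \<le> L y - L x"
    using increment(2)[OF le] \<kappa> by (simp add: KL pos_divide_le_eq mult.commute)
  show "L y - L x \<le> \<kappa> * (y - x)"
    using increment(1)[OF le] \<kappa> by (simp add: KL pos_divide_le_eq mult.commute)
qed

lemma L_nonneg_bounds: "0 \<le> y \<Longrightarrow> y / \<kappa> \<le> L y" "0 \<le> y \<Longrightarrow> L y \<le> \<kappa> * y"
  using L_increment[of 0 y] L_0 by auto

lemma L_pos: "0 < y \<Longrightarrow> 0 < L y"
  using L_nonneg_bounds(1)[of y] \<kappa> by (smt (verit) divide_pos_pos)

lemma measurable_K [measurable]: "K \<in> borel_measurable borel"
  using continuous_K by (rule borel_measurable_continuous_onI)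

lemma measurable_L [measurable]: "L \<in> borel_measurable borel"
proof (rule borel_measurable_mono, rule monoI)
  fix x y :: real assume "x \<le> y"
  then show "L x \<le> L y" using L_increment(1)[of x y] \<kappa> by (smt (verit) divide_nonneg_nonneg)
qed

text \<open>With \<open>x = L y\<close>, the mean value theorem writes the ratio \<open>y / (x * k x)\<close> in the density as
  \<open>k z / k x\<close> for some \<open>z\<close> between \<open>0\<close> and \<open>x\<close>, and Hoelder continuity makes it
  \<open>1 + O(x powr \<alpha>)\<close>: this is what makes the product over many small cells converge.\<close>

lemma gamma_density_transform:
  assumes a: "0 < a"
  obtains \<phi> where "\<phi> \<in> borel_measurable borel"
    "\<And>y. 0 < y \<Longrightarrow> \<phi> y \<le> \<kappa> powr a * exp (\<kappa> ^ 3 * y powr \<alpha> + \<kappa> * y)"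
    "\<And>y. 0 < y \<Longrightarrow> \<kappa> powr (- a) * exp (- (\<kappa> ^ 3 * y powr \<alpha> + \<kappa> * y)) \<le> \<phi> y"
    "distr (gamma_measure a) borel K = density (gamma_measure a) (\<lambda>y. ennreal (\<phi> y))"
proof -
  define \<phi> where "\<phi> y = (L y / y) powr a * (y / (L y * k (L y))) * exp (y - L y)" for y
  have [measurable]: "k \<in> borel_measurable borel"
    using continuous_k by (rule borel_measurable_continuous_onI)
  have "\<phi> \<in> borel_measurable borel" unfolding \<phi>_def by measurable
  moreover have "\<phi> y \<le> \<kappa> powr a * exp (\<kappa> ^ 3 * y powr \<alpha> + \<kappa> * y) \<and>
      \<kappa> powr (- a) * exp (- (\<kappa> ^ 3 * y powr \<alpha> + \<kappa> * y)) \<le> \<phi> y" if y: "0 < y" for y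
  proof -
    define x where "x = L y"
    have x: "0 < x" "x \<le> \<kappa> * y" "y / \<kappa> \<le> x" "K x = y"
      using L_pos[OF y] L_nonneg_bounds[of y] y KL by (auto simp: x_def)
    obtain z where z: "0 < z" "z < x" "y = x * k z" using mvt[OF x(1)] x(4) K_0 by auto
    have xy: "1 / \<kappa> \<le> x / y" "x / y \<le> \<kappa>" using x y \<kappa> by (simp_all add: field_simps)
    have "(1 / \<kappa>) powr a \<le> (x / y) powr a" "(x / y) powr a \<le> \<kappa> powr a"
      using xy a \<kappa> x(1) y by (auto intro!: powr_mono2)
    then have p: "\<kappa> powr (- a) \<le> (x / y) powr a" "(x / y) powr a \<le> \<kappa> powr a"
      using \<kappa> by (simp_all add: powr_divide powr_minus_divide)
    have ratio: "y / (x * k x) = k z / k x" using z x by simp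
    have xal: "x powr \<alpha> \<le> \<kappa> * y powr \<alpha>"
    proof -
      have "x powr \<alpha> \<le> (\<kappa> * y) powr \<alpha>" using x \<alpha> by (intro powr_mono2) auto
      also have "\<dots> = \<kappa> powr \<alpha> * y powr \<alpha>" using \<kappa> y by (simp add: powr_mult)
      also have "\<dots> \<le> \<kappa> * y powr \<alpha>"
        using powr_mono[of \<alpha> 1 \<kappa>] \<alpha> \<kappa> by (intro mult_right_mono) auto
      finally show ?thesis .
    qed
    \<comment> \<open>Stated for general arguments, as it bounds both \<open>k z / k x\<close> and
      its inverse. The three factors of \<kappa> ^ 3 come from the Hoelder constant, from
      \<open>x powr \<alpha>\<close> \<le> \<kappa> * \<open>y powr \<alpha>\<close> and from the
      lower bound of the denominator.\<close>
    have hz: "k u / k v \<le> exp (\<kappa> ^ 3 * y powr \<alpha>)" if uv: "\<bar>u - v\<bar> \<le> x" for u v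
    proof -
      have "k u - k v \<le> \<kappa> * \<bar>u - v\<bar> powr \<alpha>" using hoelder[of u v] by simp
      also have "\<dots> \<le> \<kappa> * x powr \<alpha>" using uv \<kappa> \<alpha> by (intro mult_left_mono powr_mono2) auto
      also have "\<dots> \<le> \<kappa> * (\<kappa> * y powr \<alpha>)" using xal \<kappa> by (intro mult_left_mono) auto
      finally have d: "k u - k v \<le> \<kappa> * (\<kappa> * y powr \<alpha>)" .
      have "k u / k v = 1 + (k u - k v) / k v" using k_pos[of v] by (simp add: field_simps)
      also have "(k u - k v) / k v \<le> \<kappa> * (\<kappa> * y powr \<alpha>) / (1 / \<kappa>)"
      proof -
        have "(k u - k v) / k v \<le> \<kappa> * (\<kappa> * y powr \<alpha>) / k v"
          using d k_pos[of v] by (intro divide_right_mono) auto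
        also have "\<dots> \<le> \<kappa> * (\<kappa> * y powr \<alpha>) / (1 / \<kappa>)"
          using lower[of v] \<kappa> by (intro divide_left_mono) (auto simp: k_pos)
        finally show ?thesis .
      qed
      also have "1 + \<kappa> * (\<kappa> * y powr \<alpha>) / (1 / \<kappa>) = 1 + \<kappa> ^ 3 * y powr \<alpha>"
        by (simp add: power3_eq_cube)
      also have "\<dots> \<le> exp (\<kappa> ^ 3 * y powr \<alpha>)" by (rule exp_ge_add_one_self)
      finally show ?thesis by simp
    qed
    have q: "k z / k x \<le> exp (\<kappa> ^ 3 * y powr \<alpha>)" "exp (- (\<kappa> ^ 3 * y powr \<alpha>)) \<le> k z / k x"
    proof -
      show "k z / k x \<le> exp (\<kappa> ^ 3 * y powr \<alpha>)" using z by (intro hz) auto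
      have "k x / k z \<le> exp (\<kappa> ^ 3 * y powr \<alpha>)" using z by (intro hz) auto
      then show "exp (- (\<kappa> ^ 3 * y powr \<alpha>)) \<le> k z / k x"
        using k_pos[of x] k_pos[of z] by (simp add: exp_minus field_simps)
    qed
    have "y \<le> \<kappa> * y" using y \<kappa> mult_right_mono[of 1 \<kappa> y] by simp
    then have yx: "y - x \<le> \<kappa> * y" "- (\<kappa> * y) \<le> y - x" using x(1,2) y by linarith+
    have \<phi>: "\<phi> y = (x / y) powr a * (k z / k x) * exp (y - x)"
      by (simp add: \<phi>_def x_def[symmetric] ratio)
    have "\<phi> y \<le> \<kappa> powr a * exp (\<kappa> ^ 3 * y powr \<alpha>) * exp (\<kappa> * y)"
      unfolding \<phi> using p q yx k_pos by (intro mult_mono) (auto simp: less_imp_le)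
    moreover have "\<kappa> powr (- a) * exp (- (\<kappa> ^ 3 * y powr \<alpha>)) * exp (- (\<kappa> * y)) \<le> \<phi> y"
      unfolding \<phi> using p q yx k_pos by (intro mult_mono) (auto simp: less_imp_le)
    ultimately show ?thesis by (simp add: mult.assoc exp_add[symmetric])
  qed
  moreover have "distr (gamma_measure a) borel K = density (gamma_measure a) (\<lambda>y. ennreal (\<phi> y))"
    unfolding \<phi>_def
    by (rule distr_gamma_measure_increasing[OF a deriv continuous_k k_pos K_0 LK KL])
  ultimately show thesis using that by blast
qed

end

section \<open>Products of gamma distributions\<close>

text \<open>Boxes determine a product measure, and on a box the integral of a product of functions
  of one coordinate factorises.\<close>

lemma PiM_density:
  fixes f :: "'i \<Rightarrow> 'b \<Rightarrow> ennreal"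
  assumes I: "finite I" and N: "\<And>i. prob_space (N i)" and D: "\<And>i. prob_space (density (N i) (f i))"
    and f [measurable]: "\<And>i. f i \<in> borel_measurable (N i)"
  shows "PiM I (\<lambda>i. density (N i) (f i)) = density (PiM I N) (\<lambda>x. \<Prod>i\<in>I. f i (x i))"
proof -
  interpret N: product_prob_space N I
    by (intro product_prob_spaceI N)
  interpret D: product_prob_space "\<lambda>i. density (N i) (f i)" I
    by (intro product_prob_spaceI D)
  have [measurable]: "(\<lambda>x. \<Prod>i\<in>I. f i (x i)) \<in> borel_measurable (PiM I N)" by measurable
  show ?thesis
  proof (rule D.PiM_eqI[symmetric])
    show "sets (density (PiM I N) (\<lambda>x. \<Prod>i\<in>I. f i (x i))) = sets (PiM I (\<lambda>i. density (N i) (f i)))"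
      unfolding sets_density by (rule sets_PiM_cong) simp_all
    fix A assume "\<And>i. i \<in> I \<Longrightarrow> A i \<in> sets (density (N i) (f i))"
    then have A: "\<And>i. i \<in> I \<Longrightarrow> A i \<in> sets (N i)" by simp
    have "emeasure (density (PiM I N) (\<lambda>x. \<Prod>i\<in>I. f i (x i))) (Pi\<^sub>E I A)
        = (\<integral>\<^sup>+x. (\<Prod>i\<in>I. f i (x i)) * indicator (Pi\<^sub>E I A) x \<partial>PiM I N)"
      using A I by (intro emeasure_density) auto
    also have "\<dots> = (\<integral>\<^sup>+x. (\<Prod>i\<in>I. f i (x i) * indicator (A i) (x i)) \<partial>PiM I N)"
    proof (intro nn_integral_cong)
      fix x assume x: "x \<in> space (PiM I N)"
      have "indicator (Pi\<^sub>E I A) x = (\<Prod>i\<in>I. indicator (A i) (x i) :: ennreal)"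
        using x I by (auto simp: indicator_def space_PiM PiE_iff prod_zero_iff of_bool_def)
      then show "(\<Prod>i\<in>I. f i (x i)) * indicator (Pi\<^sub>E I A) x = (\<Prod>i\<in>I. f i (x i) * indicator (A i) (x i))"
        by (simp add: prod.distrib)
    qed
    also have "\<dots> = (\<Prod>i\<in>I. \<integral>\<^sup>+x. f i x * indicator (A i) x \<partial>N i)"
      by (intro N.product_nn_integral_prod I borel_measurable_times_ennreal f borel_measurable_indicator A)
    also have "\<dots> = (\<Prod>i\<in>I. emeasure (density (N i) (f i)) (A i))"
      using A by (intro prod.cong refl) (simp add: emeasure_density)
    finally show "emeasure (density (PiM I N) (\<lambda>x. \<Prod>i\<in>I. f i (x i))) (Pi\<^sub>E I A)
        = (\<Prod>i\<in>I. emeasure (density (N i) (f i)) (A i))" .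
  qed (rule I)
qed

lemma distr_PiM_coordinatewise:
  assumes I: "finite I" and N: "\<And>i. prob_space (N i)"
    and f [measurable]: "\<And>i. f i \<in> measurable (N i) (N' i)"
  shows "distr (PiM I N) (PiM I N') (\<lambda>x. \<lambda>i\<in>I. f i (x i)) = PiM I (\<lambda>i. distr (N i) (N' i) (f i))"
proof -
  interpret N: product_prob_space N I
    by (intro product_prob_spaceI N)
  interpret D: product_prob_space "\<lambda>i. distr (N i) (N' i) (f i)" I
    by (intro product_prob_spaceI prob_space.prob_space_distr[OF N f])
  show ?thesis
  proof (rule D.PiM_eqI)
    show "sets (distr (PiM I N) (PiM I N') (\<lambda>x. \<lambda>i\<in>I. f i (x i))) = sets (PiM I (\<lambda>i. distr (N i) (N' i) (f i)))"
      unfolding sets_distr by (rule sets_PiM_cong) simp_all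
    fix A assume "\<And>i. i \<in> I \<Longrightarrow> A i \<in> sets (distr (N i) (N' i) (f i))"
    then have A: "\<And>i. i \<in> I \<Longrightarrow> A i \<in> sets (N' i)" by simp
    have vim: "(\<lambda>x. \<lambda>i\<in>I. f i (x i)) -` Pi\<^sub>E I A \<inter> space (PiM I N) = Pi\<^sub>E I (\<lambda>i. f i -` A i \<inter> space (N i))"
      by (auto simp: space_PiM PiE_iff)
    have "emeasure (distr (PiM I N) (PiM I N') (\<lambda>x. \<lambda>i\<in>I. f i (x i))) (Pi\<^sub>E I A)
        = emeasure (PiM I N) (Pi\<^sub>E I (\<lambda>i. f i -` A i \<inter> space (N i)))"
      using A I by (subst emeasure_distr) (simp_all add: vim)
    also have "\<dots> = (\<Prod>i\<in>I. emeasure (N i) (f i -` A i \<inter> space (N i)))"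
      using A by (intro N.emeasure_PiM I) (simp add: measurable_sets[OF f])
    also have "\<dots> = (\<Prod>i\<in>I. emeasure (distr (N i) (N' i) (f i)) (A i))"
      using A by (intro prod.cong refl) (simp add: emeasure_distr)
    finally show "emeasure (distr (PiM I N) (PiM I N') (\<lambda>x. \<lambda>i\<in>I. f i (x i))) (Pi\<^sub>E I A)
        = (\<Prod>i\<in>I. emeasure (distr (N i) (N' i) (f i)) (A i))" .
  qed (rule I)
qed

text \<open>The interval holds all scales that occur later: if a window inside (1, 2) is seen
  through a map that distorts lengths by a factor between 1 / \<kappa> and \<kappa>, its preimage
  lies there. The interval is compact and avoids 0, where the density may vanish or blow up.\<close>

lemma gamma_density_window:
  assumes "0 < T" "1 \<le> \<kappa>"
  obtains c1 c2 where "0 < c1" "\<And>u. 1 / \<kappa> \<le> u \<Longrightarrow> u \<le> 2 * \<kappa> \<Longrightarrow> c1 \<le> gamma_density T u"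
    "\<And>u. 1 / \<kappa> \<le> u \<Longrightarrow> u \<le> 2 * \<kappa> \<Longrightarrow> gamma_density T u \<le> c2"
proof -
  define S where "S = {1 / \<kappa>..2 * \<kappa>}"
  have S: "compact S" "S \<noteq> {}" "\<And>u. u \<in> S \<Longrightarrow> 0 < u"
  proof -
    have k: "1 / \<kappa> \<le> 1" "0 < 1 / \<kappa>" using assms by auto
    show "compact S" by (simp add: S_def)
    have "1 \<in> S" using k assms by (simp add: S_def)
    then show "S \<noteq> {}" by blast
    show "0 < u" if "u \<in> S" for u using that k(2) unfolding S_def atLeastAtMost_iff by linarith
  qed
  define h where "h u = u powr (T - 1) * exp (- u) / Gamma T" for u
  have G: "Gamma T > 0" using assms by (intro Gamma_real_pos)
  have cont: "continuous_on S h"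
    unfolding h_def using S(3) G by (intro continuous_intros) force+
  have h: "gamma_density T u = h u" if "u \<in> S" for u using S(3)[OF that] by (simp add: gamma_density_pos h_def)
  obtain m where m: "m \<in> S" "\<And>u. u \<in> S \<Longrightarrow> h m \<le> h u" using continuous_attains_inf[OF S(1,2) cont] by blast
  obtain n where n: "n \<in> S" "\<And>u. u \<in> S \<Longrightarrow> h u \<le> h n" using continuous_attains_sup[OF S(1,2) cont] by blast
  have "0 < h m" using S(3)[OF m(1)] G by (simp add: h_def)
  then show thesis using m n h by (intro that[of "h m" "h n"]) (auto simp: S_def)
qed

section \<open>Gamma vectors: total mass and normalisation\<close>

locale gamma_product =
  fixes I :: "'i set" and a :: "'i \<Rightarrow> real"
  assumes fin: "finite I" and nonempty: "I \<noteq> {}" and a_pos: "0 < a i"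
begin

abbreviation "B \<equiv> PiM I (\<lambda>_. borel :: real measure)"

definition "G = PiM I (\<lambda>i. gamma_measure (a i))"

definition tot :: "('i \<Rightarrow> real) \<Rightarrow> real" where "tot x = (\<Sum>i\<in>I. x i)"

definition normalise :: "('i \<Rightarrow> real) \<Rightarrow> 'i \<Rightarrow> real" where
  "normalise x = (\<lambda>i\<in>I. x i / tot x)"

definition scale :: "real \<Rightarrow> ('i \<Rightarrow> real) \<Rightarrow> 'i \<Rightarrow> real" where
  "scale r x = (\<lambda>i\<in>I. r * x i)"

abbreviation "T \<equiv> sum a I"

lemma T_pos: "0 < T" using fin nonempty a_pos by (intro sum_pos) auto

lemma sets_G [measurable_cong, simp]: "sets G = sets B"
  unfolding G_def by (rule sets_PiM_cong) simp_all

sublocale G: prob_space G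
  unfolding G_def by (intro prob_space_PiM prob_space_gamma_measure a_pos)

sublocale gT: prob_space "gamma_measure T"
  by (intro prob_space_gamma_measure T_pos)

lemma measurable_tot [measurable]: "tot \<in> borel_measurable B"
  unfolding tot_def by measurable

lemma measurable_normalise [measurable]: "normalise \<in> measurable B B"
  unfolding normalise_def by measurable

lemma measurable_scale [measurable]: "scale r \<in> measurable B B"
  unfolding scale_def by measurable

lemma measurable_scale' [measurable]:
  assumes [measurable]: "f \<in> borel_measurable N" "g \<in> measurable N B"
  shows "(\<lambda>x. scale (f x) (g x)) \<in> measurable N B"
  unfolding scale_def by measurable

lemma AE_pos: "AE x in G. \<forall>i\<in>I. 0 < x i"
proof (rule AE_finite_allI[OF fin])
  fix i assume i: "i \<in> I"
  show "AE x in G. 0 < x i"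
    unfolding G_def by (rule AE_PiM_component[OF _ i AE_gamma_measure_pos]) (intro prob_space_gamma_measure a_pos)
qed

lemma tot_pos: "\<forall>i\<in>I. 0 < x i \<Longrightarrow> 0 < tot x"
  unfolding tot_def using fin nonempty by (intro sum_pos) auto

lemma tot_scale: "tot (scale r x) = r * tot x"
  by (simp add: tot_def scale_def sum_distrib_left)

lemma tot_normalise: "\<forall>i\<in>I. 0 < x i \<Longrightarrow> tot (normalise x) = 1"
  using tot_pos[of x] by (simp add: tot_def normalise_def sum_divide_distrib[symmetric])

lemma normalise_scale: "r \<noteq> 0 \<Longrightarrow> normalise (scale r x) = normalise x"
  by (auto simp: normalise_def tot_scale) (auto simp: scale_def)

lemma normalise_normalise: "\<forall>i\<in>I. 0 < x i \<Longrightarrow> normalise (normalise x) = normalise x"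
  by (auto simp: normalise_def[of "normalise x"] tot_normalise) (auto simp: normalise_def)

lemma normalise_pos: "\<forall>i\<in>I. 0 < x i \<Longrightarrow> \<forall>i\<in>I. 0 < normalise x i"
  using tot_pos[of x] by (simp add: normalise_def)

lemma scale_tot_normalise: "tot x \<noteq> 0 \<Longrightarrow> scale (tot x * r) (normalise x) = scale r x"
  by (auto simp: scale_def normalise_def)

text \<open>Product form of a change of variables in each coordinate; it serves for the common
  scaling as well as for the kernels.\<close>

lemma nn_integral_coordinatewise:
  assumes f: "\<And>i. f i \<in> borel_measurable borel" and \<phi> [measurable]: "\<And>i. \<phi> i \<in> borel_measurable borel"
    and eq: "\<And>i. distr (gamma_measure (a i)) borel (f i) = density (gamma_measure (a i)) (\<phi> i)"
    and F [measurable]: "F \<in> borel_measurable B"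
  shows "(\<integral>\<^sup>+x. F (\<lambda>i\<in>I. f i (x i)) \<partial>G) = (\<integral>\<^sup>+x. (\<Prod>i\<in>I. \<phi> i (x i)) * F x \<partial>G)"
proof -
  have f' [measurable]: "f i \<in> measurable (gamma_measure (a i)) borel" for i
    using f[of i] by (simp add: measurable_def)
  have gp: "\<And>i. prob_space (gamma_measure (a i))" by (intro prob_space_gamma_measure a_pos)
  have "distr G B (\<lambda>x. \<lambda>i\<in>I. f i (x i)) = PiM I (\<lambda>i. distr (gamma_measure (a i)) borel (f i))"
    unfolding G_def by (intro distr_PiM_coordinatewise fin gp f')
  also have "\<dots> = density G (\<lambda>x. \<Prod>i\<in>I. \<phi> i (x i))"
    unfolding eq G_def
    by (intro PiM_density fin gp) (auto simp: eq[symmetric] intro!: prob_space.prob_space_distr gp f')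
  finally have law: "distr G B (\<lambda>x. \<lambda>i\<in>I. f i (x i)) = density G (\<lambda>x. \<Prod>i\<in>I. \<phi> i (x i))" .
  have "(\<integral>\<^sup>+x. F (\<lambda>i\<in>I. f i (x i)) \<partial>G) = (\<integral>\<^sup>+x. F x \<partial>distr G B (\<lambda>x. \<lambda>i\<in>I. f i (x i)))"
    using f by (intro nn_integral_distr[symmetric]) measurable
  also have "\<dots> = (\<integral>\<^sup>+x. (\<Prod>i\<in>I. \<phi> i (x i)) * F x \<partial>G)"
    unfolding law by (intro nn_integral_density) measurable
  finally show ?thesis .
qed

text \<open>A common factor in all coordinates makes the product density a function of
  \<open>tot x\<close> alone. This quasi-invariance is all that the polar decomposition
  uses.\<close>

lemma nn_integral_scale:
  assumes r: "0 < r" and F [measurable]: "F \<in> borel_measurable B"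
  shows "(\<integral>\<^sup>+x. F (scale r x) \<partial>G) = (\<integral>\<^sup>+x. ennreal (r powr (- T) * exp ((1 - 1 / r) * tot x)) * F x \<partial>G)"
proof -
  have "(\<integral>\<^sup>+x. F (\<lambda>i\<in>I. r * x i) \<partial>G)
      = (\<integral>\<^sup>+x. (\<Prod>i\<in>I. ennreal (r powr (- a i) * exp ((1 - 1 / r) * x i))) * F x \<partial>G)"
    using r a_pos by (intro nn_integral_coordinatewise distr_gamma_measure_scale) auto
  also have "(\<lambda>x. \<Prod>i\<in>I. ennreal (r powr (- a i) * exp ((1 - 1 / r) * x i)))
      = (\<lambda>x. ennreal (r powr (- T) * exp ((1 - 1 / r) * tot x)))"
    using r fin by (intro ext)
      (simp add: prod_ennreal prod.distrib powr_sum[symmetric] exp_sum[symmetric] sum_negf tot_def sum_distrib_left)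
  finally show ?thesis unfolding scale_def .
qed

text \<open>Equivalently: \<open>tot\<close> and \<open>normalise\<close> are independent under \<open>G\<close>. Both sides are computed from
  the quasi-invariance of \<open>G\<close> under scaling, up to a constant that the choice \<open>H = 1\<close> identifies.\<close>

lemma nn_integral_polar:
  assumes H [measurable]: "H \<in> borel_measurable B"
  shows "(\<integral>\<^sup>+x. H x \<partial>G) = (\<integral>\<^sup>+x. \<integral>\<^sup>+u. H (scale u (normalise x)) \<partial>gamma_measure T \<partial>G)"
proof -
  interpret GL: pair_sigma_finite G lborel ..
  define c where "c = (\<integral>\<^sup>+r. ennreal (indicator {0<..} r * r powr (- T - 1) * exp (- 1 / r) / Gamma T) \<partial>lborel)"
  have main: "(\<integral>\<^sup>+x. \<integral>\<^sup>+u. H (scale u (normalise x)) \<partial>gamma_measure T \<partial>G) = c * (\<integral>\<^sup>+x. H x \<partial>G)"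
    if H [measurable]: "H \<in> borel_measurable B" for H
  proof -
    \<comment> \<open>The weight left on \<open>H x\<close> after the substitution u = tot x * r and
      the removal of \<open>scale r\<close> by quasi-invariance. Its integral over r does not depend
      on S, as rescaling r by S shows.\<close>
    define q where "q S r = indicator {0<..} r * (r powr (- T) * exp ((1 - 1 / r) * S)) * (S / r * gamma_density T S)" for S r :: real
    have q_meas [measurable]: "(\<lambda>x. q (f x) (g x)) \<in> borel_measurable N"
      if [measurable]: "f \<in> borel_measurable N" "g \<in> borel_measurable N" for f g and N :: "'x measure"
      unfolding q_def by measurable
    have "(\<integral>\<^sup>+x. \<integral>\<^sup>+u. H (scale u (normalise x)) \<partial>gamma_measure T \<partial>G)
        = (\<integral>\<^sup>+x. \<integral>\<^sup>+r. ennreal (tot x * gamma_density T (tot x * r)) * H (scale r x) \<partial>lborel \<partial>G)"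
    proof (rule nn_integral_cong_AE, use AE_pos AE_space in eventually_elim)
      case (elim x)
      then have S: "0 < tot x" and [measurable]: "x \<in> space B" using tot_pos by (auto simp: G_def space_PiM)
      have nx [measurable]: "normalise x \<in> space B" by (auto simp: normalise_def space_PiM)
      have "(\<integral>\<^sup>+u. H (scale u (normalise x)) \<partial>gamma_measure T)
          = (\<integral>\<^sup>+u. ennreal (gamma_density T u) * H (scale u (normalise x)) \<partial>lborel)"
        by (intro nn_integral_gamma_measure) measurable
      also have "\<dots> = ennreal (tot x) * (\<integral>\<^sup>+r. ennreal (gamma_density T (tot x * r)) * H (scale (tot x * r) (normalise x)) \<partial>lborel)"
        using S by (subst nn_integral_real_affine[where t = 0 and c = "tot x"]) auto
      also have "\<dots> = (\<integral>\<^sup>+r. ennreal (tot x) * (ennreal (gamma_density T (tot x * r)) * H (scale r x)) \<partial>lborel)"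
        using S by (subst nn_integral_cmult) (auto simp: scale_tot_normalise)
      also have "\<dots> = (\<integral>\<^sup>+r. ennreal (tot x * gamma_density T (tot x * r)) * H (scale r x) \<partial>lborel)"
        using S T_pos by (intro nn_integral_cong) (simp add: ennreal_mult gamma_density_nonneg mult.assoc)
      finally show ?case .
    qed
    also have "\<dots> = (\<integral>\<^sup>+r. \<integral>\<^sup>+x. ennreal (tot x * gamma_density T (tot x * r)) * H (scale r x) \<partial>G \<partial>lborel)"
      by (intro GL.Fubini'[symmetric]) measurable
    also have "\<dots> = (\<integral>\<^sup>+r. \<integral>\<^sup>+x. ennreal (q (tot x) r) * H x \<partial>G \<partial>lborel)"
    proof (rule nn_integral_cong)
      fix r :: real
      show "(\<integral>\<^sup>+x. ennreal (tot x * gamma_density T (tot x * r)) * H (scale r x) \<partial>G)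
          = (\<integral>\<^sup>+x. ennreal (q (tot x) r) * H x \<partial>G)"
      proof (cases "0 < r")
        case True
        define F where "F x = ennreal (tot x / r * gamma_density T (tot x)) * H x" for x
        have [measurable]: "F \<in> borel_measurable B" unfolding F_def by measurable
        have "(\<integral>\<^sup>+x. ennreal (tot x * gamma_density T (tot x * r)) * H (scale r x) \<partial>G)
            = (\<integral>\<^sup>+x. F (scale r x) \<partial>G)"
          using True by (intro nn_integral_cong) (simp add: F_def tot_scale mult.commute)
        also have "\<dots> = (\<integral>\<^sup>+x. ennreal (r powr (- T) * exp ((1 - 1 / r) * tot x)) * F x \<partial>G)"
          by (intro nn_integral_scale True) measurable
        also have "\<dots> = (\<integral>\<^sup>+x. ennreal (q (tot x) r) * H x \<partial>G)"
          using True by (intro nn_integral_cong) (simp add: F_def q_def mult.assoc[symmetric] ennreal_mult'[symmetric])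
        finally show ?thesis .
      next
        case False
        have "AE x in G. ennreal (tot x * gamma_density T (tot x * r)) * H (scale r x) = 0"
          using AE_pos
        proof eventually_elim
          case (elim x)
          have "tot x * r \<le> 0" using tot_pos[OF elim] False by (simp add: mult_le_0_iff)
          then show ?case by (simp add: gamma_density_nonpos)
        qed
        then have "(\<integral>\<^sup>+x. ennreal (tot x * gamma_density T (tot x * r)) * H (scale r x) \<partial>G) = (\<integral>\<^sup>+x. 0 \<partial>G)"
          by (rule nn_integral_cong_AE)
        then show ?thesis using False by (simp add: q_def)
      qed
    qed
    also have "\<dots> = (\<integral>\<^sup>+x. \<integral>\<^sup>+r. ennreal (q (tot x) r) * H x \<partial>lborel \<partial>G)"
      by (intro GL.Fubini') measurable
    also have "\<dots> = (\<integral>\<^sup>+x. c * H x \<partial>G)"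
    proof (rule nn_integral_cong_AE, use AE_pos in eventually_elim)
      case (elim x)
      define S where "S = tot x"
      have S: "0 < S" using tot_pos[OF elim] by (simp add: S_def)
      have "(\<integral>\<^sup>+r. ennreal (q S r) \<partial>lborel) = ennreal S * (\<integral>\<^sup>+r. ennreal (q S (S * r)) \<partial>lborel)"
        using S by (subst nn_integral_real_affine[where t = 0 and c = S]) auto
      also have "\<dots> = (\<integral>\<^sup>+r. ennreal S * ennreal (q S (S * r)) \<partial>lborel)"
        by (intro nn_integral_cmult[symmetric]) measurable
      also have "\<dots> = c"
        unfolding c_def
      proof (intro nn_integral_cong)
        fix r :: real
        show "ennreal S * ennreal (q S (S * r)) = ennreal (indicator {0<..} r * r powr (- T - 1) * exp (- 1 / r) / Gamma T)"
        proof (cases "0 < r")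
          case True
          have "(1 - 1 / (S * r)) * S + - S = - 1 / r" using S True by (simp add: field_simps)
          then have e: "exp ((1 - 1 / (S * r)) * S) * exp (- S) = exp (- 1 / r)" by (simp add: exp_add[symmetric])
          have "S * q S (S * r) = S * ((S * r) powr (- T) * (1 / r) * S powr (T - 1)) * (exp ((1 - 1 / (S * r)) * S) * exp (- S)) / Gamma T"
            using S True by (simp add: q_def gamma_density_pos)
          also have "S * ((S * r) powr (- T) * (1 / r) * S powr (T - 1)) = r powr (- T - 1)"
            using S True by (simp add: powr_mult powr_diff powr_minus field_simps)
          finally show ?thesis using S True by (simp add: ennreal_mult'[symmetric] e)
        next
          case False
          then have "\<not> 0 < S * r" using S by (simp add: zero_less_mult_iff)
          then show ?thesis using False by (simp add: q_def)
        qed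
      qed
      finally show ?case by (subst nn_integral_multc) (auto simp: S_def)
    qed
    also have "\<dots> = c * (\<integral>\<^sup>+x. H x \<partial>G)" by (intro nn_integral_cmult) measurable
    finally show ?thesis .
  qed
  have "c = 1" using main[of "\<lambda>_. 1"] by (simp add: G.emeasure_space_1 gT.emeasure_space_1[simplified])
  then show ?thesis using main[OF H] by simp
qed

text \<open>Almost surely \<open>tot (scale u (normalise x))\<close> is u, so restricting the total
  mass restricts only the scale, which is independent of the normalised vector.\<close>

lemma nn_integral_window:
  assumes F [measurable]: "F \<in> borel_measurable B" and W [measurable]: "W \<in> sets borel" "W \<subseteq> {0<..}"
  shows "(\<integral>\<^sup>+x. F x * indicator W (tot x) \<partial>G)
    = (\<integral>\<^sup>+u. (\<integral>\<^sup>+x. F (scale u (normalise x)) \<partial>G) * indicator W u \<partial>gamma_measure T)"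
proof -
  interpret GT: pair_sigma_finite G "gamma_measure T" ..
  have "(\<integral>\<^sup>+x. F x * indicator W (tot x) \<partial>G)
      = (\<integral>\<^sup>+x. \<integral>\<^sup>+u. F (scale u (normalise x)) * indicator W (tot (scale u (normalise x))) \<partial>gamma_measure T \<partial>G)"
    by (intro nn_integral_polar) measurable
  also have "\<dots> = (\<integral>\<^sup>+x. \<integral>\<^sup>+u. F (scale u (normalise x)) * indicator W u \<partial>gamma_measure T \<partial>G)"
    by (rule nn_integral_cong_AE, use AE_pos in eventually_elim) (simp add: tot_scale tot_normalise)
  also have "\<dots> = (\<integral>\<^sup>+u. \<integral>\<^sup>+x. F (scale u (normalise x)) * indicator W u \<partial>G \<partial>gamma_measure T)"
    by (intro GT.Fubini'[symmetric]) measurable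
  also have "\<dots> = (\<integral>\<^sup>+u. (\<integral>\<^sup>+x. F (scale u (normalise x)) \<partial>G) * indicator W u \<partial>gamma_measure T)"
    by (rule nn_integral_cong, rule nn_integral_multc) measurable
  finally show ?thesis .
qed

end

section \<open>The normalised transformation of a gamma vector\<close>

locale gamma_kernels = gamma_product I a for I :: "'i set" and a +
  fixes k K :: "'i \<Rightarrow> real \<Rightarrow> real" and \<kappa> \<alpha> :: real
  assumes kernel: "\<And>i. hoelder_kernel (k i) (K i) \<kappa> \<alpha>"
begin

definition KK :: "('i \<Rightarrow> real) \<Rightarrow> 'i \<Rightarrow> real" where
  "KK x = (\<lambda>i\<in>I. K i (x i))"

definition LL :: "('i \<Rightarrow> real) \<Rightarrow> 'i \<Rightarrow> real" where
  "LL y = (\<lambda>i\<in>I. hoelder_kernel.L (K i) (y i))"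

definition V :: "('i \<Rightarrow> real) \<Rightarrow> real" where
  "V x = (\<Sum>i\<in>I. x i powr \<alpha>)"

lemma \<kappa>_ge_1: "1 \<le> \<kappa>" and \<alpha>_bounds: "0 < \<alpha>" "\<alpha> < 1"
  using hoelder_kernel.\<kappa>[OF kernel] hoelder_kernel.\<alpha>[OF kernel] by auto

lemma measurable_KK [measurable]: "KK \<in> measurable B B"
proof -
  have [measurable]: "K i \<in> borel_measurable borel" for i by (rule hoelder_kernel.measurable_K[OF kernel])
  show ?thesis unfolding KK_def by measurable
qed

lemma measurable_LL [measurable]: "LL \<in> measurable B B"
proof -
  have [measurable]: "hoelder_kernel.L (K i) \<in> borel_measurable borel" for i
    by (rule hoelder_kernel.measurable_L[OF kernel])
  show ?thesis unfolding LL_def by measurable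
qed

lemma measurable_V [measurable]: "V \<in> borel_measurable B"
  unfolding V_def by measurable

lemma LL_KK: "x \<in> space G \<Longrightarrow> LL (KK x) = x"
  using hoelder_kernel.LK[OF kernel]
  by (auto simp: LL_def KK_def G_def space_PiM PiE_iff extensional_def fun_eq_iff)

lemma LL_pos: "\<forall>i\<in>I. 0 < y i \<Longrightarrow> \<forall>i\<in>I. 0 < LL y i"
  using hoelder_kernel.L_pos[OF kernel] by (simp add: LL_def)

lemma tot_LL_increment:
  assumes y: "\<forall>i\<in>I. 0 < y i" and u: "u \<le> v"
  shows "(v - u) * tot y / \<kappa> \<le> tot (LL (scale v y)) - tot (LL (scale u y))"
    "tot (LL (scale v y)) - tot (LL (scale u y)) \<le> \<kappa> * ((v - u) * tot y)"
proof -
  have le: "u * y i \<le> v * y i" if "i \<in> I" for i using y u that by (intro mult_right_mono) (auto simp: less_imp_le)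
  have eq: "tot (LL (scale v y)) - tot (LL (scale u y))
      = (\<Sum>i\<in>I. hoelder_kernel.L (K i) (v * y i) - hoelder_kernel.L (K i) (u * y i))"
    by (simp add: tot_def LL_def scale_def sum_subtractf)
  have "(v - u) * tot y / \<kappa> = (\<Sum>i\<in>I. (v * y i - u * y i) / \<kappa>)"
    by (simp add: tot_def sum_distrib_left sum_divide_distrib left_diff_distrib)
  also have "\<dots> \<le> tot (LL (scale v y)) - tot (LL (scale u y))"
    unfolding eq by (intro sum_mono hoelder_kernel.L_increment(1)[OF kernel] le)
  finally show "(v - u) * tot y / \<kappa> \<le> tot (LL (scale v y)) - tot (LL (scale u y))" .
  have "tot (LL (scale v y)) - tot (LL (scale u y)) \<le> (\<Sum>i\<in>I. \<kappa> * (v * y i - u * y i))"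
    unfolding eq by (intro sum_mono hoelder_kernel.L_increment(2)[OF kernel] le)
  also have "\<dots> = \<kappa> * ((v - u) * tot y)"
    by (simp add: tot_def sum_distrib_left left_diff_distrib)
  finally show "tot (LL (scale v y)) - tot (LL (scale u y)) \<le> \<kappa> * ((v - u) * tot y)" .
qed

lemma tot_LL_0: "tot (LL (scale 0 y)) = 0"
  using hoelder_kernel.L_0[OF kernel] by (simp add: tot_def LL_def scale_def)

lemma scale_1: "tot (LL (scale 1 y)) = tot (LL y)"
  by (simp add: tot_def LL_def scale_def)

lemma tot_LL_bounds:
  assumes y: "\<forall>i\<in>I. 0 < y i"
  shows "tot y / \<kappa> \<le> tot (LL y)" "tot (LL y) \<le> \<kappa> * tot y"
  using tot_LL_increment[OF y, of 0 1] by (simp_all add: tot_LL_0 scale_1)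

text \<open>Along the ray through \<open>y\<close> the total of \<open>LL\<close> increases with
  slope between 1 / \<kappa> and \<kappa>. The preimage of a window of length \<epsilon> therefore
  has length comparable to \<epsilon>, with constants that do not involve the number of
  cells.\<close>

lemma LL_window:
  assumes y: "\<forall>i\<in>I. 0 < y i" "tot y = 1" and \<epsilon>: "0 < \<epsilon>" "\<epsilon> \<le> 1"
  defines "E \<equiv> {u. 0 < u \<and> tot (LL (scale u y)) \<in> {1<..<1 + \<epsilon>}}"
  shows "E \<subseteq> {1 / \<kappa>..2 * \<kappa>}" "\<And>u v. u \<in> E \<Longrightarrow> v \<in> E \<Longrightarrow> \<bar>u - v\<bar> \<le> \<kappa> * \<epsilon>"
    "\<exists>u0. {u0<..<u0 + \<epsilon> / \<kappa>} \<subseteq> E"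
proof -
  note \<kappa> = \<kappa>_ge_1
  define l where "l u = tot (LL (scale u y))" for u
  have inc: "(v - u) / \<kappa> \<le> l v - l u" "l v - l u \<le> \<kappa> * (v - u)" if "u \<le> v" for u v
    using tot_LL_increment[OF y(1) that] by (simp_all add: l_def y(2))
  have inc': "v - u \<le> \<kappa> * (l v - l u)" if "u \<le> v" for u v
    using inc(1)[OF that] \<kappa> by (simp add: pos_divide_le_eq mult.commute)
  have l0: "l 0 = 0" by (simp add: l_def tot_LL_0)
  have E: "u \<in> E \<longleftrightarrow> 0 < u \<and> 1 < l u \<and> l u < 1 + \<epsilon>" for u by (simp add: E_def l_def)
  show "E \<subseteq> {1 / \<kappa>..2 * \<kappa>}"
  proof
    fix u assume "u \<in> E"
    then have u: "0 < u" "1 < l u" "l u < 1 + \<epsilon>" by (auto simp: E)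
    have "1 \<le> \<kappa> * u" using inc(2)[of 0 u] u l0 by simp
    then have "1 / \<kappa> \<le> u" using \<kappa> by (simp add: pos_divide_le_eq mult.commute)
    moreover have "u \<le> \<kappa> * 2"
    proof -
      have "u \<le> \<kappa> * l u" using inc'[of 0 u] u l0 by simp
      also have "\<dots> \<le> \<kappa> * 2" using u \<epsilon> \<kappa> by (intro mult_left_mono) auto
      finally show ?thesis .
    qed
    ultimately show "u \<in> {1 / \<kappa>..2 * \<kappa>}" by simp
  qed
  have d: "v - u \<le> \<kappa> * \<epsilon>" if "u \<in> E" "v \<in> E" "u \<le> v" for u v
  proof -
    have "v - u \<le> \<kappa> * (l v - l u)" using inc' that by simp
    also have "\<dots> \<le> \<kappa> * \<epsilon>" using that \<kappa> by (intro mult_left_mono) (auto simp: E)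
    finally show ?thesis .
  qed
  show "\<bar>u - v\<bar> \<le> \<kappa> * \<epsilon>" if "u \<in> E" "v \<in> E" for u v
    using d[of u v] d[of v u] that by (cases "u \<le> v") auto
  have lip: "\<kappa>-lipschitz_on UNIV l"
  proof (rule lipschitz_onI)
    fix u v :: real
    have "dist (l u) (l v) \<le> \<kappa> * dist u v" if "u \<le> v" for u v
    proof -
      have "0 \<le> (v - u) / \<kappa>" using that \<kappa> by simp
      then have "\<bar>l u - l v\<bar> = l v - l u" using inc(1)[OF that] by linarith
      then show ?thesis using inc(2)[OF that] that by (simp add: dist_real_def)
    qed
    from this[of u v] this[of v u] show "dist (l u) (l v) \<le> \<kappa> * dist u v"
      by (cases "u \<le> v") (auto simp: dist_commute)
  qed (use \<kappa> in simp)
  \<comment> \<open>The total reaches 1 at some u0 up to \<kappa>. From there on it exceeds 1, and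
    slope at most \<kappa> keeps it below 1 + \<epsilon> for a further length \<epsilon> /
    \<kappa>.\<close>
  have "1 \<le> l \<kappa>" using inc(1)[of 0 \<kappa>] l0 \<kappa> by simp
  then obtain u0 where u0: "0 \<le> u0" "l u0 = 1"
    using IVT'[of l 0 1 \<kappa>] l0 \<kappa> continuous_on_subset[OF lipschitz_on_continuous_on[OF lip]] by auto
  have "u \<in> E" if u: "u \<in> {u0<..<u0 + \<epsilon> / \<kappa>}" for u
  proof -
    have "0 < (u - u0) / \<kappa>" using u \<kappa> by (intro divide_pos_pos) auto
    then have "1 < l u" using inc(1)[of u0 u] u u0 by simp
    moreover have "u - u0 < \<epsilon> / \<kappa>" using u by simp
    then have "\<kappa> * (u - u0) < \<epsilon>" using \<kappa> by (simp add: pos_less_divide_eq mult.commute)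
    ultimately show ?thesis using inc(2)[of u0 u] u u0 by (simp add: E)
  qed
  then show "\<exists>u0. {u0<..<u0 + \<epsilon> / \<kappa>} \<subseteq> E" by blast
qed

text \<open>In the product of the one-dimensional bounds, powers and exponents add up to
  \<open>T\<close>, \<open>V y\<close> and \<open>tot y\<close>. The number of cells disappears,
  which is what allows refinement later.\<close>

lemma nn_integral_KK:
  obtains \<psi> where "\<psi> \<in> borel_measurable B"
    "\<And>F. F \<in> borel_measurable B \<Longrightarrow> (\<integral>\<^sup>+x. F (KK x) \<partial>G) = (\<integral>\<^sup>+x. ennreal (\<psi> x) * F x \<partial>G)"
    "\<And>y. \<forall>i\<in>I. 0 < y i \<Longrightarrow> \<psi> y \<le> \<kappa> powr T * exp (\<kappa> ^ 3 * V y + \<kappa> * tot y)"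
    "\<And>y. \<forall>i\<in>I. 0 < y i \<Longrightarrow> \<kappa> powr (- T) * exp (- (\<kappa> ^ 3 * V y + \<kappa> * tot y)) \<le> \<psi> y"
proof -
  have "\<exists>\<phi>. \<phi> \<in> borel_measurable borel \<and>
    (\<forall>y>0. \<phi> y \<le> \<kappa> powr a i * exp (\<kappa> ^ 3 * y powr \<alpha> + \<kappa> * y)) \<and>
    (\<forall>y>0. \<kappa> powr (- a i) * exp (- (\<kappa> ^ 3 * y powr \<alpha> + \<kappa> * y)) \<le> \<phi> y) \<and>
    distr (gamma_measure (a i)) borel (K i) = density (gamma_measure (a i)) (\<lambda>y. ennreal (\<phi> y))" for i
    using hoelder_kernel.gamma_density_transform[OF kernel a_pos, of i i] by metis
  then obtain \<phi> where \<phi>: "\<And>i. \<phi> i \<in> borel_measurable borel"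
    "\<And>i y. 0 < y \<Longrightarrow> \<phi> i y \<le> \<kappa> powr a i * exp (\<kappa> ^ 3 * y powr \<alpha> + \<kappa> * y)"
    "\<And>i y. 0 < y \<Longrightarrow> \<kappa> powr (- a i) * exp (- (\<kappa> ^ 3 * y powr \<alpha> + \<kappa> * y)) \<le> \<phi> i y"
    "\<And>i. distr (gamma_measure (a i)) borel (K i) = density (gamma_measure (a i)) (\<lambda>y. ennreal (\<phi> i y))"
    by metis
  note [measurable] = \<phi>(1)
  define \<psi> where "\<psi> y = (\<Prod>i\<in>I. \<phi> i (y i))" for y
  have lo: "0 < \<phi> i y" if "0 < y" for i y
    using \<phi>(3)[OF that, of i] \<kappa>_ge_1 by (intro less_le_trans[OF _ \<phi>(3)[OF that, of i]]) auto
  have prods: "(\<Prod>i\<in>I. \<kappa> powr a i * exp (\<kappa> ^ 3 * y i powr \<alpha> + \<kappa> * y i)) = \<kappa> powr T * exp (\<kappa> ^ 3 * V y + \<kappa> * tot y)"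
    "(\<Prod>i\<in>I. \<kappa> powr (- a i) * exp (- (\<kappa> ^ 3 * y i powr \<alpha> + \<kappa> * y i))) = \<kappa> powr (- T) * exp (- (\<kappa> ^ 3 * V y + \<kappa> * tot y))" for y
    using fin \<kappa>_ge_1
    by (simp_all add: prod.distrib powr_sum[symmetric] exp_sum[symmetric] V_def tot_def sum.distrib
        sum_distrib_left sum_negf sum_subtractf)
  show thesis
  proof (rule that[of \<psi>])
    show "\<psi> \<in> borel_measurable B" unfolding \<psi>_def by measurable
    fix F :: "('i \<Rightarrow> real) \<Rightarrow> ennreal" assume F: "F \<in> borel_measurable B"
    have "(\<integral>\<^sup>+x. F (KK x) \<partial>G) = (\<integral>\<^sup>+x. (\<Prod>i\<in>I. ennreal (\<phi> i (x i))) * F x \<partial>G)"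
      unfolding KK_def
      by (rule nn_integral_coordinatewise[OF hoelder_kernel.measurable_K[OF kernel] _ \<phi>(4) F]) measurable
    also have "\<dots> = (\<integral>\<^sup>+x. ennreal (\<psi> x) * F x \<partial>G)"
      by (rule nn_integral_cong_AE, use AE_pos in eventually_elim)
        (simp add: \<psi>_def prod_ennreal less_imp_le[OF lo])
    finally show "(\<integral>\<^sup>+x. F (KK x) \<partial>G) = (\<integral>\<^sup>+x. ennreal (\<psi> x) * F x \<partial>G)" .
  next
    fix y :: "'i \<Rightarrow> real" assume y: "\<forall>i\<in>I. 0 < y i"
    show "\<psi> y \<le> \<kappa> powr T * exp (\<kappa> ^ 3 * V y + \<kappa> * tot y)"
      unfolding \<psi>_def prods[symmetric] using y by (intro prod_mono conjI \<phi>(2)) (auto simp: less_imp_le[OF lo])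
    show "\<kappa> powr (- T) * exp (- (\<kappa> ^ 3 * V y + \<kappa> * tot y)) \<le> \<psi> y"
      unfolding \<psi>_def prods[symmetric] using y by (intro prod_mono conjI \<phi>(3)) auto
  qed
qed

lemma V_normalise:
  assumes "\<forall>i\<in>I. 0 < x i"
  shows "V x = tot x powr \<alpha> * V (normalise x)"
proof -
  have "x i powr \<alpha> = tot x powr \<alpha> * (normalise x i) powr \<alpha>" if "i \<in> I" for i
    using tot_pos[OF assms] assms that by (simp add: normalise_def powr_divide)
  then show ?thesis unfolding V_def sum_distrib_left by (intro sum.cong) auto
qed

text \<open>For the upper comparison: there the variation is restricted for the vector before the
  transformation, \<open>LL y\<close>, while the density is estimated through the variation of
  \<open>y\<close>.\<close>

lemma V_le_LL:
  assumes y: "\<forall>i\<in>I. 0 < y i"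
  shows "V y \<le> \<kappa> * V (LL y)"
proof -
  have "y i powr \<alpha> \<le> \<kappa> * LL y i powr \<alpha>" if i: "i \<in> I" for i
  proof -
    have "y i / \<kappa> \<le> LL y i" using hoelder_kernel.L_nonneg_bounds(1)[OF kernel, of "y i" i] y i less_imp_le[of 0 "y i"] by (simp add: LL_def)
    then have "y i \<le> \<kappa> * LL y i" using \<kappa>_ge_1 by (simp add: pos_divide_le_eq mult.commute)
    then have "y i powr \<alpha> \<le> (\<kappa> * LL y i) powr \<alpha>" using y i \<alpha>_bounds by (intro powr_mono2) auto
    also have "\<dots> = \<kappa> powr \<alpha> * LL y i powr \<alpha>" using LL_pos[OF y] i \<kappa>_ge_1 by (simp add: powr_mult)
    also have "\<dots> \<le> \<kappa> * LL y i powr \<alpha>"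
      using powr_mono[of \<alpha> 1 \<kappa>] \<alpha>_bounds \<kappa>_ge_1 by (intro mult_right_mono) auto
    finally show ?thesis .
  qed
  then show ?thesis unfolding V_def sum_distrib_left by (intro sum_mono)
qed

lemma powr_le_double: "0 \<le> t \<Longrightarrow> t \<le> c \<Longrightarrow> 1 \<le> c \<Longrightarrow> t powr \<alpha> \<le> c"
  using powr_mono2[of \<alpha> t c] powr_mono[of \<alpha> 1 c] \<alpha>_bounds by simp

end

text \<open>The constants are parameters because the same two numbers must serve every grid; the
  conditions on them involve the grid only through \<open>sum a I\<close>, which is T for all
  grids.\<close>

locale gamma_kernels_window = gamma_kernels I a k K \<kappa> \<alpha>
  for I :: "'i set" and a k K \<kappa> \<alpha> +
  fixes c1 c2 :: real
  assumes c1: "0 < c1" "\<And>u. 1 / \<kappa> \<le> u \<Longrightarrow> u \<le> 2 * \<kappa> \<Longrightarrow> c1 \<le> gamma_density (sum a I) u"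
    and c2: "\<And>u. 1 / \<kappa> \<le> u \<Longrightarrow> u \<le> 2 * \<kappa> \<Longrightarrow> gamma_density (sum a I) u \<le> c2"
begin

lemma c2_pos: "0 < c2"
  using c1(1) c1(2)[of 1] c2[of 1] \<kappa>_ge_1 by (simp add: divide_le_eq)

text \<open>The total \<open>tot (LL y)\<close> is not independent of \<open>normalise y\<close>.
  Given \<open>normalise y\<close>, however, the window event confines the independent scale to a
  set whose gamma measure is comparable to \<epsilon> by \<open>LL_window\<close>, so up to
  constants the event acts like a factor \<epsilon>.\<close>

lemma window_LL:
  assumes \<Psi> [measurable]: "\<Psi> \<in> borel_measurable B" and \<epsilon>: "0 < \<epsilon>" "\<epsilon> \<le> 1"
  shows "(\<integral>\<^sup>+y. \<Psi> (normalise y) * indicator {1<..<1 + \<epsilon>} (tot (LL y)) \<partial>G)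
      \<le> ennreal (c2 * (2 * \<kappa> * \<epsilon>)) * (\<integral>\<^sup>+y. \<Psi> (normalise y) \<partial>G)" (is ?upper)
    and "ennreal (c1 * (\<epsilon> / \<kappa>)) * (\<integral>\<^sup>+y. \<Psi> (normalise y) \<partial>G)
      \<le> (\<integral>\<^sup>+y. \<Psi> (normalise y) * indicator {1<..<1 + \<epsilon>} (tot (LL y)) \<partial>G)" (is ?lower)
proof -
  define E where "E z = {u. 0 < u \<and> tot (LL (scale u z)) \<in> {1<..<1 + \<epsilon>}}" for z
  have E_meas: "E z \<in> sets borel" if [measurable]: "z \<in> space B" for z unfolding E_def by measurable
  have polar: "(\<integral>\<^sup>+y. \<Psi> (normalise y) * indicator {1<..<1 + \<epsilon>} (tot (LL y)) \<partial>G)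
      = (\<integral>\<^sup>+y. \<Psi> (normalise y) * emeasure (gamma_measure T) (E (normalise y)) \<partial>G)"
  proof -
    have "(\<integral>\<^sup>+y. \<Psi> (normalise y) * indicator {1<..<1 + \<epsilon>} (tot (LL y)) \<partial>G)
      = (\<integral>\<^sup>+y. \<integral>\<^sup>+u. \<Psi> (normalise (scale u (normalise y)))
          * indicator {1<..<1 + \<epsilon>} (tot (LL (scale u (normalise y)))) \<partial>gamma_measure T \<partial>G)"
      by (intro nn_integral_polar) measurable
    also have "\<dots> = (\<integral>\<^sup>+y. \<Psi> (normalise y) * emeasure (gamma_measure T) (E (normalise y)) \<partial>G)"
    proof (rule nn_integral_cong_AE, use AE_pos in eventually_elim)
      case (elim y)
      have "normalise y \<in> space B" by (auto simp: normalise_def space_PiM)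
      note E = E_meas[OF this]
      have "(\<integral>\<^sup>+u. \<Psi> (normalise (scale u (normalise y)))
          * indicator {1<..<1 + \<epsilon>} (tot (LL (scale u (normalise y)))) \<partial>gamma_measure T)
        = (\<integral>\<^sup>+u. \<Psi> (normalise y) * indicator (E (normalise y)) u \<partial>gamma_measure T)"
        by (rule nn_integral_cong_AE, use AE_gamma_measure_pos in eventually_elim)
          (simp add: normalise_scale normalise_normalise elim E_def indicator_def)
      also have "\<dots> = \<Psi> (normalise y) * emeasure (gamma_measure T) (E (normalise y))"
        using E by (subst nn_integral_cmult_indicator) auto
      finally show ?case .
    qed
    finally show ?thesis .
  qed
  have gE: "emeasure (gamma_measure T) (E z) \<le> ennreal (c2 * (2 * \<kappa> * \<epsilon>))"
    "ennreal (c1 * (\<epsilon> / \<kappa>)) \<le> emeasure (gamma_measure T) (E z)"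
    if z: "\<forall>i\<in>I. 0 < z i" "tot z = 1" "z \<in> space B" for z
  proof -
    note W = LL_window[OF z(1,2) \<epsilon>, folded E_def]
    have em: "emeasure (gamma_measure T) (E z) = (\<integral>\<^sup>+u. ennreal (gamma_density T u) * indicator (E z) u \<partial>lborel)"
      unfolding gamma_measure_def using E_meas[OF z(3)] by (subst emeasure_density) auto
    show "emeasure (gamma_measure T) (E z) \<le> ennreal (c2 * (2 * \<kappa> * \<epsilon>))"
    proof (cases "E z = {}")
      case False
      then obtain p where p: "p \<in> E z" by blast
      have "(\<integral>\<^sup>+u. ennreal (gamma_density T u) * indicator (E z) u \<partial>lborel)
          \<le> (\<integral>\<^sup>+u. ennreal c2 * indicator {p - \<kappa> * \<epsilon>..p + \<kappa> * \<epsilon>} u \<partial>lborel)"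
      proof (rule nn_integral_mono)
        fix u :: real
        show "ennreal (gamma_density T u) * indicator (E z) u \<le> ennreal c2 * indicator {p - \<kappa> * \<epsilon>..p + \<kappa> * \<epsilon>} u"
        proof (cases "u \<in> E z")
          case True
          then have "u \<in> {p - \<kappa> * \<epsilon>..p + \<kappa> * \<epsilon>}" using W(2)[OF p True] by (simp add: abs_le_iff) 
          moreover have "gamma_density T u \<le> c2" using W(1) True by (intro c2) auto
          ultimately show ?thesis by (simp add: indicator_def ennreal_leI)
        qed simp
      qed
      also have "\<dots> = ennreal (c2 * (2 * \<kappa> * \<epsilon>))"
        using \<epsilon> \<kappa>_ge_1 c2_pos by (simp add: nn_integral_cmult_indicator ennreal_mult[symmetric])
      finally show ?thesis by (simp add: em)
    qed simp
    obtain u0 where u0: "{u0<..<u0 + \<epsilon> / \<kappa>} \<subseteq> E z" using W(3) by blast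
    have "ennreal (c1 * (\<epsilon> / \<kappa>)) = (\<integral>\<^sup>+u. ennreal c1 * indicator {u0<..<u0 + \<epsilon> / \<kappa>} u \<partial>lborel)"
      using \<epsilon> \<kappa>_ge_1 c1(1) by (simp add: nn_integral_cmult_indicator ennreal_mult[symmetric])
    also have "\<dots> \<le> (\<integral>\<^sup>+u. ennreal (gamma_density T u) * indicator (E z) u \<partial>lborel)"
    proof (rule nn_integral_mono)
      fix u :: real
      show "ennreal c1 * indicator {u0<..<u0 + \<epsilon> / \<kappa>} u \<le> ennreal (gamma_density T u) * indicator (E z) u"
      proof (cases "u \<in> {u0<..<u0 + \<epsilon> / \<kappa>}")
        case True
        then have u: "u \<in> E z" using u0 by blast
        then have "c1 \<le> gamma_density T u" using W(1) by (intro c1(2)) auto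
        then show ?thesis using u by (simp add: indicator_def ennreal_leI)
      qed simp
    qed
    finally show "ennreal (c1 * (\<epsilon> / \<kappa>)) \<le> emeasure (gamma_measure T) (E z)" by (simp add: em)
  qed
  have nz: "\<forall>i\<in>I. 0 < normalise y i" "tot (normalise y) = 1" "normalise y \<in> space B" if "\<forall>i\<in>I. 0 < y i" for y
    using that normalise_pos tot_normalise by (auto simp: normalise_def space_PiM)
  have [measurable]: "(\<lambda>y. \<Psi> (normalise y)) \<in> borel_measurable G" by measurable
  have upper: "\<Psi> (normalise y) * emeasure (gamma_measure T) (E (normalise y)) \<le> ennreal (c2 * (2 * \<kappa> * \<epsilon>)) * \<Psi> (normalise y)"
    and lower: "ennreal (c1 * (\<epsilon> / \<kappa>)) * \<Psi> (normalise y) \<le> \<Psi> (normalise y) * emeasure (gamma_measure T) (E (normalise y))"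
    if "\<forall>i\<in>I. 0 < y i" for y
    using mult_left_mono[OF gE(1)[OF nz[OF that]], of "\<Psi> (normalise y)"]
      mult_left_mono[OF gE(2)[OF nz[OF that]], of "\<Psi> (normalise y)"]
    by (simp_all only: mult.commute zero_le)
  show ?upper unfolding polar nn_integral_cmult[OF \<open>(\<lambda>y. \<Psi> (normalise y)) \<in> borel_measurable G\<close>, symmetric]
    using AE_pos upper by (intro nn_integral_mono_AE) auto
  show ?lower unfolding polar nn_integral_cmult[OF \<open>(\<lambda>y. \<Psi> (normalise y)) \<in> borel_measurable G\<close>, symmetric]
    using AE_pos lower by (intro nn_integral_mono_AE) auto
qed

lemma gamma_measure_window:
  assumes \<epsilon>: "0 < \<epsilon>" "\<epsilon> \<le> 1"
  shows "ennreal (c1 * \<epsilon>) \<le> emeasure (gamma_measure T) {1<..<1 + \<epsilon>}"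
    "emeasure (gamma_measure T) {1<..<1 + \<epsilon>} \<le> ennreal (c2 * \<epsilon>)"
proof -
  have em: "emeasure (gamma_measure T) {1<..<1 + \<epsilon>} = (\<integral>\<^sup>+u. ennreal (gamma_density T u) * indicator {1<..<1 + \<epsilon>} u \<partial>lborel)"
    unfolding gamma_measure_def by (subst emeasure_density) auto
  have w: "1 / \<kappa> \<le> u \<and> u \<le> 2 * \<kappa>" if "u \<in> {1<..<1 + \<epsilon>}" for u
  proof -
    have "1 / \<kappa> \<le> 1" using \<kappa>_ge_1 by simp
    moreover have "1 < u" "u < 2" using that \<epsilon> by auto
    ultimately show ?thesis using \<kappa>_ge_1 by linarith
  qed
  have "ennreal (c1 * \<epsilon>) = (\<integral>\<^sup>+u. ennreal c1 * indicator {1<..<1 + \<epsilon>} u \<partial>lborel)"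
    using \<epsilon> c1(1) by (simp add: nn_integral_cmult_indicator ennreal_mult[symmetric])
  also have "\<dots> \<le> emeasure (gamma_measure T) {1<..<1 + \<epsilon>}"
    unfolding em using w by (intro nn_integral_mono) (auto simp: indicator_def intro!: ennreal_leI c1(2))
  finally show "ennreal (c1 * \<epsilon>) \<le> emeasure (gamma_measure T) {1<..<1 + \<epsilon>}" .
  have "emeasure (gamma_measure T) {1<..<1 + \<epsilon>} \<le> (\<integral>\<^sup>+u. ennreal c2 * indicator {1<..<1 + \<epsilon>} u \<partial>lborel)"
    unfolding em using w by (intro nn_integral_mono) (auto simp: indicator_def intro!: ennreal_leI c2)
  also have "\<dots> = ennreal (c2 * \<epsilon>)"
    using \<epsilon> c2_pos by (simp add: nn_integral_cmult_indicator ennreal_mult[symmetric])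
  finally show "emeasure (gamma_measure T) {1<..<1 + \<epsilon>} \<le> ennreal (c2 * \<epsilon>)" .
qed

text \<open>The density bound of \<open>nn_integral_KK\<close> at \<open>V y\<close> \<le> 2 *
  \<kappa> * R and \<open>tot y\<close> \<le> 2 * \<kappa>, the largest values possible on the
  window.\<close>

definition bound :: "real \<Rightarrow> real" where
  "bound R = \<kappa> powr T * exp (\<kappa> ^ 3 * (2 * \<kappa> * R) + \<kappa> * (2 * \<kappa>))"

lemma bound_pos: "0 < bound R"
  unfolding bound_def using \<kappa>_ge_1 by (intro mult_pos_pos exp_gt_zero powr_gt_zero[THEN iffD2]) simp

text \<open>Substitute y = \<open>KK x\<close>, so that x = \<open>LL y\<close>. On the window,
  \<open>tot (LL y)\<close> \<le> 2 bounds the mass and the variation of \<open>y\<close>, hence the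
  density by \<open>bound R\<close>; afterwards \<open>window_LL\<close> trades the window for a
  factor \<epsilon>.\<close>

lemma window_KK_upper:
  assumes \<Phi> [measurable]: "\<Phi> \<in> borel_measurable B" and \<epsilon>: "0 < \<epsilon>" "\<epsilon> \<le> 1" and R: "0 \<le> R"
  shows "(\<integral>\<^sup>+x. \<Phi> (normalise (KK x)) * indicator {..R} (V (normalise x)) * indicator {1<..<1 + \<epsilon>} (tot x) \<partial>G)
    \<le> ennreal (bound R * (c2 * (2 * \<kappa> * \<epsilon>))) * (\<integral>\<^sup>+y. \<Phi> (normalise y) \<partial>G)"
proof -
  obtain \<psi> where \<psi>: "\<psi> \<in> borel_measurable B"
    "\<And>F. F \<in> borel_measurable B \<Longrightarrow> (\<integral>\<^sup>+x. F (KK x) \<partial>G) = (\<integral>\<^sup>+x. ennreal (\<psi> x) * F x \<partial>G)"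
    "\<And>y. \<forall>i\<in>I. 0 < y i \<Longrightarrow> \<psi> y \<le> \<kappa> powr T * exp (\<kappa> ^ 3 * V y + \<kappa> * tot y)"
    by (rule nn_integral_KK) (rule that, assumption+)
  note [measurable] = \<psi>(1)
  define F where "F y = \<Phi> (normalise y) * indicator {..R} (V (normalise (LL y))) * indicator {1<..<1 + \<epsilon>} (tot (LL y))" for y
  have [measurable]: "F \<in> borel_measurable B" unfolding F_def by measurable
  have "(\<integral>\<^sup>+x. \<Phi> (normalise (KK x)) * indicator {..R} (V (normalise x)) * indicator {1<..<1 + \<epsilon>} (tot x) \<partial>G)
      = (\<integral>\<^sup>+x. F (KK x) \<partial>G)"
    by (intro nn_integral_cong) (simp add: F_def LL_KK)
  also have "\<dots> = (\<integral>\<^sup>+y. ennreal (\<psi> y) * F y \<partial>G)" by (intro \<psi>(2)) measurable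
  also have "\<dots> \<le> (\<integral>\<^sup>+y. ennreal (bound R) * (\<Phi> (normalise y) * indicator {1<..<1 + \<epsilon>} (tot (LL y))) \<partial>G)"
  proof (rule nn_integral_mono_AE, use AE_pos in eventually_elim)
    case (elim y)
    show ?case
    proof (cases "V (normalise (LL y)) \<le> R \<and> tot (LL y) \<in> {1<..<1 + \<epsilon>}")
      case True
      have t: "0 \<le> tot (LL y)" "tot (LL y) \<le> 2" using True \<epsilon> by auto
      have "tot y \<le> \<kappa> * tot (LL y)" using tot_LL_bounds(1)[OF elim] \<kappa>_ge_1 by (simp add: pos_divide_le_eq mult.commute)
      also have "\<dots> \<le> \<kappa> * 2" using t \<kappa>_ge_1 by (intro mult_left_mono) auto
      finally have ty: "tot y \<le> 2 * \<kappa>" by simp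
      have "V (LL y) \<le> 2 * R"
        unfolding V_normalise[OF LL_pos[OF elim]] using True R t
        by (intro mult_mono powr_le_double) (auto simp: V_def intro: sum_nonneg)
      then have "\<kappa> * V (LL y) \<le> \<kappa> * (2 * R)" using \<kappa>_ge_1 by (intro mult_left_mono) auto
      then have Vy: "V y \<le> 2 * \<kappa> * R" using V_le_LL[OF elim] by simp
      have "\<psi> y \<le> \<kappa> powr T * exp (\<kappa> ^ 3 * V y + \<kappa> * tot y)" by (rule \<psi>(3)[OF elim])
      also have "\<dots> \<le> bound R" unfolding bound_def using ty Vy \<kappa>_ge_1
        by (intro mult_left_mono exp_le_cancel_iff[THEN iffD2] add_mono mult_left_mono) auto
      finally show ?thesis using True by (auto simp: F_def intro!: mult_right_mono ennreal_leI)
    qed (auto simp: F_def indicator_def)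
  qed
  also have "\<dots> = ennreal (bound R) * (\<integral>\<^sup>+y. \<Phi> (normalise y) * indicator {1<..<1 + \<epsilon>} (tot (LL y)) \<partial>G)"
    by (intro nn_integral_cmult) measurable
  also have "\<dots> \<le> ennreal (bound R) * (ennreal (c2 * (2 * \<kappa> * \<epsilon>)) * (\<integral>\<^sup>+y. \<Phi> (normalise y) \<partial>G))"
    by (intro mult_left_mono window_LL(1) \<Phi> \<epsilon>) auto
  also have "\<dots> = ennreal (bound R * (c2 * (2 * \<kappa> * \<epsilon>))) * (\<integral>\<^sup>+y. \<Phi> (normalise y) \<partial>G)"
    using bound_pos[of R] by (subst ennreal_mult') (auto simp: mult.assoc less_imp_le)
  finally show ?thesis .
qed

text \<open>The converse estimate, with the variation restricted for the target vector
  \<open>y\<close>. From it null sets will pass from the transformed law to the original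
  one.\<close>

lemma window_KK_lower:
  assumes \<Phi> [measurable]: "\<Phi> \<in> borel_measurable B" and \<epsilon>: "0 < \<epsilon>" "\<epsilon> \<le> 1" and R: "0 \<le> R"
  shows "ennreal (c1 * (\<epsilon> / \<kappa>) / bound R) * (\<integral>\<^sup>+y. \<Phi> (normalise y) * indicator {..R} (V (normalise y)) \<partial>G)
    \<le> (\<integral>\<^sup>+x. \<Phi> (normalise (KK x)) * indicator {1<..<1 + \<epsilon>} (tot x) \<partial>G)"
proof -
  obtain \<psi> where \<psi>: "\<psi> \<in> borel_measurable B"
    "\<And>F. F \<in> borel_measurable B \<Longrightarrow> (\<integral>\<^sup>+x. F (KK x) \<partial>G) = (\<integral>\<^sup>+x. ennreal (\<psi> x) * F x \<partial>G)"
    "\<And>y. \<forall>i\<in>I. 0 < y i \<Longrightarrow> \<kappa> powr (- T) * exp (- (\<kappa> ^ 3 * V y + \<kappa> * tot y)) \<le> \<psi> y"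
    by (rule nn_integral_KK) (rule that, assumption+)
  note [measurable] = \<psi>(1)
  define F where "F y = \<Phi> (normalise y) * indicator {1<..<1 + \<epsilon>} (tot (LL y))" for y
  have [measurable]: "F \<in> borel_measurable B" unfolding F_def by measurable
  have b: "1 / bound R = \<kappa> powr (- T) * exp (- (\<kappa> ^ 3 * (2 * \<kappa> * R) + \<kappa> * (2 * \<kappa>)))"
    by (simp only: bound_def powr_minus exp_minus divide_inverse inverse_mult_distrib mult_1)
  have "ennreal (c1 * (\<epsilon> / \<kappa>) / bound R) * (\<integral>\<^sup>+y. \<Phi> (normalise y) * indicator {..R} (V (normalise y)) \<partial>G)
      = ennreal (1 / bound R) * (ennreal (c1 * (\<epsilon> / \<kappa>)) * (\<integral>\<^sup>+y. \<Phi> (normalise y) * indicator {..R} (V (normalise y)) \<partial>G))"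
  proof -
    have "c1 * (\<epsilon> / \<kappa>) / bound R = 1 / bound R * (c1 * (\<epsilon> / \<kappa>))" by simp
    then have "ennreal (c1 * (\<epsilon> / \<kappa>) / bound R) = ennreal (1 / bound R) * ennreal (c1 * (\<epsilon> / \<kappa>))"
      using bound_pos[of R] c1(1) \<epsilon> \<kappa>_ge_1 by (metis ennreal_mult' less_imp_le zero_less_divide_1_iff)
    then show ?thesis by (simp only: mult.assoc)
  qed
  also have "\<dots> \<le> ennreal (1 / bound R) * (\<integral>\<^sup>+y. \<Phi> (normalise y) * indicator {..R} (V (normalise y)) * indicator {1<..<1 + \<epsilon>} (tot (LL y)) \<partial>G)"
    by (intro mult_left_mono window_LL(2)[of "\<lambda>y. \<Phi> y * indicator {..R} (V y)"] \<epsilon>) auto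
  also have "\<dots> = (\<integral>\<^sup>+y. ennreal (1 / bound R) * (\<Phi> (normalise y) * indicator {..R} (V (normalise y)) * indicator {1<..<1 + \<epsilon>} (tot (LL y))) \<partial>G)"
    by (intro nn_integral_cmult[symmetric]) measurable
  also have "\<dots> \<le> (\<integral>\<^sup>+y. ennreal (\<psi> y) * F y \<partial>G)"
  proof (rule nn_integral_mono_AE, use AE_pos in eventually_elim)
    case (elim y)
    show ?case
    proof (cases "V (normalise y) \<le> R \<and> tot (LL y) \<in> {1<..<1 + \<epsilon>}")
      case True
      have t: "0 \<le> tot (LL y)" "tot (LL y) \<le> 2" using True \<epsilon> by auto
      have "tot y \<le> \<kappa> * tot (LL y)" using tot_LL_bounds(1)[OF elim] \<kappa>_ge_1 by (simp add: pos_divide_le_eq mult.commute)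
      also have "\<dots> \<le> \<kappa> * 2" using t \<kappa>_ge_1 by (intro mult_left_mono) auto
      finally have ty: "tot y \<le> 2 * \<kappa>" by simp
      have "V y \<le> 2 * \<kappa> * R"
        unfolding V_normalise[OF elim] using True R ty tot_pos[OF elim] \<kappa>_ge_1
        by (intro mult_mono powr_le_double) (auto simp: V_def intro: sum_nonneg)
      then have "1 / bound R \<le> \<kappa> powr (- T) * exp (- (\<kappa> ^ 3 * V y + \<kappa> * tot y))"
        unfolding b using ty \<kappa>_ge_1
        by (intro mult_left_mono exp_le_cancel_iff[THEN iffD2] le_imp_neg_le add_mono mult_left_mono) auto
      also have "\<dots> \<le> \<psi> y" by (rule \<psi>(3)[OF elim])
      finally show ?thesis using True by (auto simp: F_def intro!: mult_right_mono ennreal_leI)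
    qed (auto simp: F_def indicator_def)
  qed
  also have "\<dots> = (\<integral>\<^sup>+x. F (KK x) \<partial>G)" by (intro \<psi>(2)[symmetric]) measurable
  also have "\<dots> = (\<integral>\<^sup>+x. \<Phi> (normalise (KK x)) * indicator {1<..<1 + \<epsilon>} (tot x) \<partial>G)"
    by (intro nn_integral_cong) (simp add: F_def LL_KK)
  finally show ?thesis .
qed

text \<open>The constant of \<open>window_KK_upper\<close> divided by the lower bound
  \<open>c1 * \<epsilon>\<close> for the gamma measure of the window; the length \<epsilon>
  cancels.\<close>

definition const :: "real \<Rightarrow> real" where
  "const R = bound R * c2 * 2 * \<kappa> / c1"

lemma const_pos: "0 < const R"
  using bound_pos[of R] c2_pos c1(1) \<kappa>_ge_1 by (simp add: const_def)

text \<open>Since the total mass and the normalised vector are independent, conditioning on the event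
  that the total mass lies in a small window reduces the normalised transformation to the
  coordinatewise one. The price is a scaling factor \<open>u\<close> close to \<open>1\<close>.\<close>

lemma normalised_transform_upper:
  assumes \<Phi> [measurable]: "\<Phi> \<in> borel_measurable B" and \<Phi>1: "\<And>y. \<Phi> y \<le> 1"
    and \<epsilon>: "0 < \<epsilon>" "\<epsilon> \<le> 1" and R: "0 \<le> R" and \<delta>: "0 < \<delta>"
  obtains u where "1 < u" "u < 1 + \<epsilon>"
    "(\<integral>\<^sup>+x. \<Phi> (normalise (KK (scale u (normalise x)))) * indicator {..R} (V (normalise x)) \<partial>G)
      \<le> ennreal (const R) * (\<integral>\<^sup>+y. \<Phi> (normalise y) \<partial>G) + ennreal \<delta>"
proof (rule ccontr)
  assume "\<not> thesis"
  define \<psi> where "\<psi> u = (\<integral>\<^sup>+x. \<Phi> (normalise (KK (scale u (normalise x)))) * indicator {..R} (V (normalise x)) \<partial>G)" for u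
  define e where "e = (\<integral>\<^sup>+y. \<Phi> (normalise y) \<partial>G)"
  note witness = that
  \<comment> \<open>If every scale in the window failed, integrating the reverse inequality over the
    window would contradict \<open>window_KK_upper\<close>. The surplus \<delta> makes the
    contradiction strict.\<close>
  have no: "ennreal (const R) * e + ennreal \<delta> \<le> \<psi> u" if "u \<in> {1<..<1 + \<epsilon>}" for u
    using that \<open>\<not> thesis\<close> witness[of u] unfolding \<psi>_def e_def by (meson greaterThanLessThan_iff linear)
  have "e \<le> (\<integral>\<^sup>+y. 1 \<partial>G)" unfolding e_def by (intro nn_integral_mono \<Phi>1)
  then have e1: "e \<le> 1" by (simp add: G.emeasure_space_1)
  define F where "F x = \<Phi> (normalise (KK x)) * indicator {..R} (V (normalise x))" for x
  have [measurable]: "F \<in> borel_measurable B" unfolding F_def by measurable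
  have "(ennreal (const R) * e + ennreal \<delta>) * ennreal (c1 * \<epsilon>)
      \<le> (ennreal (const R) * e + ennreal \<delta>) * emeasure (gamma_measure T) {1<..<1 + \<epsilon>}"
    by (intro mult_left_mono gamma_measure_window \<epsilon>) auto
  also have "\<dots> = (\<integral>\<^sup>+u. (ennreal (const R) * e + ennreal \<delta>) * indicator {1<..<1 + \<epsilon>} u \<partial>gamma_measure T)"
    by (intro nn_integral_cmult_indicator[symmetric]) auto
  also have "\<dots> \<le> (\<integral>\<^sup>+u. \<psi> u * indicator {1<..<1 + \<epsilon>} u \<partial>gamma_measure T)"
    using no by (intro nn_integral_mono) (auto simp: indicator_def)
  also have "\<dots> = (\<integral>\<^sup>+u. (\<integral>\<^sup>+x. F (scale u (normalise x)) \<partial>G) * indicator {1<..<1 + \<epsilon>} u \<partial>gamma_measure T)"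
  proof (rule nn_integral_cong)
    fix u
    have "\<psi> u = (\<integral>\<^sup>+x. F (scale u (normalise x)) \<partial>G)" if "1 < u"
      unfolding \<psi>_def F_def
      by (rule nn_integral_cong_AE, use AE_pos in eventually_elim)
        (use that in \<open>simp add: normalise_scale normalise_normalise\<close>)
    then show "\<psi> u * indicator {1<..<1 + \<epsilon>} u = (\<integral>\<^sup>+x. F (scale u (normalise x)) \<partial>G) * indicator {1<..<1 + \<epsilon>} u"
      by (auto simp: indicator_def)
  qed
  also have "\<dots> = (\<integral>\<^sup>+x. F x * indicator {1<..<1 + \<epsilon>} (tot x) \<partial>G)"
    by (intro nn_integral_window[symmetric]) auto
  also have "\<dots> \<le> ennreal (bound R * (c2 * (2 * \<kappa> * \<epsilon>))) * e"
    unfolding F_def e_def by (rule window_KK_upper[OF \<Phi> \<epsilon> R])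
  also have "bound R * (c2 * (2 * \<kappa> * \<epsilon>)) = const R * (c1 * \<epsilon>)" using c1(1) by (simp add: const_def)
  finally have le: "(ennreal (const R) * e + ennreal \<delta>) * ennreal (c1 * \<epsilon>) \<le> ennreal (const R * (c1 * \<epsilon>)) * e" .
  obtain e' where e': "e = ennreal e'" "0 \<le> e'" using e1 by (cases e) (auto simp: top_unique)
  have c: "0 < const R" "0 < c1 * \<epsilon>" using const_pos[of R] c1(1) \<epsilon> by auto
  have "(ennreal (const R) * e + ennreal \<delta>) * ennreal (c1 * \<epsilon>) = ennreal ((const R * e' + \<delta>) * (c1 * \<epsilon>))"
    using c e' \<delta> by (subst ennreal_mult) (simp_all add: ennreal_mult)
  moreover have "ennreal (const R * (c1 * \<epsilon>)) * e = ennreal (const R * (c1 * \<epsilon>) * e')"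
    using c e' by (simp only: e'(1) ennreal_mult' less_imp_le mult_nonneg_nonneg)
  ultimately have "(const R * e' + \<delta>) * (c1 * \<epsilon>) \<le> const R * (c1 * \<epsilon>) * e'"
    using le c e' by (simp add: ennreal_le_iff del: mult_le_cancel_left mult_le_cancel_right)
  then have "\<delta> * (c1 * \<epsilon>) \<le> 0" by (simp add: algebra_simps)
  then show False using mult_pos_pos[OF \<delta> c(2)] by linarith
qed

text \<open>The same averaging in the other direction: if every scale failed, the transformed
  integral over the window would be too small for \<open>window_KK_lower\<close>.\<close>

lemma normalised_transform_lower:
  assumes \<Phi> [measurable]: "\<Phi> \<in> borel_measurable B" and \<Phi>1: "\<And>y. \<Phi> y \<le> 1"
    and \<epsilon>: "0 < \<epsilon>" "\<epsilon> \<le> 1" and R: "0 \<le> R" and \<delta>: "0 < \<delta>"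
  obtains u where "1 < u" "u < 1 + \<epsilon>"
    "(\<integral>\<^sup>+y. \<Phi> (normalise y) * indicator {..R} (V (normalise y)) \<partial>G)
      \<le> ennreal (const R) * (\<integral>\<^sup>+x. \<Phi> (normalise (KK (scale u (normalise x)))) \<partial>G) + ennreal \<delta>"
proof (rule ccontr)
  assume "\<not> thesis"
  define \<psi> where "\<psi> u = (\<integral>\<^sup>+x. \<Phi> (normalise (KK (scale u (normalise x)))) \<partial>G)" for u
  define e where "e = (\<integral>\<^sup>+y. \<Phi> (normalise y) * indicator {..R} (V (normalise y)) \<partial>G)"
  note witness = that
  have no: "ennreal (const R) * \<psi> u + ennreal \<delta> \<le> e" if "u \<in> {1<..<1 + \<epsilon>}" for u
    using that \<open>\<not> thesis\<close> witness[of u] unfolding \<psi>_def e_def by (meson greaterThanLessThan_iff linear)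
  have "e \<le> (\<integral>\<^sup>+y. 1 \<partial>G)" unfolding e_def using \<Phi>1 by (intro nn_integral_mono) (auto simp: indicator_def)
  then have e1: "e \<le> 1" by (simp add: G.emeasure_space_1)
  define F where "F x = \<Phi> (normalise (KK x))" for x
  have [measurable]: "F \<in> borel_measurable B" unfolding F_def by measurable
  define D where "D = c1 * (\<epsilon> / \<kappa>) / bound R"
  have D: "0 < D" using c1(1) \<epsilon> \<kappa>_ge_1 bound_pos[of R] by (simp add: D_def)
  \<comment> \<open>The gamma measure of the window is at most \<open>c2 * \<epsilon>\<close>, so
    \<open>const R\<close> leaves a factor 2 to spare and one constant serves both
    directions.\<close>
  have C: "const R * D = 2 * (c2 * \<epsilon>)"
    using bound_pos[of R] c1(1) \<kappa>_ge_1 by (simp add: const_def D_def)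
  obtain e' where e': "e = ennreal e'" "0 \<le> e'" using e1 by (cases e) (auto simp: top_unique)
  \<comment> \<open>Since \<open>ennreal\<close> truncates negative numbers to 0, e' - \<delta> must
    be known to be nonnegative before it is used under \<open>ennreal\<close>.\<close>
  have \<delta>e: "\<delta> \<le> e'"
  proof -
    have "ennreal \<delta> \<le> ennreal (const R) * \<psi> (1 + \<epsilon> / 2) + ennreal \<delta>" by simp
    also have "\<dots> \<le> ennreal e'" using no[of "1 + \<epsilon> / 2"] \<epsilon> e' by simp
    finally show ?thesis using e' \<delta> by simp
  qed
  have no': "\<psi> u \<le> ennreal ((e' - \<delta>) / const R)" if "u \<in> {1<..<1 + \<epsilon>}" for u
  proof -
    have *: "ennreal (const R) * \<psi> u + ennreal \<delta> \<le> ennreal e'" using no[OF that] e' by simp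
    obtain p where p: "\<psi> u = ennreal p" "0 \<le> p"
      using * const_pos[of R] by (cases "\<psi> u") (auto simp: ennreal_mult_top top_unique)
    have "const R * p + \<delta> \<le> e'"
      using * p const_pos[of R] \<delta> e' by (simp add: ennreal_mult'[symmetric] ennreal_plus[symmetric] del: ennreal_plus)
    then show ?thesis using const_pos[of R] unfolding p by (intro ennreal_leI) (simp add: pos_le_divide_eq mult.commute)
  qed
  have "ennreal D * e \<le> (\<integral>\<^sup>+x. F x * indicator {1<..<1 + \<epsilon>} (tot x) \<partial>G)"
    unfolding F_def e_def D_def by (rule window_KK_lower[OF \<Phi> \<epsilon> R])
  also have "\<dots> = (\<integral>\<^sup>+u. (\<integral>\<^sup>+x. F (scale u (normalise x)) \<partial>G) * indicator {1<..<1 + \<epsilon>} u \<partial>gamma_measure T)"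
    by (intro nn_integral_window) auto
  also have "\<dots> \<le> (\<integral>\<^sup>+u. ennreal ((e' - \<delta>) / const R) * indicator {1<..<1 + \<epsilon>} u \<partial>gamma_measure T)"
    using no' unfolding \<psi>_def F_def by (intro nn_integral_mono) (auto simp: indicator_def)
  also have "\<dots> = ennreal ((e' - \<delta>) / const R) * emeasure (gamma_measure T) {1<..<1 + \<epsilon>}"
    by (intro nn_integral_cmult_indicator) auto
  also have "\<dots> \<le> ennreal ((e' - \<delta>) / const R) * ennreal (c2 * \<epsilon>)"
    by (intro mult_left_mono gamma_measure_window \<epsilon>) auto
  finally have "ennreal (D * e') \<le> ennreal ((e' - \<delta>) / const R * (c2 * \<epsilon>))"
    using D e' \<delta>e const_pos[of R] c2_pos \<epsilon> by (simp add: ennreal_mult'[symmetric])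
  then have "D * e' \<le> (e' - \<delta>) / const R * (c2 * \<epsilon>)"
    using \<delta>e const_pos[of R] c2_pos \<epsilon> by (subst (asm) ennreal_le_iff) auto
  then have "const R * D * e' \<le> (e' - \<delta>) * (c2 * \<epsilon>)"
    using const_pos[of R] by (simp add: field_simps)
  then have "2 * (c2 * \<epsilon>) * e' \<le> (e' - \<delta>) * (c2 * \<epsilon>)" unfolding C .
  also have "\<dots> < e' * (c2 * \<epsilon>)" using \<delta> c2_pos \<epsilon> by (intro mult_strict_right_mono) auto
  finally have "2 * (e' * (c2 * \<epsilon>)) < e' * (c2 * \<epsilon>)" by (simp only: mult_ac)
  moreover have "0 \<le> e' * (c2 * \<epsilon>)" using e' c2_pos \<epsilon> by simp
  ultimately show False by linarith
qed

end

section \<open>Jumps of monotone cadlag paths\<close>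

locale monotone_path =
  fixes f :: "real \<Rightarrow> real" and T :: real
  assumes mono: "mono_on {0..T} f" and cadlag: "cadlag_on {0..T} f"
begin

lemma le: "0 \<le> s \<Longrightarrow> s \<le> t \<Longrightarrow> t \<le> T \<Longrightarrow> f s \<le> f t"
  using mono_onD[OF mono, of s t] by auto

lemma tendsto_left_limit:
  assumes s: "0 < s" "s \<le> T"
  shows "(f \<longlongrightarrow> f s - jump f s) (at_left s)"
proof -
  obtain l where l: "(f \<longlongrightarrow> l) (at s within {0..T} \<inter> {..<s})"
  proof -
    have "s \<in> {0..T}" using s by simp
    then show thesis using cadlag that unfolding cadlag_on_def by blast
  qed
  have "at s within {0..T} \<inter> {..<s} = at_left s"
    by (rule at_within_nhd[of s "{0<..}"]) (use s in auto)
  with l have l: "(f \<longlongrightarrow> l) (at_left s)" by simp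
  then have "Lim (at_left s) f = l" by (intro tendsto_Lim) simp_all
  with l s show ?thesis by (simp add: jump_def)
qed

lemma le_left_limit:
  assumes "0 \<le> u" "u < s" "s \<le> T"
  shows "f u \<le> f s - jump f s"
proof (rule tendsto_lowerbound[OF tendsto_left_limit])
  show "\<forall>\<^sub>F x in at_left s. f u \<le> f x"
    using eventually_at_left_real[OF \<open>u < s\<close>] by eventually_elim (use assms in \<open>auto intro!: le\<close>)
qed (use assms in auto)

lemma left_limit_le:
  assumes "0 \<le> u" "u < s" "s \<le> T" and b: "\<And>x. u < x \<Longrightarrow> x < s \<Longrightarrow> f x \<le> B"
  shows "f s - jump f s \<le> B"
proof (rule tendsto_upperbound[OF tendsto_left_limit])
  show "\<forall>\<^sub>F x in at_left s. f x \<le> B"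
    using eventually_at_left_real[OF \<open>u < s\<close>] by eventually_elim (use b in auto)
qed (use assms in auto)

lemma jump_0: "jump f 0 = 0"
  by (simp add: jump_def)

lemma jump_nonneg:
  assumes "0 \<le> s" "s \<le> T"
  shows "0 \<le> jump f s"
proof (cases "s = 0")
  case False
  have "f s - jump f s \<le> f s"
    by (rule left_limit_le[of 0]) (use assms False in \<open>auto intro!: le\<close>)
  then show ?thesis by simp
qed (simp add: jump_0)

text \<open>Induction on the largest jump time m: the other times lie up to some p < m, and
  \<open>f p\<close> is at most the left limit at m.\<close>

lemma sum_jump_le:
  assumes "finite F" "F \<subseteq> {a<..b}" "0 \<le> a" "a \<le> b" "b \<le> T"
  shows "sum (jump f) F \<le> f b - f a"
proof -
  have "F \<subseteq> {a<..b} \<Longrightarrow> a \<le> b \<Longrightarrow> b \<le> T \<Longrightarrow> sum (jump f) F \<le> f b - f a" for b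
    using assms(1)
  proof (induction F arbitrary: b rule: finite_linorder_max_induct)
    case empty
    then show ?case using le[of a b] assms(3) by simp
  next
    case (insert m A)
    then have m: "a < m" "m \<le> b" "m \<le> T" "m \<notin> A" by auto
    obtain p where p: "a \<le> p" "p < m" "A \<subseteq> {a<..p}"
    proof (cases "A = {}")
      case True
      then show thesis using that[of a] m by auto
    next
      case False
      then have "Max A \<in> A" using insert.hyps(1) by simp
      then show thesis using that[of "Max A"] insert.hyps insert.prems by force
    qed
    have "sum (jump f) A \<le> f p - f a" using insert.IH[of p] p m by auto
    moreover have "f p \<le> f m - jump f m" using le_left_limit[of p m] p m assms(3) by auto
    moreover have "f m \<le> f b" using m insert.prems assms(3) by (intro le) auto
    ultimately show ?case using m(4) insert.hyps(1) by simp
  qed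
  then show ?thesis using assms by blast
qed

text \<open>If any jump exceeds \<open>c\<close>, the left side subtracts \<open>c\<close> once for
  each such jump, the right side only once.\<close>

lemma sum_jump_excess_le:
  assumes F: "finite F" "F \<subseteq> {a<..b}" and ab: "0 \<le> a" "a \<le> b" "b \<le> T" and c: "0 \<le> c"
  shows "(\<Sum>s\<in>F. max 0 (jump f s - c)) \<le> max 0 (f b - f a - c)"
proof -
  define F' where "F' = {s \<in> F. c < jump f s}"
  have F': "finite F'" "F' \<subseteq> {a<..b}" using F by (auto simp: F'_def)
  have eq: "(\<Sum>s\<in>F. max 0 (jump f s - c)) = (\<Sum>s\<in>F'. jump f s - c)"
    unfolding F'_def using F(1) by (intro sum.mono_neutral_cong_right) auto
  show ?thesis
  proof (cases "F' = {}")
    case False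
    then have "1 \<le> card F'" using F'(1) by (simp add: Suc_le_eq card_gt_0_iff)
    then have "c * 1 \<le> c * real (card F')" using c by (intro mult_left_mono) auto
    then have "(\<Sum>s\<in>F'. jump f s - c) \<le> sum (jump f) F' - c" by (simp add: sum_subtractf mult.commute)
    then show ?thesis using sum_jump_le[OF F' ab] eq by simp
  qed (simp add: eq)
qed

lemma card_jumps_le:
  assumes "finite F" "F \<subseteq> {0..b}" "0 \<le> b" "b \<le> T" "\<And>s. s \<in> F \<Longrightarrow> c < jump f s" "0 < c"
  shows "real (card F) * c \<le> f b - f 0"
proof -
  have "0 \<notin> F" using assms(5)[of 0] assms(6) by (auto simp: jump_0)
  then have F: "F \<subseteq> {0<..b}" using assms(2) by (force simp: order.order_iff_strict)
  have "real (card F) * c = (\<Sum>s\<in>F. c)" by simp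
  also have "\<dots> \<le> sum (jump f) F" using assms(5) by (intro sum_mono) (auto simp: less_imp_le)
  also have "\<dots> \<le> f b - f 0" using assms F by (intro sum_jump_le) auto
  finally show ?thesis .
qed

lemma finite_jumps:
  assumes "0 \<le> b" "b \<le> T" "0 < c"
  shows "finite {s \<in> {0..b}. c < jump f s}"
proof (rule ccontr)
  assume inf: "infinite {s \<in> {0..b}. c < jump f s}"
  obtain n :: nat where n: "(f b - f 0) / c < real n" using reals_Archimedean2 by blast
  obtain F where F: "F \<subseteq> {s \<in> {0..b}. c < jump f s}" "finite F" "card F = n"
    using infinite_arbitrarily_large[OF inf] by blast
  have "real (card F) * c \<le> f b - f 0" by (rule card_jumps_le) (use F assms in auto)
  then have "real n * c \<le> f b - f 0" using F by simp
  then show False using n assms(3) by (simp add: pos_divide_less_eq)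
qed

end

section \<open>Uniform grids: cells, increments and their excess over a level\<close>

definition cell :: "real \<Rightarrow> nat \<Rightarrow> nat \<Rightarrow> real set" where
  "cell b n i = {b * real i / real n<..b * real (Suc i) / real n}"

lemma cell_disjoint:
  assumes "0 < b" "i \<noteq> j"
  shows "cell b n i \<inter> cell b n j = {}"
proof -
  have "cell b n i \<inter> cell b n j = {}" if "i < j" for i j
  proof -
    have "b * real (Suc i) / real n \<le> b * real j / real n"
      using that assms(1) by (intro divide_right_mono mult_left_mono) auto
    then show ?thesis by (auto simp: cell_def)
  qed
  from this[of i j] this[of j i] assms(2) show ?thesis by (cases "i < j") auto
qed

lemma UN_cell_le:
  assumes "0 < b" "0 < n"
  shows "(\<Union>i<k. cell b n i) = {0<..b * real k / real n}"
proof (induction k)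
  case (Suc k)
  have "0 \<le> b * real k / real n" "b * real k / real n \<le> b * real (Suc k) / real n"
    using assms by (auto intro!: divide_right_mono mult_left_mono)
  then have "{0<..b * real k / real n} \<union> cell b n k = {0<..b * real (Suc k) / real n}"
    unfolding cell_def by (intro ivl_disj_un_two(6)) auto
  then show ?case by (simp add: lessThan_Suc Un_commute Suc del: of_nat_Suc)
qed simp

lemma UN_cell: "0 < b \<Longrightarrow> 0 < n \<Longrightarrow> (\<Union>i<n. cell b n i) = {0<..b}"
  using UN_cell_le[of b n n] by simp

lemma sum_cells:
  assumes "0 < b" "0 < n" "finite F" "F \<subseteq> {0<..b * real k / real n}"
  shows "(\<Sum>i<k. \<Sum>s\<in>F \<inter> cell b n i. g s) = (\<Sum>s\<in>F. g s)"
proof -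
  have "(\<Sum>i<k. \<Sum>s\<in>F \<inter> cell b n i. g s) = (\<Sum>s\<in>(\<Union>i<k. F \<inter> cell b n i). g s)"
    using assms(3) cell_disjoint[OF assms(1), of _ _ n] by (intro sum.UNION_disjoint[symmetric]) blast+
  also have "(\<Union>i<k. F \<inter> cell b n i) = F" using UN_cell_le[OF assms(1,2), of k] assms(4) by blast
  finally show ?thesis .
qed

text \<open>The increment over \<open>cell b n i\<close>. Cells are closed on the right for this
  reason: a jump at the right end contributes to the increment, and for b > 0 the time 0, which
  carries no jump, lies in no cell.\<close>

definition increment :: "(real \<Rightarrow> real) \<Rightarrow> real \<Rightarrow> nat \<Rightarrow> nat \<Rightarrow> real" where
  "increment f b n i = f (b * real (Suc i) / real n) - f (b * real i / real n)"

lemma sum_increment: "(\<Sum>i<k. increment f b n i) = f (b * real k / real n) - f 0"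
  unfolding increment_def by (subst sum_lessThan_telescope) simp

lemma eventually_cell_separates:
  assumes "finite P" "0 < b"
  obtains N where "0 < N" "\<And>n i p q. N \<le> n \<Longrightarrow> p \<in> P \<inter> cell b n i \<Longrightarrow> q \<in> P \<inter> cell b n i \<Longrightarrow> p = q"
proof -
  obtain \<eta> where \<eta>: "0 < \<eta>" "\<And>p q. p \<in> P \<Longrightarrow> q \<in> P \<Longrightarrow> p \<noteq> q \<Longrightarrow> \<eta> \<le> \<bar>p - q\<bar>"
    using finite_separated[OF assms(1)] by metis
  obtain N0 :: nat where N0: "b / \<eta> < real N0" using reals_Archimedean2 by blast
  show thesis
  proof (rule that[of "Suc N0"])
    fix n i p q assume n: "Suc N0 \<le> n" and p: "p \<in> P \<inter> cell b n i" and q: "q \<in> P \<inter> cell b n i"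
    have "b / \<eta> < real n" using N0 n by simp
    then have "b / real n < \<eta>" using \<eta>(1) n by (simp add: divide_less_eq mult.commute)
    moreover have "b * real (Suc i) / real n = b * real i / real n + b / real n"
      by (simp add: add_divide_distrib distrib_left)
    ultimately have "\<bar>p - q\<bar> < \<eta>" using p q unfolding cell_def by auto
    then show "p = q" using \<eta>(2) p q by force
  qed simp
qed

context monotone_path
begin

lemma cell_bounds:
  assumes "0 < b" "b \<le> T" "i < n"
  shows "0 \<le> b * real i / real n" "b * real i / real n \<le> b * real (Suc i) / real n"
    "b * real (Suc i) / real n \<le> b" "b * real (Suc i) / real n \<le> T"
proof -
  show "0 \<le> b * real i / real n" using assms by simp
  show "b * real i / real n \<le> b * real (Suc i) / real n"
    using assms by (intro divide_right_mono mult_left_mono) auto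
  have "real (Suc i) \<le> real n" using assms by linarith
  then have "b * real (Suc i) \<le> b * real n" using assms by (intro mult_left_mono) auto
  then show "b * real (Suc i) / real n \<le> b" using assms by (simp add: pos_divide_le_eq)
  then show "b * real (Suc i) / real n \<le> T" using assms by linarith
qed

lemma increment_nonneg: "0 < b \<Longrightarrow> b \<le> T \<Longrightarrow> i < n \<Longrightarrow> 0 \<le> increment f b n i"
  using cell_bounds[of b i n] le by (simp add: increment_def)

lemma sum_jump_excess_le_increments:
  assumes b: "0 < b" "b \<le> T" and n: "0 < n" and F: "finite F" "F \<subseteq> {0<..b}" and c: "0 \<le> c"
  shows "(\<Sum>s\<in>F. max 0 (jump f s - c)) \<le> (\<Sum>i<n. max 0 (increment f b n i - c))"
proof -
  have "(\<Sum>s\<in>F. max 0 (jump f s - c)) = (\<Sum>i<n. \<Sum>s\<in>F \<inter> cell b n i. max 0 (jump f s - c))"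
    using b n F by (intro sum_cells[symmetric]) auto
  also have "\<dots> \<le> (\<Sum>i<n. max 0 (increment f b n i - c))"
    unfolding increment_def
    by (intro sum_mono sum_jump_excess_le cell_bounds b c) (use F in \<open>auto simp: cell_def\<close>)
  finally show ?thesis .
qed

text \<open>On a fine grid a cell contains at most one point of the partition \<open>P\<close>.
  Without such a point its increment is below \<open>c\<close>; with a point p it is at most the
  jump at p plus 2 e. The error 2 e is charged only where the jump exceeds c / 2, since otherwise
  the increment stays below \<open>c\<close>. There are at most 2 (f b - f 0) / c such jumps, whence
  the choice of \<open>e\<close>.\<close>

lemma increments_excess_le_sum_jump:
  assumes b: "0 < b" "b \<le> T" and c: "0 < c" and \<eta>: "0 < \<eta>"
  obtains N F where "finite F" "F \<subseteq> {0<..b}"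
    "\<And>n. N \<le> n \<Longrightarrow> (\<Sum>i<n. max 0 (increment f b n i - c)) \<le> (\<Sum>s\<in>F. max 0 (jump f s - c)) + \<eta>"
proof -
  define e where "e = min (c / 4) (\<eta> * c / (4 * (f b - f 0 + 1)))"
  have fb: "0 \<le> f b - f 0" using le[of 0 b] b by simp
  have e: "0 < e" "e \<le> c / 4" "e * (4 * (f b - f 0 + 1)) \<le> \<eta> * c"
  proof -
    have "0 < \<eta> * c / (4 * (f b - f 0 + 1))" using c \<eta> fb by (intro divide_pos_pos mult_pos_pos) auto
    then show "0 < e" using c unfolding e_def by (simp only: min_less_iff_conj) simp
    show "e \<le> c / 4" unfolding e_def by (rule min.cobounded1)
    have "e \<le> \<eta> * c / (4 * (f b - f 0 + 1))" by (simp add: e_def)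
    then show "e * (4 * (f b - f 0 + 1)) \<le> \<eta> * c" using fb by (subst (asm) pos_le_divide_eq) auto
  qed
  have cb: "cadlag_on {0..b} f" using cadlag by (rule cadlag_on_subset) (use b in auto)
  obtain P where P: "finite P" "P \<subseteq> {0..b}"
    "\<And>s t. 0 \<le> s \<Longrightarrow> s \<le> t \<Longrightarrow> t \<le> b \<Longrightarrow> P \<inter> {s<..t} = {} \<Longrightarrow> \<bar>f s - f t\<bar> < e"
    using cadlag_oscillation[OF cb e(1)] by metis
  obtain N where N: "0 < N" "\<And>n i p q. N \<le> n \<Longrightarrow> p \<in> P \<inter> cell b n i \<Longrightarrow> q \<in> P \<inter> cell b n i \<Longrightarrow> p = q"
    using eventually_cell_separates[OF P(1) b(1)] by metis
  define F where "F = P - {0}"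
  have F: "finite F" "F \<subseteq> {0<..b}" using P(1,2) by (auto simp: F_def order.order_iff_strict)
  define h where "h p = max 0 (jump f p - c) + (if c / 2 < jump f p then 2 * e else 0)" for p
  have hsum: "(\<Sum>p\<in>F. h p) \<le> (\<Sum>p\<in>F. max 0 (jump f p - c)) + \<eta>"
  proof -
    define F' where "F' = {p \<in> F. c / 2 < jump f p}"
    have "real (card F') * (c / 2) \<le> f b - f 0"
      using F b c by (intro card_jumps_le) (auto simp: F'_def)
    then have "e * (real (card F') * (c / 2)) \<le> e * (f b - f 0 + 1)" using e(1) by (intro mult_left_mono) auto
    then have "(2 * e * real (card F')) * c \<le> \<eta> * c" using e(3) by (simp add: algebra_simps)
    then have "2 * e * real (card F') \<le> \<eta>" using c by simp
    moreover have "(\<Sum>p\<in>F. if c / 2 < jump f p then 2 * e else 0) = 2 * e * real (card F')"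
      unfolding F'_def using F(1) by (simp add: sum.If_cases Int_def conj_commute)
    ultimately show ?thesis by (simp add: h_def sum.distrib)
  qed
  show thesis
  proof (rule that[OF F])
    fix n assume n: "N \<le> n"
    have "(\<Sum>i<n. max 0 (increment f b n i - c)) \<le> (\<Sum>i<n. \<Sum>p\<in>F \<inter> cell b n i. h p)"
    proof (rule sum_mono)
      fix i assume "i \<in> {..<n}"
      then have i: "i < n" by simp
      define u where "u = b * real i / real n"
      define v where "v = b * real (Suc i) / real n"
      have uv: "0 \<le> u" "u \<le> v" "v \<le> b" using cell_bounds[OF b i] by (auto simp: u_def v_def)
      have inc: "increment f b n i = f v - f u" and ce: "cell b n i = {u<..v}"
        by (simp_all add: increment_def cell_def u_def v_def)
      have PF: "P \<inter> {u<..v} = F \<inter> {u<..v}" using uv by (auto simp: F_def)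
      show "max 0 (increment f b n i - c) \<le> (\<Sum>p\<in>F \<inter> cell b n i. h p)"
      proof (cases "P \<inter> {u<..v} = {}")
        case True
        then have "F \<inter> cell b n i = {}" using PF ce by simp
        moreover have "increment f b n i \<le> c" using P(3)[OF uv True] e c unfolding inc by linarith
        ultimately show ?thesis by simp
      next
        case False
        then obtain p where p: "p \<in> P" "u < p" "p \<le> v" by auto
        have one: "P \<inter> {u<..v} = {p}" 
        proof -
          have pP: "p \<in> P \<inter> {u<..v}" using p by simp
          show ?thesis
          proof (intro equalityI subsetI)
            fix q assume q: "q \<in> P \<inter> {u<..v}"
            have "q = p" by (rule N(2)[OF n, where i = i, unfolded ce, OF q pP])
            then show "q \<in> {p}" by simp
          qed (use pP in simp)
        qed
        have "\<bar>f p - f v\<bar> < e" by (rule P(3)) (use p uv one in auto)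
        moreover have "f p - jump f p \<le> f u + e"
        proof (rule left_limit_le[of u])
          fix x assume x: "u < x" "x < p"
          have "P \<inter> {u<..x} \<subseteq> (P \<inter> {u<..v}) \<inter> {..x}" using x p by auto
          also have "\<dots> = {}" unfolding one using x by simp
          finally have "\<bar>f u - f x\<bar> < e" using x p uv by (intro P(3)) auto
          then show "f x \<le> f u + e" by linarith
        qed (use p uv b in auto)
        ultimately have "f v - f u \<le> jump f p + 2 * e" by linarith
        have "max 0 (f v - f u - c) \<le> h p" 
        proof (cases "c / 2 < jump f p")
          case True
          then have "h p = max 0 (jump f p - c) + 2 * e" by (simp add: h_def)
          then show ?thesis using \<open>f v - f u \<le> jump f p + 2 * e\<close> e(1) by linarith
        next
          case False
          then have "h p = max 0 (jump f p - c)" by (simp add: h_def)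
          then show ?thesis using \<open>f v - f u \<le> jump f p + 2 * e\<close> False e(2) by linarith
        qed
        moreover have "F \<inter> cell b n i = {p}" using one PF ce by simp
        ultimately show ?thesis by (simp add: inc)
      qed
    qed
    also have "\<dots> = (\<Sum>p\<in>F. h p)" using b n N(1) F by (intro sum_cells) auto
    also note hsum
    finally show "(\<Sum>i<n. max 0 (increment f b n i - c)) \<le> (\<Sum>p\<in>F. max 0 (jump f p - c)) + \<eta>" .
  qed
qed

text \<open>Unlike the number of jumps above \<open>c\<close>, this depends continuously on the jump
  sizes. It is therefore a limit of sums over grid increments, which makes it measurable when the
  path is random.\<close>

definition excess :: "real \<Rightarrow> real \<Rightarrow> real" where
  "excess b c = (\<Sum>s\<in>{s\<in>{0..b}. c < jump f s}. jump f s - c)"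

lemma sum_jump_excess_le_excess:
  assumes "0 < b" "b \<le> T" "0 < c" "finite F" "F \<subseteq> {0<..b}"
  shows "(\<Sum>s\<in>F. max 0 (jump f s - c)) \<le> excess b c"
proof -
  have "(\<Sum>s\<in>F. max 0 (jump f s - c)) = (\<Sum>s\<in>{s\<in>F. c < jump f s}. jump f s - c)"
    using assms by (intro sum.mono_neutral_cong_right) auto
  also have "\<dots> \<le> excess b c"
    unfolding excess_def using assms by (intro sum_mono2 finite_jumps) auto
  finally show ?thesis .
qed

text \<open>The sums over increments dominate the excess on every grid, and on fine grids they
  exceed it by an arbitrarily small amount.\<close>

lemma tendsto_excess:
  assumes b: "0 < b" "b \<le> T" and c: "0 < c"
  shows "(\<lambda>n. \<Sum>i<n. max 0 (increment f b n i - c)) \<longlonglongrightarrow> excess b c"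
proof (rule LIMSEQ_I)
  fix r :: real assume r: "0 < r"
  obtain N F where F: "finite F" "F \<subseteq> {0<..b}"
    "\<And>n. N \<le> n \<Longrightarrow> (\<Sum>i<n. max 0 (increment f b n i - c)) \<le> (\<Sum>s\<in>F. max 0 (jump f s - c)) + r / 2"
    by (rule increments_excess_le_sum_jump[OF b c half_gt_zero[OF r]]) (rule that, assumption+)
  define J where "J = {s \<in> {0..b}. c < jump f s}"
  have J: "finite J" "J \<subseteq> {0<..b}"
    using finite_jumps[of b c] b c jump_0 by (auto simp: J_def order.order_iff_strict)
  have "excess b c = (\<Sum>s\<in>J. max 0 (jump f s - c))"
    unfolding excess_def J_def by (intro sum.cong) auto
  then have ge: "excess b c \<le> (\<Sum>i<n. max 0 (increment f b n i - c))" if "0 < n" for n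
    using sum_jump_excess_le_increments[OF b that J] c by simp
  have "(\<Sum>s\<in>F. max 0 (jump f s - c)) \<le> excess b c"
    by (rule sum_jump_excess_le_excess[OF b c F(1,2)])
  then have "norm ((\<Sum>i<n. max 0 (increment f b n i - c)) - excess b c) < r" if "n \<ge> Suc N" for n
  proof -
    have "(\<Sum>i<n. max 0 (increment f b n i - c)) \<le> excess b c + r / 2" using F(3)[of n] that
        \<open>(\<Sum>s\<in>F. max 0 (jump f s - c)) \<le> excess b c\<close> by linarith
    moreover have "excess b c \<le> (\<Sum>i<n. max 0 (increment f b n i - c))" using ge[of n] that by simp
    ultimately show ?thesis using r unfolding real_norm_def by linarith
  qed
  then show "\<exists>no. \<forall>n\<ge>no. norm ((\<Sum>i<n. max 0 (increment f b n i - c)) - excess b c) < r" by blast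
qed

text \<open>A monotone path with finite variation of order \<open>\<alpha> < 1\<close> moves by jumps only: the increments
  below \<open>c\<close> contribute at most \<open>c powr (1 - \<alpha>) * R\<close>.\<close>

lemma sum_jump_exhausts:
  assumes T: "0 < T" and \<alpha>: "0 < \<alpha>" "\<alpha> < 1"
    and V: "\<And>m. (\<Sum>i<2 ^ m. increment f T (2 ^ m) i powr \<alpha>) \<le> R" and \<eta>: "0 < \<eta>"
  obtains F where "finite F" "F \<subseteq> {0<..T}" "f T - f 0 - \<eta> \<le> sum (jump f) F"
proof -
  have R: "0 \<le> R" using V[of 0] by (intro order_trans[OF sum_nonneg V[of 0]]) auto
  define c where "c = (\<eta> / (2 * (R + 1))) powr (1 / (1 - \<alpha>))"
  have c: "0 < c" using \<eta> R by (simp add: c_def)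
  have cR: "c powr (1 - \<alpha>) * R \<le> \<eta> / 2"
  proof -
    have "c powr (1 - \<alpha>) = \<eta> / (2 * (R + 1))"
      using \<alpha> \<eta> R by (simp add: c_def powr_powr)
    also have "\<eta> / (2 * (R + 1)) * R \<le> \<eta> / 2"
      using \<eta> R by (simp add: field_simps)
    finally show ?thesis .
  qed
  obtain N F where F: "finite F" "F \<subseteq> {0<..T}"
    "\<And>n. N \<le> n \<Longrightarrow> (\<Sum>i<n. max 0 (increment f T n i - c)) \<le> (\<Sum>s\<in>F. max 0 (jump f s - c)) + \<eta> / 2"
    by (rule increments_excess_le_sum_jump[OF T order_refl c half_gt_zero[OF \<eta>]]) (rule that, assumption+)
  define n where "n = (2 :: nat) ^ N"
  have n: "N \<le> n" "0 < n" unfolding n_def using less_exp[of N] by (auto intro: less_imp_le)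
  have "f T - f 0 = (\<Sum>i<n. increment f T n i)" using n T by (simp add: sum_increment)
  also have "\<dots> \<le> (\<Sum>i<n. max 0 (increment f T n i - c) + c powr (1 - \<alpha>) * increment f T n i powr \<alpha>)"
  proof (rule sum_mono)
    fix i assume "i \<in> {..<n}"
    then have x: "0 \<le> increment f T n i" using T by (intro increment_nonneg) auto
    have m: "min y c \<le> c powr (1 - \<alpha>) * y powr \<alpha>" if "0 \<le> y" for y
    proof (cases "y = 0")
      case False
      have z: "0 < min y c" using that False c by simp
      have "min y c = min y c powr (1 - \<alpha>) * min y c powr \<alpha>" using z by (simp add: powr_add[symmetric])
      also have "\<dots> \<le> c powr (1 - \<alpha>) * y powr \<alpha>"
        using z \<alpha> by (intro mult_mono powr_mono2) auto
      finally show ?thesis .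
    qed (use c in simp)
    have "increment f T n i \<le> max 0 (increment f T n i - c) + min (increment f T n i) c" by simp
    also have "\<dots> \<le> max 0 (increment f T n i - c) + c powr (1 - \<alpha>) * increment f T n i powr \<alpha>"
      using m[OF x] by simp
    finally show "increment f T n i \<le> max 0 (increment f T n i - c) + c powr (1 - \<alpha>) * increment f T n i powr \<alpha>" .
  qed
  also have "\<dots> \<le> ((\<Sum>s\<in>F. max 0 (jump f s - c)) + \<eta> / 2) + c powr (1 - \<alpha>) * R"
    unfolding sum.distrib sum_distrib_left[symmetric]
    using F(3)[OF n(1)] V[of N] by (intro add_mono mult_left_mono) (auto simp: n_def)
  also have "(\<Sum>s\<in>F. max 0 (jump f s - c)) \<le> sum (jump f) F"
    using F c by (intro sum_mono) (auto intro!: jump_nonneg)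
  finally have "f T - f 0 - \<eta> \<le> sum (jump f) F" using cR by linarith
  then show thesis using F that by blast
qed

end

section \<open>The measure of jumps\<close>

text \<open>Point masses at the pairs of jump time and jump size, weighted by the size. The weight
  bounds the total mass by \<open>f T - f 0\<close>, so that random paths with values in [0, 1] give
  random elements of \<open>subprob_algebra\<close>, and every sum of
  \<open>jump * \<phi>(time, jump)\<close> becomes an integral.\<close>

definition jump_measure :: "(real \<Rightarrow> real) \<Rightarrow> real \<Rightarrow> (real \<times> real) measure" where
  "jump_measure f T = distr (density (count_space {0..T}) (\<lambda>s. ennreal (jump f s))) borel (\<lambda>s. (s, jump f s))"

lemma sets_jump_measure [measurable_cong, simp]: "sets (jump_measure f T) = sets borel"
  and space_jump_measure [simp]: "space (jump_measure f T) = UNIV"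
  by (simp_all add: jump_measure_def)

lemma nn_integral_jump_measure:
  assumes "\<phi> \<in> borel_measurable borel"
  shows "(\<integral>\<^sup>+x. \<phi> x \<partial>jump_measure f T) = (\<integral>\<^sup>+s. ennreal (jump f s) * \<phi> (s, jump f s) \<partial>count_space {0..T})"
  unfolding jump_measure_def
  by (subst nn_integral_distr) (auto simp: assms nn_integral_density)

lemma emeasure_jump_measure:
  assumes "A \<in> sets borel"
  shows "emeasure (jump_measure f T) A = (\<integral>\<^sup>+s. ennreal (jump f s) * indicator A (s, jump f s) \<partial>count_space {0..T})"
  using nn_integral_jump_measure[of "indicator A" f T] assms by (simp add: nn_integral_indicator)

context monotone_path
begin

definition jumps_above :: "real \<Rightarrow> real \<Rightarrow> real set" where
  "jumps_above b c = {s \<in> {0..b}. c < jump f s}"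

lemma finite_jumps_above: "0 \<le> b \<Longrightarrow> b \<le> T \<Longrightarrow> 0 < c \<Longrightarrow> finite (jumps_above b c)"
  unfolding jumps_above_def by (rule finite_jumps)

lemma nn_integral_jumps:
  fixes g :: "real \<Rightarrow> ennreal"
  assumes b: "0 \<le> b" "b \<le> T" and g: "\<And>s. s \<in> {0..b} \<Longrightarrow> jump f s = 0 \<Longrightarrow> g s = 0"
  shows "(\<integral>\<^sup>+s. g s \<partial>count_space {0..b}) = (\<Squnion>n. \<Sum>s\<in>jumps_above b (1 / real (Suc n)). g s)"
proof -
  have "(\<integral>\<^sup>+s. g s \<partial>count_space {0..b})
      = (\<integral>\<^sup>+s. (\<Squnion>n. g s * indicator (jumps_above b (1 / real (Suc n))) s) \<partial>count_space {0..b})"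
  proof (rule nn_integral_cong)
    fix s assume "s \<in> space (count_space {0..b})"
    then have s: "s \<in> {0..b}" by simp
    show "g s = (\<Squnion>n. g s * indicator (jumps_above b (1 / real (Suc n))) s)"
    proof (cases "jump f s = 0")
      case True
      then show ?thesis using g[OF s] by simp
    next
      case False
      then have "0 < jump f s" using jump_nonneg[of s] s b by auto
      then obtain n where "1 / real (Suc n) < jump f s" using nat_approx_posE by blast
      then have "s \<in> jumps_above b (1 / real (Suc n))" using s by (simp add: jumps_above_def)
      then show ?thesis
        by (intro antisym SUP_upper2[of n] SUP_least) (auto simp: indicator_def)
    qed
  qed
  also have "\<dots> = (\<Squnion>n. \<integral>\<^sup>+s. g s * indicator (jumps_above b (1 / real (Suc n))) s \<partial>count_space {0..b})"
  proof (rule nn_integral_monotone_convergence_SUP)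
    have "jumps_above b (1 / real (Suc n)) \<subseteq> jumps_above b (1 / real (Suc (Suc n)))" for n
    proof -
      have "1 / real (Suc (Suc n)) \<le> 1 / real (Suc n)" by (intro divide_left_mono) auto
      then show ?thesis by (auto simp: jumps_above_def)
    qed
    then show "incseq (\<lambda>n s. g s * indicator (jumps_above b (1 / real (Suc n))) s)"
      by (intro incseq_SucI le_funI mult_left_mono) (auto simp: indicator_def)
  qed simp
  also have "\<dots> = (\<Squnion>n. \<Sum>s\<in>jumps_above b (1 / real (Suc n)). g s)"
  proof (rule SUP_cong[OF refl])
    fix n
    have "(\<integral>\<^sup>+s. g s * indicator (jumps_above b (1 / real (Suc n))) s \<partial>count_space {0..b})
        = (\<Sum>s\<in>jumps_above b (1 / real (Suc n)). g s * indicator (jumps_above b (1 / real (Suc n))) s)"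
      using b by (intro nn_integral_count_space' finite_jumps_above) (auto simp: jumps_above_def)
    then show "(\<integral>\<^sup>+s. g s * indicator (jumps_above b (1 / real (Suc n))) s \<partial>count_space {0..b})
        = (\<Sum>s\<in>jumps_above b (1 / real (Suc n)). g s)" by simp
  qed
  finally show ?thesis .
qed

lemma jumps_above_subset: "0 < c \<Longrightarrow> jumps_above b c \<subseteq> {0<..b}"
  using jump_0 by (auto simp: jumps_above_def order.order_iff_strict)

lemma nn_integral_jump_le:
  assumes b: "0 \<le> b" "b \<le> T"
  shows "(\<integral>\<^sup>+s. ennreal (jump f s) \<partial>count_space {0..b}) \<le> ennreal (f b - f 0)"
proof -
  have "(\<Sum>s\<in>jumps_above b (1 / real (Suc n)). ennreal (jump f s)) \<le> ennreal (f b - f 0)" for n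
  proof -
    have "(\<Sum>s\<in>jumps_above b (1 / real (Suc n)). ennreal (jump f s)) = ennreal (\<Sum>s\<in>jumps_above b (1 / real (Suc n)). jump f s)"
      using b by (intro sum_ennreal) (auto simp: jumps_above_def intro: jump_nonneg)
    also have "\<dots> \<le> ennreal (f b - f 0)"
      using b by (intro ennreal_leI sum_jump_le finite_jumps_above jumps_above_subset) auto
    finally show ?thesis .
  qed
  then show ?thesis using b by (subst nn_integral_jumps) (auto intro: SUP_least)
qed

lemma subprob_space_jump_measure:
  assumes "0 \<le> T" "f T - f 0 \<le> 1"
  shows "subprob_space (jump_measure f T)"
proof (rule subprob_spaceI)
  have "emeasure (jump_measure f T) UNIV \<le> ennreal (f T - f 0)"
    using nn_integral_jump_le[of T] assms by (subst emeasure_jump_measure) auto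
  also have "\<dots> \<le> 1" using assms by (simp add: ennreal_le_1)
  finally show "emeasure (jump_measure f T) (space (jump_measure f T)) \<le> 1" by simp
qed simp

definition jump_mass :: "real \<Rightarrow> real \<Rightarrow> real" where
  "jump_mass b c = (\<Sum>s\<in>jumps_above b c. jump f s)"

text \<open>The number of jumps above \<open>c\<close> is the right derivative of \<open>- excess b c\<close> in \<open>c\<close>.\<close>

lemma tendsto_jump_mass:
  assumes b: "0 \<le> b" "b \<le> T" and c: "0 < c"
  shows "(\<lambda>n. excess b c + c * (real n * (excess b c - excess b (c + 1 / real n)))) \<longlonglongrightarrow> jump_mass b c"
proof -
  note fin = finite_jumps_above[OF b c]
  have ex: "excess b (c + d) = (\<Sum>s\<in>jumps_above b c. max 0 (jump f s - c - d))" if "0 \<le> d" for d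
  proof -
    have "excess b (c + d) = (\<Sum>s\<in>jumps_above b (c + d). jump f s - (c + d))"
      by (simp add: excess_def jumps_above_def)
    also have "\<dots> = (\<Sum>s\<in>jumps_above b c. max 0 (jump f s - c - d))"
      using that fin by (intro sum.mono_neutral_cong_left) (auto simp: jumps_above_def)
    finally show ?thesis .
  qed
  have ex0: "excess b c = (\<Sum>s\<in>jumps_above b c. jump f s - c)"
    by (simp add: excess_def jumps_above_def)
  have "(\<lambda>n. real n * (excess b c - excess b (c + 1 / real n))) \<longlonglongrightarrow> (\<Sum>s\<in>jumps_above b c. 1)"
  proof -
    have eq: "real n * (excess b c - excess b (c + 1 / real n))
        = (\<Sum>s\<in>jumps_above b c. real n * ((jump f s - c) - max 0 (jump f s - c - 1 / real n)))" for n
      using ex[of "1 / real n"] ex0 by (simp add: sum_subtractf[symmetric] sum_distrib_left)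
    show ?thesis unfolding eq
    proof (rule tendsto_sum, rule tendsto_eventually)
      fix s assume "s \<in> jumps_above b c"
      then have x: "0 < jump f s - c" by (simp add: jumps_above_def)
      obtain N :: nat where N: "1 / (jump f s - c) < real N" using reals_Archimedean2 by blast
      show "\<forall>\<^sub>F n in sequentially. real n * ((jump f s - c) - max 0 (jump f s - c - 1 / real n)) = 1"
        using eventually_ge_at_top[of "Suc N"]
      proof eventually_elim
        case (elim n)
        have "1 / (jump f s - c) < real n" using N elim by simp
        then have "1 < real n * (jump f s - c)" using x by (simp add: divide_less_eq)
        then have "1 / real n < jump f s - c" using elim by (simp add: divide_less_eq mult.commute)
        then have "(jump f s - c) - max 0 (jump f s - c - 1 / real n) = 1 / real n" by simp
        then show ?case using elim by simp
      qed
    qed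
  qed
  then have "(\<lambda>n. excess b c + c * (real n * (excess b c - excess b (c + 1 / real n))))
      \<longlonglongrightarrow> excess b c + c * (\<Sum>s\<in>jumps_above b c. 1)"
    by (intro tendsto_intros)
  also have "excess b c + c * (\<Sum>s\<in>jumps_above b c. 1) = jump_mass b c"
    by (simp add: ex0 jump_mass_def sum_subtractf)
  finally show ?thesis .
qed

text \<open>A difference of two values of \<open>jump_mass\<close> is the total of the jumps with
  sizes between the two levels. The minimum with \<open>c\<close> makes the difference 0 for those n
  where 1 / (n + 1) lies above \<open>c\<close>.\<close>

lemma emeasure_jump_measure_box:
  assumes b: "0 \<le> b" "b \<le> T" and c: "0 < c"
  shows "emeasure (jump_measure f T) ({..b} \<times> {..c})
    = (\<Squnion>n. ennreal (jump_mass b (min c (1 / real (Suc n))) - jump_mass b c))"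
proof -
  have "emeasure (jump_measure f T) ({..b} \<times> {..c})
      = (\<integral>\<^sup>+s. ennreal (jump f s) * indicator ({..b} \<times> {..c}) (s, jump f s) \<partial>count_space {0..T})"
    by (rule emeasure_jump_measure) (simp add: borel_prod[symmetric])
  also have "\<dots> = (\<integral>\<^sup>+s. ennreal (jump f s) * indicator {..c} (jump f s) * indicator {0..b} s \<partial>count_space {0..T})"
    by (intro nn_integral_cong) (auto simp: indicator_def)
  also have "\<dots> = (\<integral>\<^sup>+s. ennreal (jump f s) * indicator {..c} (jump f s) \<partial>count_space {0..b})"
    using b by (subst (1 2) nn_integral_count_space_indicator) (auto intro!: nn_integral_cong simp: indicator_def)
  also have "\<dots> = (\<Squnion>n. \<Sum>s\<in>jumps_above b (1 / real (Suc n)). ennreal (jump f s) * indicator {..c} (jump f s))"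
    using b by (intro nn_integral_jumps) auto
  also have "\<dots> = (\<Squnion>n. ennreal (jump_mass b (min c (1 / real (Suc n))) - jump_mass b c))"
  proof (rule SUP_cong[OF refl])
    fix n
    define d where "d = 1 / real (Suc n)"
    have d: "0 < d" by (simp add: d_def)
    have sub: "jumps_above b c \<subseteq> jumps_above b (min c d)" by (auto simp: jumps_above_def)
    have "(\<Sum>s\<in>jumps_above b d. ennreal (jump f s) * indicator {..c} (jump f s))
        = (\<Sum>s\<in>jumps_above b (min c d) - jumps_above b c. ennreal (jump f s))"
      using finite_jumps_above[OF b, of d] finite_jumps_above[OF b, of "min c d"] c d
      by (intro sum.mono_neutral_cong) (auto simp: jumps_above_def indicator_def)
    also have "\<dots> = ennreal (\<Sum>s\<in>jumps_above b (min c d) - jumps_above b c. jump f s)"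
      using b by (intro sum_ennreal) (auto simp: jumps_above_def intro: jump_nonneg)
    also have "(\<Sum>s\<in>jumps_above b (min c d) - jumps_above b c. jump f s) = jump_mass b (min c d) - jump_mass b c"
      unfolding jump_mass_def using finite_jumps_above[OF b, of "min c d"] c d sub by (intro sum_diff) auto
    finally show "(\<Sum>s\<in>jumps_above b d. ennreal (jump f s) * indicator {..c} (jump f s))
        = ennreal (jump_mass b (min c d) - jump_mass b c)" .
  qed
  finally show ?thesis .
qed

end

section \<open>Measurability of the jumps of a random monotone path\<close>

locale monotone_process =
  fixes M :: "'a measure" and X :: "real \<Rightarrow> 'a \<Rightarrow> real" and T :: real
  assumes T_pos: "0 < T"
    and path: "\<And>\<omega>. \<omega> \<in> space M \<Longrightarrow> monotone_path (\<lambda>t. X t \<omega>) T"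
    and le_1: "\<And>\<omega>. \<omega> \<in> space M \<Longrightarrow> X T \<omega> - X 0 \<omega> \<le> 1"
    and measurable_X: "\<And>t. 0 \<le> t \<Longrightarrow> t \<le> T \<Longrightarrow> X t \<in> borel_measurable M"
begin

lemma measurable_increment:
  assumes "0 < b" "b \<le> T" "i < n"
  shows "(\<lambda>\<omega>. increment (\<lambda>t. X t \<omega>) b n i) \<in> borel_measurable M"
proof -
  have "0 \<le> b * real i / real n" "b * real (Suc i) / real n \<le> T" "b * real i / real n \<le> b * real (Suc i) / real n"
  proof -
    show "0 \<le> b * real i / real n" using assms by simp
    show "b * real i / real n \<le> b * real (Suc i) / real n"
      using assms by (intro divide_right_mono mult_left_mono) auto
    have "real (Suc i) \<le> real n" using assms by linarith
    then have "b * real (Suc i) \<le> b * real n" using assms by (intro mult_left_mono) auto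
    then have "b * real (Suc i) / real n \<le> b" using assms by (simp add: pos_divide_le_eq)
    then show "b * real (Suc i) / real n \<le> T" using assms by linarith
  qed
  then show ?thesis unfolding increment_def by (intro borel_measurable_diff measurable_X) auto
qed

lemma measurable_excess:
  assumes b: "0 \<le> b" "b \<le> T" and c: "0 < c"
  shows "(\<lambda>\<omega>. monotone_path.excess (\<lambda>t. X t \<omega>) b c) \<in> borel_measurable M"
proof (cases "b = 0")
  case True
  have "monotone_path.excess (\<lambda>t. X t \<omega>) b c = 0" if "\<omega> \<in> space M" for \<omega>
  proof -
    have none: "{s \<in> {0..b}. c < jump (\<lambda>t. X t \<omega>) s} = {}"
      using True c monotone_path.jump_0[OF path[OF that]] by auto
    show ?thesis unfolding monotone_path.excess_def[OF path[OF that]] none by simp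
  qed
  then show ?thesis by (subst measurable_cong[where g = "\<lambda>_. 0"]) auto
next
  case False
  then have b: "0 < b" "b \<le> T" using b by auto
  show ?thesis
  proof (rule borel_measurable_LIMSEQ_real)
    show "(\<lambda>n. \<Sum>i<n. max 0 (increment (\<lambda>t. X t \<omega>) b n i - c)) \<longlonglongrightarrow> monotone_path.excess (\<lambda>t. X t \<omega>) b c"
      if "\<omega> \<in> space M" for \<omega>
      by (rule monotone_path.tendsto_excess[OF path[OF that] b c])
    show "(\<lambda>\<omega>. \<Sum>i<n. max 0 (increment (\<lambda>t. X t \<omega>) b n i - c)) \<in> borel_measurable M" for n
      by (intro borel_measurable_sum borel_measurable_max borel_measurable_diff borel_measurable_const
          measurable_increment b) auto
  qed
qed

lemma measurable_jump_mass:
  assumes b: "0 \<le> b" "b \<le> T" and c: "0 < c"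
  shows "(\<lambda>\<omega>. monotone_path.jump_mass (\<lambda>t. X t \<omega>) b c) \<in> borel_measurable M"
proof (rule borel_measurable_LIMSEQ_real)
  show "(\<lambda>n. monotone_path.excess (\<lambda>t. X t \<omega>) b c + c * (real n * (monotone_path.excess (\<lambda>t. X t \<omega>) b c
      - monotone_path.excess (\<lambda>t. X t \<omega>) b (c + 1 / real n)))) \<longlonglongrightarrow> monotone_path.jump_mass (\<lambda>t. X t \<omega>) b c"
    if "\<omega> \<in> space M" for \<omega>
    by (rule monotone_path.tendsto_jump_mass[OF path[OF that] b c])
  have "0 < c + 1 / real n" for n using c by (intro add_pos_nonneg) auto
  then show "(\<lambda>\<omega>. monotone_path.excess (\<lambda>t. X t \<omega>) b c + c * (real n * (monotone_path.excess (\<lambda>t. X t \<omega>) b c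
      - monotone_path.excess (\<lambda>t. X t \<omega>) b (c + 1 / real n)))) \<in> borel_measurable M" for n
    by (intro borel_measurable_add borel_measurable_times borel_measurable_diff borel_measurable_const
        measurable_excess b c)
qed

text \<open>Quadrants generate the Borel sets of the plane and are stable under intersection, so
  measurability of their masses and of the total mass suffices. A quadrant that contains no
  nonnegative time or no positive size has mass 0.\<close>

lemma measurable_jump_measure [measurable]:
  "(\<lambda>\<omega>. jump_measure (\<lambda>t. X t \<omega>) T) \<in> measurable M (subprob_algebra borel)"
proof (rule measurable_subprob_algebra_generated[where G = "range (\<lambda>p :: real \<times> real. {..p})" and \<Omega> = UNIV])
  show "sets (borel :: (real \<times> real) measure) = sigma_sets UNIV (range (\<lambda>p. {..p}))"
    by (subst borel_eq_atMost) simp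
  show "Int_stable (range (\<lambda>p :: real \<times> real. {..p}))"
  proof (rule Int_stableI_image)
    fix p q :: "real \<times> real"
    show "\<exists>r\<in>UNIV. {..p} \<inter> {..q} = {..r}" by (intro bexI[of _ "inf p q"]) auto
  qed
  show sub: "subprob_space (jump_measure (\<lambda>t. X t \<omega>) T)" if "\<omega> \<in> space M" for \<omega>
    using T_pos by (intro monotone_path.subprob_space_jump_measure[OF path[OF that]] le_1[OF that]) auto
  have box: "(\<lambda>\<omega>. emeasure (jump_measure (\<lambda>t. X t \<omega>) T) ({..b} \<times> {..c})) \<in> borel_measurable M"
    if b: "0 \<le> b" "b \<le> T" and c: "0 < c" for b c
  proof (subst measurable_cong)
    show "emeasure (jump_measure (\<lambda>t. X t \<omega>) T) ({..b} \<times> {..c})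
        = (\<Squnion>n. ennreal (monotone_path.jump_mass (\<lambda>t. X t \<omega>) b (min c (1 / real (Suc n)))
            - monotone_path.jump_mass (\<lambda>t. X t \<omega>) b c))" if "\<omega> \<in> space M" for \<omega>
      by (rule monotone_path.emeasure_jump_measure_box[OF path[OF that] b c])
    have "0 < min c (1 / real (Suc n))" for n using c by simp
    then show "(\<lambda>\<omega>. \<Squnion>n. ennreal (monotone_path.jump_mass (\<lambda>t. X t \<omega>) b (min c (1 / real (Suc n)))
            - monotone_path.jump_mass (\<lambda>t. X t \<omega>) b c)) \<in> borel_measurable M"
      by (intro borel_measurable_SUP measurable_compose[OF _ measurable_ennreal] borel_measurable_diff measurable_jump_mass b c) auto
  qed
  show "(\<lambda>\<omega>. emeasure (jump_measure (\<lambda>t. X t \<omega>) T) A) \<in> borel_measurable M"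
    if A: "A \<in> range (\<lambda>p :: real \<times> real. {..p})" for A
  proof -
    obtain b c where A: "A = {..b} \<times> {..c}" using A by (force simp: less_eq_prod_def)
    show ?thesis
    proof (cases "0 \<le> b \<and> 0 < c")
      case True
      have "emeasure (jump_measure (\<lambda>t. X t \<omega>) T) A = emeasure (jump_measure (\<lambda>t. X t \<omega>) T) ({..min b T} \<times> {..c})"
        for \<omega>
        unfolding A by (subst (1 2) emeasure_jump_measure)
          (auto simp: borel_prod[symmetric] indicator_def intro!: nn_integral_cong)
      then show ?thesis using box[of "min b T" c] True T_pos by simp
    next
      case False
      have "emeasure (jump_measure (\<lambda>t. X t \<omega>) T) A = 0" for \<omega>
        unfolding A using False by (subst emeasure_jump_measure)
          (auto simp: borel_prod[symmetric] nn_integral_0_iff_AE AE_count_space indicator_def ennreal_eq_0_iff)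
      then show ?thesis by simp
    qed
  qed
  show "(\<lambda>\<omega>. emeasure (jump_measure (\<lambda>t. X t \<omega>) T) UNIV) \<in> borel_measurable M"
  proof (subst measurable_cong)
    have UN_eq: "(\<Union>n. {..T} \<times> {..real (Suc n)}) = {..T} \<times> UNIV"
    proof -
      have "\<exists>n. x \<le> real (Suc n)" for x :: real
      proof -
        obtain n where "x \<le> real n" using real_arch_simple by blast
        then have "x \<le> real (Suc n)" by simp
        then show ?thesis by blast
      qed
      then show ?thesis by auto
    qed
    show "emeasure (jump_measure (\<lambda>t. X t \<omega>) T) UNIV = (\<Squnion>n. emeasure (jump_measure (\<lambda>t. X t \<omega>) T) ({..T} \<times> {..real (Suc n)}))"
      if "\<omega> \<in> space M" for \<omega>
    proof -
      have "(\<Squnion>n. emeasure (jump_measure (\<lambda>t. X t \<omega>) T) ({..T} \<times> {..real (Suc n)}))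
          = emeasure (jump_measure (\<lambda>t. X t \<omega>) T) (\<Union>n. {..T} \<times> {..real (Suc n)})"
        by (intro SUP_emeasure_incseq) (auto simp: incseq_def borel_prod[symmetric])
      also have "\<dots> = emeasure (jump_measure (\<lambda>t. X t \<omega>) T) UNIV"
      proof -
        have "{..T} \<times> UNIV \<in> sets (borel :: (real \<times> real) measure)" by (simp add: borel_prod[symmetric])
        then show ?thesis unfolding UN_eq
          by (simp add: emeasure_jump_measure) (auto simp: indicator_def intro!: nn_integral_cong)
      qed
      finally show ?thesis by simp
    qed
    show "(\<lambda>\<omega>. \<Squnion>n. emeasure (jump_measure (\<lambda>t. X t \<omega>) T) ({..T} \<times> {..real (Suc n)})) \<in> borel_measurable M"
      using T_pos by (intro borel_measurable_SUP box) auto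
  qed
qed auto

text \<open>Makes sums over all jumps measurable in the sample point, for arbitrary Borel functions
  of time and size, although the time index ranges over an uncountable set.\<close>

lemma measurable_nn_integral_jumps:
  assumes "(\<lambda>(s, x). \<phi> s x) \<in> borel_measurable borel"
  shows "(\<lambda>\<omega>. \<integral>\<^sup>+s. ennreal (jump (\<lambda>t. X t \<omega>) s) * \<phi> s (jump (\<lambda>t. X t \<omega>) s) \<partial>count_space {0..T}) \<in> borel_measurable M"
proof -
  have "(\<lambda>\<omega>. \<integral>\<^sup>+p. (\<lambda>(s, x). \<phi> s x) p \<partial>jump_measure (\<lambda>t. X t \<omega>) T) \<in> borel_measurable M"
    by (rule measurable_compose[OF measurable_jump_measure nn_integral_measurable_subprob_algebra[OF assms]])
  then show ?thesis by (simp add: nn_integral_jump_measure[OF assms])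
qed

end

lemma infsum_count_space:
  fixes g :: "real \<Rightarrow> real"
  assumes "\<And>s. s \<in> A \<Longrightarrow> 0 \<le> g s" "(\<integral>\<^sup>+s. ennreal (g s) \<partial>count_space A) \<noteq> \<infinity>"
  shows "g summable_on A" "infsum g A = enn2real (\<integral>\<^sup>+s. ennreal (g s) \<partial>count_space A)"
proof -
  have eq: "(\<integral>\<^sup>+s. ennreal (g s) \<partial>count_space A) = (\<integral>\<^sup>+s. ennreal (norm (g s)) \<partial>count_space A)"
    using assms(1) by (intro nn_integral_cong) simp
  have abs: "Infinite_Set_Sum.abs_summable_on g A"
    unfolding Infinite_Set_Sum.abs_summable_on_def
    using assms(2) eq by (intro integrableI_bounded) (auto simp: top.not_eq_extremum)
  show "g summable_on A"
    by (rule abs_summable_summable, rule abs_summable_equivalent[THEN iffD2], rule abs)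
  show "infsum g A = enn2real (\<integral>\<^sup>+s. ennreal (g s) \<partial>count_space A)"
    using infsetsum_conv_nn_integral[OF assms(2,1)] infsetsum_infsum[OF abs] by simp
qed

text \<open>Both one-sided limits are controlled by a finite set \<open>F\<close> carrying all but \<open>e\<close> of the sum:
  near \<open>t\<close> the path does not see \<open>F\<close>, except for the point \<open>t\<close> itself.\<close>

lemma cadlag_infsum:
  fixes g :: "real \<Rightarrow> real"
  assumes g: "\<And>s. s \<in> {0..T} \<Longrightarrow> 0 \<le> g s" and sm: "g summable_on {0..T}"
  shows "cadlag_on {0..T} (\<lambda>t. infsum g {0..t})" "mono_on {0..T} (\<lambda>t. infsum g {0..t})"
proof -
  have sub: "g summable_on S" if "S \<subseteq> {0..T}" for S using summable_on_subset_banach[OF sm that] .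
  have nonneg: "0 \<le> infsum g S" if "S \<subseteq> {0..T}" for S using that by (intro infsum_nonneg g) auto
  have split: "infsum g S = infsum g R + infsum g (S - R)" if "R \<subseteq> S" "S \<subseteq> {0..T}" for S R
  proof -
    have "R \<subseteq> {0..T}" "S - R \<subseteq> {0..T}" using that by auto
    then have "infsum g (R \<union> (S - R)) = infsum g R + infsum g (S - R)"
      by (intro infsum_Un_disjoint sub) auto
    moreover have "R \<union> (S - R) = S" using that by auto
    ultimately show ?thesis by simp
  qed
  show mono: "mono_on {0..T} (\<lambda>t. infsum g {0..t})"
  proof (rule mono_onI)
    fix r s assume rs: "r \<in> {0..T}" "s \<in> {0..T}" "r \<le> s"
    then have "{0..r} \<subseteq> {0..s}" "{0..s} \<subseteq> {0..T}" by auto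
    then show "infsum g {0..r} \<le> infsum g {0..s}"
      using split[of "{0..r}" "{0..s}"] nonneg[of "{0..s} - {0..r}"] by (simp add: subset_iff)
  qed
  have tail: "\<exists>F. finite F \<and> (\<forall>S. S \<subseteq> {0..T} \<longrightarrow> S \<inter> F = {} \<longrightarrow> infsum g S \<le> e)" if e: "0 < e" for e
  proof -
    obtain F where F: "finite F" "F \<subseteq> {0..T}" "dist (sum g F) (infsum g {0..T}) \<le> e"
      using has_sum_finite_approximation[OF has_sum_infsum[OF sm] e] by auto
    have "infsum g S \<le> e" if S: "S \<subseteq> {0..T}" "S \<inter> F = {}" for S
    proof -
      have "infsum g {0..T} = sum g F + infsum g ({0..T} - F)" using split[of F "{0..T}"] F by simp
      moreover have "infsum g ({0..T} - F) = infsum g S + infsum g (({0..T} - F) - S)"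
        using S by (intro split) auto
      moreover have "0 \<le> infsum g (({0..T} - F) - S)" by (intro nonneg) auto
      ultimately show ?thesis using F(3) by (simp add: dist_real_def)
    qed
    then show ?thesis using F(1) by blast
  qed
  show "cadlag_on {0..T} (\<lambda>t. infsum g {0..t})"
    unfolding cadlag_on_def
  proof (intro ballI conjI)
    fix t assume t: "t \<in> {0..T}"
    show "((\<lambda>t. infsum g {0..t}) \<longlongrightarrow> infsum g {0..t}) (at t within {0..T} \<inter> {t<..})"
    proof (rule tendstoI)
      fix e :: real assume e: "0 < e"
      obtain F where F: "finite F" "\<And>S. S \<subseteq> {0..T} \<Longrightarrow> S \<inter> F = {} \<Longrightarrow> infsum g S \<le> e / 2" using tail[of "e / 2"] e by auto
      obtain d where d: "0 < d" "\<And>p. p \<in> F \<Longrightarrow> p \<noteq> t \<Longrightarrow> d \<le> \<bar>p - t\<bar>"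
        using finite_separated[of "insert t F"] F(1) by (metis finite.insertI insertCI)
      show "\<forall>\<^sub>F u in at t within {0..T} \<inter> {t<..}. dist (infsum g {0..u}) (infsum g {0..t}) < e"
        unfolding eventually_at
      proof (intro exI[of _ d] conjI d ballI impI)
        fix u assume u: "u \<in> {0..T} \<inter> {t<..}" "u \<noteq> t \<and> dist u t < d"
        have D: "{0..u} - {0..t} = {t<..u}" using u t by auto
        have "infsum g {t<..u} \<le> e / 2"
        proof (rule F(2))
          show "{t<..u} \<inter> F = {}" using d(2) u by (force simp: dist_real_def)
        qed (use u t in auto)
        moreover have "infsum g {0..u} = infsum g {0..t} + infsum g {t<..u}"
          using split[of "{0..t}" "{0..u}"] u unfolding D by auto
        moreover have "0 \<le> infsum g {t<..u}" using u t by (intro nonneg) auto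
        ultimately show "dist (infsum g {0..u}) (infsum g {0..t}) < e" using e by (simp add: dist_real_def)
      qed
    qed
    have "((\<lambda>t. infsum g {0..t}) \<longlongrightarrow> infsum g {0..<t}) (at t within {0..T} \<inter> {..<t})"
    proof (rule tendstoI)
      fix e :: real assume e: "0 < e"
      obtain F where F: "finite F" "\<And>S. S \<subseteq> {0..T} \<Longrightarrow> S \<inter> F = {} \<Longrightarrow> infsum g S \<le> e / 2" using tail[of "e / 2"] e by auto
      obtain d where d: "0 < d" "\<And>p. p \<in> F \<Longrightarrow> p \<noteq> t \<Longrightarrow> d \<le> \<bar>p - t\<bar>"
        using finite_separated[of "insert t F"] F(1) by (metis finite.insertI insertCI)
      show "\<forall>\<^sub>F u in at t within {0..T} \<inter> {..<t}. dist (infsum g {0..u}) (infsum g {0..<t}) < e"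
        unfolding eventually_at
      proof (intro exI[of _ d] conjI d ballI impI)
        fix u assume u: "u \<in> {0..T} \<inter> {..<t}" "u \<noteq> t \<and> dist u t < d"
        have D: "{0..<t} - {0..u} = {u<..<t}" using u t by auto
        have "infsum g {u<..<t} \<le> e / 2"
        proof (rule F(2))
          show "{u<..<t} \<inter> F = {}" using d(2) u by (force simp: dist_real_def)
        qed (use u t in auto)
        moreover have "infsum g {0..<t} = infsum g {0..u} + infsum g {u<..<t}"
        proof -
          have "{0..u} \<subseteq> {0..<t}" "{0..<t} \<subseteq> {0..T}" using u t by auto
          then show ?thesis using split[of "{0..u}" "{0..<t}"] unfolding D by simp
        qed
        moreover have "0 \<le> infsum g {u<..<t}" using u t by (intro nonneg) auto
        ultimately show "dist (infsum g {0..u}) (infsum g {0..<t}) < e" using e by (simp add: dist_real_def)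
      qed
    qed
    then show "\<exists>l. ((\<lambda>t. infsum g {0..t}) \<longlongrightarrow> l) (at t within {0..T} \<inter> {..<t})" by blast
  qed
qed

section \<open>Averages over cells\<close>

definition same_cell :: "real \<Rightarrow> nat \<Rightarrow> real \<Rightarrow> real \<Rightarrow> ennreal" where
  "same_cell T n s t = (\<Sum>i<n. indicator (cell T n i) s * indicator (cell T n i) t)"

text \<open>The mean of |h t - h s| over t in the cell of s, as n / T is the reciprocal of the cell
  length.\<close>

definition cell_oscillation :: "real \<Rightarrow> nat \<Rightarrow> (real \<Rightarrow> real) \<Rightarrow> real \<Rightarrow> ennreal" where
  "cell_oscillation T n h s = ennreal (real n / T) * (\<integral>\<^sup>+t. ennreal \<bar>h t - h s\<bar> * same_cell T n s t \<partial>lborel)"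

lemma cell_measurable [measurable]: "cell T n i \<in> sets borel"
  by (simp add: cell_def)

lemma measurable_same_cell [measurable]:
  assumes [measurable]: "f \<in> borel_measurable M" "g \<in> borel_measurable M"
  shows "(\<lambda>x. same_cell T n (f x) (g x)) \<in> borel_measurable M"
  unfolding same_cell_def by measurable

lemma measurable_cell_oscillation [measurable]:
  assumes [measurable]: "h \<in> borel_measurable borel"
  shows "cell_oscillation T n h \<in> borel_measurable borel"
  unfolding cell_oscillation_def by measurable

lemma emeasure_cell:
  assumes "0 < T"
  shows "emeasure lborel (cell T n i) = ennreal (T / real n)"
proof -
  have "T * real i / real n \<le> T * real (Suc i) / real n"
    using assms by (intro divide_right_mono mult_left_mono) auto
  moreover have "T * real (Suc i) / real n - T * real i / real n = T / real n"
    by (simp add: diff_divide_distrib[symmetric] right_diff_distrib[symmetric])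
  ultimately show ?thesis by (simp add: cell_def)
qed

lemma same_cell_le:
  assumes "0 < T" "0 < n"
  shows "same_cell T n s t \<le> indicator {0<..T} s"
proof (cases "\<exists>i<n. s \<in> cell T n i")
  case True
  then obtain i where i: "i < n" "s \<in> cell T n i" by blast
  have "same_cell T n s t = indicator (cell T n i) s * indicator (cell T n i) t"
  proof -
    have "indicator (cell T n j) s = (0 :: ennreal)" if "j \<noteq> i" for j
      using i cell_disjoint[OF assms(1) that, of n] by (auto simp: indicator_def)
    then show ?thesis unfolding same_cell_def using i
      by (subst sum.mono_neutral_right[of _ "{i}"]) auto
  qed
  also have "\<dots> \<le> 1" by (simp split: split_indicator)
  finally have "same_cell T n s t \<le> 1" .
  moreover have "s \<in> {0<..T}" using i UN_cell[OF assms] by blast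
  ultimately show ?thesis by simp
qed (auto simp: same_cell_def)

lemma nn_integral_same_cell:
  assumes "0 < T" "0 < n"
  shows "ennreal (real n / T) * (\<integral>\<^sup>+t. same_cell T n s t \<partial>lborel) \<le> indicator {0<..T} s"
proof -
  have "(\<integral>\<^sup>+t. same_cell T n s t \<partial>lborel) = (\<Sum>i<n. indicator (cell T n i) s * ennreal (T / real n))"
    unfolding same_cell_def using assms
    by (subst nn_integral_sum) (auto simp: nn_integral_cmult emeasure_cell)
  also have "\<dots> = (\<Sum>i<n. indicator (cell T n i) s) * ennreal (T / real n)" by (simp add: sum_distrib_right)
  also have "(\<Sum>i<n. indicator (cell T n i) s :: ennreal) = same_cell T n s s"
    unfolding same_cell_def by (intro sum.cong) (auto simp: indicator_def)
  finally have "ennreal (real n / T) * (\<integral>\<^sup>+t. same_cell T n s t \<partial>lborel)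
      = same_cell T n s s * (ennreal (T / real n) * ennreal (real n / T))"
    by (simp add: mult_ac)
  also have "ennreal (T / real n) * ennreal (real n / T) = 1"
    using assms by (simp add: ennreal_mult'[symmetric])
  finally show ?thesis using same_cell_le[OF assms, of s s] by simp
qed

lemma same_cell_commute: "same_cell T n s t = same_cell T n t s"
  by (simp add: same_cell_def mult.commute)

text \<open>Dominates the L1 distance between \<open>h\<close> and its cell averages. As a double
  integral it is subadditive in \<open>h\<close>, which permits approximation by combinations of
  indicators.\<close>

definition cell_variation :: "real \<Rightarrow> nat \<Rightarrow> (real \<Rightarrow> real) \<Rightarrow> ennreal" where
  "cell_variation T n h = (\<integral>\<^sup>+s. cell_oscillation T n h s \<partial>lborel)"

lemma cell_variation_add:
  assumes [measurable]: "g \<in> borel_measurable borel" "h \<in> borel_measurable borel"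
  shows "cell_variation T n (\<lambda>s. g s + h s) \<le> cell_variation T n g + cell_variation T n h"
proof -
  have "cell_oscillation T n (\<lambda>s. g s + h s) s \<le> cell_oscillation T n g s + cell_oscillation T n h s" for s
  proof -
    have "(\<integral>\<^sup>+t. ennreal \<bar>g t + h t - (g s + h s)\<bar> * same_cell T n s t \<partial>lborel)
        \<le> (\<integral>\<^sup>+t. ennreal \<bar>g t - g s\<bar> * same_cell T n s t + ennreal \<bar>h t - h s\<bar> * same_cell T n s t \<partial>lborel)"
    proof (rule nn_integral_mono)
      fix t
      have "ennreal \<bar>g t + h t - (g s + h s)\<bar> \<le> ennreal (\<bar>g t - g s\<bar> + \<bar>h t - h s\<bar>)"
        by (intro ennreal_leI) linarith
      then show "ennreal \<bar>g t + h t - (g s + h s)\<bar> * same_cell T n s t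
          \<le> ennreal \<bar>g t - g s\<bar> * same_cell T n s t + ennreal \<bar>h t - h s\<bar> * same_cell T n s t"
        by (simp add: distrib_right[symmetric] mult_right_mono)
    qed
    also have "\<dots> = (\<integral>\<^sup>+t. ennreal \<bar>g t - g s\<bar> * same_cell T n s t \<partial>lborel) + (\<integral>\<^sup>+t. ennreal \<bar>h t - h s\<bar> * same_cell T n s t \<partial>lborel)"
      by (intro nn_integral_add) measurable
    finally show ?thesis unfolding cell_oscillation_def by (simp add: distrib_left[symmetric] mult_left_mono)
  qed
  then have "cell_variation T n (\<lambda>s. g s + h s) \<le> (\<integral>\<^sup>+s. cell_oscillation T n g s + cell_oscillation T n h s \<partial>lborel)"
    unfolding cell_variation_def by (intro nn_integral_mono)
  also have "\<dots> = cell_variation T n g + cell_variation T n h"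
    unfolding cell_variation_def by (intro nn_integral_add) measurable
  finally show ?thesis .
qed

lemma cell_variation_sum:
  assumes "finite J" "\<And>j. j \<in> J \<Longrightarrow> g j \<in> borel_measurable borel"
  shows "cell_variation T n (\<lambda>s. \<Sum>j\<in>J. g j s) \<le> (\<Sum>j\<in>J. cell_variation T n (g j))"
  using assms
proof (induction J rule: finite_induct)
  case empty
  then show ?case by (simp add: cell_variation_def cell_oscillation_def)
next
  case (insert j J)
  have "cell_variation T n (\<lambda>s. g j s + (\<Sum>j\<in>J. g j s)) \<le> cell_variation T n (g j) + cell_variation T n (\<lambda>s. \<Sum>j\<in>J. g j s)"
    using insert.prems by (intro cell_variation_add borel_measurable_sum) auto
  also have "\<dots> \<le> cell_variation T n (g j) + (\<Sum>j\<in>J. cell_variation T n (g j))"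
    using insert by (intro add_left_mono) auto
  finally show ?case using insert.hyps by simp
qed

text \<open>Both terms of the triangle inequality contribute equally by symmetry of
  \<open>same_cell\<close>. The bound is uniform in n, so an error that is small in L1 may be
  dropped before n grows.\<close>

lemma cell_variation_le_integral:
  assumes T: "0 < T" "0 < n" and [measurable]: "h \<in> borel_measurable borel"
  shows "cell_variation T n h \<le> 2 * (\<integral>\<^sup>+s. ennreal \<bar>h s\<bar> * indicator {0<..T} s \<partial>lborel)"
proof -
  define c where "c = ennreal (real n / T)"
  have "cell_variation T n h \<le> (\<integral>\<^sup>+s. (c * (\<integral>\<^sup>+t. ennreal \<bar>h t\<bar> * same_cell T n s t \<partial>lborel))
      + (c * (\<integral>\<^sup>+t. ennreal \<bar>h s\<bar> * same_cell T n s t \<partial>lborel)) \<partial>lborel)"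
    unfolding cell_variation_def cell_oscillation_def c_def[symmetric]
  proof (rule nn_integral_mono)
    fix s
    have "(\<integral>\<^sup>+t. ennreal \<bar>h t - h s\<bar> * same_cell T n s t \<partial>lborel)
        \<le> (\<integral>\<^sup>+t. ennreal \<bar>h t\<bar> * same_cell T n s t + ennreal \<bar>h s\<bar> * same_cell T n s t \<partial>lborel)"
    proof (rule nn_integral_mono)
      fix t
      have "ennreal \<bar>h t - h s\<bar> \<le> ennreal (\<bar>h t\<bar> + \<bar>h s\<bar>)" by (intro ennreal_leI) linarith
      then show "ennreal \<bar>h t - h s\<bar> * same_cell T n s t \<le> ennreal \<bar>h t\<bar> * same_cell T n s t + ennreal \<bar>h s\<bar> * same_cell T n s t"
        by (simp add: distrib_right[symmetric] mult_right_mono)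
    qed
    also have "\<dots> = (\<integral>\<^sup>+t. ennreal \<bar>h t\<bar> * same_cell T n s t \<partial>lborel) + (\<integral>\<^sup>+t. ennreal \<bar>h s\<bar> * same_cell T n s t \<partial>lborel)"
      by (intro nn_integral_add) measurable
    finally show "c * (\<integral>\<^sup>+t. ennreal \<bar>h t - h s\<bar> * same_cell T n s t \<partial>lborel)
        \<le> c * (\<integral>\<^sup>+t. ennreal \<bar>h t\<bar> * same_cell T n s t \<partial>lborel) + c * (\<integral>\<^sup>+t. ennreal \<bar>h s\<bar> * same_cell T n s t \<partial>lborel)"
      by (simp add: distrib_left[symmetric] mult_left_mono)
  qed
  also have "\<dots> = (\<integral>\<^sup>+s. c * (\<integral>\<^sup>+t. ennreal \<bar>h t\<bar> * same_cell T n s t \<partial>lborel) \<partial>lborel)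
      + (\<integral>\<^sup>+s. c * (\<integral>\<^sup>+t. ennreal \<bar>h s\<bar> * same_cell T n s t \<partial>lborel) \<partial>lborel)"
    by (intro nn_integral_add) measurable
  also have "(\<integral>\<^sup>+s. c * (\<integral>\<^sup>+t. ennreal \<bar>h t\<bar> * same_cell T n s t \<partial>lborel) \<partial>lborel)
      = (\<integral>\<^sup>+s. c * (\<integral>\<^sup>+t. ennreal \<bar>h s\<bar> * same_cell T n s t \<partial>lborel) \<partial>lborel)"
  proof -
    have "(\<integral>\<^sup>+s. c * (\<integral>\<^sup>+t. ennreal \<bar>h t\<bar> * same_cell T n s t \<partial>lborel) \<partial>lborel)
        = c * (\<integral>\<^sup>+s. \<integral>\<^sup>+t. ennreal \<bar>h t\<bar> * same_cell T n s t \<partial>lborel \<partial>lborel)"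
      by (intro nn_integral_cmult) measurable
    also have "(\<integral>\<^sup>+s. \<integral>\<^sup>+t. ennreal \<bar>h t\<bar> * same_cell T n s t \<partial>lborel \<partial>lborel)
        = (\<integral>\<^sup>+t. \<integral>\<^sup>+s. ennreal \<bar>h t\<bar> * same_cell T n s t \<partial>lborel \<partial>lborel)"
      by (intro lborel_pair.Fubini') measurable
    also have "\<dots> = (\<integral>\<^sup>+s. \<integral>\<^sup>+t. ennreal \<bar>h s\<bar> * same_cell T n s t \<partial>lborel \<partial>lborel)"
      by (subst same_cell_commute) (rule refl)
    also have "c * \<dots> = (\<integral>\<^sup>+s. c * (\<integral>\<^sup>+t. ennreal \<bar>h s\<bar> * same_cell T n s t \<partial>lborel) \<partial>lborel)"
      by (intro nn_integral_cmult[symmetric]) measurable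
    finally show ?thesis .
  qed
  also have "(\<integral>\<^sup>+s. c * (\<integral>\<^sup>+t. ennreal \<bar>h s\<bar> * same_cell T n s t \<partial>lborel) \<partial>lborel)
      \<le> (\<integral>\<^sup>+s. ennreal \<bar>h s\<bar> * indicator {0<..T} s \<partial>lborel)"
  proof (rule nn_integral_mono)
    fix s
    have "c * (\<integral>\<^sup>+t. ennreal \<bar>h s\<bar> * same_cell T n s t \<partial>lborel)
        = ennreal \<bar>h s\<bar> * (c * (\<integral>\<^sup>+t. same_cell T n s t \<partial>lborel))"
      by (subst nn_integral_cmult) (auto simp: mult_ac)
    also have "\<dots> \<le> ennreal \<bar>h s\<bar> * indicator {0<..T} s"
      unfolding c_def by (intro mult_left_mono nn_integral_same_cell T) auto
    finally show "c * (\<integral>\<^sup>+t. ennreal \<bar>h s\<bar> * same_cell T n s t \<partial>lborel) \<le> ennreal \<bar>h s\<bar> * indicator {0<..T} s" .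
  qed
  finally show ?thesis by (simp add: mult_2 add_mono)
qed

lemma cell_variation_cmult:
  assumes [measurable]: "h \<in> borel_measurable borel"
  shows "cell_variation T n (\<lambda>s. c * h s) = ennreal \<bar>c\<bar> * cell_variation T n h"
proof -
  have "cell_oscillation T n (\<lambda>s. c * h s) s = ennreal \<bar>c\<bar> * cell_oscillation T n h s" for s
  proof -
    have "(\<integral>\<^sup>+t. ennreal \<bar>c * h t - c * h s\<bar> * same_cell T n s t \<partial>lborel)
        = (\<integral>\<^sup>+t. ennreal \<bar>c\<bar> * (ennreal \<bar>h t - h s\<bar> * same_cell T n s t) \<partial>lborel)"
      by (intro nn_integral_cong)
        (simp add: right_diff_distrib[symmetric] abs_mult ennreal_mult mult.assoc)
    then show ?thesis unfolding cell_oscillation_def by (simp add: nn_integral_cmult mult_ac)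
  qed
  then show ?thesis unfolding cell_variation_def
    by (subst nn_integral_cmult[symmetric]) (auto intro!: nn_integral_cong)
qed

text \<open>A Dynkin class argument. For a half line only the cell that contains its end point
  contributes; complements have the same variation; in a disjoint union all but finitely many sets
  have small total length on (0, T].\<close>

lemma cell_variation_indicator_tendsto:
  assumes T: "0 < T" and A: "A \<in> sets borel"
  shows "(\<lambda>n. cell_variation T n (indicator A)) \<longlonglongrightarrow> 0"
proof -
  have sig: "sets (borel :: real measure) = sigma_sets UNIV (range (\<lambda>b. {..b}))"
    by (subst borel_eq_atMost) simp
  have st: "Int_stable (range (\<lambda>b :: real. {..b}))"
    by (rule Int_stableI_image) auto
  have "A \<in> sigma_sets UNIV (range (\<lambda>b :: real. {..b}))" using A unfolding sig .
  have "range (\<lambda>b :: real. {..b}) \<subseteq> Pow UNIV" by simp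
  from st this \<open>A \<in> sigma_sets UNIV (range (\<lambda>b :: real. {..b}))\<close> show ?thesis
  proof (induction A rule: sigma_sets_induct_disjoint)
    case (basic A)
    then obtain b where A: "A = {..b}" by auto
    have "cell_variation T n (indicator A) \<le> ennreal (T / real n)" if n: "0 < n" for n
    proof -
      have one: "ennreal \<bar>indicator A t - indicator A s\<bar> * same_cell T n s t
          \<le> (\<Sum>i<n. indicator (cell T n i) b * (indicator (cell T n i) s * indicator (cell T n i) t))" for s t
      proof (cases "\<exists>i<n. s \<in> cell T n i \<and> t \<in> cell T n i \<and> (indicator A t :: real) \<noteq> indicator A s")
        case True
        then obtain i where i: "i < n" "s \<in> cell T n i" "t \<in> cell T n i" "(indicator A t :: real) \<noteq> indicator A s" by blast
        have "t \<le> b \<longleftrightarrow> \<not> s \<le> b" using i(4) by (auto simp: A indicator_def split: if_splits)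
        then have b: "b \<in> cell T n i" using i(2,3) unfolding cell_def greaterThanAtMost_iff by linarith
        have "ennreal \<bar>indicator A t - indicator A s\<bar> * same_cell T n s t \<le> 1 * indicator {0<..T} s"
          by (intro mult_mono same_cell_le T n) (auto simp: indicator_def)
        also have "\<dots> \<le> indicator (cell T n i) b * (indicator (cell T n i) s * indicator (cell T n i) t)"
          using i b by (simp add: indicator_def)
        also have "\<dots> \<le> (\<Sum>i<n. indicator (cell T n i) b * (indicator (cell T n i) s * indicator (cell T n i) t))"
          using i by (intro member_le_sum) auto
        finally show ?thesis .
      next
        case False
        have "ennreal \<bar>indicator A t - indicator A s\<bar> * same_cell T n s t = 0"
        proof (cases "(indicator A t :: real) = indicator A s")
          case neq: False
          then have "same_cell T n s t = 0" using False unfolding same_cell_def by (intro sum.neutral) (auto simp: indicator_def)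
          then show ?thesis by simp
        qed simp
        then show ?thesis by (simp only: zero_le)
      qed
      have "cell_variation T n (indicator A)
          \<le> (\<integral>\<^sup>+s. ennreal (real n / T) * (\<integral>\<^sup>+t. (\<Sum>i<n. indicator (cell T n i) b * (indicator (cell T n i) s * indicator (cell T n i) t)) \<partial>lborel) \<partial>lborel)"
        unfolding cell_variation_def cell_oscillation_def by (intro nn_integral_mono mult_left_mono one) auto
      also have "\<dots> = ennreal (real n / T) * (\<Sum>i<n. indicator (cell T n i) b * (emeasure lborel (cell T n i) * emeasure lborel (cell T n i)))"
      proof -
        have "(\<integral>\<^sup>+t. (\<Sum>i<n. indicator (cell T n i) b * (indicator (cell T n i) s * indicator (cell T n i) t)) \<partial>lborel)
            = (\<Sum>i<n. indicator (cell T n i) b * (indicator (cell T n i) s * emeasure lborel (cell T n i)))" for s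
        proof -
          have "(\<integral>\<^sup>+t. (\<Sum>i<n. indicator (cell T n i) b * (indicator (cell T n i) s * indicator (cell T n i) t)) \<partial>lborel)
            = (\<Sum>i<n. \<integral>\<^sup>+t. indicator (cell T n i) b * (indicator (cell T n i) s * indicator (cell T n i) t) \<partial>lborel)"
            by (rule nn_integral_sum) measurable
          also have "\<dots> = (\<Sum>i<n. indicator (cell T n i) b * (indicator (cell T n i) s * emeasure lborel (cell T n i)))"
            by (intro sum.cong refl) (simp add: nn_integral_cmult)
          finally show ?thesis .
        qed
        moreover have "(\<integral>\<^sup>+s. (\<Sum>i<n. indicator (cell T n i) b * (indicator (cell T n i) s * emeasure lborel (cell T n i))) \<partial>lborel)
            = (\<Sum>i<n. indicator (cell T n i) b * (emeasure lborel (cell T n i) * emeasure lborel (cell T n i)))"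
        proof -
          have "(\<integral>\<^sup>+s. (\<Sum>i<n. indicator (cell T n i) b * (indicator (cell T n i) s * emeasure lborel (cell T n i))) \<partial>lborel)
            = (\<Sum>i<n. \<integral>\<^sup>+s. indicator (cell T n i) b * (indicator (cell T n i) s * emeasure lborel (cell T n i)) \<partial>lborel)"
            by (rule nn_integral_sum) measurable
          also have "\<dots> = (\<Sum>i<n. indicator (cell T n i) b * (emeasure lborel (cell T n i) * emeasure lborel (cell T n i)))"
            by (intro sum.cong refl) (simp add: nn_integral_cmult nn_integral_multc)
          finally show ?thesis .
        qed
        moreover have "(\<lambda>s. \<Sum>i<n. indicator (cell T n i) b * (indicator (cell T n i) s * emeasure lborel (cell T n i))) \<in> borel_measurable lborel"
          by measurable
        ultimately show ?thesis by (simp only: nn_integral_cmult)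
      qed
      also have "\<dots> = ennreal (real n / T) * (ennreal (T / real n) * ennreal (T / real n)) * (\<Sum>i<n. indicator (cell T n i) b)"
        unfolding emeasure_cell[OF T] sum_distrib_right[symmetric] by (simp only: mult_ac)
      also have "\<dots> = ennreal (T / real n) * same_cell T n b b"
      proof -
        have "ennreal (real n / T) * (ennreal (T / real n) * ennreal (T / real n)) = ennreal (T / real n)"
          using T n by (simp add: ennreal_mult'[symmetric])
        moreover have "(\<Sum>i<n. indicator (cell T n i) b :: ennreal) = same_cell T n b b"
          unfolding same_cell_def by (intro sum.cong) (auto simp: indicator_def)
        ultimately show ?thesis by simp
      qed
      also have "\<dots> \<le> ennreal (T / real n) * 1"
        using same_cell_le[OF T n, of b b] by (intro mult_left_mono) (auto intro: order_trans simp: indicator_def split: if_splits)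
      finally show ?thesis by simp
    qed
    then have ev: "\<forall>\<^sub>F n in sequentially. cell_variation T n (indicator A) \<le> ennreal (T / real n)"
      using eventually_gt_at_top[of 0] by (rule eventually_mono[rotated])
    have "(\<lambda>n. ennreal (T / real n)) \<longlonglongrightarrow> ennreal 0"
      by (intro tendsto_ennrealI lim_const_over_n)
    then have lim: "(\<lambda>n. ennreal (T / real n)) \<longlonglongrightarrow> 0" by simp
    show ?case by (rule tendsto_sandwich[OF _ ev tendsto_const lim]) simp
  next
    case empty
    then show ?case by (simp add: cell_variation_def cell_oscillation_def)
  next
    case (compl A)
    have "\<bar>indicator (UNIV - A) t - indicator (UNIV - A) s\<bar> = \<bar>indicator A t - indicator A s :: real\<bar>" for s t
      by (simp split: split_indicator)
    then have "cell_variation T n (indicator (UNIV - A)) = cell_variation T n (indicator A)" for n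
      by (simp only: cell_variation_def cell_oscillation_def)
    then show ?case using compl(2) by (simp only:)
  next
    case (union A)
    have Am [measurable]: "A i \<in> sets borel" for i using union by (auto simp: sig)
    \<comment> \<open>Cut down to (0, T] to have finite length, as continuity from above
      requires.\<close>
    define tail where "tail k = (\<Union>j\<in>{k..}. A j) \<inter> {0<..T}" for k
    have tail_lim: "(\<lambda>k. emeasure lborel (tail k)) \<longlonglongrightarrow> emeasure lborel (\<Inter>k. tail k)"
    proof (rule Lim_emeasure_decseq)
      show "decseq tail" unfolding decseq_def tail_def by force
      have "emeasure lborel (tail i) \<le> emeasure lborel {0<..T}" for i by (intro emeasure_mono) (auto simp: tail_def)
      then show "emeasure lborel (tail i) \<noteq> \<infinity>" for i 
      proof -
        have "emeasure lborel (tail i) \<le> ennreal T" using \<open>emeasure lborel (tail i) \<le> emeasure lborel {0<..T}\<close> T by simp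
        then show ?thesis by (auto simp: top_unique)
      qed
    qed (auto simp: tail_def)
    have "(\<Inter>k. tail k) = {}"
    proof -
      have False if x: "x \<in> (\<Inter>k. tail k)" for x
      proof -
        obtain j where j: "x \<in> A j" using x by (auto simp: tail_def)
        have "x \<in> tail (Suc j)" using x by blast
        then obtain j' where "j' \<ge> Suc j" "x \<in> A j'" by (auto simp: tail_def)
        then show False using j union(1) by (auto simp: disjoint_family_on_def) (metis IntI Suc_n_not_le_n empty_iff)
      qed
      then show ?thesis by blast
    qed
    with tail_lim have tail_lim: "(\<lambda>k. emeasure lborel (tail k)) \<longlonglongrightarrow> 0" by simp
    have bound: "cell_variation T n (indicator (\<Union>i. A i)) \<le> (\<Sum>j<k. cell_variation T n (indicator (A j))) + 2 * emeasure lborel (tail k)"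
      if n: "0 < n" for n k
    proof -
      define R where "R = (\<Union>j\<in>{k..}. A j)"
      have [measurable]: "R \<in> sets borel" unfolding R_def by measurable
      have eq: "indicator (\<Union>i. A i) s = (\<Sum>j<k. indicator (A j) s) + (indicator R s :: real)" for s
      proof -
        have "(\<Union>i. A i) = (\<Union>j<k. A j) \<union> R" 
        proof (intro equalityI subsetI)
          fix x assume "x \<in> (\<Union>i. A i)"
          then obtain i where "x \<in> A i" by blast
          then show "x \<in> (\<Union>j<k. A j) \<union> R" unfolding R_def by (cases "i < k") (auto simp: not_less)
        qed (auto simp: R_def)
        moreover have "(\<Union>j<k. A j) \<inter> R = {}"
          using union(1) by (auto simp: R_def disjoint_family_on_def) (metis IntI empty_iff leD)
        moreover have "indicator (\<Union>j<k. A j) s = (\<Sum>j<k. indicator (A j) s :: real)"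
          using union(1) by (intro indicator_UN_disjoint) (auto simp: disjoint_family_on_def)
        moreover have "indicator (U \<union> R) s = indicator U s + (indicator R s :: real)" if "U \<inter> R = {}" for U
          using that by (auto simp: indicator_def)
        ultimately show ?thesis by simp
      qed
      have "cell_variation T n (indicator (\<Union>i. A i)) \<le> cell_variation T n (\<lambda>s. \<Sum>j<k. indicator (A j) s) + cell_variation T n (indicator R)"
        unfolding eq[abs_def] by (intro cell_variation_add) measurable
      also have "\<dots> \<le> (\<Sum>j<k. cell_variation T n (indicator (A j))) + 2 * (\<integral>\<^sup>+s. ennreal \<bar>indicator R s\<bar> * indicator {0<..T} s \<partial>lborel)"
        by (intro add_mono cell_variation_sum cell_variation_le_integral T n) auto
      also have "(\<integral>\<^sup>+s. ennreal \<bar>indicator R s\<bar> * indicator {0<..T} s \<partial>lborel) = (\<integral>\<^sup>+s. indicator (tail k) s \<partial>lborel)"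
        by (intro nn_integral_cong) (auto simp: indicator_def tail_def R_def)
      also have "\<dots> = emeasure lborel (tail k)" by (intro nn_integral_indicator) (auto simp: tail_def)
      finally show ?thesis .
    qed
    show ?case
    proof (rule order_tendstoI)
      fix e :: ennreal assume e: "0 < e"
      have "(\<lambda>k. 2 * emeasure lborel (tail k)) \<longlonglongrightarrow> 2 * 0"
        by (intro ennreal_tendsto_cmult tail_lim) simp
      then have "\<forall>\<^sub>F k in sequentially. 2 * emeasure lborel (tail k) < e"
        using e by (intro order_tendstoD(2)[where y = 0]) auto
      then obtain k where k: "2 * emeasure lborel (tail k) < e" by (auto simp: eventually_sequentially)
      have "(\<lambda>n. (\<Sum>j<k. cell_variation T n (indicator (A j))) + 2 * emeasure lborel (tail k))
          \<longlonglongrightarrow> (\<Sum>j<k. 0) + 2 * emeasure lborel (tail k)"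
        by (intro tendsto_add tendsto_sum tendsto_const union(3))
      then have "\<forall>\<^sub>F n in sequentially. (\<Sum>j<k. cell_variation T n (indicator (A j))) + 2 * emeasure lborel (tail k) < e"
        using k by (intro order_tendstoD(2)) auto
      then show "\<forall>\<^sub>F n in sequentially. cell_variation T n (indicator (\<Union>i. A i)) < e"
        using eventually_gt_at_top[of 0] by eventually_elim (rule order.strict_trans1[OF bound])
    qed simp
  qed
qed

text \<open>The sum counts the integers from 1 to N that are at most x, which is the integer part of
  x. Applied to h / \<epsilon>, it slices \<open>h\<close> into level sets.\<close>

lemma floor_sum_approx:
  assumes "0 \<le> x" "x \<le> real N"
  shows "\<bar>x - (\<Sum>j<N. indicator {real (Suc j)..} x)\<bar> \<le> 1"
  using assms
proof (induction N)
  case (Suc N)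
  show ?case
  proof (cases "x \<le> real N")
    case True
    then show ?thesis using Suc by simp
  next
    case False
    have "(\<Sum>j<N. indicator {real (Suc j)..} x) = (\<Sum>j<N. 1 :: real)"
      using False by (intro sum.cong) auto
    then show ?thesis using False Suc.prems by (auto simp: indicator_def)
  qed
qed simp

text \<open>A layer decomposition: a combination \<open>g\<close> of finitely many indicators of
  level sets is uniformly within \<epsilon> of \<open>h\<close>, and the remainder contributes at
  most 2 * \<epsilon> * T for every n.\<close>

lemma cell_variation_tendsto:
  assumes T: "0 < T" and h [measurable]: "h \<in> borel_measurable borel" and b: "\<And>s. 0 \<le> h s" "\<And>s. h s \<le> B"
  shows "(\<lambda>n. cell_variation T n h) \<longlonglongrightarrow> 0"
proof (rule order_tendstoI)
  fix e :: ennreal assume e: "0 < e"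
  obtain \<epsilon> where \<epsilon>: "0 < \<epsilon>" "ennreal (2 * \<epsilon> * T) < e"
  proof -
    have "(\<lambda>n. ennreal (2 * T / real n)) \<longlonglongrightarrow> ennreal 0" by (intro tendsto_ennrealI lim_const_over_n)
    then have "\<forall>\<^sub>F n in sequentially. ennreal (2 * T / real n) < e" using e by (intro order_tendstoD(2)[where y = "ennreal 0"]) auto
    then obtain n where "ennreal (2 * T / real (Suc n)) < e" unfolding eventually_sequentially by (metis le_SucI order_refl)
    then show thesis by (intro that[of "1 / real (Suc n)"]) auto
  qed
  obtain N :: nat where N: "B / \<epsilon> \<le> real N" using real_arch_simple by blast
  define A where "A j = {s. \<epsilon> * real (Suc j) \<le> h s}" for j
  have A [measurable]: "A j \<in> sets borel" for j unfolding A_def by measurable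
  define g where "g s = (\<Sum>j<N. \<epsilon> * indicator (A j) s)" for s
  have [measurable]: "g \<in> borel_measurable borel" unfolding g_def by measurable
  have hg: "\<bar>h s - g s\<bar> \<le> \<epsilon>" for s
  proof -
    have "h s / \<epsilon> \<le> B / \<epsilon>" using b(2)[of s] \<epsilon>(1) by (intro divide_right_mono) auto
    then have "\<bar>h s / \<epsilon> - (\<Sum>j<N. indicator {real (Suc j)..} (h s / \<epsilon>))\<bar> \<le> 1"
      using b(1)[of s] \<epsilon>(1) N by (intro floor_sum_approx) auto
    moreover have "(\<Sum>j<N. indicator {real (Suc j)..} (h s / \<epsilon>)) = g s / \<epsilon>"
      using \<epsilon>(1) unfolding g_def sum_divide_distrib
      by (intro sum.cong) (auto simp: A_def indicator_def pos_le_divide_eq mult.commute)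
    ultimately have "\<bar>h s - g s\<bar> / \<epsilon> \<le> 1" using \<epsilon>(1) by (simp add: diff_divide_distrib[symmetric])
    then show ?thesis using \<epsilon>(1) by (simp add: pos_divide_le_eq)
  qed
  have bound: "cell_variation T n h \<le> (\<Sum>j<N. ennreal \<bar>\<epsilon>\<bar> * cell_variation T n (indicator (A j))) + ennreal (2 * \<epsilon> * T)" if n: "0 < n" for n
  proof -
    have "cell_variation T n (\<lambda>s. g s + (h s - g s)) \<le> cell_variation T n g + cell_variation T n (\<lambda>s. h s - g s)"
      by (intro cell_variation_add) measurable
    also have "cell_variation T n g \<le> (\<Sum>j<N. cell_variation T n (\<lambda>s. \<epsilon> * indicator (A j) s))"
      unfolding g_def by (intro cell_variation_sum) auto
    also have "\<dots> = (\<Sum>j<N. ennreal \<bar>\<epsilon>\<bar> * cell_variation T n (indicator (A j)))"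
      by (intro sum.cong refl cell_variation_cmult) auto
    also have "cell_variation T n (\<lambda>s. h s - g s) \<le> 2 * (\<integral>\<^sup>+s. ennreal \<bar>h s - g s\<bar> * indicator {0<..T} s \<partial>lborel)"
      by (intro cell_variation_le_integral T n) measurable
    also have "\<dots> \<le> 2 * (\<integral>\<^sup>+s. ennreal \<epsilon> * indicator {0<..T} s \<partial>lborel)"
      by (intro mult_left_mono nn_integral_mono mult_right_mono ennreal_leI hg) auto
    also have "\<dots> = ennreal (2 * \<epsilon> * T)"
      using \<epsilon> T by (simp add: nn_integral_cmult_indicator ennreal_mult mult.assoc)
    finally show ?thesis by (simp add: add_mono)
  qed
  have "(\<lambda>n. (\<Sum>j<N. ennreal \<bar>\<epsilon>\<bar> * cell_variation T n (indicator (A j))) + ennreal (2 * \<epsilon> * T))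
      \<longlonglongrightarrow> (\<Sum>j<N. ennreal \<bar>\<epsilon>\<bar> * 0) + ennreal (2 * \<epsilon> * T)"
    by (intro tendsto_add tendsto_sum tendsto_const ennreal_tendsto_cmult cell_variation_indicator_tendsto T A) simp
  then have "\<forall>\<^sub>F n in sequentially. (\<Sum>j<N. ennreal \<bar>\<epsilon>\<bar> * cell_variation T n (indicator (A j))) + ennreal (2 * \<epsilon> * T) < e"
    using \<epsilon>(2) by (intro order_tendstoD(2)) auto
  then show "\<forall>\<^sub>F n in sequentially. cell_variation T n h < e"
    using eventually_gt_at_top[of 0] by eventually_elim (rule order.strict_trans1[OF bound])
qed simp

section \<open>Cell averages of the kernel\<close>

locale marked_kernel =
  fixes k :: "real \<Rightarrow> real \<Rightarrow> real" and T \<kappa> \<alpha> :: real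
  assumes T: "0 < T" and measurable_k [measurable]: "(\<lambda>(s, x). k s x) \<in> borel_measurable borel"
    and \<kappa>: "1 \<le> \<kappa>" and \<alpha>: "0 < \<alpha>" "\<alpha> < 1"
    and hoelder: "\<bar>k s x - k s y\<bar> \<le> \<kappa> * \<bar>x - y\<bar> powr \<alpha>"
    and lower: "1 / \<kappa> \<le> k s x" and upper: "k s x \<le> \<kappa>"
begin

lemma k_pos: "0 < k s x"
proof -
  have "0 < 1 / \<kappa>" using \<kappa> by simp
  then show ?thesis using lower[of s x] by linarith
qed

lemma measurable_k' [measurable]:
  assumes "f \<in> borel_measurable M" "g \<in> borel_measurable M"
  shows "(\<lambda>x. k (f x) (g x)) \<in> borel_measurable M"
  using measurable_compose[OF borel_measurable_Pair[OF assms] measurable_k] by simp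

text \<open>Averaging in time preserves the bounds and the Hoelder constant in x, so the averaged
  kernels again satisfy \<open>hoelder_kernel\<close> with the same \<kappa> and \<alpha>.\<close>

definition average :: "nat \<Rightarrow> nat \<Rightarrow> real \<Rightarrow> real" where
  "average n i x = real n / T * (LINT s:cell T n i|lborel. k s x)"

lemma set_integrable_cell:
  fixes h :: "real \<Rightarrow> real"
  assumes [measurable]: "h \<in> borel_measurable borel" and "\<And>s. \<bar>h s\<bar> \<le> B"
  shows "set_integrable lborel (cell T n i) h"
  unfolding set_integrable_def using assms(2)
  by (intro integrableI_bounded_set_indicator[where B = B]) (auto simp: emeasure_cell T)

lemma integral_cell_const: "(LINT s:cell T n i|lborel. c) = c * (T / real n)"
  using T by (simp add: set_lebesgue_integral_def measure_def emeasure_cell)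

lemma average_diff_le:
  fixes h :: "real \<Rightarrow> real"
  assumes n: "0 < n" and h [measurable]: "h \<in> borel_measurable borel" and hB: "\<And>s. \<bar>h s\<bar> \<le> C"
  shows "\<bar>real n / T * (LINT s:cell T n i|lborel. h s)\<bar> \<le> C"
proof -
  have "\<bar>LINT s:cell T n i|lborel. h s\<bar> \<le> (LINT s:cell T n i|lborel. \<bar>h s\<bar>)"
    using set_integral_norm_bound[OF set_integrable_cell[OF h hB, of n i]] by simp
  also have "\<dots> \<le> (LINT s:cell T n i|lborel. C)"
    using hB by (intro set_integral_mono set_integrable_cell[where B = C]) (auto intro: abs_ge_zero order_trans)
  also have "\<dots> = C * (T / real n)" by (rule integral_cell_const)
  finally have "real n / T * \<bar>LINT s:cell T n i|lborel. h s\<bar> \<le> real n / T * (C * (T / real n))"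
    using T by (intro mult_left_mono) auto
  then show ?thesis using n T by (simp add: abs_mult)
qed

lemma set_integrable_k: "set_integrable lborel (cell T n i) (\<lambda>s. k s x)"
proof (rule set_integrable_cell)
  show "\<bar>k s x\<bar> \<le> \<kappa>" for s using upper[of s x] k_pos[of s x] by simp
qed measurable

lemma average_diff: "average n i x - average n i y = real n / T * (LINT s:cell T n i|lborel. k s x - k s y)"
  unfolding average_def by (simp add: set_integral_diff[OF set_integrable_k set_integrable_k] right_diff_distrib)

lemma average_hoelder: "0 < n \<Longrightarrow> \<bar>average n i x - average n i y\<bar> \<le> \<kappa> * \<bar>x - y\<bar> powr \<alpha>"
  unfolding average_diff by (rule average_diff_le) (auto intro: hoelder)

lemma average_bounds:
  assumes "0 < n"
  shows "1 / \<kappa> \<le> average n i x" "average n i x \<le> \<kappa>"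
proof -
  have cst: "set_integrable lborel (cell T n i) (\<lambda>_. c)" for c :: real by (rule set_integrable_cell[where B = "\<bar>c\<bar>"]) auto
  have "(LINT s:cell T n i|lborel. 1 / \<kappa>) \<le> (LINT s:cell T n i|lborel. k s x)"
    by (intro set_integral_mono cst set_integrable_k lower)
  then have "real n / T * (1 / \<kappa> * (T / real n)) \<le> average n i x"
    unfolding average_def integral_cell_const using T by (intro mult_left_mono) auto
  then show "1 / \<kappa> \<le> average n i x" using assms T by simp
  have "(LINT s:cell T n i|lborel. k s x) \<le> (LINT s:cell T n i|lborel. \<kappa>)"
    by (intro set_integral_mono cst set_integrable_k upper)
  then have "average n i x \<le> real n / T * (\<kappa> * (T / real n))"
    unfolding average_def integral_cell_const using T by (intro mult_left_mono) auto
  then show "average n i x \<le> \<kappa>" using assms T by simp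
qed

lemma average_close:
  assumes n: "0 < n" and i: "i < n" "s \<in> cell T n i"
  shows "ennreal \<bar>average n i x - k s x\<bar> \<le> cell_oscillation T n (\<lambda>s. k s x) s"
proof -
  have cst: "set_integrable lborel (cell T n i) (\<lambda>_. c)" for c :: real by (rule set_integrable_cell[where B = "\<bar>c\<bar>"]) auto
  have b: "\<bar>k t x - k s x\<bar> \<le> 2 * \<kappa>" for t using upper[of t x] upper[of s x] k_pos[of t x] k_pos[of s x] by linarith
  have int: "set_integrable lborel (cell T n i) (\<lambda>t. k t x - k s x)"
    using b by (intro set_integrable_cell) auto
  have "average n i x - k s x = real n / T * (LINT t:cell T n i|lborel. k t x - k s x)"
    unfolding average_def set_integral_diff(2)[OF set_integrable_k cst] integral_cell_const
    using n T by (simp add: right_diff_distrib)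
  then have "\<bar>average n i x - k s x\<bar> \<le> real n / T * (LINT t:cell T n i|lborel. \<bar>k t x - k s x\<bar>)"
    using set_integral_norm_bound[OF int] T by (simp add: abs_mult mult_left_mono divide_right_mono)
  then have "ennreal \<bar>average n i x - k s x\<bar> \<le> ennreal (real n / T) * ennreal (LINT t:cell T n i|lborel. \<bar>k t x - k s x\<bar>)"
    using T by (subst ennreal_mult'[symmetric]) (auto intro: ennreal_leI)
  also have "ennreal (LINT t:cell T n i|lborel. \<bar>k t x - k s x\<bar>) = (\<integral>\<^sup>+t. ennreal (indicator (cell T n i) t *\<^sub>R \<bar>k t x - k s x\<bar>) \<partial>lborel)"
    unfolding set_lebesgue_integral_def using set_integrable_abs[OF int]
    by (intro nn_integral_eq_integral[symmetric]) (auto simp: set_integrable_def)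
  also have "\<dots> \<le> (\<integral>\<^sup>+t. ennreal \<bar>k t x - k s x\<bar> * same_cell T n s t \<partial>lborel)"
  proof (rule nn_integral_mono)
    fix t
    have "indicator (cell T n i) t = (indicator (cell T n i) s * indicator (cell T n i) t :: ennreal)" using i by simp
    also have "\<dots> \<le> same_cell T n s t" unfolding same_cell_def using i(1) by (intro member_le_sum) auto
    finally have "ennreal \<bar>k t x - k s x\<bar> * indicator (cell T n i) t \<le> ennreal \<bar>k t x - k s x\<bar> * same_cell T n s t"
      by (intro mult_left_mono) auto
    then show "ennreal (indicator (cell T n i) t *\<^sub>R \<bar>k t x - k s x\<bar>) \<le> ennreal \<bar>k t x - k s x\<bar> * same_cell T n s t"
      by (cases "t \<in> cell T n i") auto
  qed
  finally show ?thesis unfolding cell_oscillation_def by (simp add: mult_left_mono)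
qed

text \<open>Uniformity in x comes from a finite net: at the points l / p the averages converge in
  L1, and Hoelder continuity bridges the gaps at the cost 2 * \<kappa> * (1 / p) powr \<alpha>. The
  error is given as a measurable majorant in s, since it will be summed over jump times.\<close>

lemma average_approximates:
  assumes \<eta>: "0 < \<eta>"
  obtains N where "\<And>n. N \<le> n \<Longrightarrow> 0 < n \<and> (\<exists>h\<in>borel_measurable borel.
    (\<forall>i<n. \<forall>s\<in>cell T n i. \<forall>x\<in>{0..1}. ennreal \<bar>average n i x - k s x\<bar> \<le> h s) \<and>
    (\<integral>\<^sup>+s. h s * indicator {0<..T} s \<partial>lborel) \<le> ennreal \<eta>)"
proof -
  have "(\<lambda>p. 2 * \<kappa> * T * (1 / real p) powr \<alpha>) \<longlonglongrightarrow> 2 * \<kappa> * T * 0 powr \<alpha>"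
    using \<alpha> by (intro tendsto_mult tendsto_const tendsto_powr2 lim_1_over_n) auto
  then have "\<forall>\<^sub>F p in sequentially. 2 * \<kappa> * T * (1 / real p) powr \<alpha> < \<eta> / 2"
    using \<eta> by (intro order_tendstoD(2)) auto
  then obtain p0 where "\<And>p. p \<ge> p0 \<Longrightarrow> 2 * \<kappa> * T * (1 / real p) powr \<alpha> < \<eta> / 2"
    by (auto simp: eventually_sequentially)
  then obtain p where p: "0 < p" "2 * \<kappa> * T * (1 / real p) powr \<alpha> < \<eta> / 2" by (metis le_SucI order_refl zero_less_Suc)
  define r where "r = (1 / real p) powr \<alpha>"
  have "(\<lambda>n. \<Sum>l\<le>p. cell_variation T n (\<lambda>s. k s (real l / real p))) \<longlonglongrightarrow> (\<Sum>l\<le>p. 0)"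
    using upper k_pos by (intro tendsto_sum cell_variation_tendsto[where B = \<kappa>] T) (auto intro: less_imp_le)
  then have "\<forall>\<^sub>F n in sequentially. (\<Sum>l\<le>p. cell_variation T n (\<lambda>s. k s (real l / real p))) < ennreal (\<eta> / 2)"
    using \<eta> by (intro order_tendstoD(2)[where y = 0]) auto
  then obtain N where N: "\<And>n. n \<ge> N \<Longrightarrow> (\<Sum>l\<le>p. cell_variation T n (\<lambda>s. k s (real l / real p))) < ennreal (\<eta> / 2)"
    by (auto simp: eventually_sequentially)
  show thesis
  proof (rule that[of "Suc N"], rule conjI)
    fix n assume n: "Suc N \<le> n"
    then show n0: "0 < n" by simp
    define h where "h s = ennreal (2 * \<kappa> * r) + (\<Sum>l\<le>p. cell_oscillation T n (\<lambda>s. k s (real l / real p)) s)" for s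
    have [measurable]: "h \<in> borel_measurable borel" unfolding h_def by measurable
    show "\<exists>h\<in>borel_measurable borel.
      (\<forall>i<n. \<forall>s\<in>cell T n i. \<forall>x\<in>{0..1}. ennreal \<bar>average n i x - k s x\<bar> \<le> h s) \<and>
      (\<integral>\<^sup>+s. h s * indicator {0<..T} s \<partial>lborel) \<le> ennreal \<eta>"
    proof (intro bexI[of _ h] conjI allI impI ballI)
      fix i s x assume i: "i < n" "s \<in> cell T n i" and x: "x \<in> {0..1 :: real}"
      define l where "l = nat \<lfloor>real p * x\<rfloor>"
      have px: "0 \<le> real p * x" "real p * x \<le> real p" using x p by (auto simp: mult_left_le)
      have l: "real l \<le> real p * x" "real p * x < real l + 1"
        using px(1) unfolding l_def by (simp_all add: of_nat_nat)
      then have lp: "l \<le> p" using px(2) by linarith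
      define y where "y = real l / real p"
      have xy: "\<bar>x - y\<bar> \<le> 1 / real p"
      proof -
        have "x - y = (real p * x - real l) / real p" using p by (simp add: y_def field_simps)
        then show ?thesis using l p by (simp add: abs_le_iff divide_right_mono)
      qed
      then have pw: "\<bar>x - y\<bar> powr \<alpha> \<le> r" unfolding r_def using \<alpha> by (intro powr_mono2) auto
      then have kp: "\<kappa> * \<bar>x - y\<bar> powr \<alpha> \<le> \<kappa> * r" using \<kappa> by (intro mult_left_mono) auto
      have "\<bar>average n i x - k s x\<bar> \<le> \<bar>average n i x - average n i y\<bar> + \<bar>average n i y - k s y\<bar> + \<bar>k s x - k s y\<bar>"
        by linarith
      also have "\<dots> \<le> 2 * \<kappa> * r + \<bar>average n i y - k s y\<bar>"
        using average_hoelder[OF n0, of i x y] hoelder[of s x y] kp by linarith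
      finally have "ennreal \<bar>average n i x - k s x\<bar> \<le> ennreal (2 * \<kappa> * r + \<bar>average n i y - k s y\<bar>)" by (rule ennreal_leI)
      also have "\<dots> = ennreal (2 * \<kappa> * r) + ennreal \<bar>average n i y - k s y\<bar>"
        using \<kappa> by (intro ennreal_plus) (auto simp: r_def)
      also have "ennreal \<bar>average n i y - k s y\<bar> \<le> cell_oscillation T n (\<lambda>s. k s y) s" by (rule average_close[OF n0 i])
      also have "\<dots> \<le> (\<Sum>l\<le>p. cell_oscillation T n (\<lambda>s. k s (real l / real p)) s)"
        unfolding y_def using lp by (intro member_le_sum) auto
      finally show "ennreal \<bar>average n i x - k s x\<bar> \<le> h s" by (simp add: h_def)
    next
      have "(\<integral>\<^sup>+s. h s * indicator {0<..T} s \<partial>lborel)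
          \<le> (\<integral>\<^sup>+s. ennreal (2 * \<kappa> * r) * indicator {0<..T} s + (\<Sum>l\<le>p. cell_oscillation T n (\<lambda>s. k s (real l / real p)) s) \<partial>lborel)"
        unfolding h_def by (intro nn_integral_mono) (auto simp: indicator_def)
      also have "\<dots> = ennreal (2 * \<kappa> * r) * ennreal T + (\<Sum>l\<le>p. cell_variation T n (\<lambda>s. k s (real l / real p)))"
        unfolding cell_variation_def using T
        by (subst nn_integral_add) (auto simp: nn_integral_cmult_indicator nn_integral_sum)
      also have "\<dots> \<le> ennreal (\<eta> / 2) + ennreal (\<eta> / 2)"
      proof (intro add_mono)
        have "ennreal (2 * \<kappa> * r) * ennreal T = ennreal (2 * \<kappa> * T * r)"
          using T \<kappa> by (subst ennreal_mult[symmetric]) (auto simp: r_def mult_ac)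
        also have "\<dots> \<le> ennreal (\<eta> / 2)" using p(2) by (intro ennreal_leI) (simp add: r_def)
        finally show "ennreal (2 * \<kappa> * r) * ennreal T \<le> ennreal (\<eta> / 2)" .
        show "(\<Sum>l\<le>p. cell_variation T n (\<lambda>s. k s (real l / real p))) \<le> ennreal (\<eta> / 2)"
          using N[of n] n by (simp add: less_imp_le)
      qed
      also have "\<dots> = ennreal \<eta>" using \<eta> by (simp add: ennreal_plus[symmetric] del: ennreal_plus)
      finally show "(\<integral>\<^sup>+s. h s * indicator {0<..T} s \<partial>lborel) \<le> ennreal \<eta>" .
    qed measurable
  qed
qed

end

section \<open>Transformed pure jump paths\<close>

lemma hoelder_kernel_primitive:
  fixes k :: "real \<Rightarrow> real"
  assumes \<kappa>: "1 \<le> \<kappa>" and \<alpha>: "0 < \<alpha>" "\<alpha> < 1"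
    and h: "\<And>x y. \<bar>k x - k y\<bar> \<le> \<kappa> * \<bar>x - y\<bar> powr \<alpha>"
    and b: "\<And>x. 1 / \<kappa> \<le> k x" "\<And>x. k x \<le> \<kappa>"
  shows "hoelder_kernel k (\<lambda>x. LBINT y=0..x. k y) \<kappa> \<alpha>"
proof
  have "isCont k x" for x
  proof -
    have "((\<lambda>y. \<bar>y - x\<bar>) \<longlongrightarrow> \<bar>x - x\<bar>) (at x)" by (intro tendsto_intros)
    then have "((\<lambda>y. \<bar>y - x\<bar> powr \<alpha>) \<longlongrightarrow> 0 powr \<alpha>) (at x)"
      using \<alpha>(1) by (intro tendsto_powr2 tendsto_const) (simp_all add: always_eventually)
    then have "((\<lambda>y. \<kappa> * \<bar>y - x\<bar> powr \<alpha>) \<longlongrightarrow> 0) (at x)"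
      by (simp add: tendsto_mult_right_zero)
    then have "((\<lambda>y. k y - k x) \<longlongrightarrow> 0) (at x)"
      by (rule Lim_null_comparison[rotated]) (simp add: h)
    then show ?thesis unfolding isCont_def by (simp add: LIM_zero_iff)
  qed
  then have cont: "continuous_on S k" for S by (simp add: continuous_at_imp_continuous_on)
  fix x :: real
  define m where "m = \<bar>x\<bar> + 1"
  have "((\<lambda>u. LBINT y=ereal 0..u. k y) has_vector_derivative k x) (at x within {- m..m})"
    by (rule interval_integral_FTC2[OF _ _ cont]) (auto simp: m_def)
  moreover have "at x within {- m..m} = at x"
    by (rule at_within_interior) (auto simp: m_def interior_atLeastAtMost_real)
  ultimately show "((\<lambda>x. LBINT y=0..x. k y) has_real_derivative k x) (at x)"
    by (simp add: has_real_derivative_iff_has_vector_derivative zero_ereal_def)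
  show "(LBINT y=0..ereal 0. k y) = 0" by (simp add: zero_ereal_def)
qed (use assms in auto)

text \<open>The mean value theorem for the difference. The factor x matters: an error proportional
  to the jump size can be summed over all jumps of a path.\<close>

lemma hoelder_kernel_diff:
  assumes "hoelder_kernel k1 K1 \<kappa> \<alpha>" "hoelder_kernel k2 K2 \<kappa> \<alpha>"
    and c: "\<And>y. y \<in> {0..1} \<Longrightarrow> \<bar>k1 y - k2 y\<bar> \<le> c" and x: "x \<in> {0..1}"
  shows "\<bar>K1 x - K2 x\<bar> \<le> x * c"
proof (cases "x = 0")
  case True
  then show ?thesis using assms(1,2) by (simp add: hoelder_kernel_def)
next
  case False
  then have x0: "0 < x" using x by simp
  have "\<exists>z. 0 < z \<and> z < x \<and> (K1 x - K2 x) - (K1 0 - K2 0) = (x - 0) * (k1 z - k2 z)"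
    using assms(1,2) by (intro MVT2[OF x0] DERIV_diff) (auto simp: hoelder_kernel_def)
  then obtain z where z: "0 < z" "z < x" "K1 x - K2 x = x * (k1 z - k2 z)"
    using assms(1,2) by (auto simp: hoelder_kernel_def)
  then show ?thesis using c[of z] x x0 by (simp add: abs_mult)
qed

section \<open>Convergence of sequences of coordinates and transfer of null sets\<close>

lemma tendsto_fun:
  fixes f :: "nat \<Rightarrow> 'b \<Rightarrow> 'c::topological_space"
  assumes "\<And>j. (\<lambda>n. f n j) \<longlonglongrightarrow> g j"
  shows "f \<longlonglongrightarrow> g"
proof (rule topological_tendstoI)
  fix S assume "open S" "g \<in> S"
  then obtain X where X: "g \<in> (\<Pi>\<^sub>E i\<in>UNIV. X i)" "\<And>i. open (X i)" "finite {i. X i \<noteq> UNIV}" "(\<Pi>\<^sub>E i\<in>UNIV. X i) \<subseteq> S"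
    using product_topology_open_contains_basis[of "\<lambda>_. euclidean" UNIV S g]
    by (auto simp: open_fun_def)
  have "\<forall>\<^sub>F n in sequentially. \<forall>i\<in>{i. X i \<noteq> UNIV}. f n i \<in> X i"
    using X by (intro eventually_ball_finite) (auto intro!: topological_tendstoD[OF assms])
  then show "\<forall>\<^sub>F n in sequentially. f n \<in> S"
  proof eventually_elim
    case (elim n)
    have "f n i \<in> X i" for i using elim by (cases "X i = UNIV") auto
    then show ?case using X(4) by auto
  qed
qed

text \<open>For a compact set the cut-off distance functions are continuous and tend to its
  indicator, so the inequality passes to compact subsets of \<open>A\<close>. A finite Borel measure
  on a Polish space is inner regular, which takes care of \<open>A\<close> itself.\<close>

lemma null_set_transfer:
  fixes Y Z :: "'a \<Rightarrow> 'b::polish_space"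
  assumes M: "prob_space M" and [measurable]: "Y \<in> measurable M borel" "Z \<in> measurable M borel" "\<Omega> \<in> sets M"
    and A [measurable]: "A \<in> sets borel" and C: "C < \<infinity>"
    and le: "\<And>\<Phi>. continuous_on UNIV \<Phi> \<Longrightarrow> (\<And>x. 0 \<le> \<Phi> x) \<Longrightarrow> (\<And>x. \<Phi> x \<le> 1) \<Longrightarrow>
      (\<integral>\<^sup>+\<omega>. ennreal (\<Phi> (Y \<omega>)) * indicator \<Omega> \<omega> \<partial>M) \<le> C * (\<integral>\<^sup>+\<omega>. ennreal (\<Phi> (Z \<omega>)) \<partial>M)"
    and null: "emeasure M (Z -` A \<inter> space M) = 0"
  shows "emeasure M (Y -` A \<inter> space M \<inter> \<Omega>) = 0"
proof -
  interpret prob_space M by (rule M)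
  define \<mu> where "\<mu> = distr (density M (indicator \<Omega>)) borel Y"
  have em: "emeasure \<mu> B = emeasure M (Y -` B \<inter> space M \<inter> \<Omega>)" if [measurable]: "B \<in> sets borel" for B
  proof -
    have "emeasure \<mu> B = (\<integral>\<^sup>+\<omega>. indicator \<Omega> \<omega> * indicator (Y -` B \<inter> space M) \<omega> \<partial>M)"
      unfolding \<mu>_def by (subst emeasure_distr) (auto intro!: emeasure_density)
    also have "\<dots> = (\<integral>\<^sup>+\<omega>. indicator (Y -` B \<inter> space M \<inter> \<Omega>) \<omega> \<partial>M)"
      by (intro nn_integral_cong) (auto simp: indicator_def)
    also have "\<dots> = emeasure M (Y -` B \<inter> space M \<inter> \<Omega>)" by (rule nn_integral_indicator) measurable
    finally show ?thesis .
  qed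
  have "emeasure \<mu> K = 0" if K: "K \<subseteq> A" "compact K" for K
  proof (cases "K = {}")
    case False
    have cl: "closed K" using K(2) by (rule compact_imp_closed)
    then have Kb [measurable]: "K \<in> sets borel" by (rule borel_closed)
    define \<Phi> where "\<Phi> n x = max 0 (1 - real n * infdist x K)" for n x
    have cont: "continuous_on UNIV (\<Phi> n)" for n
      unfolding \<Phi>_def by (intro continuous_intros)
    have [measurable]: "\<Phi> n \<in> borel_measurable borel" for n using cont by (rule borel_measurable_continuous_onI)
    have \<Phi>1: "\<Phi> n x \<le> 1" for n x by (simp add: \<Phi>_def infdist_nonneg)
    have \<Phi>K: "\<Phi> n x = 1" if "x \<in> K" for n x using that by (simp add: \<Phi>_def)
    have lim: "(\<lambda>n. ennreal (\<Phi> n x)) \<longlonglongrightarrow> indicator K x" for x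
    proof (cases "x \<in> K")
      case False
      then have d: "0 < infdist x K"
        using in_closed_iff_infdist_zero[OF cl \<open>K \<noteq> {}\<close>, of x] infdist_nonneg[of x K] by linarith
      obtain N :: nat where N: "1 / infdist x K < real N" using reals_Archimedean2 by blast
      have "\<Phi> n x = 0" if "N \<le> n" for n
      proof -
        have "1 / infdist x K < real n" using N that by simp
        then show ?thesis using d by (simp add: \<Phi>_def divide_less_eq)
      qed
      then have "\<forall>\<^sub>F n in sequentially. ennreal (\<Phi> n x) = indicator K x"
        using False by (intro eventually_sequentiallyI[of N]) simp
      then show ?thesis by (rule tendsto_eventually)
    qed (simp add: \<Phi>K)
    have "(\<lambda>n. \<integral>\<^sup>+\<omega>. ennreal (\<Phi> n (Z \<omega>)) \<partial>M) \<longlonglongrightarrow> (\<integral>\<^sup>+\<omega>. indicator K (Z \<omega>) \<partial>M)"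
      using lim \<Phi>1 by (intro nn_integral_dominated_convergence[where w = "\<lambda>_. 1"]) (auto simp: emeasure_space_1 ennreal_le_1)
    also have "(\<integral>\<^sup>+\<omega>. indicator K (Z \<omega>) \<partial>M) = (\<integral>\<^sup>+\<omega>. indicator (Z -` K \<inter> space M) \<omega> \<partial>M)"
      by (intro nn_integral_cong) (auto simp: indicator_def)
    also have "\<dots> = emeasure M (Z -` K \<inter> space M)" by (rule nn_integral_indicator) measurable
    also have "\<dots> = 0"
    proof -
      have "emeasure M (Z -` K \<inter> space M) \<le> emeasure M (Z -` A \<inter> space M)" using K(1) by (intro emeasure_mono) auto
      then show ?thesis using null by simp
    qed
    finally have "(\<lambda>n. C * (\<integral>\<^sup>+\<omega>. ennreal (\<Phi> n (Z \<omega>)) \<partial>M)) \<longlonglongrightarrow> C * 0"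
      using C by (intro ennreal_tendsto_cmult) auto
    then have "emeasure \<mu> K \<le> C * 0"
    proof (rule LIMSEQ_le_const, intro exI allI impI)
      fix n :: nat
      have "emeasure \<mu> K = (\<integral>\<^sup>+\<omega>. indicator (Y -` K \<inter> space M \<inter> \<Omega>) \<omega> \<partial>M)"
        unfolding em[OF Kb] by (rule nn_integral_indicator[symmetric]) measurable
      also have "\<dots> \<le> (\<integral>\<^sup>+\<omega>. ennreal (\<Phi> n (Y \<omega>)) * indicator \<Omega> \<omega> \<partial>M)"
        by (intro nn_integral_mono) (auto simp: indicator_def \<Phi>K)
      also have "\<dots> \<le> C * (\<integral>\<^sup>+\<omega>. ennreal (\<Phi> n (Z \<omega>)) \<partial>M)"
        by (intro le cont \<Phi>1) (simp add: \<Phi>_def)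
      finally show "emeasure \<mu> K \<le> C * (\<integral>\<^sup>+\<omega>. ennreal (\<Phi> n (Z \<omega>)) \<partial>M)" .
    qed
    then show ?thesis by simp
  qed simp
  moreover have "emeasure \<mu> A = (\<Squnion>K\<in>{K. K \<subseteq> A \<and> compact K}. emeasure \<mu> K)"
  proof (rule inner_regular)
    have "emeasure \<mu> (space \<mu>) = emeasure M (Y -` UNIV \<inter> space M \<inter> \<Omega>)" using em[of UNIV] by (simp add: \<mu>_def)
    also have "\<dots> \<le> 1" using emeasure_space[of M] by (simp add: emeasure_space_1)
    finally show "emeasure \<mu> (space \<mu>) \<noteq> \<infinity>" by (auto simp: top_unique)
  qed (auto simp: \<mu>_def)
  ultimately have "emeasure \<mu> A = 0" by (auto simp: SUP_eq_const intro!: antisym SUP_least)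
  then show ?thesis using em[OF A] by simp
qed

lemma powr_add_le:
  fixes x y :: real
  assumes "0 \<le> x" "0 \<le> y" "0 < \<alpha>" "\<alpha> \<le> 1"
  shows "(x + y) powr \<alpha> \<le> x powr \<alpha> + y powr \<alpha>"
proof (cases "x = 0 \<or> y = 0")
  case False
  then have xy: "0 < x" "0 < y" using assms by auto
  have "(x + y) powr \<alpha> = x * (x + y) powr (\<alpha> - 1) + y * (x + y) powr (\<alpha> - 1)"
    using xy powr_mult_base[of "x + y" "\<alpha> - 1"] by (simp add: distrib_right[symmetric])
  also have "\<dots> \<le> x * x powr (\<alpha> - 1) + y * y powr (\<alpha> - 1)"
    using xy assms by (intro add_mono mult_left_mono powr_mono2') auto
  also have "\<dots> = x powr \<alpha> + y powr \<alpha>" 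
    using xy powr_mult_base[of x "\<alpha> - 1"] powr_mult_base[of y "\<alpha> - 1"] by simp
  finally show ?thesis .
qed auto

context marked_kernel
begin

text \<open>An oriented integral, so as to be a primitive on the whole line as
  \<open>hoelder_kernel\<close> demands; for x \<ge> 0 it is \<open>primitive k s x\<close>.\<close>

definition Kp :: "real \<Rightarrow> real \<Rightarrow> real" where
  "Kp s x = (LBINT y=0..x. k s y)"

definition Ka :: "nat \<Rightarrow> nat \<Rightarrow> real \<Rightarrow> real" where
  "Ka n i x = (LBINT y=0..x. average n i y)"

lemma hoelder_kernel_Kp: "hoelder_kernel (k s) (Kp s) \<kappa> \<alpha>"
  unfolding Kp_def[abs_def] by (intro hoelder_kernel_primitive \<kappa> \<alpha> hoelder lower upper)

lemma hoelder_kernel_Ka: "0 < n \<Longrightarrow> hoelder_kernel (average n i) (Ka n i) \<kappa> \<alpha>"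
  unfolding Ka_def[abs_def] by (intro hoelder_kernel_primitive \<kappa> \<alpha> average_hoelder average_bounds)

end

section \<open>Grid sums along a pure jump path\<close>

locale pure_jump_path = monotone_path f T + marked_kernel k T \<kappa> \<alpha>
  for f T k \<kappa> \<alpha> +
  assumes f_0: "f 0 = 0" and f_T: "f T = 1"
    and exhaust: "\<And>\<eta>. 0 < \<eta> \<Longrightarrow> \<exists>F. finite F \<and> F \<subseteq> {0<..T} \<and> 1 - \<eta> \<le> sum (jump f) F"
begin

lemma jump_le_1:
  assumes "s \<in> {0..T}"
  shows "jump f s \<in> {0..1}"
proof (cases "s = 0")
  case False
  then have "sum (jump f) {s} \<le> f T - f 0" using assms by (intro sum_jump_le) auto
  then show ?thesis using jump_nonneg[of s] assms by (simp add: f_0 f_T)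
qed (simp add: jump_0)

lemma sum_jump_le_1:
  assumes F: "finite F" "F \<subseteq> {0..T}"
  shows "sum (jump f) F \<le> 1"
proof -
  have "sum (jump f) F = sum (jump f) (F - {0})"
    using F by (intro sum.mono_neutral_right) (auto simp: jump_0)
  also have "\<dots> \<le> f T - f 0" using F T by (intro sum_jump_le) (auto simp: order.order_iff_strict)
  finally show ?thesis by (simp add: f_0 f_T)
qed

definition g :: "real \<Rightarrow> real" where "g s = Kp s (jump f s)"

lemma g_bounds:
  assumes "s \<in> {0..T}"
  shows "0 \<le> g s" "g s \<le> \<kappa> * jump f s" "jump f s / \<kappa> \<le> g s"
  using hoelder_kernel.nonneg_bounds[OF hoelder_kernel_Kp] hoelder_kernel.K_nonneg[OF hoelder_kernel_Kp]
    jump_nonneg[of s] assms by (auto simp: g_def)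

lemma summable_g: "S \<subseteq> {0..T} \<Longrightarrow> g summable_on S"
proof (rule nonneg_bdd_above_summable_on)
  assume S: "S \<subseteq> {0..T}"
  show "bdd_above (sum g ` {F. F \<subseteq> S \<and> finite F})"
  proof (rule bdd_aboveI2)
    fix F assume F: "F \<in> {F. F \<subseteq> S \<and> finite F}"
    then have FT: "finite F" "F \<subseteq> {0..T}" using S by auto
    have "sum g F \<le> (\<Sum>s\<in>F. \<kappa> * jump f s)" using FT by (intro sum_mono g_bounds) auto
    also have "\<dots> = \<kappa> * sum (jump f) F" by (simp add: sum_distrib_left)
    also have "\<dots> \<le> \<kappa> * 1" using \<kappa> by (intro mult_left_mono sum_jump_le_1 FT) auto
    finally show "sum g F \<le> \<kappa>" by simp
  qed
qed (auto intro: g_bounds)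

text \<open>All jumps together sum to at most 1, so those outside \<open>F\<close> sum to at most
  \<eta>.\<close>

lemma infsum_g_near:
  assumes F: "finite F" "F \<subseteq> {0<..T}" "1 - \<eta> \<le> sum (jump f) F" and q: "q \<in> {0..T}"
  shows "\<bar>(\<Sum>s\<in>F \<inter> {0<..q}. g s) - infsum g {0..q}\<bar> \<le> \<kappa> * \<eta>"
proof -
  have sub: "{0..q} \<subseteq> {0..T}" using q by auto
  have split: "infsum g {0..q} = infsum g (F \<inter> {0<..q}) + infsum g ({0..q} - F \<inter> {0<..q})"
  proof -
    have "infsum g ((F \<inter> {0<..q}) \<union> ({0..q} - F \<inter> {0<..q})) = infsum g (F \<inter> {0<..q}) + infsum g ({0..q} - F \<inter> {0<..q})"
      using sub by (intro infsum_Un_disjoint summable_g) auto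
    moreover have "(F \<inter> {0<..q}) \<union> ({0..q} - F \<inter> {0<..q}) = {0..q}" by auto
    ultimately show ?thesis by simp
  qed
  have "infsum g ({0..q} - F \<inter> {0<..q}) \<le> \<kappa> * \<eta>"
  proof (rule infsum_le_finite_sums)
    show "g summable_on {0..q} - F \<inter> {0<..q}" using sub by (intro summable_g) auto
    fix H assume H: "finite H" "H \<subseteq> {0..q} - F \<inter> {0<..q}"
    have HT: "H \<subseteq> {0..T}" using H sub by auto
    have "sum (jump f) (H - {0}) + sum (jump f) F = sum (jump f) (H - {0} \<union> F)"
      using H F by (intro sum.union_disjoint[symmetric]) auto
    also have "\<dots> \<le> 1" using H HT F by (intro sum_jump_le_1) auto
    finally have "sum (jump f) (H - {0}) \<le> \<eta>" using F(3) by linarith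
    moreover have "sum (jump f) H = sum (jump f) (H - {0})"
      using H by (intro sum.mono_neutral_right) (auto simp: jump_0)
    ultimately have le: "sum (jump f) H \<le> \<eta>" by simp
    have "sum g H \<le> (\<Sum>s\<in>H. \<kappa> * jump f s)" using HT by (intro sum_mono g_bounds) auto
    also have "\<dots> = \<kappa> * sum (jump f) H" by (simp add: sum_distrib_left)
    also have "\<dots> \<le> \<kappa> * \<eta>" using \<kappa> le by (intro mult_left_mono) auto
    finally show "sum g H \<le> \<kappa> * \<eta>" .
  qed
  moreover have "0 \<le> infsum g ({0..q} - F \<inter> {0<..q})" using sub by (intro infsum_nonneg g_bounds) auto
  moreover have "infsum g (F \<inter> {0<..q}) = (\<Sum>s\<in>F \<inter> {0<..q}. g s)" using F(1) by simp
  ultimately show ?thesis using split by linarith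
qed

lemma infsum_g_pos: "0 < infsum g {0..T}"
proof -
  obtain F where F: "finite F" "F \<subseteq> {0<..T}" "1 - 1 / 2 \<le> sum (jump f) F" using exhaust[of "1 / 2"] by auto
  have "(1 / 2) / \<kappa> \<le> sum (jump f) F / \<kappa>" using F(3) \<kappa> by (intro divide_right_mono) auto
  also have "\<dots> = (\<Sum>s\<in>F. jump f s / \<kappa>)" by (simp add: sum_divide_distrib)
  also have "\<dots> \<le> sum g F" using F(2) by (intro sum_mono g_bounds(3)) auto
  also have "\<dots> = infsum g F" using F(1) by simp
  also have "\<dots> \<le> infsum g {0..T}"
    using F by (intro infsum_mono_neutral summable_g) (auto intro: g_bounds)
  finally show ?thesis using \<kappa> by (smt (verit) divide_pos_pos)
qed

text \<open>Three errors. Replacing the scaled increment of a cell by the one jump of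
  \<open>F\<close> in it costs, by the Lipschitz bound, \<kappa> * (r - 1 + \<eta>) in total; one
  jump per cell is essential, as the kernels are not additive. Replacing the averaged kernel by the
  one at the jump time costs \<open>z\<close>. The jumps outside \<open>F\<close> cost \<kappa> *
  \<eta>.\<close>

lemma grid_sum_close:
  assumes n: "0 < n" and j: "j \<le> n" and r: "1 \<le> r"
    and h: "\<And>i s x. i < n \<Longrightarrow> s \<in> cell T n i \<Longrightarrow> x \<in> {0..1} \<Longrightarrow> ennreal \<bar>average n i x - k s x\<bar> \<le> h s"
    and F: "finite F" "F \<subseteq> {0<..T}" "1 - \<eta> \<le> sum (jump f) F"
    and sep: "\<And>i p q. p \<in> F \<inter> cell T n i \<Longrightarrow> q \<in> F \<inter> cell T n i \<Longrightarrow> p = q"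
    and z: "(\<integral>\<^sup>+s. ennreal (jump f s) * h s \<partial>count_space {0..T}) \<le> ennreal z" "0 \<le> z"
  shows "\<bar>(\<Sum>i<j. Ka n i (r * increment f T n i)) - infsum g {0..T * real j / real n}\<bar> \<le> \<kappa> * (r - 1 + \<eta>) + z + \<kappa> * \<eta>"
proof -
  define q where "q = T * real j / real n"
  have q: "q \<in> {0..T}" using j n T by (auto simp: q_def divide_le_eq mult_left_mono)
  define F' where "F' = F \<inter> {0<..q}"
  have F': "finite F'" "F' \<subseteq> {0<..q}" using F by (auto simp: F'_def)
  have Fcell: "F' \<inter> cell T n i = F \<inter> cell T n i" if "i < j" for i
  proof -
    have "cell T n i \<subseteq> {0<..q}" unfolding q_def using UN_cell_le[OF T n, of j] that by blast
    then show ?thesis by (auto simp: F'_def)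
  qed
  note HK = hoelder_kernel_Ka[OF n]
  have inc: "0 \<le> increment f T n i" if "i < n" for i using increment_nonneg[OF T order_refl that] .
  have jl: "sum (jump f) (F \<inter> cell T n i) \<le> increment f T n i" if "i < n" for i
    unfolding increment_def using F cell_bounds[OF T order_refl that]
    by (intro sum_jump_le) (auto simp: cell_def)
  have rge: "increment f T n i \<le> r * increment f T n i" if "i < n" for i
    using inc[OF that] r by (simp add: mult_le_cancel_right1)
  have first: "\<bar>(\<Sum>i<j. Ka n i (r * increment f T n i)) - (\<Sum>i<j. \<Sum>s\<in>F \<inter> cell T n i. Ka n i (jump f s))\<bar> \<le> \<kappa> * (r - 1 + \<eta>)"
  proof -
    have "\<bar>Ka n i (r * increment f T n i) - (\<Sum>s\<in>F \<inter> cell T n i. Ka n i (jump f s))\<bar>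
        \<le> \<kappa> * (r * increment f T n i - sum (jump f) (F \<inter> cell T n i))" if i: "i < n" for i
    proof (cases "F \<inter> cell T n i = {}")
      case True
      have "0 \<le> r * increment f T n i" using inc[OF i] r by simp
      then show ?thesis
        using hoelder_kernel.nonneg_bounds(2)[OF HK] hoelder_kernel.K_nonneg[OF HK] unfolding True by simp
    next
      case False
      then obtain p where p: "p \<in> F \<inter> cell T n i" by blast
      have one: "F \<inter> cell T n i = {p}"
      proof (intro equalityI subsetI)
        fix x assume "x \<in> F \<inter> cell T n i"
        then have "x = p" using p by (rule sep)
        then show "x \<in> {p}" by simp
      qed (use p in simp)
      have "jump f p \<le> r * increment f T n i" using jl[OF i] rge[OF i] unfolding one by simp
      then show ?thesis
        using hoelder_kernel.lipschitz[OF HK, of i "r * increment f T n i" "jump f p"] unfolding one by simp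
    qed
    then have "\<bar>\<Sum>i<j. Ka n i (r * increment f T n i) - (\<Sum>s\<in>F \<inter> cell T n i. Ka n i (jump f s))\<bar>
        \<le> (\<Sum>i<j. \<kappa> * (r * increment f T n i - sum (jump f) (F \<inter> cell T n i)))"
      using j by (intro order_trans[OF sum_abs] sum_mono) auto
    \<comment> \<open>Extended to all cells, where the increments sum to 1 and the jumps of
      \<open>F\<close> to at least 1 - \<eta>.\<close>
    also have "\<dots> \<le> (\<Sum>i<n. \<kappa> * (r * increment f T n i - sum (jump f) (F \<inter> cell T n i)))"
    proof (rule sum_mono2)
      fix i assume "i \<in> {..<n} - {..<j}"
      then have "sum (jump f) (F \<inter> cell T n i) \<le> r * increment f T n i" using jl[of i] rge[of i] by auto
      then show "0 \<le> \<kappa> * (r * increment f T n i - sum (jump f) (F \<inter> cell T n i))" using \<kappa> by simp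
    qed (use j in auto)
    also have "\<dots> = \<kappa> * (r * (\<Sum>i<n. increment f T n i) - (\<Sum>i<n. \<Sum>s\<in>F \<inter> cell T n i. jump f s))"
      by (simp add: sum_distrib_left sum_subtractf right_diff_distrib)
    also have "(\<Sum>i<n. increment f T n i) = 1" using n by (simp add: sum_increment f_0 f_T)
    also have "(\<Sum>i<n. \<Sum>s\<in>F \<inter> cell T n i. jump f s) = sum (jump f) F"
      using F n T by (intro sum_cells) auto
    also have "\<kappa> * (r * 1 - sum (jump f) F) \<le> \<kappa> * (r - 1 + \<eta>)" using F(3) \<kappa> by (intro mult_left_mono) auto
    finally show ?thesis by (simp add: sum_subtractf)
  qed
  have second: "\<bar>(\<Sum>i<j. \<Sum>s\<in>F \<inter> cell T n i. Ka n i (jump f s)) - (\<Sum>s\<in>F'. g s)\<bar> \<le> z"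
  proof -
    \<comment> \<open>\<open>h s\<close> may be infinite. Then the right side is infinite as well,
      unless the jump is 0, and in that case both kernels vanish.\<close>
    have d: "ennreal \<bar>Ka n i (jump f s) - g s\<bar> \<le> ennreal (jump f s) * h s" if i: "i < n" "s \<in> F \<inter> cell T n i" for i s
    proof (cases "h s")
      case (real c)
      have s: "s \<in> {0..T}" using i F(2) by auto
      have "\<bar>Ka n i (jump f s) - Kp s (jump f s)\<bar> \<le> jump f s * c"
      proof (rule hoelder_kernel_diff[OF HK hoelder_kernel_Kp _ jump_le_1[OF s]])
        show "\<bar>average n i y - k s y\<bar> \<le> c" if "y \<in> {0..1}" for y
          using h[OF i(1) _ that, of s] i(2) real by simp
      qed
      then have "ennreal \<bar>Ka n i (jump f s) - g s\<bar> \<le> ennreal (jump f s * c)" unfolding g_def by (rule ennreal_leI)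
      then show ?thesis using real jump_nonneg[of s] s by (simp add: ennreal_mult)
    next
      case top
      have s: "s \<in> {0..T}" using i F(2) by auto
      show ?thesis
      proof (cases "jump f s = 0")
        case True
        then show ?thesis using hoelder_kernel.K_0[OF HK] hoelder_kernel.K_0[OF hoelder_kernel_Kp] by (simp add: g_def)
      next
        case False
        then have "0 < jump f s" using jump_nonneg[of s] s by simp
        then show ?thesis using top by (simp add: ennreal_mult_top)
      qed
    qed
    have "(\<Sum>s\<in>F'. g s) = (\<Sum>i<j. \<Sum>s\<in>F' \<inter> cell T n i. g s)"
      using F' n T by (intro sum_cells[symmetric]) (auto simp: q_def)
    also have "\<dots> = (\<Sum>i<j. \<Sum>s\<in>F \<inter> cell T n i. g s)" by (intro sum.cong) (auto simp: Fcell)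
    finally have eq: "(\<Sum>i<j. \<Sum>s\<in>F \<inter> cell T n i. Ka n i (jump f s)) - (\<Sum>s\<in>F'. g s)
        = (\<Sum>i<j. \<Sum>s\<in>F \<inter> cell T n i. Ka n i (jump f s) - g s)" by (simp add: sum_subtractf)
    have "ennreal \<bar>\<Sum>i<j. \<Sum>s\<in>F \<inter> cell T n i. Ka n i (jump f s) - g s\<bar>
        \<le> ennreal (\<Sum>i<j. \<Sum>s\<in>F \<inter> cell T n i. \<bar>Ka n i (jump f s) - g s\<bar>)"
      by (rule ennreal_leI, rule order_trans[OF sum_abs], rule sum_mono, rule sum_abs)
    also have "\<dots> = (\<Sum>i<j. \<Sum>s\<in>F \<inter> cell T n i. ennreal \<bar>Ka n i (jump f s) - g s\<bar>)"
      by (simp add: sum_ennreal sum_nonneg)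
    also have "\<dots> \<le> (\<Sum>i<j. \<Sum>s\<in>F \<inter> cell T n i. ennreal (jump f s) * h s)"
      using j d by (intro sum_mono) auto
    also have "\<dots> \<le> (\<Sum>i<n. \<Sum>s\<in>F \<inter> cell T n i. ennreal (jump f s) * h s)"
      using j by (intro sum_mono2) auto
    also have "\<dots> = (\<Sum>s\<in>F. ennreal (jump f s) * h s)"
      using F n T by (intro sum_cells) auto
    also have "\<dots> = (\<integral>\<^sup>+s. ennreal (jump f s) * h s * indicator F s \<partial>count_space {0..T})"
      using F by (subst nn_integral_count_space'[of F]) auto
    also have "\<dots> \<le> (\<integral>\<^sup>+s. ennreal (jump f s) * h s \<partial>count_space {0..T})"
      by (intro nn_integral_mono) (auto simp: indicator_def)
    also note z(1)
    finally show ?thesis unfolding eq using z(2) by simp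
  qed
  have third: "\<bar>(\<Sum>s\<in>F'. g s) - infsum g {0..q}\<bar> \<le> \<kappa> * \<eta>"
    unfolding F'_def by (rule infsum_g_near[OF F q])
  show ?thesis using first second third unfolding q_def by linarith
qed

end

section \<open>The Dirichlet process\<close>

context pure_jump_path
begin

text \<open>Jumps after \<open>b\<close> sum to at most \<open>f T - f b\<close>. A finite set that
  misses only e of the total therefore misses at most e of \<open>f b\<close> among the jumps up to
  \<open>b\<close>.\<close>

lemma emeasure_jump_measure_strip:
  assumes b: "0 \<le> b" "b \<le> T"
  shows "emeasure (jump_measure f T) ({..b} \<times> UNIV) = ennreal (f b)"
proof -
  have "emeasure (jump_measure f T) ({..b} \<times> UNIV) = (\<integral>\<^sup>+s. ennreal (jump f s) * indicator ({..b} \<times> UNIV) (s, jump f s) \<partial>count_space {0..T})"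
    by (rule emeasure_jump_measure) (simp add: borel_prod[symmetric])
  also have "\<dots> = (\<integral>\<^sup>+s. ennreal (jump f s) \<partial>count_space {0..b})"
    using b by (subst (1 2) nn_integral_count_space_indicator) (auto intro!: nn_integral_cong simp: indicator_def)
  also have "\<dots> = ennreal (f b)"
  proof (rule antisym)
    show "(\<integral>\<^sup>+s. ennreal (jump f s) \<partial>count_space {0..b}) \<le> ennreal (f b)"
      using nn_integral_jump_le[OF b] by (simp add: f_0)
    show "ennreal (f b) \<le> (\<integral>\<^sup>+s. ennreal (jump f s) \<partial>count_space {0..b})"
    proof (rule ennreal_le_epsilon)
      fix e :: real assume e: "0 < e"
      obtain F where F: "finite F" "F \<subseteq> {0<..T}" "1 - e \<le> sum (jump f) F" using exhaust[OF e] by auto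
      have "sum (jump f) F = sum (jump f) (F \<inter> {0<..b}) + sum (jump f) (F \<inter> {b<..T})"
      proof -
        have "F = (F \<inter> {0<..b}) \<union> (F \<inter> {b<..T})" using F(2) b by auto
        moreover have "sum (jump f) ((F \<inter> {0<..b}) \<union> (F \<inter> {b<..T})) = sum (jump f) (F \<inter> {0<..b}) + sum (jump f) (F \<inter> {b<..T})"
          using F(1) by (intro sum.union_disjoint) auto
        ultimately show ?thesis by simp
      qed
      moreover have "sum (jump f) (F \<inter> {b<..T}) \<le> f T - f b" using F b by (intro sum_jump_le) auto
      ultimately have "f b \<le> sum (jump f) (F \<inter> {0<..b}) + e" using F(3) f_T by linarith
      then have "ennreal (f b) \<le> ennreal (sum (jump f) (F \<inter> {0<..b}) + e)" by (rule ennreal_leI)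
      also have "\<dots> = ennreal (sum (jump f) (F \<inter> {0<..b})) + ennreal e"
        using e b by (intro ennreal_plus sum_nonneg jump_nonneg) auto
      also have "ennreal (sum (jump f) (F \<inter> {0<..b})) = (\<Sum>s\<in>F \<inter> {0<..b}. ennreal (jump f s))"
        using b by (intro sum_ennreal[symmetric] jump_nonneg) auto
      also have "\<dots> = (\<integral>\<^sup>+s. ennreal (jump f s) * indicator (F \<inter> {0<..b}) s \<partial>count_space {0..b})"
        using F by (subst nn_integral_count_space'[of "F \<inter> {0<..b}"]) auto
      also have "\<dots> \<le> (\<integral>\<^sup>+s. ennreal (jump f s) \<partial>count_space {0..b})"
        by (intro nn_integral_mono) (auto simp: indicator_def)
      finally show "ennreal (f b) \<le> (\<integral>\<^sup>+s. ennreal (jump f s) \<partial>count_space {0..b}) + ennreal e"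
        by (simp add: add_right_mono)
    qed
  qed
  finally show ?thesis .
qed

text \<open>A dyadic time of level m0 is a grid point of every finer dyadic grid, with index
  \<open>i0 * 2 ^ (lev p - m0)\<close>, so no cell is cut. The scales \<open>r p\<close> stand for
  the factors left over by the window argument.\<close>

lemma grid_sums_tendsto:
  assumes lev: "\<And>p. p \<le> lev p"
    and h: "\<And>p i s x. i < 2 ^ lev p \<Longrightarrow> s \<in> cell T (2 ^ lev p) i \<Longrightarrow> x \<in> {0..1} \<Longrightarrow>
      ennreal \<bar>average (2 ^ lev p) i x - k s x\<bar> \<le> h p s"
    and Z: "(\<lambda>p. \<integral>\<^sup>+s. ennreal (jump f s) * h p s \<partial>count_space {0..T}) \<longlonglongrightarrow> 0"
    and r: "\<And>p. 1 \<le> r p" "r \<longlonglongrightarrow> 1" and j: "i0 \<le> 2 ^ m0"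
  shows "(\<lambda>p. \<Sum>i<i0 * 2 ^ (lev p - m0). Ka (2 ^ lev p) i (r p * increment f T (2 ^ lev p) i))
    \<longlonglongrightarrow> infsum g {0..T * real i0 / 2 ^ m0}"
proof (rule LIMSEQ_I)
  fix e :: real assume e: "0 < e"
  \<comment> \<open>Each of the three terms with factor \<kappa> in \<open>grid_sum_close\<close>
    then costs at most e / 8, and e / 4 is spent on the averages.\<close>
  define \<eta> where "\<eta> = e / (8 * \<kappa>)"
  have \<eta>: "0 < \<eta>" "\<kappa> * \<eta> = e / 8" using e \<kappa> by (auto simp: \<eta>_def)
  obtain F where F: "finite F" "F \<subseteq> {0<..T}" "1 - \<eta> \<le> sum (jump f) F" using exhaust[OF \<eta>(1)] by auto
  obtain N where N: "0 < N" "\<And>n i p q. N \<le> n \<Longrightarrow> p \<in> F \<inter> cell T n i \<Longrightarrow> q \<in> F \<inter> cell T n i \<Longrightarrow> p = q"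
    using eventually_cell_separates[OF F(1) T] by metis
  have "\<forall>\<^sub>F p in sequentially. (\<integral>\<^sup>+s. ennreal (jump f s) * h p s \<partial>count_space {0..T}) < ennreal (e / 4)"
    using Z e by (intro order_tendstoD(2)[where y = 0]) auto
  moreover have "\<forall>\<^sub>F p in sequentially. r p < 1 + e / (8 * \<kappa>)"
    using e \<kappa> by (intro order_tendstoD(2)[OF r(2)]) auto
  moreover note eventually_ge_at_top[of "max N m0"]
  ultimately have "\<forall>\<^sub>F p in sequentially. norm ((\<Sum>i<i0 * 2 ^ (lev p - m0). Ka (2 ^ lev p) i (r p * increment f T (2 ^ lev p) i))
      - infsum g {0..T * real i0 / 2 ^ m0}) < e"
  proof eventually_elim
    case (elim p)
    have lp: "N \<le> 2 ^ lev p" "m0 \<le> lev p"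
    proof -
      show "m0 \<le> lev p" using elim(3) lev[of p] by simp
      have "N \<le> lev p" using elim(3) lev[of p] by simp
      then show "N \<le> 2 ^ lev p" using less_exp[of "lev p"] by linarith
    qed
    have pow: "(2::nat) ^ lev p = 2 ^ m0 * 2 ^ (lev p - m0)" using lp(2) by (simp add: power_add[symmetric])
    have eq: "T * real (i0 * 2 ^ (lev p - m0)) / real (2 ^ lev p) = T * real i0 / 2 ^ m0"
      unfolding pow by simp
    have "\<bar>(\<Sum>i<i0 * 2 ^ (lev p - m0). Ka (2 ^ lev p) i (r p * increment f T (2 ^ lev p) i))
        - infsum g {0..T * real (i0 * 2 ^ (lev p - m0)) / real (2 ^ lev p)}\<bar> \<le> \<kappa> * (r p - 1 + \<eta>) + e / 4 + \<kappa> * \<eta>"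
    proof (rule grid_sum_close[OF _ _ r(1) h F N(2)[OF lp(1)]])
      show "i0 * 2 ^ (lev p - m0) \<le> 2 ^ lev p" unfolding pow using j by simp
      show "(\<integral>\<^sup>+s. ennreal (jump f s) * h p s \<partial>count_space {0..T}) \<le> ennreal (e / 4)" using elim(1) by simp
    qed (use e in auto)
    also have "\<kappa> * (r p - 1 + \<eta>) + e / 4 + \<kappa> * \<eta> = \<kappa> * (r p - 1) + e / 2" 
      using \<eta>(2) unfolding distrib_left by linarith
    also have "\<kappa> * (r p - 1) \<le> \<kappa> * \<eta>" using elim(2) \<kappa> by (intro mult_left_mono) (auto simp: \<eta>_def)
    finally show ?case using e \<eta>(2) unfolding eq by simp
  qed
  then show "\<exists>no. \<forall>p\<ge>no. norm ((\<Sum>i<i0 * 2 ^ (lev p - m0). Ka (2 ^ lev p) i (r p * increment f T (2 ^ lev p) i))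
      - infsum g {0..T * real i0 / 2 ^ m0}) < e"
    by (simp add: eventually_sequentially)
qed

end

text \<open>Writing the ratio as a * Gamma (a + \<alpha>) / Gamma (a + 1) removes the pole at 0 and
  leaves a continuous quotient on [0, T]. Linearity in \<open>a\<close> is what keeps the sum of the
  \<alpha>-moments over n cells of length T / n bounded.\<close>

lemma Gamma_ratio_bound:
  assumes "0 < T" "0 < \<alpha>"
  obtains C :: real where "\<And>a. 0 < a \<Longrightarrow> a \<le> T \<Longrightarrow> Gamma (a + \<alpha>) / Gamma a \<le> C * a"
proof -
  have "continuous_on {0..T} (\<lambda>a. Gamma (a + \<alpha>) / Gamma (a + 1) :: real)"
  proof (intro continuous_intros)
    have "continuous_on {0..T} (\<lambda>a. Gamma (a + c))" if "0 < c" for c :: real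
    proof (rule continuous_on_compose2[OF continuous_on_Gamma[of "{0<..}"]])
      show "{0<..} \<inter> \<int>\<^sub>\<le>\<^sub>0 = ({} :: real set)" by (force simp: nonpos_Ints_def)
    qed (use that in \<open>auto intro!: continuous_intros\<close>)
    then show "continuous_on {0..T} (\<lambda>a. Gamma (a + \<alpha>))" "continuous_on {0..T} (\<lambda>a. Gamma (a + 1))"
      using assms by auto
    show "\<forall>a\<in>{0..T}. Gamma (a + 1) \<noteq> 0"
    proof
      fix a assume "a \<in> {0..T}"
      then have "0 < Gamma (a + 1)" by (intro Gamma_real_pos) auto
      then show "Gamma (a + 1) \<noteq> 0" by simp
    qed
  qed
  then have "compact ((\<lambda>a. Gamma (a + \<alpha>) / Gamma (a + 1)) ` {0..T})" by (rule compact_continuous_image) simp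
  then obtain C where C: "\<And>a. a \<in> {0..T} \<Longrightarrow> norm (Gamma (a + \<alpha>) / Gamma (a + 1)) \<le> C"
    using compact_imp_bounded[THEN bounded_iff[THEN iffD1]] by fastforce
  show thesis
  proof (rule that[of C])
    fix a assume a: "0 < a" "a \<le> T"
    have "a \<notin> \<int>\<^sub>\<le>\<^sub>0" using a by (force simp: nonpos_Ints_def)
    then have "Gamma (a + 1) = a * Gamma a" by (rule Gamma_plus1)
    moreover have "0 < Gamma a" using a by (intro Gamma_real_pos)
    ultimately have "Gamma (a + \<alpha>) / Gamma a = Gamma (a + \<alpha>) / Gamma (a + 1) * a" using a by simp
    also have "\<dots> \<le> C * a"
    proof (rule mult_right_mono)
      show "Gamma (a + \<alpha>) / Gamma (a + 1) \<le> C" 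
        by (rule order_trans[OF abs_ge_self C[unfolded real_norm_def]]) (use a in auto)
    qed (use a in simp)
    finally show "Gamma (a + \<alpha>) / Gamma a \<le> C * a" .
  qed
qed

section \<open>Increments, variation and mean jump measure of the Dirichlet process\<close>

locale dirichlet_transform = gamma_process M \<gamma> + marked_kernel k T \<kappa> \<alpha>
  for M :: "'a measure" and \<gamma> k T \<kappa> \<alpha>
begin

abbreviation "D \<equiv> dirichlet_process \<gamma> T"

lemma \<gamma>_path: "\<omega> \<in> space M \<Longrightarrow> monotone_path (\<lambda>t. \<gamma> t \<omega>) T"
  by unfold_locales (auto intro!: cadlag_on_subset[OF cadlag_X] mono_on_subset[OF mono_X])

lemma \<gamma>_nonneg: "\<omega> \<in> space M \<Longrightarrow> 0 \<le> t \<Longrightarrow> 0 \<le> \<gamma> t \<omega>"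
  using mono_onD[OF mono_X, of \<omega> 0 t] X_0 by auto

lemma D_path: 
  assumes \<omega>: "\<omega> \<in> space M"
  shows "monotone_path (\<lambda>t. D t \<omega>) T"
proof
  interpret monotone_path "\<lambda>t. \<gamma> t \<omega>" T by (rule \<gamma>_path[OF \<omega>])
  have T0: "0 \<le> \<gamma> T \<omega>" using T by (intro \<gamma>_nonneg \<omega>) simp
  show "mono_on {0..T} (\<lambda>t. D t \<omega>)"
    unfolding dirichlet_process_def using T0 le by (intro mono_onI divide_right_mono) auto
  show "cadlag_on {0..T} (\<lambda>t. D t \<omega>)"
    unfolding cadlag_on_def dirichlet_process_def divide_inverse
  proof (intro ballI conjI)
    fix t assume t: "t \<in> {0..T}"
    show "((\<lambda>t. \<gamma> t \<omega> * inverse (\<gamma> T \<omega>)) \<longlongrightarrow> \<gamma> t \<omega> * inverse (\<gamma> T \<omega>)) (at t within {0..T} \<inter> {t<..})"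
      using cadlag t unfolding cadlag_on_def by (intro tendsto_mult_right) blast
    obtain l where "((\<lambda>t. \<gamma> t \<omega>) \<longlongrightarrow> l) (at t within {0..T} \<inter> {..<t})"
      using cadlag t unfolding cadlag_on_def by blast
    then have "((\<lambda>t. \<gamma> t \<omega> * inverse (\<gamma> T \<omega>)) \<longlongrightarrow> l * inverse (\<gamma> T \<omega>)) (at t within {0..T} \<inter> {..<t})"
      by (rule tendsto_mult_right)
    then show "\<exists>l. ((\<lambda>t. \<gamma> t \<omega> * inverse (\<gamma> T \<omega>)) \<longlongrightarrow> l) (at t within {0..T} \<inter> {..<t})" by blast
  qed
qed

lemma D_0: "\<omega> \<in> space M \<Longrightarrow> D 0 \<omega> = 0"
  by (simp add: dirichlet_process_def X_0)

lemma D_T: "\<gamma> T \<omega> \<noteq> 0 \<Longrightarrow> D T \<omega> = 1"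
  by (simp add: dirichlet_process_def)

lemma measurable_D: "0 \<le> t \<Longrightarrow> D t \<in> borel_measurable M"
  using random_variable_X[of t] random_variable_X[of T] T
  unfolding dirichlet_process_def[abs_def] by (intro borel_measurable_divide) auto

sublocale D: monotone_process M D T
  using T by (intro monotone_process.intro D_path measurable_D) (auto simp: D_0 dirichlet_process_def[of \<gamma> T T])

lemma law_\<gamma>: 
  assumes "0 < h"
  shows "distr M borel (\<gamma> h) = gamma_measure h"
proof -
  have "distr M lborel (\<gamma> h) = gamma_measure h"
    using distributed_distr_eq_density[OF gamma_distributed[OF assms]]
    by (simp add: gamma_measure_def gamma_density_def[abs_def])
  moreover have "distr M borel (\<gamma> h) = distr M lborel (\<gamma> h)" by (rule distr_cong) auto
  ultimately show ?thesis by simp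
qed

lemma law_increment:
  assumes "0 \<le> s" "s < t"
  shows "distr M borel (\<lambda>\<omega>. \<gamma> t \<omega> - \<gamma> s \<omega>) = gamma_measure (t - s)"
  using stationary_increments[of s "t - s"] law_\<gamma>[of "t - s"] assms by simp

lemma law_increments:
  assumes t0: "0 \<le> t 0" and step: "\<And>i. i < n \<Longrightarrow> t i < t (Suc i)" and n: "0 < n"
  shows "distr M (PiM {..<n} (\<lambda>_. borel)) (\<lambda>\<omega>. \<lambda>i\<in>{..<n}. \<gamma> (t (Suc i)) \<omega> - \<gamma> (t i) \<omega>)
    = PiM {..<n} (\<lambda>i. gamma_measure (t (Suc i) - t i))"
proof -
  have mono: "t i \<le> t j" if "i \<le> j" "j \<le> n" for i j
    using that
  proof (induction j rule: dec_induct)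
    case (step j)
    then have "t j < t (Suc j)" by (intro assms(2)) simp
    then show ?case using step by simp
  qed simp
  have nonneg: "0 \<le> t i" if "i \<le> n" for i using mono[of 0 i] t0 that by simp
  have rv: "(\<lambda>\<omega>. \<gamma> (t (Suc i)) \<omega> - \<gamma> (t i) \<omega>) \<in> borel_measurable M" if "i < n" for i
    using that by (intro borel_measurable_diff random_variable_X nonneg) auto
  have "indep_vars (\<lambda>_. borel) (\<lambda>i \<omega>. \<gamma> (t (Suc i)) \<omega> - \<gamma> (t i) \<omega>) {..<n}"
    using mono by (intro independent_increments t0 mono_onI) auto
  then have "distr M (PiM {..<n} (\<lambda>_. borel)) (\<lambda>\<omega>. \<lambda>i\<in>{..<n}. \<gamma> (t (Suc i)) \<omega> - \<gamma> (t i) \<omega>)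
      = PiM {..<n} (\<lambda>i. distr M borel (\<lambda>\<omega>. \<gamma> (t (Suc i)) \<omega> - \<gamma> (t i) \<omega>))"
    using n rv by (subst (asm) indep_vars_iff_distr_eq_PiM') auto
  also have "\<dots> = PiM {..<n} (\<lambda>i. gamma_measure (t (Suc i) - t i))"
    using nonneg step by (intro PiM_cong refl law_increment) auto
  finally show ?thesis .
qed

lemma AE_\<gamma>_pos: "AE \<omega> in M. 0 < \<gamma> T \<omega>"
proof (rule AE_distrD[where f = "\<gamma> T"])
  show "\<gamma> T \<in> measurable M borel" using T by (intro random_variable_X) simp
  show "AE x in distr M borel (\<gamma> T). 0 < x" unfolding law_\<gamma>[OF T] by (rule AE_gamma_measure_pos)
qed

text \<open>For the two cells cut at \<open>b\<close>, the polar decomposition splits \<gamma> b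
  into \<open>D b\<close> and an independent factor distributed as \<gamma> T. Means multiply, so b
  equals T times the mean of \<open>D b\<close>.\<close>

lemma nn_integral_D:
  assumes b: "0 \<le> b" "b \<le> T"
  shows "(\<integral>\<^sup>+\<omega>. ennreal (D b \<omega>) \<partial>M) = ennreal (b / T)"
proof (cases "b = 0 \<or> b = T")
  case True
  have "(\<integral>\<^sup>+\<omega>. ennreal (D b \<omega>) \<partial>M) = (\<integral>\<^sup>+\<omega>. ennreal (b / T) \<partial>M)"
  proof (rule nn_integral_cong_AE, use AE_\<gamma>_pos AE_space in eventually_elim)
    case (elim \<omega>)
    then show ?case using True T D_0 D_T[of \<omega>] by auto
  qed
  then show ?thesis by (simp add: emeasure_space_1)
next
  case False
  then have b: "0 < b" "b < T" using b by auto
  define a where "a i = (if i = (0::nat) then b else T - b)" for i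
  define t where "t i = (if i = (0::nat) then 0 else if i = 1 then b else T)" for i
  have two: "{..<2} = {0, 1::nat}" by auto
  interpret g: gamma_product "{..<2::nat}" a
    by unfold_locales (use b two in \<open>auto simp: a_def\<close>)
  have sum_a: "sum a {..<2} = T" by (simp add: two a_def)
  define X where "X \<omega> = (\<lambda>i\<in>{..<2}. \<gamma> (t (Suc i)) \<omega> - \<gamma> (t i) \<omega>)" for \<omega>
  have law: "distr M g.B X = g.G"
  proof -
    have "distr M g.B X = PiM {..<2} (\<lambda>i. gamma_measure (t (Suc i) - t i))"
      unfolding X_def using b by (intro law_increments) (auto simp: t_def)
    also have "\<dots> = g.G" unfolding g.G_def by (intro PiM_cong refl arg_cong[where f = gamma_measure]) (auto simp: t_def a_def two)
    finally show ?thesis .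
  qed
  have X [measurable]: "X \<in> measurable M g.B"
    unfolding X_def using b by (intro measurable_restrict borel_measurable_diff random_variable_X) (auto simp: t_def)
  define e where "e = (\<integral>\<^sup>+x. ennreal (g.normalise x 0) \<partial>g.G)"
  have [measurable]: "(\<lambda>x. x 0) \<in> borel_measurable g.B" by (rule measurable_component_singleton) simp
  have [measurable]: "(\<lambda>x. g.normalise x 0) \<in> borel_measurable g.B"
    by (rule measurable_compose[OF g.measurable_normalise measurable_component_singleton]) simp
  have "ennreal b = (\<integral>\<^sup>+x. ennreal (x powr 1) \<partial>gamma_measure b)"
  proof -
    have "b \<notin> \<int>\<^sub>\<le>\<^sub>0" using b by (force simp: nonpos_Ints_def)
    then have "Gamma (b + 1) = b * Gamma b" by (rule Gamma_plus1)
    moreover have "0 < Gamma b" using b by (intro Gamma_real_pos)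
    ultimately have "Gamma (b + 1) / Gamma b = b" by simp
    then show ?thesis using b by (simp only: gamma_moment zero_less_one)
  qed
  also have "\<dots> = (\<integral>\<^sup>+x. ennreal x \<partial>gamma_measure b)"
    by (rule nn_integral_cong_AE, use AE_gamma_measure_pos in eventually_elim) simp
  also have "\<dots> = (\<integral>\<^sup>+\<omega>. ennreal (\<gamma> b \<omega>) \<partial>M)"
    unfolding law_\<gamma>[OF b(1), symmetric] using b by (intro nn_integral_distr random_variable_X) auto
  also have "\<dots> = (\<integral>\<^sup>+\<omega>. ennreal (X \<omega> 0) \<partial>M)"
    by (intro nn_integral_cong) (simp add: X_def t_def X_0)
  also have "\<dots> = (\<integral>\<^sup>+x. ennreal (x 0) \<partial>g.G)" unfolding law[symmetric] by (rule nn_integral_distr[symmetric]) measurable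
  also have "\<dots> = (\<integral>\<^sup>+x. \<integral>\<^sup>+u. ennreal (g.scale u (g.normalise x) 0) \<partial>gamma_measure (sum a {..<2}) \<partial>g.G)"
    by (intro g.nn_integral_polar) measurable
  also have "\<dots> = (\<integral>\<^sup>+x. ennreal (g.normalise x 0) * ennreal T \<partial>g.G)"
  proof (rule nn_integral_cong_AE, use g.AE_pos in eventually_elim)
    case (elim x)
    have n0: "0 < g.normalise x 0" using g.normalise_pos[OF elim] by simp
    have "(\<integral>\<^sup>+u. ennreal (g.scale u (g.normalise x) 0) \<partial>gamma_measure (sum a {..<2}))
        = (\<integral>\<^sup>+u. ennreal (g.normalise x 0) * ennreal (u powr 1) \<partial>gamma_measure T)"
      unfolding sum_a
    proof (rule nn_integral_cong_AE, use AE_gamma_measure_pos in eventually_elim)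
      case (elim u)
      then show ?case using n0 by (simp add: g.scale_def ennreal_mult mult.commute)
    qed
    also have "\<dots> = ennreal (g.normalise x 0) * (\<integral>\<^sup>+u. ennreal (u powr 1) \<partial>gamma_measure T)"
      by (rule nn_integral_cmult) (subst measurable_cong_sets[OF sets_gamma_measure refl], simp)
    also have "(\<integral>\<^sup>+u. ennreal (u powr 1) \<partial>gamma_measure T) = ennreal (Gamma (T + 1) / Gamma T)"
      by (rule gamma_moment) (use T in auto)
    also have "Gamma (T + 1) / Gamma T = T"
    proof -
      have "T \<notin> \<int>\<^sub>\<le>\<^sub>0" using T by (force simp: nonpos_Ints_def)
      then have "Gamma (T + 1) = T * Gamma T" by (rule Gamma_plus1)
      moreover have "0 < Gamma T" using T by (intro Gamma_real_pos)
      ultimately show ?thesis by simp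
    qed
    finally show ?case .
  qed
  also have "\<dots> = e * ennreal T" unfolding e_def by (intro nn_integral_multc) measurable
  finally have be: "ennreal b = e * ennreal T" .
  have "e = (\<integral>\<^sup>+\<omega>. ennreal (g.normalise (X \<omega>) 0) \<partial>M)"
    unfolding e_def law[symmetric] by (rule nn_integral_distr) measurable
  also have "\<dots> = (\<integral>\<^sup>+\<omega>. ennreal (D b \<omega>) \<partial>M)"
  proof (rule nn_integral_cong)
    fix \<omega> assume \<omega>: "\<omega> \<in> space M"
    have "X \<omega> 0 = \<gamma> b \<omega>" "X \<omega> 1 = \<gamma> T \<omega> - \<gamma> b \<omega>" using X_0[OF \<omega>] by (simp_all add: X_def t_def)
    moreover have "g.tot (X \<omega>) = X \<omega> 0 + X \<omega> 1" unfolding g.tot_def by (simp add: two)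
    ultimately show "ennreal (g.normalise (X \<omega>) 0) = ennreal (D b \<omega>)"
      by (simp add: g.normalise_def dirichlet_process_def)
  qed
  finally have "ennreal b = (\<integral>\<^sup>+\<omega>. ennreal (D b \<omega>) \<partial>M) * ennreal T" using be by simp
  then have "ennreal b * ennreal (1 / T) = (\<integral>\<^sup>+\<omega>. ennreal (D b \<omega>) \<partial>M) * (ennreal T * ennreal (1 / T))" by (simp add: mult_ac)
  then show ?thesis using T b by (simp add: ennreal_mult[symmetric])
qed

definition V\<^sub>D :: "'a \<Rightarrow> nat \<Rightarrow> real" where
  "V\<^sub>D \<omega> n = (\<Sum>i<n. increment (\<lambda>t. D t \<omega>) T n i powr \<alpha>)"

lemma increment_D: "increment (\<lambda>t. D t \<omega>) T n i = increment (\<lambda>t. \<gamma> t \<omega>) T n i / \<gamma> T \<omega>"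
  by (simp add: increment_def dirichlet_process_def diff_divide_distrib)

text \<open>Expectations are taken for \<gamma>, whose increments have explicit moments. Passing to
  \<open>D\<close> divides the sums by \<open>\<gamma> T \<omega> powr \<alpha>\<close>, which is
  positive for almost every path. Refinement increases the sums by subadditivity of the
  power.\<close>

lemma AE_variation_bounded: "AE \<omega> in M. \<exists>R :: nat. \<forall>m. V\<^sub>D \<omega> (2 ^ m) \<le> real R"
proof -
  define W where "W m \<omega> = (\<Sum>i<2 ^ m. increment (\<lambda>t. \<gamma> t \<omega>) T (2 ^ m) i powr \<alpha>)" for m \<omega>
  have grid: "0 \<le> T * real i / real n" "T * real i / real n < T * real (Suc i) / real n"
    "T * real (Suc i) / real n - T * real i / real n = T / real n" if "0 < n" for i n
    using T that by (auto simp: divide_strict_right_mono diff_divide_distrib[symmetric] right_diff_distrib[symmetric])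
  have inc_meas: "(\<lambda>\<omega>. increment (\<lambda>t. \<gamma> t \<omega>) T n i) \<in> borel_measurable M" if "0 < n" for n i
    unfolding increment_def using grid(1)[OF that, of i] grid(1)[OF that, of "Suc i"]
    by (intro borel_measurable_diff random_variable_X) auto
  have W_meas: "W m \<in> borel_measurable M" for m
  proof -
    have [measurable]: "(\<lambda>\<omega>. increment (\<lambda>t. \<gamma> t \<omega>) T (2 ^ m) i) \<in> borel_measurable M" for i by (rule inc_meas) simp
    show ?thesis unfolding W_def[abs_def] by measurable
  qed
  have W_mono: "W m \<omega> \<le> W (Suc m) \<omega>" if \<omega>: "\<omega> \<in> space M" for m \<omega>
  proof -
    interpret monotone_path "\<lambda>t. \<gamma> t \<omega>" T by (rule \<gamma>_path[OF \<omega>])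
    let ?i = "increment (\<lambda>t. \<gamma> t \<omega>) T"
    have split: "?i (2 ^ m) i = ?i (2 ^ Suc m) (i * 2) + ?i (2 ^ Suc m) (Suc (i * 2))" for i
    proof -
      have "T * real (i * 2) / real (2 ^ Suc m) = T * real i / real (2 ^ m)"
        "T * real (Suc (Suc (i * 2))) / real (2 ^ Suc m) = T * real (Suc i) / real (2 ^ m)"
        by (simp_all add: field_simps)
      then show ?thesis unfolding increment_def by simp
    qed
    have "W m \<omega> \<le> (\<Sum>i<2 ^ m. ?i (2 ^ Suc m) (i * 2) powr \<alpha> + ?i (2 ^ Suc m) (Suc (i * 2)) powr \<alpha>)"
      unfolding W_def split using \<alpha> T
      by (intro sum_mono powr_add_le increment_nonneg) auto
    also have "\<dots> = (\<Sum>i<2 ^ m. sum (\<lambda>l. ?i (2 ^ Suc m) l powr \<alpha>) {i * 2..<i * 2 + 2})"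
      by (intro sum.cong refl) (simp add: numeral_2_eq_2)
    also have "\<dots> = (\<Sum>l<2 ^ m * 2. ?i (2 ^ Suc m) l powr \<alpha>)" by (rule sum.nat_group)
    also have "\<dots> = W (Suc m) \<omega>" unfolding W_def by (simp add: mult.commute)
    finally show ?thesis .
  qed
  obtain C where C: "\<And>a. 0 < a \<Longrightarrow> a \<le> T \<Longrightarrow> Gamma (a + \<alpha>) / Gamma a \<le> C * a"
    using Gamma_ratio_bound[OF T \<alpha>(1)] by metis
  have W_int: "(\<integral>\<^sup>+\<omega>. ennreal (W m \<omega>) \<partial>M) \<le> ennreal (C * T)" for m
  proof -
    define n where "n = (2::nat) ^ m"
    have n: "0 < n" by (simp add: n_def)
    have one: "(\<integral>\<^sup>+\<omega>. ennreal (increment (\<lambda>t. \<gamma> t \<omega>) T n i powr \<alpha>) \<partial>M) = ennreal (Gamma (T / real n + \<alpha>) / Gamma (T / real n))" for i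
    proof -
      have "(\<integral>\<^sup>+\<omega>. ennreal (increment (\<lambda>t. \<gamma> t \<omega>) T n i powr \<alpha>) \<partial>M)
          = (\<integral>\<^sup>+x. ennreal (x powr \<alpha>) \<partial>distr M borel (\<lambda>\<omega>. increment (\<lambda>t. \<gamma> t \<omega>) T n i))"
        using inc_meas[OF n] by (intro nn_integral_distr[symmetric]) auto
      also have "distr M borel (\<lambda>\<omega>. increment (\<lambda>t. \<gamma> t \<omega>) T n i) = gamma_measure (T / real n)"
        unfolding increment_def by (subst law_increment[OF grid(1,2)[OF n]]) (simp only: grid(3)[OF n])
      also have "(\<integral>\<^sup>+x. ennreal (x powr \<alpha>) \<partial>gamma_measure (T / real n)) = ennreal (Gamma (T / real n + \<alpha>) / Gamma (T / real n))"
        using T n \<alpha> by (intro gamma_moment) auto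
      finally show ?thesis .
    qed
    have "(\<integral>\<^sup>+\<omega>. ennreal (W m \<omega>) \<partial>M) = (\<integral>\<^sup>+\<omega>. (\<Sum>i<n. ennreal (increment (\<lambda>t. \<gamma> t \<omega>) T n i powr \<alpha>)) \<partial>M)"
      unfolding W_def n_def by (intro nn_integral_cong sum_ennreal[symmetric]) auto
    also have "\<dots> = (\<Sum>i<n. \<integral>\<^sup>+\<omega>. ennreal (increment (\<lambda>t. \<gamma> t \<omega>) T n i powr \<alpha>) \<partial>M)"
    proof -
      note [measurable] = inc_meas[OF n]
      show ?thesis by (intro nn_integral_sum) measurable
    qed
    also have "\<dots> = (\<Sum>i<n. ennreal (Gamma (T / real n + \<alpha>) / Gamma (T / real n)))" by (simp only: one)
    also have "\<dots> \<le> (\<Sum>i<n. ennreal (C * (T / real n)))"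
      using T n by (intro sum_mono ennreal_leI C) (auto simp: divide_le_eq)
    also have "\<dots> = ennreal (C * T)"
    proof -
      have "0 \<le> C"
      proof -
        have "0 < Gamma (T + \<alpha>) / Gamma T" using T \<alpha> by (intro divide_pos_pos Gamma_real_pos) auto
        then have "0 < C * T" using C[OF T order_refl] by linarith
        then show ?thesis using T by (simp add: zero_less_mult_iff)
      qed
      then have "(\<Sum>i<n. ennreal (C * (T / real n))) = ennreal (\<Sum>i<n. C * (T / real n))" using T by (intro sum_ennreal) auto
      then show ?thesis using n by simp
    qed
    finally show ?thesis .
  qed
  have "(\<integral>\<^sup>+\<omega>. (\<Squnion>m. ennreal (W m \<omega>)) \<partial>M) = (\<Squnion>m. \<integral>\<^sup>+\<omega>. ennreal (W m \<omega>) \<partial>M)"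
    using W_mono W_meas by (intro nn_integral_monotone_convergence_SUP_AE) (auto intro: ennreal_leI)
  also have "\<dots> \<le> ennreal (C * T)" by (intro SUP_least W_int)
  finally have "(\<integral>\<^sup>+\<omega>. (\<Squnion>m. ennreal (W m \<omega>)) \<partial>M) \<noteq> \<infinity>" by (auto simp: top_unique)
  then have "AE \<omega> in M. (\<Squnion>m. ennreal (W m \<omega>)) \<noteq> \<infinity>"
    using W_meas by (intro nn_integral_PInf_AE borel_measurable_SUP) auto
  then show ?thesis using AE_\<gamma>_pos AE_space
  proof eventually_elim
    case (elim \<omega>)
    interpret monotone_path "\<lambda>t. \<gamma> t \<omega>" T by (rule \<gamma>_path[OF elim(3)])
    obtain c where c: "(\<Squnion>m. ennreal (W m \<omega>)) = ennreal c" "0 \<le> c" using elim(1) by (cases "\<Squnion>m. ennreal (W m \<omega>)") auto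
    have W_le: "W m \<omega> \<le> c" for m
    proof -
      have "ennreal (W m \<omega>) \<le> ennreal c" unfolding c(1)[symmetric] by (rule SUP_upper) simp
      then show ?thesis using c(2) by simp
    qed
    obtain R :: nat where R: "c / \<gamma> T \<omega> powr \<alpha> \<le> real R" using real_arch_simple by blast
    have "V\<^sub>D \<omega> (2 ^ m) \<le> real R" for m
    proof -
      have "V\<^sub>D \<omega> (2 ^ m) = W m \<omega> / \<gamma> T \<omega> powr \<alpha>"
        unfolding V\<^sub>D_def W_def increment_D sum_divide_distrib
        by (intro sum.cong refl powr_divide)
      also have "\<dots> \<le> c / \<gamma> T \<omega> powr \<alpha>" using W_le by (intro divide_right_mono) auto
      finally show ?thesis using R by simp
    qed
    then show ?case by blast
  qed
qed

lemma AE_pure_jump: "AE \<omega> in M. pure_jump_path (\<lambda>t. D t \<omega>) T k \<kappa> \<alpha>"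
  using AE_variation_bounded AE_\<gamma>_pos AE_space
proof eventually_elim
  case (elim \<omega>)
  interpret D: monotone_path "\<lambda>t. D t \<omega>" T by (rule D_path[OF elim(3)])
  obtain R :: nat where R: "\<And>m. V\<^sub>D \<omega> (2 ^ m) \<le> real R" using elim(1) by blast
  show ?case
  proof
    show "D 0 \<omega> = 0" "D T \<omega> = 1" using D_0 D_T elim by auto
    fix \<eta> :: real assume "0 < \<eta>"
    from D.sum_jump_exhausts[OF T \<alpha> R[unfolded V\<^sub>D_def] this]
    obtain F where "finite F" "F \<subseteq> {0<..T}" "D T \<omega> - D 0 \<omega> - \<eta> \<le> sum (jump (\<lambda>t. D t \<omega>)) F" by metis
    then show "\<exists>F. finite F \<and> F \<subseteq> {0<..T} \<and> 1 - \<eta> \<le> sum (jump (\<lambda>t. D t \<omega>)) F"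
      using D_0 D_T elim by auto
  qed
qed

text \<open>Averaging \<open>jump_measure\<close> over the sample space and projecting to time gives
  a probability measure whose distribution function at \<open>b\<close> is the mean of
  \<open>D b\<close>, that is b / T. Hence it is the uniform law. Pure jump paths are needed for the
  strip of times up to \<open>b\<close> to carry the mass \<open>D b\<close>.\<close>

lemma nn_integral_compensation:
  assumes h [measurable]: "h \<in> borel_measurable borel"
  shows "(\<integral>\<^sup>+\<omega>. \<integral>\<^sup>+s. ennreal (jump (\<lambda>t. D t \<omega>) s) * h s \<partial>count_space {0..T} \<partial>M)
    = ennreal (1 / T) * (\<integral>\<^sup>+s. h s * indicator {0<..T} s \<partial>lborel)"
proof -
  define J where "J \<omega> = jump_measure (\<lambda>t. D t \<omega>) T" for \<omega>
  have J [measurable]: "J \<in> measurable M (subprob_algebra borel)" unfolding J_def by (rule D.measurable_jump_measure)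
  define \<nu> where "\<nu> = distr (M \<bind> J) borel fst"
  have sb: "sets (M \<bind> J) = sets borel" by (rule sets_bind) (auto simp: J_def not_empty)
  have fst_meas [measurable]: "fst \<in> measurable (M \<bind> J) (borel :: real measure)"
    using measurable_fst[of "borel :: real measure" "borel :: real measure"]
    unfolding measurable_cong_sets[OF sb refl] borel_prod .
  have \<nu>_em: "emeasure \<nu> A = (\<integral>\<^sup>+\<omega>. emeasure (J \<omega>) (A \<times> UNIV) \<partial>M)" if A: "A \<in> sets borel" for A
  proof -
    have AU: "A \<times> UNIV \<in> sets (borel :: (real \<times> real) measure)" using A by (simp add: borel_prod[symmetric])
    have "emeasure \<nu> A = emeasure (M \<bind> J) (A \<times> UNIV)"
    proof -
      have "fst -` A \<inter> space (M \<bind> J) = A \<times> UNIV" using sets_eq_imp_space_eq[OF sb] by auto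
      then show ?thesis unfolding \<nu>_def using A by (subst emeasure_distr) auto
    qed
    also have "\<dots> = (\<integral>\<^sup>+\<omega>. emeasure (J \<omega>) (A \<times> UNIV) \<partial>M)" by (rule emeasure_bind[OF not_empty J AU])
    finally show ?thesis .
  qed
  have strip: "emeasure \<nu> {..b} = ennreal (b / T)" if b: "0 \<le> b" "b \<le> T" for b
  proof -
    have "emeasure \<nu> {..b} = (\<integral>\<^sup>+\<omega>. ennreal (D b \<omega>) \<partial>M)"
      unfolding \<nu>_em[OF atMost_borel]
    proof (rule nn_integral_cong_AE, use AE_pure_jump in eventually_elim)
      case (elim \<omega>)
      show ?case unfolding J_def by (rule pure_jump_path.emeasure_jump_measure_strip[OF elim b])
    qed
    then show ?thesis by (simp add: nn_integral_D[OF b])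
  qed
  have neg: "emeasure \<nu> {..b} = 0" if b: "b < 0" for b
  proof -
    have "emeasure \<nu> {..b} \<le> emeasure \<nu> {..0}" using b by (intro emeasure_mono) (auto simp: \<nu>_def)
    also have "\<dots> = 0" using strip[of 0] T by simp
    finally show ?thesis by simp
  qed
  have big: "emeasure \<nu> A = 1" if A: "{..T} \<subseteq> A" "A \<in> sets borel" for A
  proof (rule antisym)
    have "emeasure (J \<omega>) (A \<times> UNIV) \<le> 1" if "\<omega> \<in> space M" for \<omega>
      using subprob_space.subprob_emeasure_le_1 measurable_space[OF J that] by (auto simp: space_subprob_algebra)
    then have "emeasure \<nu> A \<le> (\<integral>\<^sup>+\<omega>. 1 \<partial>M)" unfolding \<nu>_em[OF A(2)] by (intro nn_integral_mono) auto
    then show "emeasure \<nu> A \<le> 1" by (simp add: emeasure_space_1)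
    have "emeasure \<nu> {..T} \<le> emeasure \<nu> A" using A by (intro emeasure_mono) (auto simp: \<nu>_def)
    then show "1 \<le> emeasure \<nu> A" using strip[of T] T by simp
  qed
  have \<nu>_real: "real_distribution \<nu>"
  proof (intro real_distribution.intro prob_spaceI)
    show "emeasure \<nu> (space \<nu>) = 1" using big[of UNIV] by (simp add: \<nu>_def)
    show "real_distribution_axioms \<nu>" by (simp add: real_distribution_axioms_def \<nu>_def)
  qed
  define U where "U = uniform_measure lborel {0<..T}"
  have U_real: "real_distribution U"
  proof (intro real_distribution.intro)
    show "prob_space U" unfolding U_def using T by (intro prob_space_uniform_measure) auto
    show "real_distribution_axioms U" by (simp add: real_distribution_axioms_def U_def)
  qed
  have "cdf \<nu> = cdf U"
  proof
    fix b
    have U_em: "emeasure U {..b} = emeasure lborel ({0<..T} \<inter> {..b}) / ennreal T"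
      unfolding U_def using T by (subst emeasure_uniform_measure) auto
    consider "b < 0" | "0 \<le> b" "b \<le> T" | "T < b" by linarith
    then have "emeasure \<nu> {..b} = emeasure U {..b}"
    proof cases
      case 1
      then have "{0<..T} \<inter> {..b} = {}" by auto
      then show ?thesis using neg[OF 1] by (simp add: U_em)
    next
      case 2
      then have "{0<..T} \<inter> {..b} = {0<..b}" by auto
      then show ?thesis using strip[OF 2] 2 T by (simp add: U_em divide_ennreal)
    next
      case 3
      then have "{0<..T} \<inter> {..b} = {0<..T}" by auto
      then show ?thesis using big[of "{..b}"] 3 T by (simp add: U_em divide_ennreal)
    qed
    then show "cdf \<nu> b = cdf U b" by (simp add: cdf_def measure_def)
  qed
  then have \<nu>U: "\<nu> = U" by (rule cdf_unique[OF \<nu>_real U_real])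
  have h2 [measurable]: "(\<lambda>p. h (fst p)) \<in> borel_measurable (borel :: (real \<times> real) measure)"
    by (simp add: borel_prod[symmetric])
  have "(\<integral>\<^sup>+\<omega>. \<integral>\<^sup>+s. ennreal (jump (\<lambda>t. D t \<omega>) s) * h s \<partial>count_space {0..T} \<partial>M)
      = (\<integral>\<^sup>+\<omega>. \<integral>\<^sup>+p. h (fst p) \<partial>J \<omega> \<partial>M)"
    unfolding J_def by (subst nn_integral_jump_measure) auto
  also have "\<dots> = (\<integral>\<^sup>+p. h (fst p) \<partial>(M \<bind> J))" by (rule nn_integral_bind[OF h2 J, symmetric])
  also have "\<dots> = (\<integral>\<^sup>+s. h s \<partial>\<nu>)" unfolding \<nu>_def by (rule nn_integral_distr[symmetric]) measurable
  also have "\<dots> = (\<integral>\<^sup>+s. h s * indicator {0<..T} s \<partial>lborel) / ennreal T"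
    unfolding \<nu>U U_def using T by (subst nn_integral_uniform_measure) auto
  also have "\<dots> = ennreal (1 / T) * (\<integral>\<^sup>+s. h s * indicator {0<..T} s \<partial>lborel)"
    using T by (simp add: divide_ennreal_def inverse_ennreal mult.commute divide_inverse)
  finally show ?thesis .
qed

text \<open>The majorants are chosen with integrals at most 2 to the power - p. By
  \<open>nn_integral_compensation\<close> the mean errors along the jumps are then summable in p, so
  the errors tend to 0 almost surely and not just in mean. The condition
  \<open>p \<le> lev p\<close> lets every dyadic time lie on all late grids.\<close>

lemma approximating_levels:
  obtains lev :: "nat \<Rightarrow> nat" and h :: "nat \<Rightarrow> real \<Rightarrow> ennreal"
  where "\<And>p. p \<le> lev p"
    "\<And>p i s x. i < 2 ^ lev p \<Longrightarrow> s \<in> cell T (2 ^ lev p) i \<Longrightarrow> x \<in> {0..1} \<Longrightarrow>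
      ennreal \<bar>average (2 ^ lev p) i x - k s x\<bar> \<le> h p s"
    "AE \<omega> in M. (\<lambda>p. \<integral>\<^sup>+s. ennreal (jump (\<lambda>t. D t \<omega>) s) * h p s \<partial>count_space {0..T}) \<longlonglongrightarrow> 0"
proof -
  define Q where "Q p l h \<longleftrightarrow> p \<le> l \<and> h \<in> borel_measurable borel \<and>
    (\<forall>i<2 ^ l. \<forall>s\<in>cell T (2 ^ l) i. \<forall>x\<in>{0..1}. ennreal \<bar>average (2 ^ l) i x - k s x\<bar> \<le> h s) \<and>
    (\<integral>\<^sup>+s. h s * indicator {0<..T} s \<partial>lborel) \<le> ennreal ((1 / 2) ^ p)" for p l :: nat and h
  have "\<exists>l h. Q p l h" for p
  proof -
    obtain N where N: "\<And>n. N \<le> n \<Longrightarrow> 0 < n \<and> (\<exists>h\<in>borel_measurable borel.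
      (\<forall>i<n. \<forall>s\<in>cell T n i. \<forall>x\<in>{0..1}. ennreal \<bar>average n i x - k s x\<bar> \<le> h s) \<and>
      (\<integral>\<^sup>+s. h s * indicator {0<..T} s \<partial>lborel) \<le> ennreal ((1 / 2) ^ p))"
      using average_approximates[of "(1 / 2) ^ p"] by auto
    have "N \<le> 2 ^ max p N" using less_exp[of "max p N"] by linarith
    from N[OF this] show ?thesis unfolding Q_def by (intro exI[of _ "max p N"]) auto
  qed
  then obtain lev where "\<And>p. \<exists>h. Q p (lev p) h" by metis
  then obtain h where "\<And>p. Q p (lev p) (h p)" by metis
  then have lev: "\<And>p. p \<le> lev p" and h_meas: "\<And>p. h p \<in> borel_measurable borel"
    and h: "\<And>p. \<forall>i<2 ^ lev p. \<forall>s\<in>cell T (2 ^ lev p) i. \<forall>x\<in>{0..1}. ennreal \<bar>average (2 ^ lev p) i x - k s x\<bar> \<le> h p s"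
    and h_int: "\<And>p. (\<integral>\<^sup>+s. h p s * indicator {0<..T} s \<partial>lborel) \<le> ennreal ((1 / 2) ^ p)"
    unfolding Q_def by blast+
  define Z where "Z p \<omega> = (\<integral>\<^sup>+s. ennreal (jump (\<lambda>t. D t \<omega>) s) * h p s \<partial>count_space {0..T})" for p \<omega>
  have Z_meas: "Z p \<in> borel_measurable M" for p
  proof -
    have "(\<lambda>(s, x :: real). h p s) \<in> borel_measurable (borel :: (real \<times> real) measure)"
      unfolding borel_prod[symmetric] case_prod_beta by (rule measurable_compose[OF measurable_fst h_meas])
    then show ?thesis unfolding Z_def[abs_def] by (rule D.measurable_nn_integral_jumps)
  qed
  have Z_int: "(\<integral>\<^sup>+\<omega>. Z p \<omega> \<partial>M) \<le> ennreal (1 / T * (1 / 2) ^ p)" for p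
  proof -
    have "(\<integral>\<^sup>+\<omega>. Z p \<omega> \<partial>M) \<le> ennreal (1 / T) * ennreal ((1 / 2) ^ p)"
      unfolding Z_def nn_integral_compensation[OF h_meas] by (intro mult_left_mono h_int) auto
    also have "ennreal (1 / T) * ennreal ((1 / 2) ^ p) = ennreal (1 / T * (1 / 2) ^ p)"
      by (rule ennreal_mult[symmetric]) (use T in auto)
    finally show ?thesis .
  qed
  have sm: "summable (\<lambda>p. 1 / T * (1 / 2 :: real) ^ p)" by (intro summable_mult summable_geometric) simp
  have "(\<integral>\<^sup>+\<omega>. (\<Sum>p. Z p \<omega>) \<partial>M) = (\<Sum>p. \<integral>\<^sup>+\<omega>. Z p \<omega> \<partial>M)" by (intro nn_integral_suminf Z_meas)
  also have "\<dots> \<le> (\<Sum>p. ennreal (1 / T * (1 / 2) ^ p))" by (intro suminf_le Z_int) auto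
  also have "\<dots> = ennreal (\<Sum>p. 1 / T * (1 / 2) ^ p)" using T by (intro suminf_ennreal2 sm) auto
  finally have "(\<integral>\<^sup>+\<omega>. (\<Sum>p. Z p \<omega>) \<partial>M) \<noteq> \<infinity>" by (auto simp: top_unique)
  then have "AE \<omega> in M. (\<Sum>p. Z p \<omega>) \<noteq> \<infinity>"
    using Z_meas by (intro nn_integral_PInf_AE borel_measurable_suminf) auto
  then have "AE \<omega> in M. (\<lambda>p. Z p \<omega>) \<longlonglongrightarrow> 0"
  proof eventually_elim
    case (elim \<omega>)
    have fin: "Z p \<omega> \<noteq> \<infinity>" for p
    proof -
      have "(\<Sum>l\<in>{p}. Z l \<omega>) \<le> (\<Sum>p. Z p \<omega>)" by (intro sum_le_suminf) auto
      then show ?thesis using elim by (auto simp: top_unique)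
    qed
    define y where "y p = enn2real (Z p \<omega>)" for p
    have y: "Z p \<omega> = ennreal (y p)" "0 \<le> y p" for p using fin[of p] by (auto simp: y_def less_top)
    have "summable y" using elim y by (intro summable_suminf_not_top) auto
    then have "(\<lambda>p. ennreal (y p)) \<longlonglongrightarrow> ennreal 0" by (intro tendsto_ennrealI summable_LIMSEQ_zero)
    then show ?case by (simp add: y(1))
  qed
  then show thesis using lev h unfolding Z_def by (intro that[of lev h]) auto
qed

end

section \<open>The transformed Dirichlet process\<close>

context dirichlet_transform
begin

lemma Kp_eq_primitive: "0 \<le> x \<Longrightarrow> Kp s x = primitive k s x"
  by (simp add: Kp_def primitive_def zero_ereal_def interval_integral_Icc)

lemma measurable_primitive: "(\<lambda>(s, x). primitive k s x) \<in> borel_measurable borel"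
proof -
  have [measurable]: "(\<lambda>p :: (real \<times> real) \<times> real. indicator {0..snd (fst p)} (snd p) :: real) \<in> borel_measurable ((borel \<Otimes>\<^sub>M borel) \<Otimes>\<^sub>M lborel)"
  proof -
    have "(\<lambda>p :: (real \<times> real) \<times> real. indicator {0..snd (fst p)} (snd p) :: real)
        = (\<lambda>p. if 0 \<le> snd p \<and> snd p \<le> snd (fst p) then 1 else 0)" by (auto simp: indicator_def)
    then show ?thesis by simp
  qed
  have "(\<lambda>p. \<integral>y. indicator {0..snd p} y *\<^sub>R k (fst p) y \<partial>lborel) \<in> borel_measurable (borel \<Otimes>\<^sub>M borel)"
    by (rule lborel.borel_measurable_lebesgue_integral) (simp add: case_prod_beta)
  then show ?thesis by (simp add: primitive_def set_lebesgue_integral_def borel_prod case_prod_beta)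
qed

abbreviation jump_D :: "'a \<Rightarrow> real \<Rightarrow> real" where
  "jump_D \<omega> s \<equiv> jump (\<lambda>t. D t \<omega>) s"

lemma jump_D_in:
  assumes "\<omega> \<in> space M" "s \<in> {0..T}"
  shows "jump_D \<omega> s \<in> {0..1}"
proof -
  interpret D: monotone_path "\<lambda>t. D t \<omega>" T by (rule D_path[OF assms(1)])
  show ?thesis
  proof (cases "s = 0")
    case False
    then have "sum (jump_D \<omega>) {s} \<le> D T \<omega> - D 0 \<omega>" using assms by (intro D.sum_jump_le) auto
    then show ?thesis using D.jump_nonneg[of s] D.le_1[OF assms(1)] assms by simp
  qed (simp add: D.jump_0)
qed

lemma Kp_jump_bounds:
  assumes "\<omega> \<in> space M" "s \<in> {0..T}"
  shows "0 \<le> Kp s (jump_D \<omega> s)" "Kp s (jump_D \<omega> s) \<le> \<kappa> * jump_D \<omega> s"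
  using hoelder_kernel.nonneg_bounds[OF hoelder_kernel_Kp] hoelder_kernel.K_nonneg[OF hoelder_kernel_Kp]
    jump_D_in[OF assms] by auto

definition num :: "real \<Rightarrow> 'a \<Rightarrow> real" where
  "num t \<omega> = infsum (\<lambda>s. Kp s (jump_D \<omega> s)) {0..t}"

lemma num_finite:
  assumes \<omega>: "\<omega> \<in> space M" and t: "t \<in> {0..T}"
  shows "(\<integral>\<^sup>+s. ennreal (Kp s (jump_D \<omega> s)) \<partial>count_space {0..t}) \<noteq> \<infinity>"
proof -
  interpret D: monotone_path "\<lambda>t. D t \<omega>" T by (rule D_path[OF \<omega>])
  have "(\<integral>\<^sup>+s. ennreal (Kp s (jump_D \<omega> s)) \<partial>count_space {0..t})
      \<le> (\<integral>\<^sup>+s. ennreal \<kappa> * ennreal (jump_D \<omega> s) \<partial>count_space {0..t})"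
  proof (rule nn_integral_mono)
    fix s assume "s \<in> space (count_space {0..t})"
    then have s: "s \<in> {0..T}" using t by simp
    have "ennreal (Kp s (jump_D \<omega> s)) \<le> ennreal (\<kappa> * jump_D \<omega> s)" by (intro ennreal_leI Kp_jump_bounds \<omega> s)
    then show "ennreal (Kp s (jump_D \<omega> s)) \<le> ennreal \<kappa> * ennreal (jump_D \<omega> s)"
      using \<kappa> jump_D_in[OF \<omega> s] by (simp add: ennreal_mult)
  qed
  also have "\<dots> = ennreal \<kappa> * (\<integral>\<^sup>+s. ennreal (jump_D \<omega> s) \<partial>count_space {0..t})"
    by (rule nn_integral_cmult) simp
  also have "\<dots> \<le> ennreal \<kappa> * ennreal (D t \<omega> - D 0 \<omega>)"
    using t by (intro mult_left_mono D.nn_integral_jump_le) auto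
  also have "\<dots> < \<infinity>" by (simp add: ennreal_mult_less_top)
  finally show ?thesis by simp
qed

text \<open>Brings the sum into the weighted form that \<open>measurable_nn_integral_jumps\<close>
  handles. Dividing by the jump is harmless where the jump is 0, because the primitive vanishes
  there too.\<close>

lemma num_eq:
  assumes \<omega>: "\<omega> \<in> space M" and t: "t \<in> {0..T}"
  shows "(\<lambda>s. Kp s (jump_D \<omega> s)) summable_on {0..t}"
    "num t \<omega> = enn2real (\<integral>\<^sup>+s. ennreal (jump_D \<omega> s) * (ennreal (primitive k s (jump_D \<omega> s) / jump_D \<omega> s) * indicator {..t} s) \<partial>count_space {0..T})"
proof -
  have nn: "0 \<le> Kp s (jump_D \<omega> s)" if "s \<in> {0..t}" for s using that t by (intro Kp_jump_bounds \<omega>) auto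
  note inf = infsum_count_space[where g = "\<lambda>s. Kp s (jump_D \<omega> s)" and A = "{0..t}", OF nn num_finite[OF \<omega> t]]
  show "(\<lambda>s. Kp s (jump_D \<omega> s)) summable_on {0..t}" by (rule inf(1))
  have "(\<integral>\<^sup>+s. ennreal (Kp s (jump_D \<omega> s)) \<partial>count_space {0..t})
      = (\<integral>\<^sup>+s. ennreal (jump_D \<omega> s) * (ennreal (primitive k s (jump_D \<omega> s) / jump_D \<omega> s) * indicator {..t} s) \<partial>count_space {0..T})"
  proof (subst (1 2) nn_integral_count_space_indicator, simp, simp, rule nn_integral_cong)
    fix s :: real
    show "ennreal (Kp s (jump_D \<omega> s)) * indicator {0..t} s
        = ennreal (jump_D \<omega> s) * (ennreal (primitive k s (jump_D \<omega> s) / jump_D \<omega> s) * indicator {..t} s) * indicator {0..T} s"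
    proof (cases "s \<in> {0..t}")
      case True
      then have s: "s \<in> {0..T}" using t by auto
      have J: "0 \<le> jump_D \<omega> s" using jump_D_in[OF \<omega> s] by simp
      have "ennreal (Kp s (jump_D \<omega> s)) = ennreal (jump_D \<omega> s) * ennreal (primitive k s (jump_D \<omega> s) / jump_D \<omega> s)"
      proof (cases "jump_D \<omega> s = 0")
        case False
        have "0 \<le> primitive k s (jump_D \<omega> s)" using Kp_jump_bounds(1)[OF \<omega> s] Kp_eq_primitive[OF J] by simp
        then show ?thesis using J False by (simp add: ennreal_mult[symmetric] Kp_eq_primitive)
      qed (simp add: hoelder_kernel.K_0[OF hoelder_kernel_Kp])
      then show ?thesis using True s by simp
    next
      case False
      then show ?thesis using t by (auto simp: indicator_def)
    qed
  qed
  then show "num t \<omega> = enn2real (\<integral>\<^sup>+s. ennreal (jump_D \<omega> s) * (ennreal (primitive k s (jump_D \<omega> s) / jump_D \<omega> s) * indicator {..t} s) \<partial>count_space {0..T})"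
    by (simp only: num_def inf(2))
qed

lemma measurable_num:
  assumes t: "t \<in> {0..T}"
  shows "num t \<in> borel_measurable M"
proof (subst measurable_cong[OF num_eq(2)[OF _ t]])
  have "(\<lambda>p. ennreal ((\<lambda>(s, x). primitive k s x) p / snd p) * indicator {..t} (fst p)) \<in> borel_measurable (borel :: (real \<times> real) measure)"
  proof -
    note [measurable] = measurable_primitive[folded borel_prod]
    show ?thesis unfolding borel_prod[symmetric] by measurable
  qed
  then have "(\<lambda>(s, x). ennreal (primitive k s x / x) * indicator {..t} s) \<in> borel_measurable borel"
    by (simp add: case_prod_beta)
  from D.measurable_nn_integral_jumps[OF this]
  show "(\<lambda>\<omega>. enn2real (\<integral>\<^sup>+s. ennreal (jump_D \<omega> s) * (ennreal (primitive k s (jump_D \<omega> s) / jump_D \<omega> s) * indicator {..t} s) \<partial>count_space {0..T})) \<in> borel_measurable M"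
    by (rule borel_measurable_enn2real)
qed

definition DK :: "real \<Rightarrow> 'a \<Rightarrow> real" where
  "DK t \<omega> = num t \<omega> / num T \<omega>"

lemma measurable_DK: "t \<in> {0..T} \<Longrightarrow> DK t \<in> borel_measurable M"
  unfolding DK_def[abs_def] using T by (intro borel_measurable_divide measurable_num) auto

lemma cadlag_DK:
  assumes \<omega>: "\<omega> \<in> space M"
  shows "cadlag_on {0..T} (\<lambda>t. DK t \<omega>)"
proof -
  have c: "cadlag_on {0..T} (\<lambda>t. num t \<omega>)"
    unfolding num_def using T by (intro cadlag_infsum Kp_jump_bounds num_eq \<omega>) auto
  show ?thesis
    unfolding cadlag_on_def DK_def divide_inverse
  proof (intro ballI conjI)
    fix t assume t: "t \<in> {0..T}"
    show "((\<lambda>t. num t \<omega> * inverse (num T \<omega>)) \<longlongrightarrow> num t \<omega> * inverse (num T \<omega>)) (at t within {0..T} \<inter> {t<..})"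
      using c t unfolding cadlag_on_def by (intro tendsto_mult_right) blast
    obtain l where "((\<lambda>t. num t \<omega>) \<longlongrightarrow> l) (at t within {0..T} \<inter> {..<t})"
      using c t unfolding cadlag_on_def by blast
    then have "((\<lambda>t. num t \<omega> * inverse (num T \<omega>)) \<longlongrightarrow> l * inverse (num T \<omega>)) (at t within {0..T} \<inter> {..<t})"
      by (rule tendsto_mult_right)
    then show "\<exists>l. ((\<lambda>t. num t \<omega> * inverse (num T \<omega>)) \<longlongrightarrow> l) (at t within {0..T} \<inter> {..<t})" by blast
  qed
qed

text \<open>Turns cell increments into values at all dyadic times, each rounded down to the grid.
  Vectors from different grids thus become points of one sequence space, where they can
  converge.\<close>

definition grid_eval :: "nat \<Rightarrow> (nat \<Rightarrow> real) \<Rightarrow> nat \<Rightarrow> real" where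
  "grid_eval n z j = (\<Sum>i\<in>{i. i < n \<and> T * real (Suc i) / real n \<le> dyadic_time T j}. z i)"

lemma measurable_grid_eval [measurable]: "grid_eval n \<in> measurable (PiM {..<n} (\<lambda>_. borel)) borel"
  unfolding grid_eval_def[abs_def]
  by (intro measurable_coordinatewise_then_product borel_measurable_sum measurable_component_singleton) auto

lemma grid_eval_cong: "(\<And>i. i < n \<Longrightarrow> x i = y i) \<Longrightarrow> grid_eval n x = grid_eval n y"
  by (auto simp: grid_eval_def intro!: sum.cong)

lemma grid_eval_dyadic:
  assumes "m \<le> l" "i0 \<le> 2 ^ m"
  shows "grid_eval (2 ^ l) z (prod_encode (m, i0)) = (\<Sum>i<i0 * 2 ^ (l - m). z i)"
proof -
  have pow: "(2::nat) ^ l = 2 ^ m * 2 ^ (l - m)" using assms(1) by (simp add: power_add[symmetric])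
  have "T * real (Suc i) / real (2 ^ l) \<le> T * real i0 / 2 ^ m \<longleftrightarrow> i < i0 * 2 ^ (l - m)" for i
  proof -
    have "T * real i0 / 2 ^ m = T * real (i0 * 2 ^ (l - m)) / real (2 ^ l)" unfolding pow by simp
    then have "T * real (Suc i) / real (2 ^ l) \<le> T * real i0 / 2 ^ m \<longleftrightarrow> T * real (Suc i) \<le> T * real (i0 * 2 ^ (l - m))"
      by (simp add: divide_le_cancel del: of_nat_Suc of_nat_mult)
    also have "\<dots> \<longleftrightarrow> real (Suc i) \<le> real (i0 * 2 ^ (l - m))" using T by simp
    also have "\<dots> \<longleftrightarrow> i < i0 * 2 ^ (l - m)" unfolding of_nat_le_iff by auto
    finally show ?thesis .
  qed
  moreover have "i < 2 ^ l" if "i < i0 * 2 ^ (l - m)" for i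
  proof -
    have "i0 * 2 ^ (l - m) \<le> 2 ^ l" unfolding pow using assms(2) by simp
    then show ?thesis using that by linarith
  qed
  ultimately have "{i. i < 2 ^ l \<and> T * real (Suc i) / real (2 ^ l) \<le> dyadic_time T (prod_encode (m, i0))} = {..<i0 * 2 ^ (l - m)}"
    using assms(2) by (auto simp: dyadic_time_eq min_def)
  then show ?thesis by (simp add: grid_eval_def)
qed

lemma dyadic_index:
  obtains m i0 where "i0 \<le> 2 ^ m" "dyadic_time T j = T * real i0 / 2 ^ m"
    "\<And>n z. grid_eval n z j = grid_eval n z (prod_encode (m, i0))"
proof -
  obtain m i where mi: "j = prod_encode (m, i)" by (metis prod_decode_inverse surj_pair)
  have "dyadic_time T (prod_encode (m, min i (2 ^ m))) = dyadic_time T j" by (simp add: mi dyadic_time_eq)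
  then show thesis by (intro that[of "min i (2 ^ m)" m]) (auto simp: mi dyadic_time_eq grid_eval_def)
qed

section \<open>Discretised processes and their convergence at dyadic times\<close>

definition D_vec :: "'a \<Rightarrow> nat \<Rightarrow> real" where
  "D_vec \<omega> j = D (dyadic_time T j) \<omega>"

definition DK_vec :: "'a \<Rightarrow> nat \<Rightarrow> real" where
  "DK_vec \<omega> j = DK (dyadic_time T j) \<omega>"

definition D_inc :: "nat \<Rightarrow> 'a \<Rightarrow> nat \<Rightarrow> real" where
  "D_inc n \<omega> i = increment (\<lambda>t. D t \<omega>) T n i"

text \<open>The discrete counterpart of the increments of \<open>DK\<close>, with the scale
  \<open>r\<close> of the window argument in front; r = 1 is the plain discretisation.\<close>

definition K_inc :: "nat \<Rightarrow> real \<Rightarrow> 'a \<Rightarrow> nat \<Rightarrow> real" where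
  "K_inc n r \<omega> i = Ka n i (r * D_inc n \<omega> i) / (\<Sum>i<n. Ka n i (r * D_inc n \<omega> i))"

lemma measurable_D_vec [measurable]: "D_vec \<in> measurable M borel"
  unfolding D_vec_def[abs_def] using T dyadic_time_in[of T]
  by (intro measurable_coordinatewise_then_product measurable_D) auto

lemma measurable_DK_vec [measurable]: "DK_vec \<in> measurable M borel"
  unfolding DK_vec_def[abs_def] using T dyadic_time_in[of T]
  by (intro measurable_coordinatewise_then_product measurable_DK) auto

text \<open>Each coordinate is eventually constant: once a dyadic time lies on the grid, the
  increments telescope to the exact value.\<close>

lemma grid_eval_D_inc_tendsto:
  assumes \<omega>: "\<omega> \<in> space M" and lev: "\<And>p. p \<le> lev p"
  shows "(\<lambda>p. grid_eval (2 ^ lev p) (D_inc (2 ^ lev p) \<omega>)) \<longlonglongrightarrow> D_vec \<omega>"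
proof (rule tendsto_fun, rule tendsto_eventually)
  fix j
  obtain m i0 where mi: "i0 \<le> 2 ^ m" "dyadic_time T j = T * real i0 / 2 ^ m"
    "\<And>n z. grid_eval n z j = grid_eval n z (prod_encode (m, i0))" by (rule dyadic_index) blast
  show "\<forall>\<^sub>F p in sequentially. grid_eval (2 ^ lev p) (D_inc (2 ^ lev p) \<omega>) j = D_vec \<omega> j"
    using eventually_ge_at_top[of m]
  proof eventually_elim
    case (elim p)
    have ml: "m \<le> lev p" using elim lev[of p] by simp
    have pow: "(2::nat) ^ lev p = 2 ^ m * 2 ^ (lev p - m)" using ml by (simp add: power_add[symmetric])
    have "T * real (i0 * 2 ^ (lev p - m)) / real (2 ^ lev p) = dyadic_time T j" unfolding mi(2) pow by simp
    then show ?case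
      unfolding mi(3) grid_eval_dyadic[OF ml mi(1)] D_inc_def sum_increment
      by (simp add: D_vec_def D_0[OF \<omega>])
  qed
qed

lemma grid_eval_K_inc_tendsto:
  assumes \<omega>: "pure_jump_path (\<lambda>t. D t \<omega>) T k \<kappa> \<alpha>" and lev: "\<And>p. p \<le> lev p"
    and h: "\<And>p i s x. i < 2 ^ lev p \<Longrightarrow> s \<in> cell T (2 ^ lev p) i \<Longrightarrow> x \<in> {0..1} \<Longrightarrow>
      ennreal \<bar>average (2 ^ lev p) i x - k s x\<bar> \<le> h p s"
    and Z: "(\<lambda>p. \<integral>\<^sup>+s. ennreal (jump_D \<omega> s) * h p s \<partial>count_space {0..T}) \<longlonglongrightarrow> 0"
    and r: "\<And>p. 1 \<le> r p" "r \<longlonglongrightarrow> 1"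
  shows "(\<lambda>p. grid_eval (2 ^ lev p) (K_inc (2 ^ lev p) (r p) \<omega>)) \<longlonglongrightarrow> DK_vec \<omega>"
proof -
  interpret P: pure_jump_path "\<lambda>t. D t \<omega>" T k \<kappa> \<alpha> by (rule \<omega>)
  have num: "num t \<omega> = infsum P.g {0..t}" for t by (simp add: num_def P.g_def[abs_def])
  define y where "y p i = Ka (2 ^ lev p) i (r p * D_inc (2 ^ lev p) \<omega> i)" for p i
  note lim = P.grid_sums_tendsto[OF lev h Z r, folded D_inc_def, folded y_def num]
  have tot: "(\<lambda>p. \<Sum>i<2 ^ lev p. y p i) \<longlonglongrightarrow> num T \<omega>"
    using lim[of 1 0] by simp
  have pos: "num T \<omega> \<noteq> 0" using P.infsum_g_pos by (simp add: num)
  show ?thesis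
  proof (rule tendsto_fun)
    fix j
    obtain m i0 where mi: "i0 \<le> 2 ^ m" "dyadic_time T j = T * real i0 / 2 ^ m"
      "\<And>n z. grid_eval n z j = grid_eval n z (prod_encode (m, i0))" by (rule dyadic_index) blast
    have "(\<lambda>p. (\<Sum>i<i0 * 2 ^ (lev p - m). y p i) / (\<Sum>i<2 ^ lev p. y p i)) \<longlonglongrightarrow> num (dyadic_time T j) \<omega> / num T \<omega>"
      unfolding mi(2) by (intro tendsto_divide lim mi(1) tot pos)
    then have lim': "(\<lambda>p. (\<Sum>i<i0 * 2 ^ (lev p - m). y p i) / (\<Sum>i<2 ^ lev p. y p i)) \<longlonglongrightarrow> DK_vec \<omega> j"
      by (simp add: DK_vec_def DK_def)
    have ev: "\<forall>\<^sub>F p in sequentially. (\<Sum>i<i0 * 2 ^ (lev p - m). y p i) / (\<Sum>i<2 ^ lev p. y p i)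
        = grid_eval (2 ^ lev p) (K_inc (2 ^ lev p) (r p) \<omega>) j"
      using eventually_ge_at_top[of m]
    proof eventually_elim
      case (elim p)
      have ml: "m \<le> lev p" using elim lev[of p] by simp
      show ?case
        unfolding mi(3) grid_eval_dyadic[OF ml mi(1)] K_inc_def y_def[symmetric] sum_divide_distrib ..
    qed
    show "(\<lambda>p. grid_eval (2 ^ lev p) (K_inc (2 ^ lev p) (r p) \<omega>) j) \<longlonglongrightarrow> DK_vec \<omega> j"
      by (rule Lim_transform_eventually[OF lim' ev])
  qed
qed

text \<open>\<open>C\<close> is fixed before the grid, the test function and \<epsilon>. This is
  possible because the parameters T / n of the cells add up to T on every grid, and the window
  constants depend only on this sum and \<kappa>.\<close>

lemma discrete_bounds:
  obtains C :: "real \<Rightarrow> real" where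
    "\<And>R n \<Phi> \<epsilon>. 0 \<le> R \<Longrightarrow> 0 < n \<Longrightarrow> \<Phi> \<in> borel_measurable borel \<Longrightarrow> (\<And>y. 0 \<le> \<Phi> y) \<Longrightarrow> (\<And>y. \<Phi> y \<le> 1) \<Longrightarrow> 0 < \<epsilon> \<Longrightarrow> \<epsilon> \<le> 1 \<Longrightarrow>
      \<exists>u. 1 < u \<and> u < 1 + \<epsilon> \<and> (\<integral>\<^sup>+\<omega>. ennreal (\<Phi> (grid_eval n (K_inc n u \<omega>))) * indicator {..R} (V\<^sub>D \<omega> n) \<partial>M)
        \<le> ennreal (C R) * (\<integral>\<^sup>+\<omega>. ennreal (\<Phi> (grid_eval n (D_inc n \<omega>))) \<partial>M) + ennreal \<epsilon>"
    "\<And>R n \<Phi> \<epsilon>. 0 \<le> R \<Longrightarrow> 0 < n \<Longrightarrow> \<Phi> \<in> borel_measurable borel \<Longrightarrow> (\<And>y. 0 \<le> \<Phi> y) \<Longrightarrow> (\<And>y. \<Phi> y \<le> 1) \<Longrightarrow> 0 < \<epsilon> \<Longrightarrow> \<epsilon> \<le> 1 \<Longrightarrow>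
      \<exists>u. 1 < u \<and> u < 1 + \<epsilon> \<and> (\<integral>\<^sup>+\<omega>. ennreal (\<Phi> (grid_eval n (D_inc n \<omega>))) * indicator {..R} (V\<^sub>D \<omega> n) \<partial>M)
        \<le> ennreal (C R) * (\<integral>\<^sup>+\<omega>. ennreal (\<Phi> (grid_eval n (K_inc n u \<omega>))) \<partial>M) + ennreal \<epsilon>"
proof -
  obtain c1 c2 where c: "0 < c1" "\<And>u. 1 / \<kappa> \<le> u \<Longrightarrow> u \<le> 2 * \<kappa> \<Longrightarrow> c1 \<le> gamma_density T u"
    "\<And>u. 1 / \<kappa> \<le> u \<Longrightarrow> u \<le> 2 * \<kappa> \<Longrightarrow> gamma_density T u \<le> c2"
    using gamma_density_window[OF T \<kappa>] by metis
  define C where "C R = \<kappa> powr T * exp (\<kappa> ^ 3 * (2 * \<kappa> * R) + \<kappa> * (2 * \<kappa>)) * c2 * 2 * \<kappa> / c1" for R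
  have main: "(\<exists>u. 1 < u \<and> u < 1 + \<epsilon> \<and> (\<integral>\<^sup>+\<omega>. ennreal (\<Phi> (grid_eval n (K_inc n u \<omega>))) * indicator {..R} (V\<^sub>D \<omega> n) \<partial>M)
        \<le> ennreal (C R) * (\<integral>\<^sup>+\<omega>. ennreal (\<Phi> (grid_eval n (D_inc n \<omega>))) \<partial>M) + ennreal \<epsilon>) \<and>
    (\<exists>u. 1 < u \<and> u < 1 + \<epsilon> \<and> (\<integral>\<^sup>+\<omega>. ennreal (\<Phi> (grid_eval n (D_inc n \<omega>))) * indicator {..R} (V\<^sub>D \<omega> n) \<partial>M)
        \<le> ennreal (C R) * (\<integral>\<^sup>+\<omega>. ennreal (\<Phi> (grid_eval n (K_inc n u \<omega>))) \<partial>M) + ennreal \<epsilon>)"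
    if R: "0 \<le> R" and n: "0 < n" and \<Phi> [measurable]: "\<Phi> \<in> borel_measurable borel"
      and \<Phi>0: "\<And>y. 0 \<le> \<Phi> y" and \<Phi>1: "\<And>y. \<Phi> y \<le> 1" and \<epsilon>: "0 < \<epsilon>" "\<epsilon> \<le> 1"
    for R n \<Phi> \<epsilon>
  proof -
    have sumT: "(\<Sum>i<n. T / real n) = T" using n by simp
    interpret W: gamma_kernels_window "{..<n}" "\<lambda>_. T / real n" "average n" "Ka n" \<kappa> \<alpha> c1 c2
    proof (intro gamma_kernels_window.intro gamma_kernels.intro gamma_product.intro
        gamma_kernels_axioms.intro gamma_kernels_window_axioms.intro)
      show "{..<n} \<noteq> {}" "0 < T / real n" using n T by (auto simp: lessThan_empty_iff)
      show "hoelder_kernel (average n i) (Ka n i) \<kappa> \<alpha>" for i by (rule hoelder_kernel_Ka[OF n])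
    qed (use c n in \<open>auto simp: sumT\<close>)
    have const: "W.const R = C R" unfolding W.const_def W.bound_def C_def sumT ..
    define X where "X \<omega> = (\<lambda>i\<in>{..<n}. increment (\<lambda>t. \<gamma> t \<omega>) T n i)" for \<omega>
    have grid: "0 \<le> T * real i / real n" "T * real i / real n < T * real (Suc i) / real n"
      "T * real (Suc i) / real n - T * real i / real n = T / real n" for i
      using T n by (auto simp: divide_strict_right_mono diff_divide_distrib[symmetric] right_diff_distrib[symmetric])
    have X [measurable]: "X \<in> measurable M W.B"
      unfolding X_def increment_def using grid(1) grid(1)[of "Suc _"]
      by (intro measurable_restrict borel_measurable_diff random_variable_X) auto
    have "distr M W.B X = PiM {..<n} (\<lambda>i. gamma_measure (T * real (Suc i) / real n - T * real i / real n))"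
      unfolding X_def increment_def using grid n by (intro law_increments[where t = "\<lambda>i. T * real i / real n"]) auto
    also have "\<dots> = W.G" unfolding grid(3) W.G_def ..
    finally have law: "distr M W.B X = W.G" .
    have transfer: "(\<integral>\<^sup>+x. F x \<partial>W.G) = (\<integral>\<^sup>+\<omega>. F (X \<omega>) \<partial>M)" if "F \<in> borel_measurable W.B" for F
      unfolding law[symmetric] using that by (intro nn_integral_distr X) auto
    have tot: "W.tot (X \<omega>) = \<gamma> T \<omega>" if "\<omega> \<in> space M" for \<omega>
      using n X_0[OF that] by (simp add: W.tot_def X_def sum_increment)
    have nx: "W.normalise (X \<omega>) i = D_inc n \<omega> i" if "\<omega> \<in> space M" "i < n" for \<omega> i
    proof -
      have "X \<omega> i = increment (\<lambda>t. \<gamma> t \<omega>) T n i" using that by (simp add: X_def)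
      then show ?thesis using that by (simp add: W.normalise_def tot D_inc_def increment_D)
    qed
    have eD: "grid_eval n (W.normalise (X \<omega>)) = grid_eval n (D_inc n \<omega>)" if "\<omega> \<in> space M" for \<omega>
      using nx[OF that] by (rule grid_eval_cong)
    have eV: "W.V (W.normalise (X \<omega>)) = V\<^sub>D \<omega> n" if "\<omega> \<in> space M" for \<omega>
      using nx[OF that] by (simp add: W.V_def V\<^sub>D_def D_inc_def)
    have eK: "grid_eval n (W.normalise (W.KK (W.scale u (W.normalise (X \<omega>))))) = grid_eval n (K_inc n u \<omega>)"
      if "\<omega> \<in> space M" for \<omega> u
    proof (rule grid_eval_cong)
      fix i assume i: "i < n"
      have KK: "W.KK (W.scale u (W.normalise (X \<omega>))) l = Ka n l (u * D_inc n \<omega> l)" if "l < n" for l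
        using that nx[OF \<open>\<omega> \<in> space M\<close>] by (simp add: W.KK_def W.scale_def)
      then show "W.normalise (W.KK (W.scale u (W.normalise (X \<omega>)))) i = K_inc n u \<omega> i"
        using i by (simp add: W.normalise_def W.tot_def K_inc_def)
    qed
    define \<Psi> where "\<Psi> x = ennreal (\<Phi> (grid_eval n x))" for x
    have [measurable]: "\<Psi> \<in> borel_measurable W.B" unfolding \<Psi>_def by measurable
    have \<Psi>1: "\<Psi> x \<le> 1" for x using \<Phi>1 by (simp add: \<Psi>_def ennreal_le_1)
    have iD: "(\<integral>\<^sup>+x. \<Psi> (W.normalise x) \<partial>W.G) = (\<integral>\<^sup>+\<omega>. ennreal (\<Phi> (grid_eval n (D_inc n \<omega>))) \<partial>M)"
      by (subst transfer) (auto intro!: nn_integral_cong simp: \<Psi>_def eD)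
    have iDV: "(\<integral>\<^sup>+x. \<Psi> (W.normalise x) * indicator {..R} (W.V (W.normalise x)) \<partial>W.G)
        = (\<integral>\<^sup>+\<omega>. ennreal (\<Phi> (grid_eval n (D_inc n \<omega>))) * indicator {..R} (V\<^sub>D \<omega> n) \<partial>M)"
      by (subst transfer) (auto intro!: nn_integral_cong simp: \<Psi>_def eD eV)
    have iK: "(\<integral>\<^sup>+x. \<Psi> (W.normalise (W.KK (W.scale u (W.normalise x)))) \<partial>W.G)
        = (\<integral>\<^sup>+\<omega>. ennreal (\<Phi> (grid_eval n (K_inc n u \<omega>))) \<partial>M)" for u
      by (subst transfer) (auto intro!: nn_integral_cong simp: \<Psi>_def eK)
    have iKV: "(\<integral>\<^sup>+x. \<Psi> (W.normalise (W.KK (W.scale u (W.normalise x)))) * indicator {..R} (W.V (W.normalise x)) \<partial>W.G)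
        = (\<integral>\<^sup>+\<omega>. ennreal (\<Phi> (grid_eval n (K_inc n u \<omega>))) * indicator {..R} (V\<^sub>D \<omega> n) \<partial>M)" for u
      by (subst transfer) (auto intro!: nn_integral_cong simp: \<Psi>_def eK eV)
    obtain u where "1 < u" "u < 1 + \<epsilon>"
      "(\<integral>\<^sup>+x. \<Psi> (W.normalise (W.KK (W.scale u (W.normalise x)))) * indicator {..R} (W.V (W.normalise x)) \<partial>W.G)
        \<le> ennreal (W.const R) * (\<integral>\<^sup>+y. \<Psi> (W.normalise y) \<partial>W.G) + ennreal \<epsilon>"
      by (rule W.normalised_transform_upper[OF \<open>\<Psi> \<in> borel_measurable W.B\<close> \<Psi>1 \<epsilon> R \<epsilon>(1)])
    moreover obtain v where "1 < v" "v < 1 + \<epsilon>"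
      "(\<integral>\<^sup>+y. \<Psi> (W.normalise y) * indicator {..R} (W.V (W.normalise y)) \<partial>W.G)
        \<le> ennreal (W.const R) * (\<integral>\<^sup>+x. \<Psi> (W.normalise (W.KK (W.scale v (W.normalise x)))) \<partial>W.G) + ennreal \<epsilon>"
      by (rule W.normalised_transform_lower[OF \<open>\<Psi> \<in> borel_measurable W.B\<close> \<Psi>1 \<epsilon> R \<epsilon>(1)])
    ultimately show ?thesis unfolding iD iDV iK iKV const by blast
  qed
  show thesis
  proof (rule that[of C], goal_cases)
    case (1 R n \<Phi> \<epsilon>)
    show ?case by (rule conjunct1[OF main[OF 1]])
  next
    case (2 R n \<Phi> \<epsilon>)
    show ?case by (rule conjunct2[OF main[OF 2]])
  qed
qed

text \<open>All levels are restricted at once, so that one event serves every grid and survives the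
  limit. R is a natural number, so that countably many such events cover almost the whole
  space.\<close>

definition \<Omega> :: "nat \<Rightarrow> 'a set" where
  "\<Omega> R = {\<omega> \<in> space M. \<forall>m. V\<^sub>D \<omega> (2 ^ m) \<le> real R}"

lemma measurable_D_inc: "0 < n \<Longrightarrow> i < n \<Longrightarrow> (\<lambda>\<omega>. D_inc n \<omega> i) \<in> borel_measurable M"
  unfolding D_inc_def using D.measurable_increment[of T i n] T by simp

lemma sets_\<Omega> [measurable]: "\<Omega> R \<in> sets M"
proof -
  have [measurable]: "(\<lambda>\<omega>. V\<^sub>D \<omega> (2 ^ m)) \<in> borel_measurable M" for m
  proof -
    have "(\<lambda>\<omega>. \<Sum>i<2 ^ m. D_inc (2 ^ m) \<omega> i powr \<alpha>) \<in> borel_measurable M"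
    proof (rule borel_measurable_sum)
      fix i assume "i \<in> {..<(2::nat) ^ m}"
      then have [measurable]: "(\<lambda>\<omega>. D_inc (2 ^ m) \<omega> i) \<in> borel_measurable M" by (intro measurable_D_inc) auto
      show "(\<lambda>\<omega>. D_inc (2 ^ m) \<omega> i powr \<alpha>) \<in> borel_measurable M" by measurable
    qed
    then show ?thesis by (simp add: V\<^sub>D_def D_inc_def)
  qed
  show ?thesis unfolding \<Omega>_def by measurable
qed

lemma measurable_grid_D: "0 < n \<Longrightarrow> (\<lambda>\<omega>. grid_eval n (D_inc n \<omega>)) \<in> measurable M borel"
  unfolding grid_eval_def[abs_def]
  by (intro measurable_coordinatewise_then_product borel_measurable_sum measurable_D_inc) auto

lemma measurable_grid_K: "0 < n \<Longrightarrow> (\<lambda>\<omega>. grid_eval n (K_inc n u \<omega>)) \<in> measurable M borel"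
proof -
  assume n: "0 < n"
  have Ka: "(\<lambda>\<omega>. Ka n i (u * D_inc n \<omega> i)) \<in> borel_measurable M" if "i < n" for i
    by (rule measurable_compose[OF _ hoelder_kernel.measurable_K[OF hoelder_kernel_Ka[OF n]]])
      (intro borel_measurable_times borel_measurable_const measurable_D_inc n that)
  show ?thesis unfolding grid_eval_def[abs_def] K_inc_def
    by (intro measurable_coordinatewise_then_product borel_measurable_sum borel_measurable_divide Ka) auto
qed

text \<open>On the grid \<open>lev p\<close>, \<open>discrete_bounds\<close> with error 1 / (p + 1)
  yields a scale u p between 1 and 1 + 1 / (p + 1). The scales change with p and with the test
  function, but they tend to 1, so both sides converge for a continuous bounded test
  function.\<close>

lemma limit_bounds:
  obtains C :: "nat \<Rightarrow> real" where
    "\<And>R \<Phi>. continuous_on UNIV \<Phi> \<Longrightarrow> (\<And>y. 0 \<le> \<Phi> y) \<Longrightarrow> (\<And>y. \<Phi> y \<le> 1) \<Longrightarrow>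
      (\<integral>\<^sup>+\<omega>. ennreal (\<Phi> (DK_vec \<omega>)) * indicator (\<Omega> R) \<omega> \<partial>M) \<le> ennreal (C R) * (\<integral>\<^sup>+\<omega>. ennreal (\<Phi> (D_vec \<omega>)) \<partial>M)"
    "\<And>R \<Phi>. continuous_on UNIV \<Phi> \<Longrightarrow> (\<And>y. 0 \<le> \<Phi> y) \<Longrightarrow> (\<And>y. \<Phi> y \<le> 1) \<Longrightarrow>
      (\<integral>\<^sup>+\<omega>. ennreal (\<Phi> (D_vec \<omega>)) * indicator (\<Omega> R) \<omega> \<partial>M) \<le> ennreal (C R) * (\<integral>\<^sup>+\<omega>. ennreal (\<Phi> (DK_vec \<omega>)) \<partial>M)"
proof -
  obtain C :: "real \<Rightarrow> real" where
    C1: "\<And>R n \<Phi> \<epsilon>. 0 \<le> R \<Longrightarrow> 0 < n \<Longrightarrow> \<Phi> \<in> borel_measurable borel \<Longrightarrow> (\<And>y. 0 \<le> \<Phi> y) \<Longrightarrow> (\<And>y. \<Phi> y \<le> 1) \<Longrightarrow> 0 < \<epsilon> \<Longrightarrow> \<epsilon> \<le> 1 \<Longrightarrow>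
      \<exists>u. 1 < u \<and> u < 1 + \<epsilon> \<and> (\<integral>\<^sup>+\<omega>. ennreal (\<Phi> (grid_eval n (K_inc n u \<omega>))) * indicator {..R} (V\<^sub>D \<omega> n) \<partial>M)
        \<le> ennreal (C R) * (\<integral>\<^sup>+\<omega>. ennreal (\<Phi> (grid_eval n (D_inc n \<omega>))) \<partial>M) + ennreal \<epsilon>" and
    C2: "\<And>R n \<Phi> \<epsilon>. 0 \<le> R \<Longrightarrow> 0 < n \<Longrightarrow> \<Phi> \<in> borel_measurable borel \<Longrightarrow> (\<And>y. 0 \<le> \<Phi> y) \<Longrightarrow> (\<And>y. \<Phi> y \<le> 1) \<Longrightarrow> 0 < \<epsilon> \<Longrightarrow> \<epsilon> \<le> 1 \<Longrightarrow>
      \<exists>u. 1 < u \<and> u < 1 + \<epsilon> \<and> (\<integral>\<^sup>+\<omega>. ennreal (\<Phi> (grid_eval n (D_inc n \<omega>))) * indicator {..R} (V\<^sub>D \<omega> n) \<partial>M)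
        \<le> ennreal (C R) * (\<integral>\<^sup>+\<omega>. ennreal (\<Phi> (grid_eval n (K_inc n u \<omega>))) \<partial>M) + ennreal \<epsilon>"
    by (rule discrete_bounds) blast
  obtain lev :: "nat \<Rightarrow> nat" and h :: "nat \<Rightarrow> real \<Rightarrow> ennreal" where
    lev: "\<And>p. p \<le> lev p" and
    h: "\<And>p i s x. i < 2 ^ lev p \<Longrightarrow> s \<in> cell T (2 ^ lev p) i \<Longrightarrow> x \<in> {0..1} \<Longrightarrow>
      ennreal \<bar>average (2 ^ lev p) i x - k s x\<bar> \<le> h p s" and
    Z: "AE \<omega> in M. (\<lambda>p. \<integral>\<^sup>+s. ennreal (jump_D \<omega> s) * h p s \<partial>count_space {0..T}) \<longlonglongrightarrow> 0"
    by (rule approximating_levels) blast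
  define n where "n p = (2::nat) ^ lev p" for p
  have n: "0 < n p" for p by (simp add: n_def)
  define \<epsilon> where "\<epsilon> p = 1 / real (Suc p)" for p
  have \<epsilon>: "0 < \<epsilon> p" "\<epsilon> p \<le> 1" for p by (auto simp: \<epsilon>_def)
  have \<epsilon>_lim: "\<epsilon> \<longlonglongrightarrow> 0" unfolding \<epsilon>_def[abs_def] by (rule LIMSEQ_Suc[OF lim_1_over_n])
  \<comment> \<open>Stated for any event \<open>S\<close>: the restricted side uses \<Omega> R, the
    other side the whole space.\<close>
  have conv: "(\<lambda>p. \<integral>\<^sup>+\<omega>. ennreal (\<Phi> (grid_eval (n p) (K_inc (n p) (u p) \<omega>))) * indicator S \<omega> \<partial>M)
        \<longlonglongrightarrow> (\<integral>\<^sup>+\<omega>. ennreal (\<Phi> (DK_vec \<omega>)) * indicator S \<omega> \<partial>M)"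
    "(\<lambda>p. \<integral>\<^sup>+\<omega>. ennreal (\<Phi> (grid_eval (n p) (D_inc (n p) \<omega>))) * indicator S \<omega> \<partial>M)
        \<longlonglongrightarrow> (\<integral>\<^sup>+\<omega>. ennreal (\<Phi> (D_vec \<omega>)) * indicator S \<omega> \<partial>M)"
    if \<Phi>: "continuous_on UNIV \<Phi>" "\<And>y. \<Phi> y \<le> 1" and u: "\<And>p. 1 < u p" "\<And>p. u p < 1 + \<epsilon> p" and S [measurable]: "S \<in> sets M"
    for \<Phi> u S
  proof -
    have [measurable]: "\<Phi> \<in> borel_measurable borel" using \<Phi>(1) by (rule borel_measurable_continuous_onI)
    note [measurable] = measurable_grid_K[OF n] measurable_grid_D[OF n]
    have u1: "u \<longlonglongrightarrow> 1"
    proof (rule tendsto_sandwich[of "\<lambda>_. 1" u sequentially "\<lambda>p. 1 + \<epsilon> p"])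
      show "(\<lambda>p. 1 + \<epsilon> p) \<longlonglongrightarrow> 1" using tendsto_add[OF tendsto_const \<epsilon>_lim, of 1] by simp
    qed (auto simp: less_imp_le u)
    have \<Phi>_lim: "(\<lambda>p. ennreal (\<Phi> (y p)) * c) \<longlonglongrightarrow> ennreal (\<Phi> z) * c" if "y \<longlonglongrightarrow> z" "c < \<infinity>" for y z and c :: ennreal
    proof -
      have "isCont \<Phi> z" using \<Phi>(1) by (simp add: continuous_on_eq_continuous_at)
      then have "(\<lambda>p. ennreal (\<Phi> (y p))) \<longlonglongrightarrow> ennreal (\<Phi> z)" 
        by (intro tendsto_ennrealI isCont_tendsto_compose[OF _ that(1)])
      then have "(\<lambda>p. c * ennreal (\<Phi> (y p))) \<longlonglongrightarrow> c * ennreal (\<Phi> z)"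
        using that(2) by (intro ennreal_tendsto_cmult) auto
      then show ?thesis by (simp only: mult.commute)
    qed
    have dom: "ennreal (\<Phi> y) * indicator S \<omega> \<le> 1" for y \<omega> using \<Phi>(2)[of y] by (auto simp: indicator_def ennreal_le_1)
    show "(\<lambda>p. \<integral>\<^sup>+\<omega>. ennreal (\<Phi> (grid_eval (n p) (K_inc (n p) (u p) \<omega>))) * indicator S \<omega> \<partial>M)
        \<longlonglongrightarrow> (\<integral>\<^sup>+\<omega>. ennreal (\<Phi> (DK_vec \<omega>)) * indicator S \<omega> \<partial>M)"
    proof (rule nn_integral_dominated_convergence[where w = "\<lambda>_. 1"])
      show "AE \<omega> in M. (\<lambda>p. ennreal (\<Phi> (grid_eval (n p) (K_inc (n p) (u p) \<omega>))) * indicator S \<omega>) \<longlonglongrightarrow> ennreal (\<Phi> (DK_vec \<omega>)) * indicator S \<omega>"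
        using Z AE_pure_jump
      proof eventually_elim
        case (elim \<omega>)
        show ?case unfolding n_def
          by (rule \<Phi>_lim[OF grid_eval_K_inc_tendsto[OF elim(2) lev h elim(1) less_imp_le[OF u(1)] u1]]) (auto simp: indicator_def)
      qed
    qed (auto simp: dom emeasure_space_1)
    show "(\<lambda>p. \<integral>\<^sup>+\<omega>. ennreal (\<Phi> (grid_eval (n p) (D_inc (n p) \<omega>))) * indicator S \<omega> \<partial>M)
        \<longlonglongrightarrow> (\<integral>\<^sup>+\<omega>. ennreal (\<Phi> (D_vec \<omega>)) * indicator S \<omega> \<partial>M)"
    proof (rule nn_integral_dominated_convergence[where w = "\<lambda>_. 1"])
      show "AE \<omega> in M. (\<lambda>p. ennreal (\<Phi> (grid_eval (n p) (D_inc (n p) \<omega>))) * indicator S \<omega>) \<longlonglongrightarrow> ennreal (\<Phi> (D_vec \<omega>)) * indicator S \<omega>"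
        using AE_space
      proof eventually_elim
        case (elim \<omega>)
        show ?case unfolding n_def
          by (rule \<Phi>_lim[OF grid_eval_D_inc_tendsto[OF elim lev]]) (auto simp: indicator_def)
      qed
    qed (auto simp: dom emeasure_space_1)
  qed
  have full: "(\<integral>\<^sup>+\<omega>. f \<omega> * indicator (space M) \<omega> \<partial>M) = (\<integral>\<^sup>+\<omega>. f \<omega> \<partial>M)" for f :: "'a \<Rightarrow> ennreal"
    by (intro nn_integral_cong) simp
  have rhs: "(\<lambda>p. ennreal c * a p + ennreal (\<epsilon> p)) \<longlonglongrightarrow> ennreal c * b" if "a \<longlonglongrightarrow> b" for a b c
  proof -
    have "(\<lambda>p. ennreal c * a p + ennreal (\<epsilon> p)) \<longlonglongrightarrow> ennreal c * b + ennreal 0"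
      by (intro tendsto_add ennreal_tendsto_cmult tendsto_ennrealI \<epsilon>_lim that) simp
    then show ?thesis by simp
  qed
  \<comment> \<open>Replaces the event at level \<open>lev p\<close>, which varies with p, by the
    fixed smaller event \<Omega> R.\<close>
  have \<Omega>V: "indicator (\<Omega> R) \<omega> \<le> (indicator {..real R} (V\<^sub>D \<omega> (n p)) :: ennreal)" for R \<omega> p
    by (auto simp: \<Omega>_def n_def indicator_def)
  show thesis
  proof (rule that[of "\<lambda>R. C (real R)"])
    fix R \<Phi> assume \<Phi>: "continuous_on UNIV \<Phi>" "\<And>y. 0 \<le> \<Phi> y" "\<And>y :: nat \<Rightarrow> real. \<Phi> y \<le> (1 :: real)"
    have \<Phi>m: "\<Phi> \<in> borel_measurable borel" using \<Phi>(1) by (rule borel_measurable_continuous_onI)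
    have "\<forall>p. \<exists>u. 1 < u \<and> u < 1 + \<epsilon> p \<and> (\<integral>\<^sup>+\<omega>. ennreal (\<Phi> (grid_eval (n p) (K_inc (n p) u \<omega>))) * indicator {..real R} (V\<^sub>D \<omega> (n p)) \<partial>M)
        \<le> ennreal (C (real R)) * (\<integral>\<^sup>+\<omega>. ennreal (\<Phi> (grid_eval (n p) (D_inc (n p) \<omega>))) \<partial>M) + ennreal (\<epsilon> p)"
    proof
      show "\<exists>u. 1 < u \<and> u < 1 + \<epsilon> p \<and> (\<integral>\<^sup>+\<omega>. ennreal (\<Phi> (grid_eval (n p) (K_inc (n p) u \<omega>))) * indicator {..real R} (V\<^sub>D \<omega> (n p)) \<partial>M)
        \<le> ennreal (C (real R)) * (\<integral>\<^sup>+\<omega>. ennreal (\<Phi> (grid_eval (n p) (D_inc (n p) \<omega>))) \<partial>M) + ennreal (\<epsilon> p)" for p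
        by (rule C1[OF _ n \<Phi>m \<Phi>(2,3) \<epsilon>]) simp
    qed
    from choice[OF this] obtain u where uu: "\<forall>p. 1 < u p \<and> u p < 1 + \<epsilon> p \<and> (\<integral>\<^sup>+\<omega>. ennreal (\<Phi> (grid_eval (n p) (K_inc (n p) (u p) \<omega>))) * indicator {..real R} (V\<^sub>D \<omega> (n p)) \<partial>M)
        \<le> ennreal (C (real R)) * (\<integral>\<^sup>+\<omega>. ennreal (\<Phi> (grid_eval (n p) (D_inc (n p) \<omega>))) \<partial>M) + ennreal (\<epsilon> p)" ..
    then have u: "\<And>p. 1 < u p" "\<And>p. u p < 1 + \<epsilon> p"
      and le: "\<And>p. (\<integral>\<^sup>+\<omega>. ennreal (\<Phi> (grid_eval (n p) (K_inc (n p) (u p) \<omega>))) * indicator {..real R} (V\<^sub>D \<omega> (n p)) \<partial>M)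
        \<le> ennreal (C (real R)) * (\<integral>\<^sup>+\<omega>. ennreal (\<Phi> (grid_eval (n p) (D_inc (n p) \<omega>))) \<partial>M) + ennreal (\<epsilon> p)"
      by blast+
    show "(\<integral>\<^sup>+\<omega>. ennreal (\<Phi> (DK_vec \<omega>)) * indicator (\<Omega> R) \<omega> \<partial>M) \<le> ennreal (C (real R)) * (\<integral>\<^sup>+\<omega>. ennreal (\<Phi> (D_vec \<omega>)) \<partial>M)"
    proof (rule LIMSEQ_le[OF conv(1)[OF \<Phi>(1,3) u sets_\<Omega>] rhs[OF conv(2)[OF \<Phi>(1,3) u sets.top, unfolded full]]], intro exI allI impI)
      fix p :: nat
      have "(\<integral>\<^sup>+\<omega>. ennreal (\<Phi> (grid_eval (n p) (K_inc (n p) (u p) \<omega>))) * indicator (\<Omega> R) \<omega> \<partial>M)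
          \<le> (\<integral>\<^sup>+\<omega>. ennreal (\<Phi> (grid_eval (n p) (K_inc (n p) (u p) \<omega>))) * indicator {..real R} (V\<^sub>D \<omega> (n p)) \<partial>M)"
        by (intro nn_integral_mono mult_left_mono \<Omega>V) auto
      also note le[of p]
      finally show "(\<integral>\<^sup>+\<omega>. ennreal (\<Phi> (grid_eval (n p) (K_inc (n p) (u p) \<omega>))) * indicator (\<Omega> R) \<omega> \<partial>M)
          \<le> ennreal (C (real R)) * (\<integral>\<^sup>+\<omega>. ennreal (\<Phi> (grid_eval (n p) (D_inc (n p) \<omega>))) \<partial>M) + ennreal (\<epsilon> p)" .
    qed
  next
    fix R \<Phi> assume \<Phi>: "continuous_on UNIV \<Phi>" "\<And>y. 0 \<le> \<Phi> y" "\<And>y :: nat \<Rightarrow> real. \<Phi> y \<le> (1 :: real)"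
    have \<Phi>m: "\<Phi> \<in> borel_measurable borel" using \<Phi>(1) by (rule borel_measurable_continuous_onI)
    have "\<forall>p. \<exists>u. 1 < u \<and> u < 1 + \<epsilon> p \<and> (\<integral>\<^sup>+\<omega>. ennreal (\<Phi> (grid_eval (n p) (D_inc (n p) \<omega>))) * indicator {..real R} (V\<^sub>D \<omega> (n p)) \<partial>M)
        \<le> ennreal (C (real R)) * (\<integral>\<^sup>+\<omega>. ennreal (\<Phi> (grid_eval (n p) (K_inc (n p) u \<omega>))) \<partial>M) + ennreal (\<epsilon> p)"
    proof
      show "\<exists>u. 1 < u \<and> u < 1 + \<epsilon> p \<and> (\<integral>\<^sup>+\<omega>. ennreal (\<Phi> (grid_eval (n p) (D_inc (n p) \<omega>))) * indicator {..real R} (V\<^sub>D \<omega> (n p)) \<partial>M)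
        \<le> ennreal (C (real R)) * (\<integral>\<^sup>+\<omega>. ennreal (\<Phi> (grid_eval (n p) (K_inc (n p) u \<omega>))) \<partial>M) + ennreal (\<epsilon> p)" for p
        by (rule C2[OF _ n \<Phi>m \<Phi>(2,3) \<epsilon>]) simp
    qed
    from choice[OF this] obtain u where uu: "\<forall>p. 1 < u p \<and> u p < 1 + \<epsilon> p \<and> (\<integral>\<^sup>+\<omega>. ennreal (\<Phi> (grid_eval (n p) (D_inc (n p) \<omega>))) * indicator {..real R} (V\<^sub>D \<omega> (n p)) \<partial>M)
        \<le> ennreal (C (real R)) * (\<integral>\<^sup>+\<omega>. ennreal (\<Phi> (grid_eval (n p) (K_inc (n p) (u p) \<omega>))) \<partial>M) + ennreal (\<epsilon> p)" ..
    then have u: "\<And>p. 1 < u p" "\<And>p. u p < 1 + \<epsilon> p"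
      and le: "\<And>p. (\<integral>\<^sup>+\<omega>. ennreal (\<Phi> (grid_eval (n p) (D_inc (n p) \<omega>))) * indicator {..real R} (V\<^sub>D \<omega> (n p)) \<partial>M)
        \<le> ennreal (C (real R)) * (\<integral>\<^sup>+\<omega>. ennreal (\<Phi> (grid_eval (n p) (K_inc (n p) (u p) \<omega>))) \<partial>M) + ennreal (\<epsilon> p)"
      by blast+
    show "(\<integral>\<^sup>+\<omega>. ennreal (\<Phi> (D_vec \<omega>)) * indicator (\<Omega> R) \<omega> \<partial>M) \<le> ennreal (C (real R)) * (\<integral>\<^sup>+\<omega>. ennreal (\<Phi> (DK_vec \<omega>)) \<partial>M)"
    proof (rule LIMSEQ_le[OF conv(2)[OF \<Phi>(1,3) u sets_\<Omega>] rhs[OF conv(1)[OF \<Phi>(1,3) u sets.top, unfolded full]]], intro exI allI impI)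
      fix p :: nat
      have "(\<integral>\<^sup>+\<omega>. ennreal (\<Phi> (grid_eval (n p) (D_inc (n p) \<omega>))) * indicator (\<Omega> R) \<omega> \<partial>M)
          \<le> (\<integral>\<^sup>+\<omega>. ennreal (\<Phi> (grid_eval (n p) (D_inc (n p) \<omega>))) * indicator {..real R} (V\<^sub>D \<omega> (n p)) \<partial>M)"
        by (intro nn_integral_mono mult_left_mono \<Omega>V) auto
      also note le[of p]
      finally show "(\<integral>\<^sup>+\<omega>. ennreal (\<Phi> (grid_eval (n p) (D_inc (n p) \<omega>))) * indicator (\<Omega> R) \<omega> \<partial>M)
          \<le> ennreal (C (real R)) * (\<integral>\<^sup>+\<omega>. ennreal (\<Phi> (grid_eval (n p) (K_inc (n p) (u p) \<omega>))) \<partial>M) + ennreal (\<epsilon> p)" .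
    qed
  qed
qed

lemma AE_\<Omega>: "AE \<omega> in M. \<exists>R. \<omega> \<in> \<Omega> R"
  using AE_variation_bounded AE_space by eventually_elim (auto simp: \<Omega>_def)

text \<open>The constants may grow with R, but each of them is finite; null sets are transferred on
  every \<Omega> R separately and then united.\<close>

lemma null_iff:
  assumes A: "A \<in> sets borel"
  shows "emeasure M (DK_vec -` A \<inter> space M) = 0 \<longleftrightarrow> emeasure M (D_vec -` A \<inter> space M) = 0"
proof -
  obtain C :: "nat \<Rightarrow> real" where
    C1: "\<And>R \<Phi>. continuous_on UNIV \<Phi> \<Longrightarrow> (\<And>y. 0 \<le> \<Phi> y) \<Longrightarrow> (\<And>y. \<Phi> y \<le> 1) \<Longrightarrow>
      (\<integral>\<^sup>+\<omega>. ennreal (\<Phi> (DK_vec \<omega>)) * indicator (\<Omega> R) \<omega> \<partial>M) \<le> ennreal (C R) * (\<integral>\<^sup>+\<omega>. ennreal (\<Phi> (D_vec \<omega>)) \<partial>M)" and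
    C2: "\<And>R \<Phi>. continuous_on UNIV \<Phi> \<Longrightarrow> (\<And>y. 0 \<le> \<Phi> y) \<Longrightarrow> (\<And>y. \<Phi> y \<le> 1) \<Longrightarrow>
      (\<integral>\<^sup>+\<omega>. ennreal (\<Phi> (D_vec \<omega>)) * indicator (\<Omega> R) \<omega> \<partial>M) \<le> ennreal (C R) * (\<integral>\<^sup>+\<omega>. ennreal (\<Phi> (DK_vec \<omega>)) \<partial>M)"
    by (rule limit_bounds) blast
  have union: "emeasure M (Y -` A \<inter> space M) = 0"
    if [measurable]: "Y \<in> measurable M borel" and null: "\<And>R. emeasure M (Y -` A \<inter> space M \<inter> \<Omega> R) = 0" for Y :: "'a \<Rightarrow> nat \<Rightarrow> real"
  proof -
    have m: "Y -` A \<inter> space M \<in> sets M" using A by measurable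
    have "AE \<omega> in M. \<forall>R. \<omega> \<notin> Y -` A \<inter> space M \<inter> \<Omega> R"
      unfolding AE_all_countable
    proof
      fix R
      show "AE \<omega> in M. \<omega> \<notin> Y -` A \<inter> space M \<inter> \<Omega> R"
        using null[of R] m by (intro AE_not_in null_setsI) auto
    qed
    then have "AE \<omega> in M. \<omega> \<notin> Y -` A \<inter> space M" using AE_\<Omega> by eventually_elim auto
    then show ?thesis
      by (subst (asm) AE_iff_measurable[OF m]) auto
  qed
  show ?thesis
  proof
    assume null: "emeasure M (D_vec -` A \<inter> space M) = 0"
    show "emeasure M (DK_vec -` A \<inter> space M) = 0"
    proof (rule union[OF measurable_DK_vec])
      show "emeasure M (DK_vec -` A \<inter> space M \<inter> \<Omega> R) = 0" for R
        by (rule null_set_transfer[OF prob_space_axioms measurable_DK_vec measurable_D_vec sets_\<Omega> A _ C1 null]) simp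
    qed
  next
    assume null: "emeasure M (DK_vec -` A \<inter> space M) = 0"
    show "emeasure M (D_vec -` A \<inter> space M) = 0"
    proof (rule union[OF measurable_D_vec])
      show "emeasure M (D_vec -` A \<inter> space M \<inter> \<Omega> R) = 0" for R
        by (rule null_set_transfer[OF prob_space_axioms measurable_D_vec measurable_DK_vec sets_\<Omega> A _ C2 null]) simp
    qed
  qed
qed

end

section \<open>Equivalence of the laws\<close>

lemma cadlag_on_cong:
  assumes "cadlag_on S f" "\<And>t. t \<in> S \<Longrightarrow> g t = f t"
  shows "cadlag_on S g"
  unfolding cadlag_on_def
proof (intro ballI conjI)
  fix t assume t: "t \<in> S"
  have eq: "(g \<longlongrightarrow> l) (at t within S \<inter> R) \<longleftrightarrow> (f \<longlongrightarrow> l) (at t within S \<inter> R)" for l R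
    using assms(2) by (intro tendsto_cong) (simp add: eventually_at_filter)
  obtain l where "(f \<longlongrightarrow> f t) (at t within S \<inter> {t<..})" "(f \<longlongrightarrow> l) (at t within S \<inter> {..<t})"
    using assms(1) t unfolding cadlag_on_def by blast
  then show "(g \<longlongrightarrow> g t) (at t within S \<inter> {t<..})" "\<exists>l. (g \<longlongrightarrow> l) (at t within S \<inter> {..<t})"
    unfolding eq assms(2)[OF t] by blast+
qed

lemma sample_path_measurable:
  assumes T: "0 < T" and cadlag: "\<And>\<omega>. \<omega> \<in> space M \<Longrightarrow> cadlag_on {0..T} (\<lambda>t. X t \<omega>)"
    and meas: "\<And>t. t \<in> {0..T} \<Longrightarrow> X t \<in> borel_measurable M"
  shows "sample_path T X \<in> measurable M (skorohod_borel T)"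
proof (rule measurable_skorohod_borel[OF T])
  show "sample_path T X \<omega> \<in> skorohod_space T" if "\<omega> \<in> space M" for \<omega>
    using cadlag_on_cong[OF cadlag[OF that], of "sample_path T X \<omega>"]
    by (simp add: skorohod_space_def sample_path_def)
  fix m i assume i: "i \<le> (2::nat) ^ m"
  have "T * real i \<le> T * 2 ^ m" using i T by (intro mult_left_mono) (auto simp: of_nat_le_iff[symmetric] simp del: of_nat_le_iff)
  then have t: "T * real i / 2 ^ m \<in> {0..T}" using T by (simp add: pos_divide_le_eq)
  then show "(\<lambda>\<omega>. sample_path T X \<omega> (T * real i / 2 ^ m)) \<in> borel_measurable M"
    using meas[OF t] by (simp add: sample_path_def)
qed

lemma skorohod_law_null_iff:
  assumes T: "0 < T" and X: "sample_path T X \<in> measurable M (skorohod_borel T)"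
    and B: "B \<in> sets (skorohod_borel T)"
    and A: "\<And>f. f \<in> skorohod_space T \<Longrightarrow> f \<in> B \<longleftrightarrow> (\<lambda>j. f (dyadic_time T j)) \<in> A"
  shows "emeasure (skorohod_law M T X) B = emeasure M ((\<lambda>\<omega> j. X (dyadic_time T j) \<omega>) -` A \<inter> space M)"
proof -
  have sp: "sample_path T X \<omega> \<in> skorohod_space T" if "\<omega> \<in> space M" for \<omega>
    using measurable_space[OF X that] by (simp add: skorohod_borel_def space_measure_of_conv)
  have "(\<lambda>j. sample_path T X \<omega> (dyadic_time T j)) = (\<lambda>j. X (dyadic_time T j) \<omega>)" for \<omega>
    using dyadic_time_in[of T] T by (simp add: sample_path_def)
  then have "sample_path T X -` B \<inter> space M = (\<lambda>\<omega> j. X (dyadic_time T j) \<omega>) -` A \<inter> space M"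
    using A[OF sp] by auto
  then show ?thesis unfolding skorohod_law_def using B by (simp add: emeasure_distr[OF X])
qed

context dirichlet_transform
begin

text \<open>Stated for a process that merely agrees with \<open>DK\<close> on [0, T], because the
  process of the theorem is formed with the original kernel and \<open>DK\<close> with its extension
  to the plane.\<close>

lemma laws_equivalent:
  assumes Y: "\<And>t \<omega>. t \<in> {0..T} \<Longrightarrow> \<omega> \<in> space M \<Longrightarrow> Y t \<omega> = DK t \<omega>"
  shows "sample_path T D \<in> measurable M (skorohod_borel T)"
    "sample_path T Y \<in> measurable M (skorohod_borel T)"
    "equivalent_measures (skorohod_law M T Y) (skorohod_law M T D)"
proof -
  show D_meas: "sample_path T D \<in> measurable M (skorohod_borel T)"
    using monotone_path.cadlag[OF D_path] by (intro sample_path_measurable T measurable_D) auto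
  have "Y t \<in> borel_measurable M" if "t \<in> {0..T}" for t
    using measurable_DK[OF that] measurable_cong[of M "Y t" "DK t" borel] Y that by blast
  then show Y_meas: "sample_path T Y \<in> measurable M (skorohod_borel T)"
    using cadlag_on_cong[OF cadlag_DK] Y by (intro sample_path_measurable T) auto
  have null: "emeasure (skorohod_law M T Y) B = 0 \<longleftrightarrow> emeasure (skorohod_law M T D) B = 0"
    if B: "B \<in> sets (skorohod_borel T)" for B
  proof -
    obtain A where A: "A \<in> sets borel"
      "\<And>f. f \<in> skorohod_space T \<Longrightarrow> f \<in> B \<longleftrightarrow> (\<lambda>j. f (dyadic_time T j)) \<in> A"
      using skorohod_borel_cylinder[OF T B] by metis
    have "(\<lambda>\<omega> j. Y (dyadic_time T j) \<omega>) -` A \<inter> space M = DK_vec -` A \<inter> space M"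
      using Y dyadic_time_in[of T] T by (auto simp: DK_vec_def[abs_def])
    moreover have "(\<lambda>\<omega> j. D (dyadic_time T j) \<omega>) -` A \<inter> space M = D_vec -` A \<inter> space M"
      by (auto simp: D_vec_def[abs_def])
    ultimately show ?thesis
      using null_iff[OF A(1)] skorohod_law_null_iff[OF T Y_meas B A(2)] skorohod_law_null_iff[OF T D_meas B A(2)] by simp
  qed
  then show "equivalent_measures (skorohod_law M T Y) (skorohod_law M T D)"
    unfolding equivalent_measures_def absolutely_continuous_def
    by (auto simp: null_sets_def) (auto simp: skorohod_law_def)
qed

end

text \<open>Projecting both arguments to their intervals extends the kernel to the plane. The
  projection does not increase distances, so the Hoelder constant is kept.\<close>

lemma marked_kernel_clamp:
  fixes k :: "real \<Rightarrow> real \<Rightarrow> real"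
  assumes T: "0 < T" and k: "(\<lambda>(s, x). k s x) \<in> borel_measurable (restrict_space borel ({0..T} \<times> {0..1}))"
    and \<kappa>: "1 \<le> \<kappa>" and \<alpha>: "0 < \<alpha>" "\<alpha> < 1"
    and h: "\<And>s x y. s \<in> {0..T} \<Longrightarrow> x \<in> {0..1} \<Longrightarrow> y \<in> {0..1} \<Longrightarrow> \<bar>k s x - k s y\<bar> \<le> \<kappa> * \<bar>x - y\<bar> powr \<alpha>"
    and b: "\<And>s x. s \<in> {0..T} \<Longrightarrow> x \<in> {0..1} \<Longrightarrow> 1 / \<kappa> \<le> k s x \<and> k s x \<le> \<kappa>"
  shows "marked_kernel (\<lambda>s x. k (max 0 (min T s)) (max 0 (min 1 x))) T \<kappa> \<alpha>"
proof
  have s: "max 0 (min T s) \<in> {0..T}" for s using T by simp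
  have x: "max 0 (min 1 x) \<in> {0..1}" for x :: real by simp
  have "(\<lambda>p :: real \<times> real. (max 0 (min T (fst p)), max 0 (min 1 (snd p)))) \<in> measurable borel (restrict_space borel ({0..T} \<times> {0..1}))"
  proof (rule measurable_restrict_space2)
    show "(\<lambda>p :: real \<times> real. (max 0 (min T (fst p)), max 0 (min 1 (snd p)))) \<in> borel_measurable borel"
      by (intro borel_measurable_continuous_onI continuous_intros)
  qed (use T in auto)
  from measurable_compose[OF this k]
  show "(\<lambda>(s, x). k (max 0 (min T s)) (max 0 (min 1 x))) \<in> borel_measurable borel"
    by (simp add: case_prod_beta)
  fix s x y :: real
  have "\<bar>k (max 0 (min T s)) (max 0 (min 1 x)) - k (max 0 (min T s)) (max 0 (min 1 y))\<bar>
      \<le> \<kappa> * \<bar>max 0 (min 1 x) - max 0 (min 1 y)\<bar> powr \<alpha>"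
    by (rule h[OF s x x])
  also have "\<dots> \<le> \<kappa> * \<bar>x - y\<bar> powr \<alpha>"
  proof (intro mult_left_mono powr_mono2)
    show "\<bar>max 0 (min 1 x) - max 0 (min 1 y)\<bar> \<le> \<bar>x - y\<bar>" unfolding max_def min_def by auto
  qed (use \<kappa> \<alpha> in auto)
  finally show "\<bar>k (max 0 (min T s)) (max 0 (min 1 x)) - k (max 0 (min T s)) (max 0 (min 1 y))\<bar> \<le> \<kappa> * \<bar>x - y\<bar> powr \<alpha>" .
  show "1 / \<kappa> \<le> k (max 0 (min T s)) (max 0 (min 1 x))" "k (max 0 (min T s)) (max 0 (min 1 x)) \<le> \<kappa>"
    using b[OF s x] by auto
qed (use assms in auto)

theorem theorem4p3:
  fixes M :: "'a measure" and \<gamma> :: "real \<Rightarrow> 'a \<Rightarrow> real"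
    and k :: "real \<Rightarrow> real \<Rightarrow> real" and T \<kappa> \<alpha> :: real
  assumes "gamma_process M \<gamma>"
    and "0 < T"
    and "(\<lambda>(s, x). k s x) \<in> borel_measurable (restrict_space borel ({0..T} \<times> {0..1}))"
    and "1 \<le> \<kappa>" and "0 < \<alpha>" and "\<alpha> < 1"
    and "\<And>s x y. s \<in> {0..T} \<Longrightarrow> x \<in> {0..1} \<Longrightarrow> y \<in> {0..1} \<Longrightarrow>
           \<bar>k s x - k s y\<bar> \<le> \<kappa> * \<bar>x - y\<bar> powr \<alpha>"
    and "\<And>s x. s \<in> {0..T} \<Longrightarrow> x \<in> {0..1} \<Longrightarrow> 1 / \<kappa> \<le> k s x \<and> k s x \<le> \<kappa>"
  shows "sample_path T (dirichlet_process \<gamma> T) \<in> measurable M (skorohod_borel T) \<and>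
    sample_path T (jump_transform (primitive k) T (dirichlet_process \<gamma> T))
      \<in> measurable M (skorohod_borel T) \<and>
    equivalent_measures
      (skorohod_law M T (jump_transform (primitive k) T (dirichlet_process \<gamma> T)))
      (skorohod_law M T (dirichlet_process \<gamma> T))"
proof -
  define c where "c = (\<lambda>s x. k (max 0 (min T s)) (max 0 (min 1 x)))"
  have "marked_kernel c T \<kappa> \<alpha>"
    unfolding c_def by (rule marked_kernel_clamp) (use assms in auto)
  then interpret dirichlet_transform M \<gamma> c T \<kappa> \<alpha>
    using assms(1) by (intro dirichlet_transform.intro)
  \<comment> \<open>On [0, T] and [0, 1] the projection is the identity, and the jumps of the
    Dirichlet process lie in [0, 1]; so both kernels give the same transformed process.\<close>
  have prim: "primitive c s x = primitive k s x" if "s \<in> {0..T}" "x \<in> {0..1}" for s x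
    unfolding primitive_def
  proof (rule set_lebesgue_integral_cong)
    show "\<forall>y. y \<in> {0..x} \<longrightarrow> c s y = k s y"
    proof (intro allI impI)
      fix y assume "y \<in> {0..x}"
      then have "max 0 (min T s) = s" "max 0 (min 1 y) = y" using that by auto
      then show "c s y = k s y" by (simp add: c_def)
    qed
  qed simp
  have "jump_transform (primitive k) T (dirichlet_process \<gamma> T) t \<omega> = DK t \<omega>"
    if t: "t \<in> {0..T}" and \<omega>: "\<omega> \<in> space M" for t \<omega>
  proof -
    have "(\<Sum>\<^sub>\<infinity>s\<in>{0..u}. primitive k s (jump_D \<omega> s)) = num u \<omega>" if "u \<in> {0..T}" for u
      unfolding num_def
    proof (rule infsum_cong)
      fix s assume "s \<in> {0..u}"
      then have s: "s \<in> {0..T}" using that by auto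
      have "jump_D \<omega> s \<in> {0..1}" by (rule jump_D_in[OF \<omega> s])
      then show "primitive k s (jump_D \<omega> s) = Kp s (jump_D \<omega> s)"
        using prim[OF s] by (simp add: Kp_eq_primitive)
    qed
    from this[OF t] this[of T] show ?thesis using T by (simp add: jump_transform_def DK_def)
  qed
  from laws_equivalent[OF this] show ?thesis by blast
qed

end
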